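(* Let $K$ be a field of prime characteristic $p$ with $[K:K^p]<\infty$, let $S=K[x_1,\dots,x_n]$ or $S=K[\![x_1,\dots,x_n]\!]$, and let $e\ge1$. Let $f\in S$ be a non-zero non-unit element and $R=S/fS$. Then $F_*^e(R)$ is a maximal Cohen-Macaulay $R$-module isomorphic to $\operatorname{Cok}_S(M_S(f,e))$ as $S$-modules (and as $R$-modules).
   Context: For a commutative ring $A$ of prime characteristic $p$ and an $A$-module $M$, $F_*^eM$ is the $A$-module with elements $\{F_*^em : m\in M\}$, addition inherited from $M$ and action $a\,F_*^em=F_*^e(a^{p^e}m)$. Put $q=p^e$, let $\Lambda_e$ be a basis of $K$ as a $K^{q}$-vector space, $\Delta_e=\{\lambda x_1^{a_1}\cdots x_n^{a_n} : \lambda\in\Lambda_e,\ 0\le a_i\le q-1\}$ and $r_e=|\Delta_e|=[K:K^p]^eq^n$. Then $\{F_*^e(j): j\in\Delta_e\}$ is a basis of the free $S$-module $F_*^e(S)$. For $f\in S$, $M_S(f,e)$ is the $r_e\times r_e$ matrix over $S$ representing the $S$-linear map $F_*^e(S)\to F_*^e(S)$, $F_*^e(s)\mapsto F_*^e(fs)$, in this basis: $M_S(f,e)=[f_{(i,j)}]$ where $F_*^e(jf)=\sum_{i\in\Delta_e}f_{(i,j)}F_*^e(i)$. For a square matrix $B$ of size $m$ over $S$, $\operatorname{Cok}_S(B)$ is the cokernel of $S^m\to S^m$, $X\mapsto BX$. A finitely generated module $M$ over a Noetherian local ring $A$ is maximal Cohen-Macaulay if $\operatorname{depth}_AM=\dim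 A$; over a non-local ring $A$ the condition is that $M_{\mathfrak m}$ is maximal Cohen-Macaulay over $A_{\mathfrak m}$ for every maximal ideal $\mathfrak m\in\operatorname{Supp}M$. *)

theory Defs
  imports "HOL-Algebra.Algebra" "HOL-Library.Extended_Nat"
begin

section \<open>Modules\<close>

text \<open>A module is a record extending \<^typ>\<open>'b ring\<close>, so the fields \<open>mult\<close> and \<open>one\<close> are present but carry
  no meaning; they are inherited or left \<open>undefined\<close> in the constructions below.\<close>

definition with_smult :: "('b, 'm) ring_scheme \<Rightarrow> ('a \<Rightarrow> 'b \<Rightarrow> 'b) \<Rightarrow> ('a, 'b) module" where
  "with_smult M s = \<lparr>carrier = carrier M, monoid.mult = monoid.mult M, one = one M,
     ring.zero = ring.zero M, add = add M, smult = s\<rparr>"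

definition regular_module :: "('a, 'm) ring_scheme \<Rightarrow> ('a, 'a) module" where
  "regular_module A = with_smult A (monoid.mult A)"

definition restrict_scalars ::
    "('s \<Rightarrow> 'a) \<Rightarrow> ('a, 'b, 'm) module_scheme \<Rightarrow> ('s, 'b) module" where
  "restrict_scalars h M = with_smult M (\<lambda>s x. h s \<odot>\<^bsub>M\<^esub> x)"

text \<open>Scalars from a quotient \<open>A Quot I\<close>, i.e. cosets, acting on an \<open>A\<close>-module killed by \<open>I\<close>
  through any representative; meaningful only if \<open>I\<close> annihilates the module.\<close>

definition descend_scalars :: "('a, 'b, 'm) module_scheme \<Rightarrow> ('a set, 'b) module" where
  "descend_scalars M = with_smult M (\<lambda>V x. THE y. \<forall>a\<in>V. a \<odot>\<^bsub>M\<^esub> x = y)"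

definition annihilates :: "'a set \<Rightarrow> ('a, 'b, 'm) module_scheme \<Rightarrow> bool" where
  "annihilates I M \<longleftrightarrow> (\<forall>a\<in>I. \<forall>x\<in>carrier M. a \<odot>\<^bsub>M\<^esub> x = \<zero>\<^bsub>M\<^esub>)"

definition module_isos ::
    "('a, 'c) ring_scheme \<Rightarrow> ('a, 'b, 'm) module_scheme \<Rightarrow> ('a, 'd, 'n) module_scheme \<Rightarrow> ('b \<Rightarrow> 'd) set"
  where
  "module_isos A M N = {h. bij_betw h (carrier M) (carrier N) \<and>
     (\<forall>x\<in>carrier M. \<forall>y\<in>carrier M. h (x \<oplus>\<^bsub>M\<^esub> y) = h x \<oplus>\<^bsub>N\<^esub> h y) \<and>
     (\<forall>a\<in>carrier A. \<forall>x\<in>carrier M. h (a \<odot>\<^bsub>M\<^esub> x) = a \<odot>\<^bsub>N\<^esub> h x)}"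

definition module_isomorphic ::
    "('a, 'c) ring_scheme \<Rightarrow> ('a, 'b, 'm) module_scheme \<Rightarrow> ('a, 'd, 'n) module_scheme \<Rightarrow> bool" where
  "module_isomorphic A M N \<longleftrightarrow> module A M \<and> module A N \<and> module_isos A M N \<noteq> {}"

definition module_quot :: "('a, 'b, 'm) module_scheme \<Rightarrow> 'b set \<Rightarrow> ('a, 'b set) module" where
  "module_quot M N = \<lparr>carrier = a_rcosets\<^bsub>M\<^esub> N, monoid.mult = undefined, one = undefined,
     ring.zero = N, add = set_add M, smult = (\<lambda>a V. \<Union>x\<in>V. N +>\<^bsub>M\<^esub> (a \<odot>\<^bsub>M\<^esub> x))\<rparr>"

definition finitely_generated_module ::
    "('a, 'c) ring_scheme \<Rightarrow> ('a, 'b, 'm) module_scheme \<Rightarrow> bool" where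
  "finitely_generated_module A M \<longleftrightarrow> (\<exists>G. finite G \<and> G \<subseteq> carrier M \<and>
     (\<forall>x\<in>carrier M. \<exists>c\<in>G \<rightarrow> carrier A. x = (\<Oplus>\<^bsub>M\<^esub>g\<in>G. c g \<odot>\<^bsub>M\<^esub> g)))"

text \<open>The submodule \<open>IM\<close>.\<close>

definition ideal_times_module ::
    "('a, 'c) ring_scheme \<Rightarrow> 'a set \<Rightarrow> ('a, 'b, 'm) module_scheme \<Rightarrow> 'b set" where
  "ideal_times_module A I M =
     \<Inter>{N. submodule N A M \<and> (\<forall>a\<in>I. \<forall>x\<in>carrier M. a \<odot>\<^bsub>M\<^esub> x \<in> N)}"


section \<open>Matrices over a ring, indexed by a finite set\<close>

definition free_module :: "('a, 'c) ring_scheme \<Rightarrow> 'i set \<Rightarrow> ('a, 'i \<Rightarrow> 'a) module" where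
  "free_module A D = \<lparr>carrier = D \<rightarrow>\<^sub>E carrier A, monoid.mult = undefined, one = undefined,
     ring.zero = (\<lambda>i\<in>D. \<zero>\<^bsub>A\<^esub>), add = (\<lambda>V W. \<lambda>i\<in>D. V i \<oplus>\<^bsub>A\<^esub> W i), smult = (\<lambda>a V. \<lambda>i\<in>D. a \<otimes>\<^bsub>A\<^esub> V i)\<rparr>"

definition mat_vec ::
    "('a, 'c) ring_scheme \<Rightarrow> 'i set \<Rightarrow> ('i \<Rightarrow> 'i \<Rightarrow> 'a) \<Rightarrow> ('i \<Rightarrow> 'a) \<Rightarrow> ('i \<Rightarrow> 'a)" where
  "mat_vec A D B V = (\<lambda>i\<in>D. \<Oplus>\<^bsub>A\<^esub>j\<in>D. B i j \<otimes>\<^bsub>A\<^esub> V j)"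

definition Cok ::
    "('a, 'c) ring_scheme \<Rightarrow> 'i set \<Rightarrow> ('i \<Rightarrow> 'i \<Rightarrow> 'a) \<Rightarrow> ('a, ('i \<Rightarrow> 'a) set) module" where
  "Cok A D B = module_quot (free_module A D) (mat_vec A D B ` carrier (free_module A D))"

text \<open>Coordinates with respect to a finite basis \<open>D\<close> of a free module, and the matrix of a linear
  endomorphism: column \<open>j\<close> holds the coordinates of the image of the basis element \<open>j\<close>.\<close>

definition coordinates ::
    "('a, 'c) ring_scheme \<Rightarrow> ('a, 'b, 'm) module_scheme \<Rightarrow> 'b set \<Rightarrow> 'b \<Rightarrow> ('b \<Rightarrow> 'a)" where
  "coordinates A M D x =
     (THE c. c \<in> D \<rightarrow>\<^sub>E carrier A \<and> x = (\<Oplus>\<^bsub>M\<^esub>i\<in>D. c i \<odot>\<^bsub>M\<^esub> i))"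

definition rep_matrix ::
    "('a, 'c) ring_scheme \<Rightarrow> ('a, 'b, 'm) module_scheme \<Rightarrow> 'b set \<Rightarrow> ('b \<Rightarrow> 'b) \<Rightarrow> ('b \<Rightarrow> 'b \<Rightarrow> 'a)" where
  "rep_matrix A M D \<phi> = (\<lambda>i j. coordinates A M D (\<phi> j) i)"


section \<open>Localization and support\<close>

definition loc_rel ::
    "('a, 'c) ring_scheme \<Rightarrow> ('a, 'b, 'm) module_scheme \<Rightarrow> 'a set \<Rightarrow> (('b \<times> 'a) \<times> ('b \<times> 'a)) set" where
  "loc_rel A M U = {((x, s), (y, t)). x \<in> carrier M \<and> y \<in> carrier M \<and> s \<in> U \<and> t \<in> U \<and>
     (\<exists>u\<in>U. u \<odot>\<^bsub>M\<^esub> (t \<odot>\<^bsub>M\<^esub> x) = u \<odot>\<^bsub>M\<^esub> (s \<odot>\<^bsub>M\<^esub> y))}"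

text \<open>The fraction \<open>x / s\<close>.\<close>

definition loc_frac ::
    "('a, 'c) ring_scheme \<Rightarrow> ('a, 'b, 'm) module_scheme \<Rightarrow> 'a set \<Rightarrow> 'b \<Rightarrow> 'a \<Rightarrow> ('b \<times> 'a) set" where
  "loc_frac A M U x s = loc_rel A M U `` {(x, s)}"

text \<open>Operations on fractions are unions over representatives, as for \<^const>\<open>FactRing\<close>: by
  well-definedness all members of such a union coincide.\<close>

definition loc_add ::
    "('a, 'c) ring_scheme \<Rightarrow> ('a, 'b, 'm) module_scheme \<Rightarrow> 'a set \<Rightarrow>
     ('b \<times> 'a) set \<Rightarrow> ('b \<times> 'a) set \<Rightarrow> ('b \<times> 'a) set" where
  "loc_add A M U V W = (\<Union>(x, s)\<in>V. \<Union>(y, t)\<in>W.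
     loc_frac A M U (t \<odot>\<^bsub>M\<^esub> x \<oplus>\<^bsub>M\<^esub> s \<odot>\<^bsub>M\<^esub> y) (s \<otimes>\<^bsub>A\<^esub> t))"

definition loc_smult ::
    "('a, 'c) ring_scheme \<Rightarrow> ('a, 'b, 'm) module_scheme \<Rightarrow> 'a set \<Rightarrow>
     ('a \<times> 'a) set \<Rightarrow> ('b \<times> 'a) set \<Rightarrow> ('b \<times> 'a) set" where
  "loc_smult A M U V W = (\<Union>(a, s)\<in>V. \<Union>(y, t)\<in>W. loc_frac A M U (a \<odot>\<^bsub>M\<^esub> y) (s \<otimes>\<^bsub>A\<^esub> t))"

definition loc_ring :: "('a, 'c) ring_scheme \<Rightarrow> 'a set \<Rightarrow> ('a \<times> 'a) set ring" where
  "loc_ring A U = (let M = regular_module A in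
     \<lparr>carrier = (carrier A \<times> U) // loc_rel A M U, monoid.mult = loc_smult A M U,
      one = loc_frac A M U \<one>\<^bsub>A\<^esub> \<one>\<^bsub>A\<^esub>, ring.zero = loc_frac A M U \<zero>\<^bsub>A\<^esub> \<one>\<^bsub>A\<^esub>, add = loc_add A M U\<rparr>)"

definition loc_module ::
    "('a, 'c) ring_scheme \<Rightarrow> ('a, 'b, 'm) module_scheme \<Rightarrow> 'a set \<Rightarrow>
     (('a \<times> 'a) set, ('b \<times> 'a) set) module" where
  "loc_module A M U =
     \<lparr>carrier = (carrier M \<times> U) // loc_rel A M U, monoid.mult = undefined, one = undefined,
      ring.zero = loc_frac A M U \<zero>\<^bsub>M\<^esub> \<one>\<^bsub>A\<^esub>, add = loc_add A M U, smult = loc_smult A M U\<rparr>"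

abbreviation ring_at :: "('a, 'c) ring_scheme \<Rightarrow> 'a set \<Rightarrow> ('a \<times> 'a) set ring" where
  "ring_at A P \<equiv> loc_ring A (carrier A - P)"

abbreviation module_at ::
    "('a, 'c) ring_scheme \<Rightarrow> ('a, 'b, 'm) module_scheme \<Rightarrow> 'a set \<Rightarrow>
     (('a \<times> 'a) set, ('b \<times> 'a) set) module" where
  "module_at A M P \<equiv> loc_module A M (carrier A - P)"

definition Supp :: "('a, 'c) ring_scheme \<Rightarrow> ('a, 'b, 'm) module_scheme \<Rightarrow> 'a set set" where
  "Supp A M = {P. primeideal P A \<and> carrier (module_at A M P) \<noteq> {\<zero>\<^bsub>module_at A M P\<^esub>}}"


section \<open>Dimension, depth, maximal Cohen-Macaulay modules\<close>

definition local_ring :: "('a, 'c) ring_scheme \<Rightarrow> bool" where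
  "local_ring A \<longleftrightarrow> cring A \<and> (\<exists>!I. maximalideal I A)"

definition max_ideal :: "('a, 'c) ring_scheme \<Rightarrow> 'a set" where
  "max_ideal A = (THE I. maximalideal I A)"

definition krull_dim :: "('a, 'c) ring_scheme \<Rightarrow> enat" where
  "krull_dim A = Sup {enat l | l. \<exists>P :: nat \<Rightarrow> 'a set.
     (\<forall>i\<le>l. primeideal (P i) A) \<and> (\<forall>i<l. P i \<subset> P (Suc i))}"

definition nonzerodivisor_on ::
    "('a, 'b, 'm) module_scheme \<Rightarrow> 'a \<Rightarrow> bool" where
  "nonzerodivisor_on M a \<longleftrightarrow> (\<forall>x\<in>carrier M. a \<odot>\<^bsub>M\<^esub> x = \<zero>\<^bsub>M\<^esub> \<longrightarrow> x = \<zero>\<^bsub>M\<^esub>)"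

abbreviation quot_by_list ::
    "('a, 'c) ring_scheme \<Rightarrow> ('a, 'b, 'm) module_scheme \<Rightarrow> 'a list \<Rightarrow> ('a, 'b set) module" where
  "quot_by_list A M as \<equiv> module_quot M (ideal_times_module A (Idl\<^bsub>A\<^esub> (set as)) M)"

definition regular_sequence ::
    "('a, 'c) ring_scheme \<Rightarrow> ('a, 'b, 'm) module_scheme \<Rightarrow> 'a list \<Rightarrow> bool" where
  "regular_sequence A M as \<longleftrightarrow> set as \<subseteq> carrier A \<and>
     (\<forall>i<length as. nonzerodivisor_on (quot_by_list A M (take i as)) (as ! i)) \<and>
     carrier (quot_by_list A M as) \<noteq> {\<zero>\<^bsub>quot_by_list A M as\<^esub>}"

text \<open>Depth of a finitely generated module over a local ring; the zero module has depth \<open>\<infinity>\<close>.\<close>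

definition depth :: "('a, 'c) ring_scheme \<Rightarrow> ('a, 'b, 'm) module_scheme \<Rightarrow> enat" where
  "depth A M = (if carrier M = {\<zero>\<^bsub>M\<^esub>} then \<infinity>
     else Sup {enat (length as) | as. regular_sequence A M as \<and> set as \<subseteq> max_ideal A})"

definition mcm_local :: "('a, 'c) ring_scheme \<Rightarrow> ('a, 'b, 'm) module_scheme \<Rightarrow> bool" where
  "mcm_local A M \<longleftrightarrow> noetherian_ring A \<and> local_ring A \<and> module A M \<and>
     finitely_generated_module A M \<and> depth A M = krull_dim A"

definition maximal_cohen_macaulay ::
    "('a, 'c) ring_scheme \<Rightarrow> ('a, 'b, 'm) module_scheme \<Rightarrow> bool" where
  "maximal_cohen_macaulay A M \<longleftrightarrow> noetherian_ring A \<and> module A M \<and> finitely_generated_module A M \<and>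
     (if local_ring A then mcm_local A M
      else \<forall>I. maximalideal I A \<and> I \<in> Supp A M \<longrightarrow> mcm_local (ring_at A I) (module_at A M I))"


section \<open>Polynomials and formal power series in \<open>n\<close> variables\<close>

text \<open>As in \<^theory>\<open>HOL-Algebra.Indexed_Polynomials\<close>, monomials are multisets of variable indices (here
  \<open>0, \<dots>, n - 1\<close>) and a series is its coefficient function. The carrier of the polynomial ring is the
  one defined there, as is the addition.\<close>

definition series_mult ::
    "('a, 'c) ring_scheme \<Rightarrow> (nat multiset \<Rightarrow> 'a) \<Rightarrow> (nat multiset \<Rightarrow> 'a) \<Rightarrow> (nat multiset \<Rightarrow> 'a)" where
  "series_mult K f g = (\<lambda>m. \<Oplus>\<^bsub>K\<^esub>a\<in>{a. a \<subseteq># m}. f a \<otimes>\<^bsub>K\<^esub> g (m - a))"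

definition power_series_ring :: "('a, 'c) ring_scheme \<Rightarrow> nat \<Rightarrow> (nat multiset \<Rightarrow> 'a) ring" where
  "power_series_ring K n =
     \<lparr>carrier = {f. (\<forall>m. f m \<in> carrier K) \<and> (\<forall>m. f m \<noteq> \<zero>\<^bsub>K\<^esub> \<longrightarrow> set_mset m \<subseteq> {..<n})},
      monoid.mult = series_mult K, one = ring.indexed_const K \<one>\<^bsub>K\<^esub>, ring.zero = ring.indexed_const K \<zero>\<^bsub>K\<^esub>,
      add = ring.indexed_padd K\<rparr>"

definition polynomial_ring :: "('a, 'c) ring_scheme \<Rightarrow> nat \<Rightarrow> (nat multiset \<Rightarrow> 'a) ring" where
  "polynomial_ring K n =
     (power_series_ring K n)\<lparr>carrier := ring.indexed_pset K {..<n} (carrier K)\<rparr>"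

text \<open>The term with coefficient \<open>c\<close> at the monomial \<open>a\<close>.\<close>

definition series_monom :: "('a, 'c) ring_scheme \<Rightarrow> 'a \<Rightarrow> nat multiset \<Rightarrow> (nat multiset \<Rightarrow> 'a)" where
  "series_monom K c a = (\<lambda>m. if m = a then c else \<zero>\<^bsub>K\<^esub>)"


section \<open>Frobenius push-forward and the matrix \<open>M\<^sub>S(f,e)\<close>\<close>

definition has_characteristic :: "('a, 'c) ring_scheme \<Rightarrow> nat \<Rightarrow> bool" where
  "has_characteristic A p \<longleftrightarrow> (\<forall>m::nat. [m] \<cdot>\<^bsub>A\<^esub> \<one>\<^bsub>A\<^esub> = \<zero>\<^bsub>A\<^esub> \<longleftrightarrow> p dvd m)"

text \<open>\<open>frobenius_pushforward p e A M\<close> is \<open>F\<^sup>e\<^sub>*M\<close>; the element \<open>F\<^sup>e\<^sub>*m\<close> is represented by \<open>m\<close> itself.\<close>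

definition frobenius_pushforward ::
    "nat \<Rightarrow> nat \<Rightarrow> ('a, 'c) ring_scheme \<Rightarrow> ('a, 'b, 'm) module_scheme \<Rightarrow> ('a, 'b) module" where
  "frobenius_pushforward p e A M = with_smult M (\<lambda>a x. (a [^]\<^bsub>A\<^esub> (p ^ e)) \<odot>\<^bsub>M\<^esub> x)"

abbreviation frobenius_ring :: "nat \<Rightarrow> nat \<Rightarrow> ('a, 'c) ring_scheme \<Rightarrow> ('a, 'a) module" where
  "frobenius_ring p e A \<equiv> frobenius_pushforward p e A (regular_module A)"

text \<open>The subfield of \<open>q\<close>-th powers.\<close>

definition powers_subfield :: "('a, 'c) ring_scheme \<Rightarrow> nat \<Rightarrow> 'a set" where
  "powers_subfield K q = (\<lambda>x. x [^]\<^bsub>K\<^esub> q) ` carrier K"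

definition is_field_basis :: "('a, 'c) ring_scheme \<Rightarrow> 'a set \<Rightarrow> 'a set \<Rightarrow> bool" where
  "is_field_basis K F B \<longleftrightarrow>
     (\<exists>us. set us = B \<and> ring.independent K F us \<and> ring.Span K F us = carrier K)"

definition Delta ::
    "('a, 'c) ring_scheme \<Rightarrow> nat \<Rightarrow> nat \<Rightarrow> 'a set \<Rightarrow> (nat multiset \<Rightarrow> 'a) set" where
  "Delta K n q \<Lambda> = {series_monom K c a | c a.
     c \<in> \<Lambda> \<and> set_mset a \<subseteq> {..<n} \<and> (\<forall>i<n. count a i \<le> q - 1)}"

definition frobenius_matrix ::
    "nat \<Rightarrow> nat \<Rightarrow> ('a, 'c) ring_scheme \<Rightarrow> 'a set \<Rightarrow> 'a \<Rightarrow> ('a \<Rightarrow> 'a \<Rightarrow> 'a)" where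
  "frobenius_matrix p e S D f = rep_matrix S (frobenius_ring p e S) D (\<lambda>s. f \<otimes>\<^bsub>S\<^esub> s)"

end

theory Submission
  imports Defs
begin

text \<open>For an \<open>S\<close>-basis \<open>\<Delta>\<close> of \<open>F\<^sub>*\<^sup>e S\<close>, multiplication by \<open>f\<close> on \<open>F\<^sub>*\<^sup>e S\<close> has the matrix \<open>M(f, e)\<close>
  and its cokernel is \<open>F\<^sub>*\<^sup>e (S / fS)\<close>.

  For the maximal Cohen-Macaulay property, a change of coordinates that makes \<open>f\<close> regular in the last
  variable turns \<open>S / fS\<close> into a finite free module over the ring \<open>B\<close> in one variable less, by
  Weierstrass division. By induction on the number \<open>n\<close> of variables, chains of primes in \<open>S / fS\<close> have
  length at most \<open>n - 1\<close> (contract them to \<open>B\<close>), and every maximal ideal contains a regular sequence of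
  length \<open>n - 1\<close> (lift one from \<open>B\<close>). The \<open>p\<^sup>e\<close>-th powers of such a sequence are regular too, i.e. the
  sequence is regular on \<open>F\<^sub>*\<^sup>e (S / fS)\<close>; conversely a regular sequence of length \<open>d\<close> forces a chain of
  primes of length \<open>d\<close>. This makes depth and dimension of the localizations agree.\<close>

section \<open>Prime and maximal ideals\<close>

text \<open>The field may be finite, so a linear change of variables need not make \<open>f\<close>
  regular in the last variable x_k. The substitution x_i -> x_i + x_k^(d i) works over every field:
  for the weights \<open>d i\<close> it is homogeneous, and if one monomial of \<open>f\<close> is
  alone in having extremal weight D, then x_k^D occurs in the image with the coefficient of that
  monomial. Extremal means maximal for polynomials and minimal for power series, so that one
  division argument covers both rings. The substitution depends on \<open>f\<close>, hence so does
  the map from B to S, and every statement about S/fS is relative to such a map. Exponents are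
  carried through the induction from the start: \<open>cm_ring\<close> asks, for each given q, for a
  sequence whose q-th powers are regular. Depth and dimension are compared through d \<le> depth
  \<le> dim \<le> d, where d bounds the chains of primes and is also the length of the sequences.
  The basis of K over its q-th powers enters through the freeness of the push-forward of S, which
  also yields finite generation.\<close>

lemma (in cring) exists_maximal_disjoint:
  assumes J: "ideal J R" and disj: "J \<inter> U = {}"
  shows "\<exists>P. ideal P R \<and> J \<subseteq> P \<and> P \<inter> U = {} \<and> (\<forall>I. ideal I R \<longrightarrow> P \<subseteq> I \<longrightarrow> I \<inter> U = {} \<longrightarrow> I = P)"
proof -
  define F where "F = {I. ideal I R \<and> J \<subseteq> I \<and> I \<inter> U = {}}"
  have "\<exists>P\<in>F. \<forall>Y\<in>F. P \<subseteq> Y \<longrightarrow> Y = P"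
  proof (rule subset_Zorn_nonempty)
    show "F \<noteq> {}" using J disj by (auto simp: F_def)
  next
    fix C assume "C \<noteq> {}" and C: "subset.chain F C"
    moreover have "subset.chain {I. ideal I R} C"
      using C unfolding pred_on.chain_def F_def by auto
    ultimately have "ideal (\<Union>C) R" using chain_Union_is_ideal[of C] by simp
    with \<open>C \<noteq> {}\<close> C show "\<Union>C \<in> F" unfolding pred_on.chain_def F_def by auto
  qed
  then obtain P where P: "P \<in> F" "\<forall>Y\<in>F. P \<subseteq> Y \<longrightarrow> Y = P" by blast
  then show ?thesis unfolding F_def by (intro exI[of _ P]) auto
qed

text \<open>An ideal that is maximal among those missing a multiplicative set is prime: if neither a
  nor b lies in \<open>P\<close>, both enlargements of \<open>P\<close> meet \<open>U\<close>, and
  the product of the two witnesses lies in P + (ab).\<close>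

lemma (in cring) exists_prime_disjoint:
  assumes J: "ideal J R" and U: "U \<subseteq> carrier R" "\<one> \<in> U" "\<And>x y. x \<in> U \<Longrightarrow> y \<in> U \<Longrightarrow> x \<otimes> y \<in> U"
    and disj: "J \<inter> U = {}"
  shows "\<exists>P. primeideal P R \<and> J \<subseteq> P \<and> P \<inter> U = {}"
proof -
  obtain P where P: "ideal P R" "J \<subseteq> P" "P \<inter> U = {}"
    and max: "\<And>I. ideal I R \<Longrightarrow> P \<subseteq> I \<Longrightarrow> I \<inter> U = {} \<Longrightarrow> I = P"
    using exists_maximal_disjoint[OF J disj] by blast
  interpret P: ideal P R by fact
  \<comment> \<open>Otherwise P + (a) would still miss \<open>U\<close>, and maximality would force
    a into \<open>P\<close>.\<close>
  have "\<exists>x\<in>P. \<exists>r\<in>carrier R. x \<oplus> r \<otimes> a \<in> U" if a: "a \<in> carrier R" "a \<notin> P" for a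
  proof (rule ccontr)
    assume none: "\<not> ?thesis"
    have "ideal (P <+>\<^bsub>R\<^esub> PIdl a) R" by (rule add_ideals[OF P(1) cgenideal_ideal[OF a(1)]])
    moreover have sub: "P \<subseteq> P <+>\<^bsub>R\<^esub> PIdl a"
    proof
      fix x assume "x \<in> P"
      then have "x = x \<oplus> \<zero> \<otimes> a" using a P.Icarr by simp
      then show "x \<in> P <+>\<^bsub>R\<^esub> PIdl a" using \<open>x \<in> P\<close> unfolding set_add_def' cgenideal_def by blast
    qed
    moreover have "(P <+>\<^bsub>R\<^esub> PIdl a) \<inter> U = {}"
      using none unfolding set_add_def' cgenideal_def by auto
    ultimately have "P <+>\<^bsub>R\<^esub> PIdl a = P" by (rule max)
    moreover have "a \<in> P <+>\<^bsub>R\<^esub> PIdl a"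
    proof -
      have "a = \<zero> \<oplus> \<one> \<otimes> a" using a by simp
      then show ?thesis using P.zero_closed unfolding set_add_def' cgenideal_def by blast
    qed
    ultimately show False using a by simp
  qed note meets = this
  have "primeideal P R"
  proof (rule primeidealI[OF P(1) is_cring])
    show "carrier R \<noteq> P" using P(3) U by auto
  next
    fix a b assume ab: "a \<in> carrier R" "b \<in> carrier R" "a \<otimes> b \<in> P"
    show "a \<in> P \<or> b \<in> P"
    proof (rule ccontr)
      assume "\<not> ?thesis"
      then obtain x r y s where xr: "x \<in> P" "r \<in> carrier R" "x \<oplus> r \<otimes> a \<in> U"
        and ys: "y \<in> P" "s \<in> carrier R" "y \<oplus> s \<otimes> b \<in> U" using meets ab by metis
      have c: "x \<in> carrier R" "y \<in> carrier R" using xr ys P.Icarr by auto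
      have "(x \<oplus> r \<otimes> a) \<otimes> (y \<oplus> s \<otimes> b) = x \<otimes> (y \<oplus> s \<otimes> b) \<oplus> (r \<otimes> a \<otimes> y \<oplus> (r \<otimes> s) \<otimes> (a \<otimes> b))"
        using c xr(2) ys(2) ab by algebra
      moreover have "\<dots> \<in> P"
        using c xr ys ab by (auto intro!: P.a_closed intro: P.I_r_closed P.I_l_closed)
      ultimately show False using U(3)[OF xr(3) ys(3)] P(3) by auto
    qed
  qed
  then show ?thesis using P by blast
qed

lemma (in cring) exists_maximal_above:
  assumes J: "ideal J R" "\<one> \<notin> J"
  shows "\<exists>M. maximalideal M R \<and> J \<subseteq> M"
proof -
  have "J \<inter> {\<one>} = {}" using J(2) by simp
  then obtain P where P: "ideal P R" "J \<subseteq> P" "P \<inter> {\<one>} = {}"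
    and max: "\<And>I. ideal I R \<Longrightarrow> P \<subseteq> I \<Longrightarrow> I \<inter> {\<one>} = {} \<Longrightarrow> I = P"
    using exists_maximal_disjoint[OF J(1)] by blast
  have "maximalideal P R"
  proof (rule maximalidealI[OF P(1)])
    show "carrier R \<noteq> P" using P(3) by auto
    fix I assume I: "ideal I R" "P \<subseteq> I"
    show "I = P \<or> I = carrier R"
    proof (cases "\<one> \<in> I")
      case True
      then show ?thesis using ideal.one_imp_carrier[OF I(1)] by simp
    next
      case False
      then show ?thesis using max[OF I] by simp
    qed
  qed
  then show ?thesis using P(2) by blast
qed

text \<open>The element c is an inverse of b modulo \<open>M\<close>, so this says that the residue
  ring is a field. Being a statement about elements, it can be pulled back along homomorphisms
  witness by witness.\<close>

lemma (in cring) maximalideal_iff: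
  "maximalideal M R \<longleftrightarrow> ideal M R \<and> \<one> \<notin> M \<and> (\<forall>b\<in>carrier R. b \<notin> M \<longrightarrow> (\<exists>c\<in>carrier R. \<one> \<ominus> b \<otimes> c \<in> M))"
proof (intro iffI conjI ballI impI)
  assume M: "maximalideal M R"
  then interpret M: maximalideal M R .
  show "ideal M R" by (rule M.is_ideal)
  show "\<one> \<notin> M" using M.I_notcarr M.one_imp_carrier by auto
  fix b assume b: "b \<in> carrier R" "b \<notin> M"
  have sub: "M \<subseteq> M <+>\<^bsub>R\<^esub> PIdl b"
  proof
    fix x assume "x \<in> M"
    then have "x = x \<oplus> \<zero> \<otimes> b" using b M.Icarr by simp
    then show "x \<in> M <+>\<^bsub>R\<^esub> PIdl b" using \<open>x \<in> M\<close> unfolding set_add_def' cgenideal_def by blast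
  qed
  have b': "b \<in> M <+>\<^bsub>R\<^esub> PIdl b"
  proof -
    have "b = \<zero> \<oplus> \<one> \<otimes> b" using b by simp
    then show ?thesis using M.zero_closed unfolding set_add_def' cgenideal_def by blast
  qed
  have idl: "ideal (M <+>\<^bsub>R\<^esub> PIdl b) R" by (rule add_ideals[OF M.is_ideal cgenideal_ideal[OF b(1)]])
  then have "M <+>\<^bsub>R\<^esub> PIdl b \<subseteq> carrier R" using additive_subgroup.a_subset ideal.axioms(1) by blast
  from M.I_maximal[OF idl sub this] have "M <+>\<^bsub>R\<^esub> PIdl b = carrier R" using b b' by auto
  then have "\<one> \<in> M <+>\<^bsub>R\<^esub> PIdl b" by simp
  then obtain x c where xc: "x \<in> M" "c \<in> carrier R" "\<one> = x \<oplus> c \<otimes> b"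
    unfolding set_add_def' cgenideal_def by auto
  have "\<one> \<ominus> b \<otimes> c = x \<oplus> c \<otimes> b \<ominus> b \<otimes> c" using xc(3) by simp
  also have "\<dots> = x" using xc(1,2) b M.Icarr[OF xc(1)] by algebra
  finally have "\<one> \<ominus> b \<otimes> c \<in> M" using xc(1) by (simp only:)
  then show "\<exists>c\<in>carrier R. \<one> \<ominus> b \<otimes> c \<in> M" using xc(2) by blast
next
  assume asm: "ideal M R \<and> \<one> \<notin> M \<and> (\<forall>b\<in>carrier R. b \<notin> M \<longrightarrow> (\<exists>c\<in>carrier R. \<one> \<ominus> b \<otimes> c \<in> M))"
  then have "ideal M R" by simp
  show "maximalideal M R"
  proof (rule maximalidealI[OF \<open>ideal M R\<close>])
    show "carrier R \<noteq> M" using asm by auto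
  next
    fix J assume J: "ideal J R" "M \<subseteq> J" "J \<subseteq> carrier R"
    interpret J: ideal J R by fact
    show "J = M \<or> J = carrier R"
    proof (cases "J = M")
      case False
      then obtain b where b: "b \<in> J" "b \<notin> M" using J by auto
      then obtain c where c: "c \<in> carrier R" "\<one> \<ominus> b \<otimes> c \<in> M" using asm J by blast
      have bc: "b \<in> carrier R" using b J by auto
      have "\<one> = (\<one> \<ominus> b \<otimes> c) \<oplus> b \<otimes> c" using bc c(1) by algebra
      also have "\<dots> \<in> J" using c b J(2) by (intro J.a_closed J.I_r_closed) auto
      finally show ?thesis using J.one_imp_carrier by blast
    qed simp
  qed
qed

lemma ring_hom_cringI':
  "cring R \<Longrightarrow> cring S \<Longrightarrow> h \<in> ring_hom R S \<Longrightarrow> ring_hom_cring R S h"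
  by (simp add: ring_hom_cring_def ring_hom_cring_axioms_def)

lemma (in ring_hom_cring) ideal_vimage:
  assumes "ideal P S" shows "ideal {x \<in> carrier R. h x \<in> P} R"
proof -
  interpret P: ideal P S by fact
  interpret R': ring R by (rule R.ring_axioms)
  show ?thesis
  proof (rule idealI)
    show "ring R" by (rule R.ring_axioms)
    show "subgroup {x \<in> carrier R. h x \<in> P} (add_monoid R)"
      by (rule R.add.subgroupI) (auto simp: P.a_closed a_inv_def[symmetric] intro: exI[of _ "\<zero>\<^bsub>R\<^esub>"])
  qed (auto intro: P.I_l_closed P.I_r_closed)
qed

lemma (in ring_hom_cring) primeideal_vimage:
  assumes "primeideal P S" shows "primeideal {x \<in> carrier R. h x \<in> P} R"
proof -
  interpret P: primeideal P S by fact
  show ?thesis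
  proof (rule primeidealI[OF ideal_vimage[OF P.is_ideal] R.is_cring])
    show "carrier R \<noteq> {x \<in> carrier R. h x \<in> P}"
    proof
      assume "carrier R = {x \<in> carrier R. h x \<in> P}"
      then have "h \<one>\<^bsub>R\<^esub> \<in> P" using R.one_closed by blast
      then have "\<one>\<^bsub>S\<^esub> \<in> P" by simp
      then show False using P.one_imp_carrier P.I_notcarr by auto
    qed
  qed (auto dest!: P.I_prime[rotated 2])
qed

lemma (in ring_hom_cring) hom_minus_eq:
  "x \<in> carrier R \<Longrightarrow> y \<in> carrier R \<Longrightarrow> h (x \<ominus>\<^bsub>R\<^esub> y) = h x \<ominus>\<^bsub>S\<^esub> h y"
  by (simp add: a_minus_def)

lemma (in ring_hom_cring) hom_pow:
  "x \<in> carrier R \<Longrightarrow> h (x [^]\<^bsub>R\<^esub> (k::nat)) = h x [^]\<^bsub>S\<^esub> k"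
  by (induction k) auto

text \<open>An inverse modulo \<open>M\<close> chosen in \<open>S\<close> has a preimage in
  \<open>R\<close>; this is where surjectivity enters. For the map from B to S, which is not
  surjective, integrality takes its place later.\<close>

lemma (in ring_hom_cring) maximalideal_vimage:
  assumes "maximalideal M S" and surj: "h ` carrier R = carrier S"
  shows "maximalideal {x \<in> carrier R. h x \<in> M} R"
proof -
  from assms(1) have M: "ideal M S" "\<one>\<^bsub>S\<^esub> \<notin> M"
    "\<And>b. b \<in> carrier S \<Longrightarrow> b \<notin> M \<Longrightarrow> \<exists>c\<in>carrier S. \<one>\<^bsub>S\<^esub> \<ominus>\<^bsub>S\<^esub> b \<otimes>\<^bsub>S\<^esub> c \<in> M"
    unfolding S.maximalideal_iff by auto
  show ?thesis
    unfolding R.maximalideal_iff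
  proof (intro conjI ballI impI ideal_vimage M(1))
    show "\<one>\<^bsub>R\<^esub> \<notin> {x \<in> carrier R. h x \<in> M}" using M(2) by simp
  next
    fix b assume b: "b \<in> carrier R" "b \<notin> {x \<in> carrier R. h x \<in> M}"
    then obtain c where "c \<in> carrier S" "\<one>\<^bsub>S\<^esub> \<ominus>\<^bsub>S\<^esub> h b \<otimes>\<^bsub>S\<^esub> c \<in> M" using M(3)[of "h b"] by auto
    moreover from this obtain c' where "c' \<in> carrier R" "c = h c'" using surj by auto
    ultimately show "\<exists>c\<in>carrier R. \<one>\<^bsub>R\<^esub> \<ominus>\<^bsub>R\<^esub> b \<otimes>\<^bsub>R\<^esub> c \<in> {x \<in> carrier R. h x \<in> M}"
      using b by (intro bexI[of _ c']) (auto simp: hom_minus_eq)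
  qed
qed

section \<open>Regular sequences\<close>

text \<open>For a list a1, ..., an this is a1 M + ... + an M, the submodule that
  \<open>ideal_times_module\<close> describes as an intersection. The recursion permits induction on
  the generators and supplies explicit witnesses.\<close>

primrec list_span :: "('a, 'b, 'm) module_scheme \<Rightarrow> 'a list \<Rightarrow> 'b set" where
  "list_span M [] = {\<zero>\<^bsub>M\<^esub>}"
| "list_span M (a # as) = {a \<odot>\<^bsub>M\<^esub> x \<oplus>\<^bsub>M\<^esub> y | x y. x \<in> carrier M \<and> y \<in> list_span M as}"

text \<open>A regular sequence without the condition that the last quotient be nonzero, phrased with
  submodules of \<open>M\<close> in place of quotient modules.\<close>

definition weakly_regular :: "('a, 'b, 'm) module_scheme \<Rightarrow> 'a list \<Rightarrow> bool" where
  "weakly_regular M as \<longleftrightarrow> (\<forall>i<length as. \<forall>x\<in>carrier M.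
     as ! i \<odot>\<^bsub>M\<^esub> x \<in> list_span M (take i as) \<longrightarrow> x \<in> list_span M (take i as))"

text \<open>The length \<open>l\<close> counts strict inclusions, as in \<open>krull_dim\<close>, so
  l + 1 primes are involved.\<close>

definition prime_chain :: "('a, 'c) ring_scheme \<Rightarrow> nat \<Rightarrow> (nat \<Rightarrow> 'a set) \<Rightarrow> bool" where
  "prime_chain A l P \<longleftrightarrow> (\<forall>i\<le>l. primeideal (P i) A) \<and> (\<forall>i<l. P i \<subset> P (Suc i))"

lemma (in module) list_span_submodule:
  "set as \<subseteq> carrier R \<Longrightarrow> submodule (list_span M as) R M"
proof (induction as)
  case Nil
  show ?case by (rule submoduleI) auto
next
  case (Cons a as)
  then have a: "a \<in> carrier R" and N: "submodule (list_span M as) R M" by auto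
  note N = submoduleE[OF N]
  have z: "\<zero>\<^bsub>M\<^esub> \<in> list_span M as"
  proof -
    obtain x where "x \<in> list_span M as" using N(2) by auto
    then have "x \<oplus>\<^bsub>M\<^esub> (\<ominus>\<^bsub>M\<^esub> x) \<in> list_span M as" using N(3,5) by auto
    then show ?thesis using \<open>x \<in> list_span M as\<close> N(1) M.r_neg by auto
  qed
  show ?case
  proof (rule submoduleI)
    show "list_span M (a # as) \<subseteq> carrier M" using a N(1) by auto
    show "\<zero>\<^bsub>M\<^esub> \<in> list_span M (a # as)"
      using z a by (auto intro!: exI[of _ "\<zero>\<^bsub>M\<^esub>"])
  next
    fix u assume "u \<in> list_span M (a # as)"
    then obtain x y where u: "u = a \<odot>\<^bsub>M\<^esub> x \<oplus>\<^bsub>M\<^esub> y" "x \<in> carrier M" "y \<in> list_span M as" by auto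
    have "\<ominus>\<^bsub>M\<^esub> u = a \<odot>\<^bsub>M\<^esub> (\<ominus>\<^bsub>M\<^esub> x) \<oplus>\<^bsub>M\<^esub> (\<ominus>\<^bsub>M\<^esub> y)"
      using u a N(1) by (auto simp: smult_r_minus M.minus_add)
    then show "\<ominus>\<^bsub>M\<^esub> u \<in> list_span M (a # as)" using u N(3) M.a_inv_closed by auto
    fix v assume "v \<in> list_span M (a # as)"
    then obtain x' y' where v: "v = a \<odot>\<^bsub>M\<^esub> x' \<oplus>\<^bsub>M\<^esub> y'" "x' \<in> carrier M" "y' \<in> list_span M as" by auto
    have "u \<oplus>\<^bsub>M\<^esub> v = a \<odot>\<^bsub>M\<^esub> (x \<oplus>\<^bsub>M\<^esub> x') \<oplus>\<^bsub>M\<^esub> (y \<oplus>\<^bsub>M\<^esub> y')"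
      using u v a subsetD[OF N(1)] by (simp add: smult_r_distr M.a_ac)
    then show "u \<oplus>\<^bsub>M\<^esub> v \<in> list_span M (a # as)" using u v N(5) M.a_closed by auto
  next
    fix b u assume b: "b \<in> carrier R" and "u \<in> list_span M (a # as)"
    then obtain x y where u: "u = a \<odot>\<^bsub>M\<^esub> x \<oplus>\<^bsub>M\<^esub> y" "x \<in> carrier M" "y \<in> list_span M as" by auto
    have "b \<odot>\<^bsub>M\<^esub> u = a \<odot>\<^bsub>M\<^esub> (b \<odot>\<^bsub>M\<^esub> x) \<oplus>\<^bsub>M\<^esub> b \<odot>\<^bsub>M\<^esub> y"
      using u a b subsetD[OF N(1)] by (simp add: smult_r_distr smult_assoc1[symmetric] R.m_comm)
    then show "b \<odot>\<^bsub>M\<^esub> u \<in> list_span M (a # as)" using u b N(4) by auto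
  qed
qed

lemma (in module) submodule_zero: "submodule N R M \<Longrightarrow> \<zero>\<^bsub>M\<^esub> \<in> N"
  using submoduleE(1,2,4)[of N] by (metis R.zero_closed all_not_in_conv smult_l_null subset_iff)

lemma (in module) list_span_mult:
  assumes "set as \<subseteq> carrier R" "a \<in> set as" "x \<in> carrier M"
  shows "a \<odot>\<^bsub>M\<^esub> x \<in> list_span M as"
  using assms
proof (induction as)
  case (Cons b as)
  then have b: "b \<in> carrier R" "set as \<subseteq> carrier R" by auto
  note N = list_span_submodule[OF b(2)]
  show ?case
  proof (cases "a = b")
    case True
    then have "a \<odot>\<^bsub>M\<^esub> x = b \<odot>\<^bsub>M\<^esub> x \<oplus>\<^bsub>M\<^esub> \<zero>\<^bsub>M\<^esub>" using Cons.prems b by simp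
    then show ?thesis using Cons.prems(3) submodule_zero[OF N] unfolding list_span.simps by blast
  next
    case False
    then have "a \<odot>\<^bsub>M\<^esub> x \<in> list_span M as" using Cons b by auto
    moreover from this have "a \<odot>\<^bsub>M\<^esub> x = b \<odot>\<^bsub>M\<^esub> \<zero>\<^bsub>M\<^esub> \<oplus>\<^bsub>M\<^esub> a \<odot>\<^bsub>M\<^esub> x"
      using b submoduleE(1)[OF N] by auto
    ultimately show ?thesis using M.zero_closed unfolding list_span.simps by blast
  qed
qed simp

lemma (in module) list_span_minimal:
  assumes "submodule N R M" "\<And>a x. a \<in> set as \<Longrightarrow> x \<in> carrier M \<Longrightarrow> a \<odot>\<^bsub>M\<^esub> x \<in> N"
  shows "list_span M as \<subseteq> N"
  using assms(2)
proof (induction as)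
  case Nil
  then show ?case using submodule_zero[OF assms(1)] by auto
next
  case (Cons b as)
  then show ?case using submoduleE(5)[OF assms(1)] by auto
qed

text \<open>This is the annihilator of M/N. It serves to pass from generators to the ideal that they
  generate, and it is the J_k in the construction of prime chains.\<close>

lemma (in module) conductor_ideal:
  assumes "submodule N R M"
  shows "ideal {a \<in> carrier R. \<forall>x\<in>carrier M. a \<odot>\<^bsub>M\<^esub> x \<in> N} R"
proof -
  note N = submoduleE[OF assms] submodule_zero[OF assms]
  show ?thesis
  proof (rule idealI[OF R.ring_axioms])
    show "subgroup {a \<in> carrier R. \<forall>x\<in>carrier M. a \<odot>\<^bsub>M\<^esub> x \<in> N} (add_monoid R)"
      by (rule R.add.subgroupI)
        (use N in \<open>auto simp: a_inv_def[symmetric] smult_l_minus smult_l_distr intro!: exI[of _ "\<zero>\<^bsub>R\<^esub>"]\<close>)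
  next
    fix a b assume a: "a \<in> {a \<in> carrier R. \<forall>x\<in>carrier M. a \<odot>\<^bsub>M\<^esub> x \<in> N}" and b: "b \<in> carrier R"
    show "b \<otimes> a \<in> {a \<in> carrier R. \<forall>x\<in>carrier M. a \<odot>\<^bsub>M\<^esub> x \<in> N}"
      using a b N by (auto simp: smult_assoc1)
    then show "a \<otimes> b \<in> {a \<in> carrier R. \<forall>x\<in>carrier M. a \<odot>\<^bsub>M\<^esub> x \<in> N}"
      using a b by (auto simp: R.m_comm)
  qed
qed

text \<open>The generators lie in the conductor of \<open>list_span M as\<close>, which is an ideal,
  hence so does all that they generate; the other inclusion is minimality of the span.\<close>

lemma (in module) ideal_times_list_span:
  assumes "set as \<subseteq> carrier R"
  shows "ideal_times_module R (Idl (set as)) M = list_span M as"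
proof
  note N = list_span_submodule[OF assms]
  have "Idl (set as) \<subseteq> {a \<in> carrier R. \<forall>x\<in>carrier M. a \<odot>\<^bsub>M\<^esub> x \<in> list_span M as}"
    by (rule R.genideal_minimal[OF conductor_ideal[OF N]]) (use list_span_mult assms in auto)
  then show "ideal_times_module R (Idl (set as)) M \<subseteq> list_span M as"
    unfolding ideal_times_module_def using N by blast
next
  show "list_span M as \<subseteq> ideal_times_module R (Idl (set as)) M"
    unfolding ideal_times_module_def
  proof (intro Inter_greatest, clarify)
    fix N x assume N: "submodule N R M" "\<forall>a\<in>Idl (set as). \<forall>x\<in>carrier M. a \<odot>\<^bsub>M\<^esub> x \<in> N"
      and x: "x \<in> list_span M as"
    show "x \<in> N"
      using list_span_minimal[OF N(1)] N(2) x R.genideal_self[OF assms] by blast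
  qed
qed

lemma (in module) coset_eq_iff:
  assumes N: "submodule N R M" and "x \<in> carrier M" "y \<in> carrier M"
  shows "N +>\<^bsub>M\<^esub> x = N +>\<^bsub>M\<^esub> y \<longleftrightarrow> x \<ominus>\<^bsub>M\<^esub> y \<in> N"
proof -
  interpret N: abelian_subgroup N M
    by (rule abelian_subgroupI3) (use N M.abelian_group_axioms in \<open>auto simp: additive_subgroup_def submodule_def\<close>)
  have "N +>\<^bsub>M\<^esub> x = N +>\<^bsub>M\<^esub> y \<longleftrightarrow> x \<in> N +>\<^bsub>M\<^esub> y"
    using N.a_rcos_self[OF assms(2)] N.a_repr_independence'[OF _ assms(3), of x] by auto
  then show ?thesis using N.a_rcos_module[OF assms(3,2)] by (simp add: a_minus_def)
qed

lemma (in module) coset_eq_self_iff: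
  assumes N: "submodule N R M" and "x \<in> carrier M"
  shows "N +>\<^bsub>M\<^esub> x = N \<longleftrightarrow> x \<in> N"
proof -
  have "N +>\<^bsub>M\<^esub> \<zero>\<^bsub>M\<^esub> = N" using M.a_coset_add_zero submoduleE(1)[OF N] by auto
  moreover have "x \<ominus>\<^bsub>M\<^esub> \<zero>\<^bsub>M\<^esub> = x"
    using assms(2) M.add.inv_one by (simp add: a_minus_def a_inv_def)
  ultimately show ?thesis using coset_eq_iff[OF N assms(2) M.zero_closed] by simp
qed

text \<open>Two representatives of a coset differ by an element of \<open>N\<close>, which
  \<open>a\<close> maps into \<open>N\<close>, so the union in \<open>module_quot\<close> runs over
  equal cosets.\<close>

lemma (in module) smult_coset:
  assumes N: "submodule N R M" and "x \<in> carrier M" "a \<in> carrier R"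
  shows "a \<odot>\<^bsub>module_quot M N\<^esub> (N +>\<^bsub>M\<^esub> x) = N +>\<^bsub>M\<^esub> (a \<odot>\<^bsub>M\<^esub> x)"
proof -
  have x: "x \<in> N +>\<^bsub>M\<^esub> x"
    using submodule_zero[OF N] assms(2) unfolding a_r_coset_def' by force
  have "N +>\<^bsub>M\<^esub> (a \<odot>\<^bsub>M\<^esub> y) = N +>\<^bsub>M\<^esub> (a \<odot>\<^bsub>M\<^esub> x)" if y: "y \<in> N +>\<^bsub>M\<^esub> x" for y
  proof -
    obtain z where z: "z \<in> N" "y = z \<oplus>\<^bsub>M\<^esub> x" using y unfolding a_r_coset_def' by auto
    have c: "z \<in> carrier M" using z submoduleE(1)[OF N] by auto
    have "a \<odot>\<^bsub>M\<^esub> y \<ominus>\<^bsub>M\<^esub> a \<odot>\<^bsub>M\<^esub> x = a \<odot>\<^bsub>M\<^esub> z"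
      using z c assms by (simp add: smult_r_distr a_minus_def M.a_assoc M.r_neg)
    then show ?thesis using z c assms submoduleE(4)[OF N] coset_eq_iff[OF N] by auto
  qed
  then have "(\<Union>y\<in>N +>\<^bsub>M\<^esub> x. N +>\<^bsub>M\<^esub> (a \<odot>\<^bsub>M\<^esub> y)) = (\<Union>y\<in>N +>\<^bsub>M\<^esub> x. N +>\<^bsub>M\<^esub> (a \<odot>\<^bsub>M\<^esub> x))"
    by (rule SUP_cong[OF refl])
  then show ?thesis using x by (auto simp add: module_quot_def simp del: UN_iff)
qed

lemma (in module) nonzerodivisor_on_quot:
  assumes N: "submodule N R M" and a: "a \<in> carrier R"
  shows "nonzerodivisor_on (module_quot M N) a \<longleftrightarrow> (\<forall>x\<in>carrier M. a \<odot>\<^bsub>M\<^esub> x \<in> N \<longrightarrow> x \<in> N)"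
proof -
  have "carrier (module_quot M N) = (\<lambda>x. N +>\<^bsub>M\<^esub> x) ` carrier M" "\<zero>\<^bsub>module_quot M N\<^esub> = N"
    by (auto simp: module_quot_def A_RCOSETS_def')
  then have "nonzerodivisor_on (module_quot M N) a \<longleftrightarrow>
      (\<forall>x\<in>carrier M. a \<odot>\<^bsub>module_quot M N\<^esub> (N +>\<^bsub>M\<^esub> x) = N \<longrightarrow> N +>\<^bsub>M\<^esub> x = N)"
    unfolding nonzerodivisor_on_def by simp
  also have "\<dots> \<longleftrightarrow> (\<forall>x\<in>carrier M. a \<odot>\<^bsub>M\<^esub> x \<in> N \<longrightarrow> x \<in> N)"
  proof (intro ball_cong refl)
    fix x assume x: "x \<in> carrier M"
    show "(a \<odot>\<^bsub>module_quot M N\<^esub> (N +>\<^bsub>M\<^esub> x) = N \<longrightarrow> N +>\<^bsub>M\<^esub> x = N) =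
      (a \<odot>\<^bsub>M\<^esub> x \<in> N \<longrightarrow> x \<in> N)"
      unfolding smult_coset[OF N x a] coset_eq_self_iff[OF N x]
        coset_eq_self_iff[OF N smult_closed[OF a x]] ..
  qed
  finally show ?thesis .
qed

lemma (in module) module_quot_trivial:
  assumes N: "submodule N R M"
  shows "carrier (module_quot M N) = {\<zero>\<^bsub>module_quot M N\<^esub>} \<longleftrightarrow> N = carrier M"
proof -
  have *: "carrier (module_quot M N) = (\<lambda>x. N +>\<^bsub>M\<^esub> x) ` carrier M" "\<zero>\<^bsub>module_quot M N\<^esub> = N"
    by (auto simp: module_quot_def A_RCOSETS_def')
  have "(\<lambda>x. N +>\<^bsub>M\<^esub> x) ` carrier M = {N} \<longleftrightarrow> (\<forall>x\<in>carrier M. N +>\<^bsub>M\<^esub> x = N)"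
    using M.zero_closed by blast
  also have "\<dots> \<longleftrightarrow> carrier M \<subseteq> N"
    using coset_eq_self_iff[OF N] by (simp add: subset_eq)
  finally show ?thesis unfolding * using submoduleE(1)[OF N] by blast
qed

text \<open>Removes the iterated quotient modules: vanishing of a coset is membership in a
  submodule. From here on regularity is handled inside \<open>M\<close>.\<close>

lemma (in module) regular_sequence_iff:
  "regular_sequence R M as \<longleftrightarrow>
     set as \<subseteq> carrier R \<and> weakly_regular M as \<and> list_span M as \<noteq> carrier M"
proof (cases "set as \<subseteq> carrier R")
  case True
  then have t: "set (take i as) \<subseteq> carrier R" for i using set_take_subset by fast
  have n: "i < length as \<Longrightarrow> as ! i \<in> carrier R" for i using True nth_mem by blast
  show ?thesis unfolding regular_sequence_def weakly_regular_def ideal_times_list_span[OF t]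
    ideal_times_list_span[OF True] module_quot_trivial[OF list_span_submodule[OF True]]
    using True nonzerodivisor_on_quot[OF list_span_submodule[OF t] n] by auto
qed (simp add: regular_sequence_def)

text \<open>With \<open>J\<^sub>k\<close> the annihilator of \<open>M / (a\<^sub>1, \<dots>, a\<^sub>k)M\<close>, a prime containing \<open>J\<^sub>k\<^sub>+\<^sub>1\<close> strictly contains a prime
  containing \<open>J\<^sub>k\<close> that avoids \<open>a\<^sub>k\<^sub>+\<^sub>1\<close>: the products of powers of \<open>a\<^sub>k\<^sub>+\<^sub>1\<close> and elements outside the given
  prime do not meet \<open>J\<^sub>k\<close>.\<close>

lemma (in module) regular_sequence_prime_chain:
  assumes as: "set as \<subseteq> carrier R" "weakly_regular M as" and ne: "list_span M as \<noteq> carrier M"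
  shows "\<exists>P. prime_chain R (length as) P"
proof -
  define J where "J k = {a \<in> carrier R. \<forall>x\<in>carrier M. a \<odot>\<^bsub>M\<^esub> x \<in> list_span M (take k as)}" for k
  have t: "set (take k as) \<subseteq> carrier R" for k using as(1) set_take_subset by fast
  note N = list_span_submodule[OF t]
  have J: "ideal (J k) R" for k unfolding J_def by (rule conductor_ideal[OF N])
  have chain: "k \<le> length as \<Longrightarrow> primeideal Q R \<Longrightarrow> J k \<subseteq> Q \<Longrightarrow> \<exists>P. prime_chain R k P \<and> P k = Q" for k Q
  proof (induction k arbitrary: Q)
    case 0
    then show ?case by (intro exI[of _ "\<lambda>_. Q"]) (auto simp: prime_chain_def)
  next
    case (Suc k)
    interpret Q: primeideal Q R by fact
    define b where "b = as ! k"
    have b: "b \<in> carrier R" using as(1) Suc.prems nth_mem unfolding b_def by force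
    have take: "take (Suc k) as = take k as @ [b]" using Suc.prems by (simp add: b_def take_Suc_conv_app_nth)
    have mono: "J k \<subseteq> J (Suc k)"
    proof -
      have "list_span M (take k as) \<subseteq> list_span M (take (Suc k) as)"
      proof (rule list_span_minimal[OF N])
        fix a x assume "a \<in> set (take k as)" "x \<in> carrier M"
        then show "a \<odot>\<^bsub>M\<^esub> x \<in> list_span M (take (Suc k) as)"
          by (intro list_span_mult[OF t]) (simp_all add: take)
      qed
      then show ?thesis unfolding J_def by blast
    qed
    have "b \<in> set (take (Suc k) as)" by (simp add: take)
    then have bJ: "b \<in> J (Suc k)" unfolding J_def using b list_span_mult[OF t] by blast
    have nzd: "x \<in> carrier M \<Longrightarrow> b \<odot>\<^bsub>M\<^esub> x \<in> list_span M (take k as) \<Longrightarrow> x \<in> list_span M (take k as)" for x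
      using as(2) Suc.prems unfolding weakly_regular_def b_def by auto
    \<comment> \<open>Taking i = 0 forces a prime that misses \<open>U\<close> to lie in
      \<open>Q\<close>; taking s = \<one> and i = 1 keeps b out of it.\<close>
    define U where "U = {s \<otimes> b [^] i | s i. s \<in> carrier R - Q \<and> i \<in> (UNIV::nat set)}"
    have nzdp: "x \<in> carrier M \<Longrightarrow> b [^] (i::nat) \<odot>\<^bsub>M\<^esub> x \<in> list_span M (take k as) \<Longrightarrow> x \<in> list_span M (take k as)" for x i
    proof (induction i arbitrary: x)
      case (Suc i)
      have "b [^] i \<odot>\<^bsub>M\<^esub> (b \<odot>\<^bsub>M\<^esub> x) \<in> list_span M (take k as)"
        using Suc.prems b by (simp add: smult_assoc1)
      then have "b \<odot>\<^bsub>M\<^esub> x \<in> list_span M (take k as)" using Suc.IH Suc.prems(1) b by blast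
      then show ?case using nzd Suc.prems(1) by blast
    qed simp
    have "\<exists>P. primeideal P R \<and> J k \<subseteq> P \<and> P \<inter> U = {}"
    proof (rule R.exists_prime_disjoint[OF J])
      show "U \<subseteq> carrier R" using b by (auto simp: U_def)
      have one: "\<one> \<notin> Q" using Q.I_notcarr Q.one_imp_carrier by auto
      then show "\<one> \<in> U" unfolding U_def by (auto intro!: exI[of _ \<one>] exI[of _ "0::nat"])
      show "x \<otimes> y \<in> U" if xy: "x \<in> U" "y \<in> U" for x y
      proof -
        obtain s i s' i' where *: "x = s \<otimes> b [^] (i::nat)" "y = s' \<otimes> b [^] (i'::nat)"
          "s \<in> carrier R - Q" "s' \<in> carrier R - Q" using xy unfolding U_def by blast
        have "x \<otimes> y = (s \<otimes> s') \<otimes> b [^] (i + i')"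
          using * b by (simp add: R.nat_pow_mult[symmetric] R.m_ac)
        moreover have "s \<otimes> s' \<in> carrier R - Q" using * Q.I_prime by auto
        ultimately show ?thesis unfolding U_def by blast
      qed
      \<comment> \<open>If s b^i annihilates the quotient then so does s, because b is a
        nonzerodivisor on it. Then s lies in \<open>J k\<close>, hence in \<open>J (Suc k)\<close>
        and in \<open>Q\<close>.\<close>
      show "J k \<inter> U = {}"
      proof (rule ccontr)
        assume "J k \<inter> U \<noteq> {}"
        then obtain s i where s: "s \<in> carrier R - Q" "s \<otimes> b [^] (i::nat) \<in> J k" unfolding U_def by blast
        have "s \<odot>\<^bsub>M\<^esub> x \<in> list_span M (take k as)" if x: "x \<in> carrier M" for x
        proof (rule nzdp)
          show "b [^] i \<odot>\<^bsub>M\<^esub> (s \<odot>\<^bsub>M\<^esub> x) \<in> list_span M (take k as)"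
            using s x b unfolding J_def by (simp add: smult_assoc1[symmetric] R.m_comm)
        qed (use s x in auto)
        then have "s \<in> J k" using s unfolding J_def by auto
        then show False using mono Suc.prems(3) s by auto
      qed
    qed
    then obtain P0 where P0: "primeideal P0 R" "J k \<subseteq> P0" "P0 \<inter> U = {}" by blast
    have one: "\<one> \<notin> Q" using Q.I_notcarr Q.one_imp_carrier by auto
    have "b \<in> U" unfolding U_def using b one by (auto intro!: exI[of _ \<one>] exI[of _ "1::nat"])
    then have "b \<notin> P0" using P0 by auto
    moreover have "P0 \<subseteq> Q"
    proof
      fix s assume s: "s \<in> P0"
      then have "s \<in> carrier R" using ideal.Icarr[OF primeideal.axioms(1)[OF P0(1)]] by simp
      show "s \<in> Q"
      proof (rule ccontr)
        assume "s \<notin> Q"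
        then have "s \<otimes> b [^] (0::nat) \<in> U" unfolding U_def using \<open>s \<in> carrier R\<close> by blast
        then have "s \<in> U" using \<open>s \<in> carrier R\<close> by simp
        then show False using P0 s by auto
      qed
    qed
    ultimately have str: "P0 \<subset> Q" using bJ Suc.prems(3) by blast
    obtain P where P: "prime_chain R k P" "P k = P0" using Suc.IH[OF _ P0(1,2)] Suc.prems(1) by auto
    show ?case
    proof (intro exI conjI)
      show "prime_chain R (Suc k) (P(Suc k := Q))"
        using P str Suc.prems(2) unfolding prime_chain_def by (simp add: less_Suc_eq le_Suc_eq)
    qed simp
  qed
  \<comment> \<open>The last quotient is nonzero, so its annihilator is a proper ideal and some
    prime above it can serve as the top of the chain.\<close>
  obtain x where "x \<in> carrier M" "x \<notin> list_span M as"
    using ne submoduleE(1)[OF list_span_submodule[OF as(1)]] by auto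
  then have "\<one> \<notin> J (length as)" unfolding J_def by auto
  then obtain Q where "primeideal Q R" "J (length as) \<subseteq> Q"
    using R.exists_prime_disjoint[OF J, of "{\<one>}"] by auto
  then show ?thesis using chain[OF order_refl, of Q] by auto
qed

section \<open>Rings that are finite and free over a subring modulo an element\<close>

text \<open>One number \<open>d\<close> plays two roles: it bounds the chains of primes, and it is
  the exact length of a regular sequence inside every maximal ideal. The exponent q is fixed before
  the sequence is chosen, and it is the q-th powers that have to be weakly regular, because on the
  push-forward g acts as multiplication by g^q.\<close>

definition cm_ring :: "('a, 'c) ring_scheme \<Rightarrow> nat \<Rightarrow> bool" where
  "cm_ring A d \<longleftrightarrow> cring A \<and> noetherian_ring A \<and> (\<forall>l P. prime_chain A l P \<longrightarrow> l \<le> d) \<and>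
     (\<forall>M q::nat. maximalideal M A \<and> q \<ge> 1 \<longrightarrow> (\<exists>gs. set gs \<subseteq> M \<and> length gs = d \<and>
        weakly_regular (regular_module A) (map (\<lambda>g. g [^]\<^bsub>A\<^esub> q) gs)))"

lemma (in ideal) coset_eq_zero_iff:
  "x \<in> carrier R \<Longrightarrow> I +> x = \<zero>\<^bsub>R Quot I\<^esub> \<longleftrightarrow> x \<in> I"
  using rcos_const_imp_mem[of x] a_rcos_zero[OF is_ideal, of x] by (auto simp: FactRing_def)

text \<open>\<open>\<beta>\<close> gives the coordinates of \<open>S / fS\<close> with respect to a basis of length \<open>D\<close> over \<open>B\<close>.\<close>

locale finite_free_mod = B: cring B + S: cring S
  for B :: "('b, 'm) ring_scheme" and S :: "('a, 'n) ring_scheme" +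
  fixes \<phi> :: "'b \<Rightarrow> 'a" and \<beta> :: "'a \<Rightarrow> nat \<Rightarrow> 'b" and D :: nat and f :: 'a
  assumes hom: "\<phi> \<in> ring_hom B S" and f_closed: "f \<in> carrier S"
    and coord_closed: "\<And>g j. g \<in> carrier S \<Longrightarrow> j < D \<Longrightarrow> \<beta> g j \<in> carrier B"
    and coord_add: "\<And>g h j. g \<in> carrier S \<Longrightarrow> h \<in> carrier S \<Longrightarrow> j < D \<Longrightarrow> \<beta> (g \<oplus>\<^bsub>S\<^esub> h) j = \<beta> g j \<oplus>\<^bsub>B\<^esub> \<beta> h j"
    and coord_smult: "\<And>b g j. b \<in> carrier B \<Longrightarrow> g \<in> carrier S \<Longrightarrow> j < D \<Longrightarrow> \<beta> (\<phi> b \<otimes>\<^bsub>S\<^esub> g) j = b \<otimes>\<^bsub>B\<^esub> \<beta> g j"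
    and coord_eq_0: "\<And>g. g \<in> carrier S \<Longrightarrow> (\<forall>j<D. \<beta> g j = \<zero>\<^bsub>B\<^esub>) \<longleftrightarrow> g \<in> PIdl\<^bsub>S\<^esub> f"
    and coord_surj: "\<And>b. (\<forall>j<D. b j \<in> carrier B) \<Longrightarrow> \<exists>g\<in>carrier S. \<forall>j<D. \<beta> g j = b j"
begin

sublocale \<phi>: ring_hom_cring B S \<phi>
  by (rule ring_hom_cringI'[OF B.is_cring S.is_cring hom])

lemma coord_uminus: "g \<in> carrier S \<Longrightarrow> j < D \<Longrightarrow> \<beta> (\<ominus>\<^bsub>S\<^esub> g) j = \<ominus>\<^bsub>B\<^esub> \<beta> g j"
proof -
  assume g: "g \<in> carrier S" "j < D"
  have "\<ominus>\<^bsub>S\<^esub> g = \<phi> (\<ominus>\<^bsub>B\<^esub> \<one>\<^bsub>B\<^esub>) \<otimes>\<^bsub>S\<^esub> g" using g by (simp add: S.l_minus)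
  then show ?thesis using g coord_smult[of "\<ominus>\<^bsub>B\<^esub> \<one>\<^bsub>B\<^esub>" g j] coord_closed[of g j] by (simp add: B.l_minus)
qed

lemma coord_minus:
  "g \<in> carrier S \<Longrightarrow> h \<in> carrier S \<Longrightarrow> j < D \<Longrightarrow> \<beta> (g \<ominus>\<^bsub>S\<^esub> h) j = \<beta> g j \<ominus>\<^bsub>B\<^esub> \<beta> h j"
  by (simp add: a_minus_def coord_add coord_uminus)

lemma coord_zero: "j < D \<Longrightarrow> \<beta> \<zero>\<^bsub>S\<^esub> j = \<zero>\<^bsub>B\<^esub>"
  using coord_eq_0[of "\<zero>\<^bsub>S\<^esub>"] additive_subgroup.zero_closed[OF ideal.axioms(1)[OF S.cgenideal_ideal[OF f_closed]]]
  by auto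

section \<open>The noetherian property of S/fS as a module over B\<close>

definition bsub :: "'a set \<Rightarrow> bool" where
  "bsub T \<longleftrightarrow> T \<subseteq> carrier S \<and> PIdl\<^bsub>S\<^esub> f \<subseteq> T \<and> (\<forall>x\<in>T. \<forall>y\<in>T. x \<oplus>\<^bsub>S\<^esub> y \<in> T) \<and>
     (\<forall>b\<in>carrier B. \<forall>x\<in>T. \<phi> b \<otimes>\<^bsub>S\<^esub> x \<in> T)"

text \<open>Ideals containing f are one source of \<open>bsub\<close> sets. The other consists of
  the spans of powers of an element, used for integrality, which are closed only under scalars from
  \<open>B\<close>.\<close>

lemma bsub_ideal: "ideal I S \<Longrightarrow> f \<in> I \<Longrightarrow> bsub I"
  unfolding bsub_def using S.cgenideal_minimal[of I f] ideal.Icarr[of I S]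
    additive_subgroup.a_closed[OF ideal.axioms(1), of I S] ideal.I_l_closed[of I S]
  by auto

lemma bsub_minus:
  assumes "bsub T" "x \<in> T" "y \<in> T" shows "x \<ominus>\<^bsub>S\<^esub> y \<in> T"
proof -
  have c: "x \<in> carrier S" "y \<in> carrier S" using assms unfolding bsub_def by auto
  have "\<phi> (\<ominus>\<^bsub>B\<^esub> \<one>\<^bsub>B\<^esub>) \<otimes>\<^bsub>S\<^esub> y \<in> T" using assms unfolding bsub_def by blast
  then have "\<ominus>\<^bsub>S\<^esub> y \<in> T" using c by (simp add: S.l_minus)
  then show ?thesis using assms unfolding bsub_def a_minus_def by blast
qed

text \<open>The leading coefficient ideals of the Hilbert basis argument, with the position of the
  first possibly nonzero coordinate in place of the degree.\<close>

definition lead :: "nat \<Rightarrow> 'a set \<Rightarrow> 'b set" where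
  "lead j T = {\<beta> g j | g. g \<in> T \<and> (\<forall>i<j. \<beta> g i = \<zero>\<^bsub>B\<^esub>)}"

lemma lead_ideal:
  assumes T: "bsub T" and j: "j < D"
  shows "ideal (lead j T) B"
proof -
  have c: "g \<in> T \<Longrightarrow> g \<in> carrier S" for g using T unfolding bsub_def by auto
  have mult: "b \<otimes>\<^bsub>B\<^esub> x \<in> lead j T" if b: "b \<in> carrier B" "x \<in> lead j T" for b x
  proof -
    obtain g where g: "g \<in> T" "\<forall>i<j. \<beta> g i = \<zero>\<^bsub>B\<^esub>" "x = \<beta> g j" using b unfolding lead_def by auto
    have "\<phi> b \<otimes>\<^bsub>S\<^esub> g \<in> T" using T b g unfolding bsub_def by blast
    moreover have "i < D \<Longrightarrow> \<beta> (\<phi> b \<otimes>\<^bsub>S\<^esub> g) i = b \<otimes>\<^bsub>B\<^esub> \<beta> g i" for i using b c[OF g(1)] coord_smult by auto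
    ultimately show ?thesis using g b j unfolding lead_def by (auto intro!: exI[of _ "\<phi> b \<otimes>\<^bsub>S\<^esub> g"])
  qed
  have sub: "lead j T \<subseteq> carrier B" using j c coord_closed unfolding lead_def by auto
  show ?thesis
  proof (rule idealI[OF B.ring_axioms])
    show "subgroup (lead j T) (add_monoid B)"
    proof (rule B.add.subgroupI)
      show "lead j T \<subseteq> carrier B" by (rule sub)
      have "\<zero>\<^bsub>S\<^esub> \<in> T"
        using T additive_subgroup.zero_closed[OF ideal.axioms(1)[OF S.cgenideal_ideal[OF f_closed]]]
        unfolding bsub_def by auto
      then show "lead j T \<noteq> {}" using j coord_zero unfolding lead_def by auto
    next
      fix x assume x: "x \<in> lead j T"
      then have "(\<ominus>\<^bsub>B\<^esub> \<one>\<^bsub>B\<^esub>) \<otimes>\<^bsub>B\<^esub> x \<in> lead j T" by (intro mult) auto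
      then show "\<ominus>\<^bsub>B\<^esub> x \<in> lead j T" using x sub by (auto simp: B.l_minus)
      fix y assume y: "y \<in> lead j T"
      obtain g where g: "g \<in> T" "\<forall>i<j. \<beta> g i = \<zero>\<^bsub>B\<^esub>" "x = \<beta> g j" using x unfolding lead_def by auto
      obtain h where h: "h \<in> T" "\<forall>i<j. \<beta> h i = \<zero>\<^bsub>B\<^esub>" "y = \<beta> h j" using y unfolding lead_def by auto
      have "g \<oplus>\<^bsub>S\<^esub> h \<in> T" using T g h unfolding bsub_def by blast
      moreover have "i < D \<Longrightarrow> \<beta> (g \<oplus>\<^bsub>S\<^esub> h) i = \<beta> g i \<oplus>\<^bsub>B\<^esub> \<beta> h i" for i
        using coord_add c g(1) h(1) by auto
      ultimately show "x \<oplus>\<^bsub>B\<^esub> y \<in> lead j T" using g h j unfolding lead_def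
        by (auto intro!: exI[of _ "g \<oplus>\<^bsub>S\<^esub> h"])
    qed
  next
    fix x b assume "x \<in> lead j T" "b \<in> carrier B"
    then show "b \<otimes>\<^bsub>B\<^esub> x \<in> lead j T" by (intro mult)
    then show "x \<otimes>\<^bsub>B\<^esub> b \<in> lead j T" using \<open>x \<in> lead j T\<close> \<open>b \<in> carrier B\<close> sub by (simp add: B.m_comm subset_iff)
  qed
qed

text \<open>Descending induction on the number k of initial coordinates known to vanish: subtracting
  an element of \<open>T\<close> with the same k-th coordinate produces one more zero.\<close>

lemma lead_subset_imp:
  assumes T: "bsub T" and T': "bsub T'" and sub: "T \<subseteq> T'" and l: "\<And>j. j < D \<Longrightarrow> lead j T' \<subseteq> lead j T"
  shows "T' \<subseteq> T"
proof -
  have c: "g \<in> T' \<Longrightarrow> g \<in> carrier S" for g using T' unfolding bsub_def by auto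
  have "\<forall>g\<in>T'. (\<forall>i<k. \<beta> g i = \<zero>\<^bsub>B\<^esub>) \<longrightarrow> g \<in> T" if "k \<le> D" for k
    using that
  proof (induction k rule: inc_induct)
    \<comment> \<open>All \<open>D\<close> coordinates vanish, so the element lies in fS, which
      every \<open>bsub\<close> set contains.\<close>
    case base
    then show ?case using coord_eq_0 c T unfolding bsub_def by auto
  next
    case (step k)
    show ?case
    proof (intro ballI impI)
      fix g assume g: "g \<in> T'" "\<forall>i<k. \<beta> g i = \<zero>\<^bsub>B\<^esub>"
      then have "\<beta> g k \<in> lead k T'" unfolding lead_def by auto
      then have "\<beta> g k \<in> lead k T" using l[of k] step by auto
      then obtain h where h: "h \<in> T" "\<forall>i<k. \<beta> h i = \<zero>\<^bsub>B\<^esub>" "\<beta> g k = \<beta> h k" unfolding lead_def by auto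
      have hT': "h \<in> T'" using h sub by auto
      have gh: "g \<ominus>\<^bsub>S\<^esub> h \<in> T'" using bsub_minus[OF T' g(1)] h sub by auto
      have "\<forall>i<Suc k. \<beta> (g \<ominus>\<^bsub>S\<^esub> h) i = \<zero>\<^bsub>B\<^esub>"
        using g h c[OF g(1)] c[OF hT'] coord_minus coord_closed step
        by (auto simp: less_Suc_eq a_minus_def B.r_neg)
      then have "g \<ominus>\<^bsub>S\<^esub> h \<in> T" using step.IH gh by blast
      then have "(g \<ominus>\<^bsub>S\<^esub> h) \<oplus>\<^bsub>S\<^esub> h \<in> T" using T h unfolding bsub_def by blast
      moreover have "(g \<ominus>\<^bsub>S\<^esub> h) \<oplus>\<^bsub>S\<^esub> h = g" using c[OF g(1)] c[OF hT'] by algebra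
      ultimately show "g \<in> T" by simp
    qed
  qed
  from this[of 0] show ?thesis by auto
qed

text \<open>On the chain, each of the \<open>D\<close> ideals \<open>lead j\<close> takes a largest
  value because \<open>B\<close> is noetherian. The largest of the finitely many members that attain
  these values attains all of them at once, and \<open>lead_subset_imp\<close> makes it the
  maximum.\<close>

lemma bsub_chain_max:
  assumes "noetherian_ring B" and ne: "C \<noteq> {}" and C: "\<And>T. T \<in> C \<Longrightarrow> bsub T"
    and chain: "\<And>T T'. T \<in> C \<Longrightarrow> T' \<in> C \<Longrightarrow> T \<subseteq> T' \<or> T' \<subseteq> T"
  shows "\<exists>T\<in>C. \<forall>T'\<in>C. T' \<subseteq> T"
proof -
  interpret B: noetherian_ring B by fact
  have mono: "T \<subseteq> T' \<Longrightarrow> lead j T \<subseteq> lead j T'" for j T T' unfolding lead_def by blast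
  have ex: "\<exists>T\<in>C. \<forall>T'\<in>C. lead j T' \<subseteq> lead j T" if j: "j < D" for j
  proof -
    have "\<Union>(lead j ` C) \<in> lead j ` C"
    proof (rule B.ideal_chain_is_trivial)
      show "subset.chain {I. ideal I B} (lead j ` C)"
        unfolding pred_on.chain_def
      proof (intro conjI ballI subsetI)
        fix I assume "I \<in> lead j ` C"
        then show "I \<in> {I. ideal I B}" using lead_ideal[OF C j] by auto
      next
        fix I J assume "I \<in> lead j ` C" "J \<in> lead j ` C"
        then obtain T T' where "T \<in> C" "T' \<in> C" "I = lead j T" "J = lead j T'" by auto
        then show "(\<subset>)\<^sup>=\<^sup>= I J \<or> (\<subset>)\<^sup>=\<^sup>= J I"
          using chain[of T T'] mono[of T T' j] mono[of T' T j] by auto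
      qed
    qed (use ne in simp)
    then obtain T where "T \<in> C" "\<Union>(lead j ` C) = lead j T" by auto
    then show ?thesis by (intro bexI[of _ T]) auto
  qed
  have "k \<le> D \<Longrightarrow> \<exists>T\<in>C. \<forall>j<k. \<forall>T'\<in>C. lead j T' \<subseteq> lead j T" for k
  proof (induction k)
    case 0
    then show ?case using ne by auto
  next
    case (Suc k)
    then obtain T where T: "T \<in> C" "\<forall>j<k. \<forall>T'\<in>C. lead j T' \<subseteq> lead j T" by auto
    obtain U where U: "U \<in> C" "\<forall>T'\<in>C. lead k T' \<subseteq> lead k U" using ex[of k] Suc by auto
    from chain[OF T(1) U(1)] show ?case
    proof
      assume "T \<subseteq> U"
      then have "\<forall>j<Suc k. \<forall>T'\<in>C. lead j T' \<subseteq> lead j U"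
        using T U mono[of T U] unfolding less_Suc_eq by blast
      then show ?thesis using U by blast
    next
      assume "U \<subseteq> T"
      then have "\<forall>j<Suc k. \<forall>T'\<in>C. lead j T' \<subseteq> lead j T"
        using T U mono[of U T] unfolding less_Suc_eq by blast
      then show ?thesis using T by blast
    qed
  qed
  from this[of D] obtain T where T: "T \<in> C" "\<forall>j<D. \<forall>T'\<in>C. lead j T' \<subseteq> lead j T" by blast
  have "T' \<subseteq> T" if T': "T' \<in> C" for T'
    using chain[OF T(1) T']
  proof
    assume "T \<subseteq> T'"
    then show ?thesis using lead_subset_imp[OF C[OF T(1)] C[OF T']] T T' by blast
  qed
  then show ?thesis using T by blast
qed

section \<open>Integrality over B modulo f, and contraction of prime and maximal ideals\<close>

primrec pspan :: "'a \<Rightarrow> nat \<Rightarrow> 'a set" where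
  "pspan a 0 = PIdl\<^bsub>S\<^esub> f"
| "pspan a (Suc k) = {\<phi> b \<otimes>\<^bsub>S\<^esub> a [^]\<^bsub>S\<^esub> k \<oplus>\<^bsub>S\<^esub> y | b y. b \<in> carrier B \<and> y \<in> pspan a k}"

lemma pspan_bsub: "a \<in> carrier S \<Longrightarrow> bsub (pspan a k)"
proof (induction k)
  case 0
  then show ?case using bsub_ideal[OF S.cgenideal_ideal[OF f_closed] S.cgenideal_self[OF f_closed]] by simp
next
  case (Suc k)
  then have IH: "pspan a k \<subseteq> carrier S" "PIdl\<^bsub>S\<^esub> f \<subseteq> pspan a k"
    "\<And>x y. x \<in> pspan a k \<Longrightarrow> y \<in> pspan a k \<Longrightarrow> x \<oplus>\<^bsub>S\<^esub> y \<in> pspan a k"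
    "\<And>b x. b \<in> carrier B \<Longrightarrow> x \<in> pspan a k \<Longrightarrow> \<phi> b \<otimes>\<^bsub>S\<^esub> x \<in> pspan a k" unfolding bsub_def by auto
  have "pspan a k \<subseteq> pspan a (Suc k)"
  proof
    fix y assume y: "y \<in> pspan a k"
    then have "y = \<phi> \<zero>\<^bsub>B\<^esub> \<otimes>\<^bsub>S\<^esub> a [^]\<^bsub>S\<^esub> k \<oplus>\<^bsub>S\<^esub> y" using IH(1) Suc.prems by auto
    then show "y \<in> pspan a (Suc k)" using y unfolding pspan.simps by blast
  qed
  moreover have "x \<oplus>\<^bsub>S\<^esub> x' \<in> pspan a (Suc k)" if x: "x \<in> pspan a (Suc k)" "x' \<in> pspan a (Suc k)" for x x'
  proof -
    obtain b y b' y' where *: "x = \<phi> b \<otimes>\<^bsub>S\<^esub> a [^]\<^bsub>S\<^esub> k \<oplus>\<^bsub>S\<^esub> y" "x' = \<phi> b' \<otimes>\<^bsub>S\<^esub> a [^]\<^bsub>S\<^esub> k \<oplus>\<^bsub>S\<^esub> y'"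
      "b \<in> carrier B" "b' \<in> carrier B" "y \<in> pspan a k" "y' \<in> pspan a k" using x by auto
    then have "x \<oplus>\<^bsub>S\<^esub> x' = \<phi> (b \<oplus>\<^bsub>B\<^esub> b') \<otimes>\<^bsub>S\<^esub> a [^]\<^bsub>S\<^esub> k \<oplus>\<^bsub>S\<^esub> (y \<oplus>\<^bsub>S\<^esub> y')"
      using Suc.prems subsetD[OF IH(1)] by (simp add: S.l_distr S.a_ac)
    then show ?thesis using * IH(3) unfolding pspan.simps by blast
  qed
  moreover have "\<phi> c \<otimes>\<^bsub>S\<^esub> x \<in> pspan a (Suc k)" if x: "c \<in> carrier B" "x \<in> pspan a (Suc k)" for c x
  proof -
    obtain b y where *: "x = \<phi> b \<otimes>\<^bsub>S\<^esub> a [^]\<^bsub>S\<^esub> k \<oplus>\<^bsub>S\<^esub> y"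
      "b \<in> carrier B" "y \<in> pspan a k" using x by auto
    then have "\<phi> c \<otimes>\<^bsub>S\<^esub> x = \<phi> (c \<otimes>\<^bsub>B\<^esub> b) \<otimes>\<^bsub>S\<^esub> a [^]\<^bsub>S\<^esub> k \<oplus>\<^bsub>S\<^esub> \<phi> c \<otimes>\<^bsub>S\<^esub> y"
      using Suc.prems x(1) subsetD[OF IH(1)] by (simp add: S.r_distr S.m_assoc)
    then show ?thesis using * x(1) IH(4) unfolding pspan.simps by blast
  qed
  ultimately show ?case
    using IH(1,2) Suc.prems unfolding bsub_def by auto
qed

lemma pspan_Suc_mono: "a \<in> carrier S \<Longrightarrow> pspan a k \<subseteq> pspan a (Suc k)"
proof
  fix y assume a: "a \<in> carrier S" and y: "y \<in> pspan a k"
  then have "y \<in> carrier S" using pspan_bsub unfolding bsub_def by blast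
  then have "y = \<phi> \<zero>\<^bsub>B\<^esub> \<otimes>\<^bsub>S\<^esub> a [^]\<^bsub>S\<^esub> k \<oplus>\<^bsub>S\<^esub> y" using a by auto
  then show "y \<in> pspan a (Suc k)" using y unfolding pspan.simps by blast
qed

text \<open>Since \<open>pspan a k\<close> is fS + B + B a + ... + B a^(k-1), membership of a^k in
  it is a monic equation of degree k for a, modulo f. It exists because the ascending sequence of
  these spans has a largest member.\<close>

lemma integral:
  assumes "noetherian_ring B" and a: "a \<in> carrier S"
  shows "\<exists>k. a [^]\<^bsub>S\<^esub> k \<in> pspan a k"
proof -
  have "\<exists>T\<in>range (pspan a). \<forall>T'\<in>range (pspan a). T' \<subseteq> T"
  proof (rule bsub_chain_max[OF assms(1)])
    fix T T' assume "T \<in> range (pspan a)" "T' \<in> range (pspan a)"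
    then obtain i j where ij: "T = pspan a i" "T' = pspan a j" by auto
    have "i \<le> j \<Longrightarrow> pspan a i \<subseteq> pspan a j" for i j
      by (rule lift_Suc_mono_le[of "pspan a"]) (use pspan_Suc_mono[OF a] in auto)
    then show "T \<subseteq> T' \<or> T' \<subseteq> T" unfolding ij using nat_le_linear by blast
  qed (use pspan_bsub[OF a] in auto)
  then obtain k where "\<forall>T'\<in>range (pspan a). T' \<subseteq> pspan a k" by blast
  then have "pspan a (Suc k) \<subseteq> pspan a k" by blast
  moreover have "\<zero>\<^bsub>S\<^esub> \<in> pspan a k"
    using pspan_bsub[OF a, of k] additive_subgroup.zero_closed[OF ideal.axioms(1)[OF S.cgenideal_ideal[OF f_closed]]]
    unfolding bsub_def by auto
  moreover have "a [^]\<^bsub>S\<^esub> k = \<phi> \<one>\<^bsub>B\<^esub> \<otimes>\<^bsub>S\<^esub> a [^]\<^bsub>S\<^esub> k \<oplus>\<^bsub>S\<^esub> \<zero>\<^bsub>S\<^esub>" using a by simp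
  ultimately have "a [^]\<^bsub>S\<^esub> k \<in> pspan a k" unfolding pspan.simps by blast
  then show ?thesis ..
qed

text \<open>Splits off the constant term b, so that the remaining terms share a factor a; z collects
  the part in fS.\<close>

lemma pspan_constant_term:
  assumes a: "a \<in> carrier S"
  shows "x \<in> pspan a (Suc k) \<Longrightarrow> \<exists>b y z. b \<in> carrier B \<and> y \<in> pspan a k \<and> z \<in> PIdl\<^bsub>S\<^esub> f \<and>
    x = \<phi> b \<oplus>\<^bsub>S\<^esub> a \<otimes>\<^bsub>S\<^esub> y \<oplus>\<^bsub>S\<^esub> z"
proof (induction k arbitrary: x)
  have fI: "z \<in> PIdl\<^bsub>S\<^esub> f \<Longrightarrow> z \<in> carrier S" for z
    using ideal.Icarr[OF S.cgenideal_ideal[OF f_closed]] by auto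
  have z0: "\<zero>\<^bsub>S\<^esub> \<in> PIdl\<^bsub>S\<^esub> f"
    by (rule additive_subgroup.zero_closed[OF ideal.axioms(1)[OF S.cgenideal_ideal[OF f_closed]]])
  {
    case 0
    then obtain b y where "b \<in> carrier B" "y \<in> PIdl\<^bsub>S\<^esub> f" "x = \<phi> b \<oplus>\<^bsub>S\<^esub> y"
      by auto
    then show ?case using z0 a fI
      by (intro exI[of _ b] exI[of _ "\<zero>\<^bsub>S\<^esub>"] exI[of _ y]) auto
  next
    case (Suc k)
    then obtain b w where bw: "b \<in> carrier B" "w \<in> pspan a (Suc k)" "x = \<phi> b \<otimes>\<^bsub>S\<^esub> a [^]\<^bsub>S\<^esub> (Suc k) \<oplus>\<^bsub>S\<^esub> w"
      unfolding pspan.simps(2)[of a "Suc k"] by blast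
    obtain b' y z where w: "b' \<in> carrier B" "y \<in> pspan a k" "z \<in> PIdl\<^bsub>S\<^esub> f"
      "w = \<phi> b' \<oplus>\<^bsub>S\<^esub> a \<otimes>\<^bsub>S\<^esub> y \<oplus>\<^bsub>S\<^esub> z" using Suc.IH[OF bw(2)] by blast
    have y: "y \<in> carrier S" using w(2) pspan_bsub[OF a] unfolding bsub_def by blast
    have "x = \<phi> b' \<oplus>\<^bsub>S\<^esub> a \<otimes>\<^bsub>S\<^esub> (\<phi> b \<otimes>\<^bsub>S\<^esub> a [^]\<^bsub>S\<^esub> k \<oplus>\<^bsub>S\<^esub> y) \<oplus>\<^bsub>S\<^esub> z"
      using bw w y a fI[OF w(3)] by (simp add: S.r_distr S.m_ac S.a_ac)
    moreover have "\<phi> b \<otimes>\<^bsub>S\<^esub> a [^]\<^bsub>S\<^esub> k \<oplus>\<^bsub>S\<^esub> y \<in> pspan a (Suc k)" using bw w by auto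
    ultimately show ?case using w bw by blast
  }
qed

text \<open>Incomparability for integral extensions. Take a in \<open>P'\<close> but not in
  \<open>P\<close>, and a monic equation for a modulo \<open>P\<close> of least degree. Its constant
  term is a multiple of a modulo \<open>P\<close>, hence lies in \<open>P'\<close>; if it lay in
  \<open>P\<close>, the factor a could be cancelled and the degree would drop.\<close>

lemma contraction_strict:
  assumes "noetherian_ring B" and P: "primeideal P S" "f \<in> P" and P': "ideal P' S" "P \<subset> P'"
  shows "{b \<in> carrier B. \<phi> b \<in> P} \<subset> {b \<in> carrier B. \<phi> b \<in> P'}"
proof -
  interpret P: primeideal P S by fact
  interpret P': ideal P' S by fact
  have fP: "PIdl\<^bsub>S\<^esub> f \<subseteq> P" by (rule S.cgenideal_minimal[OF P.is_ideal P(2)])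
  obtain a where a: "a \<in> P'" "a \<notin> P" using P' by auto
  have ac: "a \<in> carrier S" using a by simp
  have pc: "y \<in> pspan a k \<Longrightarrow> y \<in> carrier S" for y k using pspan_bsub[OF ac, of k] unfolding bsub_def by auto
  \<comment> \<open>Modulo \<open>P\<close>, a satisfies a monic equation of degree k over
    \<open>B\<close>.\<close>
  let ?Q = "\<lambda>k. \<exists>y\<in>pspan a k. a [^]\<^bsub>S\<^esub> k \<ominus>\<^bsub>S\<^esub> y \<in> P"
  obtain k0 where k0: "a [^]\<^bsub>S\<^esub> k0 \<in> pspan a k0" using integral[OF assms(1) ac] by auto
  have "a [^]\<^bsub>S\<^esub> k0 \<ominus>\<^bsub>S\<^esub> a [^]\<^bsub>S\<^esub> k0 \<in> P" using ac by (simp add: a_minus_def S.r_neg)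
  then have "?Q k0" using k0 by blast
  define k where "k = (LEAST k. ?Q k)"
  have Q: "?Q k" and least: "\<And>j. j < k \<Longrightarrow> \<not> ?Q j"
    unfolding k_def using LeastI[of ?Q, OF \<open>?Q k0\<close>] not_less_Least[of _ ?Q] by blast+
  have "\<one>\<^bsub>S\<^esub> \<notin> P" using P.I_notcarr P.one_imp_carrier by auto
  obtain y where y: "y \<in> pspan a k" "a [^]\<^bsub>S\<^esub> k \<ominus>\<^bsub>S\<^esub> y \<in> P" using Q by auto
  \<comment> \<open>A monic equation of degree 0 would say that \<one> lies in
    \<open>P\<close>.\<close>
  have "k \<noteq> 0"
  proof
    assume "k = 0"
    then have yP: "y \<in> P" "\<one>\<^bsub>S\<^esub> \<ominus>\<^bsub>S\<^esub> y \<in> P" using y fP by auto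
    then have "(\<one>\<^bsub>S\<^esub> \<ominus>\<^bsub>S\<^esub> y) \<oplus>\<^bsub>S\<^esub> y \<in> P" by blast
    moreover have "(\<one>\<^bsub>S\<^esub> \<ominus>\<^bsub>S\<^esub> y) \<oplus>\<^bsub>S\<^esub> y = \<one>\<^bsub>S\<^esub>" using yP(1)[THEN P.Icarr] by algebra
    ultimately show False using \<open>\<one>\<^bsub>S\<^esub> \<notin> P\<close> by simp
  qed
  then obtain k' where k': "k = Suc k'" using not0_implies_Suc by blast
  obtain b y' z where b: "b \<in> carrier B" "y' \<in> pspan a k'" "z \<in> PIdl\<^bsub>S\<^esub> f"
    "y = \<phi> b \<oplus>\<^bsub>S\<^esub> a \<otimes>\<^bsub>S\<^esub> y' \<oplus>\<^bsub>S\<^esub> z" using pspan_constant_term[OF ac] y(1) unfolding k' by blast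
  have c: "y' \<in> carrier S" "z \<in> P" "z \<in> carrier S" "\<phi> b \<in> carrier S" "a [^]\<^bsub>S\<^esub> k' \<in> carrier S"
    using b fP pc ac by auto
  define w where "w = a [^]\<^bsub>S\<^esub> k' \<ominus>\<^bsub>S\<^esub> y'"
  have w: "w \<in> carrier S" unfolding w_def using c by simp
  have eq: "a [^]\<^bsub>S\<^esub> k \<ominus>\<^bsub>S\<^esub> y \<oplus>\<^bsub>S\<^esub> z = a \<otimes>\<^bsub>S\<^esub> w \<ominus>\<^bsub>S\<^esub> \<phi> b"
    unfolding b(4) k' w_def S.nat_pow_Suc using c ac by algebra
  have wP: "a \<otimes>\<^bsub>S\<^esub> w \<ominus>\<^bsub>S\<^esub> \<phi> b \<in> P" unfolding eq[symmetric] using y(2) c(2) by blast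
  have "\<phi> b = a \<otimes>\<^bsub>S\<^esub> w \<oplus>\<^bsub>S\<^esub> \<ominus>\<^bsub>S\<^esub> (a \<otimes>\<^bsub>S\<^esub> w \<ominus>\<^bsub>S\<^esub> \<phi> b)" using c w ac by algebra
  moreover have "\<dots> \<in> P'" using wP P'(2) a w by (intro P'.a_closed P'.a_inv_closed P'.I_r_closed) auto
  ultimately have bP': "\<phi> b \<in> P'" by simp
  have "\<phi> b \<notin> P"
  proof
    assume "\<phi> b \<in> P"
    then have "(a \<otimes>\<^bsub>S\<^esub> w \<ominus>\<^bsub>S\<^esub> \<phi> b) \<oplus>\<^bsub>S\<^esub> \<phi> b \<in> P" using wP by blast
    moreover have "(a \<otimes>\<^bsub>S\<^esub> w \<ominus>\<^bsub>S\<^esub> \<phi> b) \<oplus>\<^bsub>S\<^esub> \<phi> b = a \<otimes>\<^bsub>S\<^esub> w" using c w ac by algebra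
    ultimately have "w \<in> P" using P.I_prime[OF ac w] a by auto
    then have "?Q k'" using b(2) unfolding w_def by blast
    then show False using least[of k'] k' by simp
  qed
  then show ?thesis using bP' b(1) P'(2) by auto
qed

lemma prime_chain_contraction:
  assumes N: "noetherian_ring B" and P: "prime_chain S l P" and f: "f \<in> P 0"
  shows "prime_chain B l (\<lambda>i. {b \<in> carrier B. \<phi> b \<in> P i})"
proof -
  have fi: "i \<le> l \<Longrightarrow> f \<in> P i" for i
  proof (induction i)
    case (Suc i)
    then have "P i \<subset> P (Suc i)" using P unfolding prime_chain_def by auto
    then show ?case using Suc by auto
  qed (rule f)
  have pi: "i \<le> l \<Longrightarrow> primeideal (P i) S" for i using P unfolding prime_chain_def by auto
  show ?thesis unfolding prime_chain_def
  proof (intro conjI allI impI)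
    fix i assume "i \<le> l"
    then show "primeideal {b \<in> carrier B. \<phi> b \<in> P i} B" by (intro \<phi>.primeideal_vimage pi)
  next
    fix i assume i: "i < l"
    show "{b \<in> carrier B. \<phi> b \<in> P i} \<subset> {b \<in> carrier B. \<phi> b \<in> P (Suc i)}"
      using i by (intro contraction_strict[OF N pi fi primeideal.axioms(1)[OF pi]]) (use P in \<open>auto simp: prime_chain_def\<close>)
  qed
qed

text \<open>If a is inverse to b in \<open>Q\<close>, multiply the monic equation of a by b^k: the
  leading term becomes 1, and every lower term becomes b times an element that comes from
  \<open>B\<close>.\<close>

lemma unit_contraction:
  assumes N: "noetherian_ring B" and Q: "cring Q" and p: "p \<in> ring_hom S Q"
    and ker: "\<And>x. x \<in> PIdl\<^bsub>S\<^esub> f \<Longrightarrow> p x = \<zero>\<^bsub>Q\<^esub>"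
    and b: "b \<in> carrier B" and a: "a \<in> carrier S" and ba: "p (\<phi> b) \<otimes>\<^bsub>Q\<^esub> p a = \<one>\<^bsub>Q\<^esub>"
  shows "\<exists>c\<in>carrier B. p (\<phi> b) \<otimes>\<^bsub>Q\<^esub> p (\<phi> c) = \<one>\<^bsub>Q\<^esub>"
proof -
  interpret Q: cring Q by fact
  interpret \<pi>: ring_hom_cring S Q p by (rule ring_hom_cringI'[OF S.is_cring Q p])
  \<comment> \<open>An element of \<open>pspan a k\<close> has degree less than k in a, so k factors
    b absorb all powers of a and at least one b is left over.\<close>
  have claim: "\<exists>c\<in>carrier B. p (\<phi> b) [^]\<^bsub>Q\<^esub> k \<otimes>\<^bsub>Q\<^esub> p y = p (\<phi> b) \<otimes>\<^bsub>Q\<^esub> p (\<phi> c)"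
    if "y \<in> pspan a k" for k y
    using that
  proof (induction k arbitrary: y)
    case 0
    then have "p y = \<zero>\<^bsub>Q\<^esub>" using ker by simp
    then show ?case using b by (intro bexI[of _ "\<zero>\<^bsub>B\<^esub>"]) auto
  next
    case (Suc k)
    then obtain c0 y' where y: "c0 \<in> carrier B" "y' \<in> pspan a k" "y = \<phi> c0 \<otimes>\<^bsub>S\<^esub> a [^]\<^bsub>S\<^esub> k \<oplus>\<^bsub>S\<^esub> y'" by auto
    obtain c' where c': "c' \<in> carrier B" "p (\<phi> b) [^]\<^bsub>Q\<^esub> k \<otimes>\<^bsub>Q\<^esub> p y' = p (\<phi> b) \<otimes>\<^bsub>Q\<^esub> p (\<phi> c')"
      using Suc.IH[OF y(2)] by auto
    have y'c: "y' \<in> carrier S" using y(2) pspan_bsub[OF a] unfolding bsub_def by blast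
    have Bc: "p (\<phi> b) \<in> carrier Q" "p a \<in> carrier Q" "p (\<phi> c0) \<in> carrier Q" "p (\<phi> c') \<in> carrier Q"
      "p y' \<in> carrier Q"
      using b a y(1) c'(1) y'c by simp_all
    have "p (\<phi> b) [^]\<^bsub>Q\<^esub> Suc k \<otimes>\<^bsub>Q\<^esub> p y
      = p (\<phi> b) [^]\<^bsub>Q\<^esub> Suc k \<otimes>\<^bsub>Q\<^esub> (p (\<phi> c0) \<otimes>\<^bsub>Q\<^esub> p a [^]\<^bsub>Q\<^esub> k \<oplus>\<^bsub>Q\<^esub> p y')"
      using y(1,3) a y'c by (simp add: \<pi>.hom_pow)
    also have "\<dots> = p (\<phi> b) \<otimes>\<^bsub>Q\<^esub> p (\<phi> c0) \<otimes>\<^bsub>Q\<^esub> (p (\<phi> b) [^]\<^bsub>Q\<^esub> k \<otimes>\<^bsub>Q\<^esub> p a [^]\<^bsub>Q\<^esub> k)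
       \<oplus>\<^bsub>Q\<^esub> p (\<phi> b) \<otimes>\<^bsub>Q\<^esub> (p (\<phi> b) [^]\<^bsub>Q\<^esub> k \<otimes>\<^bsub>Q\<^esub> p y')"
      using Bc by (simp add: Q.r_distr Q.m_ac)
    also have "p (\<phi> b) [^]\<^bsub>Q\<^esub> k \<otimes>\<^bsub>Q\<^esub> p a [^]\<^bsub>Q\<^esub> k = \<one>\<^bsub>Q\<^esub>"
      using Bc(1,2) ba by (simp add: Q.nat_pow_distrib[symmetric])
    also have "p (\<phi> b) [^]\<^bsub>Q\<^esub> k \<otimes>\<^bsub>Q\<^esub> p y' = p (\<phi> b) \<otimes>\<^bsub>Q\<^esub> p (\<phi> c')" by (rule c'(2))
    also have "p (\<phi> b) \<otimes>\<^bsub>Q\<^esub> p (\<phi> c0) \<otimes>\<^bsub>Q\<^esub> \<one>\<^bsub>Q\<^esub> \<oplus>\<^bsub>Q\<^esub> p (\<phi> b) \<otimes>\<^bsub>Q\<^esub> (p (\<phi> b) \<otimes>\<^bsub>Q\<^esub> p (\<phi> c'))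
      = p (\<phi> b) \<otimes>\<^bsub>Q\<^esub> p (\<phi> (c0 \<oplus>\<^bsub>B\<^esub> b \<otimes>\<^bsub>B\<^esub> c'))"
      using Bc b y(1) c'(1) by (simp add: Q.r_distr)
    finally show ?case using b y(1) c'(1) by blast
  qed
  obtain k where k: "a [^]\<^bsub>S\<^esub> k \<in> pspan a k" using integral[OF N a] by auto
  obtain c where c: "c \<in> carrier B" "p (\<phi> b) [^]\<^bsub>Q\<^esub> k \<otimes>\<^bsub>Q\<^esub> p (a [^]\<^bsub>S\<^esub> k) = p (\<phi> b) \<otimes>\<^bsub>Q\<^esub> p (\<phi> c)"
    using claim[OF k] by auto
  have "p (\<phi> b) [^]\<^bsub>Q\<^esub> k \<otimes>\<^bsub>Q\<^esub> p (a [^]\<^bsub>S\<^esub> k) = \<one>\<^bsub>Q\<^esub>"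
    using a b ba by (simp add: \<pi>.hom_pow Q.nat_pow_distrib[symmetric])
  then show ?thesis using c by auto
qed

text \<open>The residue ring S/M is integral over the image of \<open>B\<close>, so an inverse found
  there for an element of \<open>B\<close> can be replaced by one that comes from
  \<open>B\<close>.\<close>

lemma maximal_contraction:
  assumes N: "noetherian_ring B" and M: "maximalideal M S" "f \<in> M"
  shows "maximalideal {b \<in> carrier B. \<phi> b \<in> M} B"
  unfolding B.maximalideal_iff
proof (intro conjI ballI impI)
  have Mi: "ideal M S" by (rule maximalideal.axioms(1)[OF M(1)])
  have M': "\<one>\<^bsub>S\<^esub> \<notin> M" "\<And>b. b \<in> carrier S \<Longrightarrow> b \<notin> M \<Longrightarrow> \<exists>c\<in>carrier S. \<one>\<^bsub>S\<^esub> \<ominus>\<^bsub>S\<^esub> b \<otimes>\<^bsub>S\<^esub> c \<in> M"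
    using M(1) unfolding S.maximalideal_iff by auto
  show "ideal {b \<in> carrier B. \<phi> b \<in> M} B" by (rule \<phi>.ideal_vimage[OF Mi])
  show "\<one>\<^bsub>B\<^esub> \<notin> {b \<in> carrier B. \<phi> b \<in> M}" using M' by simp
  fix b assume b: "b \<in> carrier B" "b \<notin> {b \<in> carrier B. \<phi> b \<in> M}"
  then obtain a where a: "a \<in> carrier S" "\<one>\<^bsub>S\<^esub> \<ominus>\<^bsub>S\<^esub> \<phi> b \<otimes>\<^bsub>S\<^esub> a \<in> M" using M'(2)[of "\<phi> b"] by auto
  have fM: "PIdl\<^bsub>S\<^esub> f \<subseteq> M" by (rule S.cgenideal_minimal[OF Mi M(2)])
  have Qc: "cring (S Quot M)" by (rule ideal.quotient_is_cring[OF Mi S.is_cring])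
  have Qh: "(+>\<^bsub>S\<^esub>) M \<in> ring_hom S (S Quot M)" by (rule ideal.rcos_ring_hom[OF Mi])
  define Q p where "Q = S Quot M" and "p = (\<lambda>x. M +>\<^bsub>S\<^esub> x)"
  have Qc: "cring Q" and Qh: "p \<in> ring_hom S Q" using Qc Qh by (simp_all add: Q_def p_def)
  have zero: "p x = \<zero>\<^bsub>Q\<^esub> \<longleftrightarrow> x \<in> M" if "x \<in> carrier S" for x
    unfolding Q_def p_def by (rule ideal.coset_eq_zero_iff[OF Mi that])
  interpret \<pi>: ring_hom_cring S Q p by (rule ring_hom_cringI'[OF S.is_cring Qc Qh])
  have eq_one: "\<one>\<^bsub>S\<^esub> \<ominus>\<^bsub>S\<^esub> x \<in> M \<longleftrightarrow> p x = \<one>\<^bsub>Q\<^esub>" if x: "x \<in> carrier S" for x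
  proof -
    have "\<one>\<^bsub>S\<^esub> \<ominus>\<^bsub>S\<^esub> x \<in> M \<longleftrightarrow> \<one>\<^bsub>Q\<^esub> \<ominus>\<^bsub>Q\<^esub> p x = \<zero>\<^bsub>Q\<^esub>"
      using zero[of "\<one>\<^bsub>S\<^esub> \<ominus>\<^bsub>S\<^esub> x"] x by (simp add: \<pi>.hom_minus_eq)
    also have "\<dots> \<longleftrightarrow> p x = \<one>\<^bsub>Q\<^esub>"
      using \<pi>.S.r_right_minus_eq[of "\<one>\<^bsub>Q\<^esub>" "p x"] \<pi>.hom_closed[OF x] by auto
    finally show ?thesis .
  qed
  have "\<exists>c\<in>carrier B. p (\<phi> b) \<otimes>\<^bsub>Q\<^esub> p (\<phi> c) = \<one>\<^bsub>Q\<^esub>"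
  proof (rule unit_contraction[OF N Qc Qh _ b(1) a(1)])
    show "p x = \<zero>\<^bsub>Q\<^esub>" if "x \<in> PIdl\<^bsub>S\<^esub> f" for x
      using that fM zero ideal.Icarr[OF Mi] by blast
    show "p (\<phi> b) \<otimes>\<^bsub>Q\<^esub> p a = \<one>\<^bsub>Q\<^esub>"
      using eq_one[of "\<phi> b \<otimes>\<^bsub>S\<^esub> a"] a b by (simp add: \<pi>.hom_mult)
  qed
  then obtain c where c: "c \<in> carrier B" "p (\<phi> b) \<otimes>\<^bsub>Q\<^esub> p (\<phi> c) = \<one>\<^bsub>Q\<^esub>" by auto
  then have "\<one>\<^bsub>S\<^esub> \<ominus>\<^bsub>S\<^esub> \<phi> b \<otimes>\<^bsub>S\<^esub> \<phi> c \<in> M"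
    using eq_one[of "\<phi> b \<otimes>\<^bsub>S\<^esub> \<phi> c"] b by (simp add: \<pi>.hom_mult)
  then have "\<one>\<^bsub>B\<^esub> \<ominus>\<^bsub>B\<^esub> b \<otimes>\<^bsub>B\<^esub> c \<in> {b \<in> carrier B. \<phi> b \<in> M}" using b c by (simp add: \<phi>.hom_minus_eq)
  then show "\<exists>c\<in>carrier B. \<one>\<^bsub>B\<^esub> \<ominus>\<^bsub>B\<^esub> b \<otimes>\<^bsub>B\<^esub> c \<in> {b \<in> carrier B. \<phi> b \<in> M}" using c by blast
qed

end

section \<open>Transfer of regular sequences between B, S and S/fS\<close>

lemma regular_module_simps [simp]:
  "carrier (regular_module A) = carrier A" "\<zero>\<^bsub>regular_module A\<^esub> = \<zero>\<^bsub>A\<^esub>"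
  "x \<oplus>\<^bsub>regular_module A\<^esub> y = x \<oplus>\<^bsub>A\<^esub> y" "x \<odot>\<^bsub>regular_module A\<^esub> y = x \<otimes>\<^bsub>A\<^esub> y"
  by (simp_all add: regular_module_def with_smult_def)

lemma (in cring) regular_module_module: "module R (regular_module R)"
proof (rule moduleI)
  show "abelian_group (regular_module R)"
  proof (rule abelian_groupI)
    fix x assume "x \<in> carrier (regular_module R)"
    then show "\<exists>y\<in>carrier (regular_module R). y \<oplus>\<^bsub>regular_module R\<^esub> x = \<zero>\<^bsub>regular_module R\<^esub>"
      by (intro bexI[of _ "\<ominus> x"]) (auto simp: l_neg)
  qed (auto simp: a_ac)
qed (auto simp: is_cring l_distr r_distr m_assoc)

lemma (in cring) list_span_singleton_regular:
  assumes "f \<in> carrier R"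
  shows "list_span (regular_module R) [f] = PIdl f"
proof -
  have "list_span (regular_module R) [f] = {f \<otimes> x \<oplus> \<zero> | x. x \<in> carrier R}" by simp
  also have "\<dots> = {x \<otimes> f | x. x \<in> carrier R}"
  proof -
    have "f \<otimes> x \<oplus> \<zero> = x \<otimes> f" if "x \<in> carrier R" for x using assms that by (simp add: m_comm)
    then show ?thesis by (intro Collect_cong) metis
  qed
  finally show ?thesis by (simp add: cgenideal_def)
qed

text \<open>\<open>list_span\<close> peels its list from the front, whereas the inductions below
  keep f at the head, to express working modulo f, and peel off the element after it.\<close>

lemma (in cring) list_span_Cons_regular:
  assumes f: "f \<in> carrier R" and g: "g \<in> carrier R" and gs: "set gs \<subseteq> carrier R"
  shows "x \<in> list_span (regular_module R) (f # g # gs) \<longleftrightarrow>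
    (\<exists>v\<in>carrier R. \<exists>w\<in>list_span (regular_module R) (f # gs). x = g \<otimes> v \<oplus> w)"
proof -
  interpret M: module R "regular_module R" by (rule regular_module_module)
  have sub: "list_span (regular_module R) gs \<subseteq> carrier R"
    using M.submoduleE(1)[OF M.list_span_submodule[OF gs]] by simp
  have swap: "f \<otimes> u \<oplus> (g \<otimes> v \<oplus> y) = g \<otimes> v \<oplus> (f \<otimes> u \<oplus> y)"
    if "u \<in> carrier R" "v \<in> carrier R" "y \<in> list_span (regular_module R) gs" for u v y
    using that f g subsetD[OF sub] by (simp add: a_lcomm)
  show ?thesis
  proof
    assume "x \<in> list_span (regular_module R) (f # g # gs)"
    then obtain u v y where *: "u \<in> carrier R" "v \<in> carrier R" "y \<in> list_span (regular_module R) gs"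
      "x = f \<otimes> u \<oplus> (g \<otimes> v \<oplus> y)" by auto
    then have "f \<otimes> u \<oplus> y \<in> list_span (regular_module R) (f # gs)" by auto
    moreover have "x = g \<otimes> v \<oplus> (f \<otimes> u \<oplus> y)" unfolding *(4) by (rule swap[OF *(1-3)])
    ultimately show "\<exists>v\<in>carrier R. \<exists>w\<in>list_span (regular_module R) (f # gs). x = g \<otimes> v \<oplus> w"
      using *(2) by blast
  next
    assume "\<exists>v\<in>carrier R. \<exists>w\<in>list_span (regular_module R) (f # gs). x = g \<otimes> v \<oplus> w"
    then obtain u v y where *: "u \<in> carrier R" "v \<in> carrier R" "y \<in> list_span (regular_module R) gs"
      "x = g \<otimes> v \<oplus> (f \<otimes> u \<oplus> y)" by auto
    have "x = f \<otimes> u \<oplus> (g \<otimes> v \<oplus> y)" unfolding *(4) by (rule swap[OF *(1-3), symmetric])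
    moreover have "g \<otimes> v \<oplus> y \<in> list_span (regular_module R) (g # gs)" using *(2,3) by auto
    ultimately show "x \<in> list_span (regular_module R) (f # g # gs)"
      using *(1) unfolding list_span.simps(2)[of _ f] regular_module_simps by blast
  qed
qed

context finite_free_mod
begin

text \<open>Modulo f, \<open>S\<close> is a sum of \<open>D\<close> copies of \<open>B\<close>, and
  in a free module the submodule generated by multiples of scalars is computed coordinate by
  coordinate.\<close>

lemma list_span_coord:
  assumes "set bs \<subseteq> carrier B" "x \<in> carrier S"
  shows "x \<in> list_span (regular_module S) (f # map \<phi> bs) \<longleftrightarrow>
    (\<forall>j<D. \<beta> x j \<in> list_span (regular_module B) bs)"
  using assms
proof (induction bs arbitrary: x)
  case Nil
  have "x \<in> list_span (regular_module S) [f] \<longleftrightarrow> x \<in> PIdl\<^bsub>S\<^esub> f"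
    using S.list_span_singleton_regular[OF f_closed] by simp
  then show ?case using coord_eq_0[OF Nil(2)] by simp
next
  case (Cons b bs)
  then have b: "b \<in> carrier B" "set bs \<subseteq> carrier B" by auto
  interpret M: module S "regular_module S" by (rule S.regular_module_module)
  interpret N: module B "regular_module B" by (rule B.regular_module_module)
  have \<phi>bs: "set (map \<phi> bs) \<subseteq> carrier S" "set (f # map \<phi> bs) \<subseteq> carrier S" using b f_closed by auto
  note sub = M.submoduleE(1)[OF M.list_span_submodule[OF \<phi>bs(2)], simplified]
  note subB = N.submoduleE(1)[OF N.list_span_submodule[OF b(2)], simplified]
  have "x \<in> list_span (regular_module S) (f # map \<phi> (b # bs)) \<longleftrightarrow>
    (\<exists>v\<in>carrier S. \<exists>w\<in>list_span (regular_module S) (f # map \<phi> bs). x = \<phi> b \<otimes>\<^bsub>S\<^esub> v \<oplus>\<^bsub>S\<^esub> w)"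
    using S.list_span_Cons_regular[OF f_closed _ \<phi>bs(1), of "\<phi> b" x] b(1)
    by (simp only: list.map \<phi>.hom_closed)
  also have "\<dots> \<longleftrightarrow> (\<forall>j<D. \<beta> x j \<in> list_span (regular_module B) (b # bs))"
  proof
    assume "\<exists>v\<in>carrier S. \<exists>w\<in>list_span (regular_module S) (f # map \<phi> bs). x = \<phi> b \<otimes>\<^bsub>S\<^esub> v \<oplus>\<^bsub>S\<^esub> w"
    then obtain v w where vw: "v \<in> carrier S" "w \<in> list_span (regular_module S) (f # map \<phi> bs)"
      "x = \<phi> b \<otimes>\<^bsub>S\<^esub> v \<oplus>\<^bsub>S\<^esub> w" by blast
    have w: "w \<in> carrier S" using vw(2) sub by auto
    have wj: "\<forall>j<D. \<beta> w j \<in> list_span (regular_module B) bs" using Cons.IH[OF b(2) w] vw(2) by simp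
    show "\<forall>j<D. \<beta> x j \<in> list_span (regular_module B) (b # bs)"
    proof (intro allI impI)
      fix j assume j: "j < D"
      have "\<beta> x j = b \<otimes>\<^bsub>B\<^esub> \<beta> v j \<oplus>\<^bsub>B\<^esub> \<beta> w j"
        using j b vw w by (simp add: coord_add coord_smult)
      then show "\<beta> x j \<in> list_span (regular_module B) (b # bs)"
        using wj coord_closed[OF vw(1) j] j by auto
    qed
  next
    assume "\<forall>j<D. \<beta> x j \<in> list_span (regular_module B) (b # bs)"
    then have "\<forall>j. \<exists>c d. j < D \<longrightarrow> c \<in> carrier B \<and> d \<in> list_span (regular_module B) bs \<and> \<beta> x j = b \<otimes>\<^bsub>B\<^esub> c \<oplus>\<^bsub>B\<^esub> d"
      by auto
    then obtain c d where cd: "\<And>j. j < D \<Longrightarrow> c j \<in> carrier B \<and> d j \<in> list_span (regular_module B) bs \<and> \<beta> x j = b \<otimes>\<^bsub>B\<^esub> c j \<oplus>\<^bsub>B\<^esub> d j"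
      by metis
    \<comment> \<open>The chosen c j are assembled into one element v; subtracting \<phi> b times v
      then leaves the coordinates d j.\<close>
    obtain v where v: "v \<in> carrier S" "\<forall>j<D. \<beta> v j = c j" using coord_surj[of c] cd by auto
    define w where "w = x \<ominus>\<^bsub>S\<^esub> \<phi> b \<otimes>\<^bsub>S\<^esub> v"
    have w: "w \<in> carrier S" unfolding w_def using Cons.prems v b by simp
    have "\<beta> w j \<in> list_span (regular_module B) bs" if j: "j < D" for j
    proof -
      have d: "d j \<in> carrier B" using cd[OF j] subB by auto
      have "\<beta> w j = \<beta> x j \<ominus>\<^bsub>B\<^esub> b \<otimes>\<^bsub>B\<^esub> c j"
        unfolding w_def using j v b Cons.prems by (simp add: coord_minus coord_smult)
      also have "\<dots> = (b \<otimes>\<^bsub>B\<^esub> c j \<oplus>\<^bsub>B\<^esub> d j) \<ominus>\<^bsub>B\<^esub> b \<otimes>\<^bsub>B\<^esub> c j" using cd[OF j] by simp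
      also have "\<dots> = d j" using d b(1) cd[OF j, THEN conjunct1] by algebra
      finally show ?thesis using cd[OF j] by simp
    qed
    then have "w \<in> list_span (regular_module S) (f # map \<phi> bs)" using Cons.IH[OF b(2) w] by blast
    moreover have "x = \<phi> b \<otimes>\<^bsub>S\<^esub> v \<oplus>\<^bsub>S\<^esub> w"
      unfolding w_def using \<phi>.hom_closed[OF b(1)] v(1) Cons.prems(2) by algebra
    ultimately show "\<exists>v\<in>carrier S. \<exists>w\<in>list_span (regular_module S) (f # map \<phi> bs). x = \<phi> b \<otimes>\<^bsub>S\<^esub> v \<oplus>\<^bsub>S\<^esub> w"
      using v(1) by blast
  qed
  finally show ?case .
qed

text \<open>A sequence regular on \<open>B\<close> stays regular on a free module over
  \<open>B\<close>, as each coordinate shows.\<close>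

lemma weakly_regular_lift:
  assumes bs: "set bs \<subseteq> carrier B" "weakly_regular (regular_module B) bs"
    and i: "i < length bs" and x: "x \<in> carrier S"
    and mem: "\<phi> (bs ! i) \<otimes>\<^bsub>S\<^esub> x \<in> list_span (regular_module S) (f # map \<phi> (take i bs))"
  shows "x \<in> list_span (regular_module S) (f # map \<phi> (take i bs))"
proof -
  have t: "set (take i bs) \<subseteq> carrier B" using bs(1) set_take_subset by fast
  have b: "bs ! i \<in> carrier B" using bs(1) i nth_mem by blast
  have "\<forall>j<D. bs ! i \<otimes>\<^bsub>B\<^esub> \<beta> x j \<in> list_span (regular_module B) (take i bs)"
    using mem list_span_coord[OF t, of "\<phi> (bs ! i) \<otimes>\<^bsub>S\<^esub> x"] b x by (simp add: coord_smult)
  then have "\<forall>j<D. \<beta> x j \<in> list_span (regular_module B) (take i bs)"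
    using bs(2) i coord_closed[OF x] unfolding weakly_regular_def by simp
  then show ?thesis using list_span_coord[OF t x] by blast
qed

text \<open>Index 0 asks that f be a nonzerodivisor; every later index is shifted by one against the
  sequence in \<open>B\<close>.\<close>

lemma weakly_regular_Cons:
  assumes bs: "set bs \<subseteq> carrier B" "weakly_regular (regular_module B) bs"
    and f: "\<And>x. x \<in> carrier S \<Longrightarrow> f \<otimes>\<^bsub>S\<^esub> x = \<zero>\<^bsub>S\<^esub> \<Longrightarrow> x = \<zero>\<^bsub>S\<^esub>"
  shows "weakly_regular (regular_module S) (f # map \<phi> bs)"
  unfolding weakly_regular_def
proof (intro allI impI ballI)
  fix i x assume i: "i < length (f # map \<phi> bs)" and "x \<in> carrier (regular_module S)"
    and mem: "(f # map \<phi> bs) ! i \<odot>\<^bsub>regular_module S\<^esub> x \<in> list_span (regular_module S) (take i (f # map \<phi> bs))"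
  then have x: "x \<in> carrier S" by simp
  show "x \<in> list_span (regular_module S) (take i (f # map \<phi> bs))"
  proof (cases i)
    case 0
    then show ?thesis using mem f[OF x] by simp
  next
    case (Suc k)
    then show ?thesis using weakly_regular_lift[OF bs _ x, of k] mem i
      by (simp add: take_map nth_map)
  qed
qed

lemma quotient_hom:
  "cring (S Quot PIdl\<^bsub>S\<^esub> f)" "(+>\<^bsub>S\<^esub>) (PIdl\<^bsub>S\<^esub> f) \<in> ring_hom S (S Quot PIdl\<^bsub>S\<^esub> f)"
  "(+>\<^bsub>S\<^esub>) (PIdl\<^bsub>S\<^esub> f) ` carrier S = carrier (S Quot PIdl\<^bsub>S\<^esub> f)"
  "\<And>x. x \<in> carrier S \<Longrightarrow> PIdl\<^bsub>S\<^esub> f +>\<^bsub>S\<^esub> x = \<zero>\<^bsub>S Quot PIdl\<^bsub>S\<^esub> f\<^esub> \<longleftrightarrow> x \<in> PIdl\<^bsub>S\<^esub> f"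
proof -
  note I = S.cgenideal_ideal[OF f_closed]
  show "cring (S Quot PIdl\<^bsub>S\<^esub> f)" by (rule ideal.quotient_is_cring[OF I S.is_cring])
  show "(+>\<^bsub>S\<^esub>) (PIdl\<^bsub>S\<^esub> f) \<in> ring_hom S (S Quot PIdl\<^bsub>S\<^esub> f)" by (rule ideal.rcos_ring_hom[OF I])
  show "(+>\<^bsub>S\<^esub>) (PIdl\<^bsub>S\<^esub> f) ` carrier S = carrier (S Quot PIdl\<^bsub>S\<^esub> f)"
    by (auto simp: FactRing_def A_RCOSETS_def')
  show "PIdl\<^bsub>S\<^esub> f +>\<^bsub>S\<^esub> x = \<zero>\<^bsub>S Quot PIdl\<^bsub>S\<^esub> f\<^esub> \<longleftrightarrow> x \<in> PIdl\<^bsub>S\<^esub> f" if "x \<in> carrier S" for x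
    by (rule ideal.coset_eq_zero_iff[OF I that])
qed

end

text \<open>The kernel of p is generated by f, so pulling a span back to \<open>S\<close> adds f to
  the generators.\<close>

lemma list_span_surj_hom:
  assumes "cring S" "cring Q" "p \<in> ring_hom S Q" and surj: "p ` carrier S = carrier Q"
    and f: "f \<in> carrier S" and ker: "\<And>x. x \<in> carrier S \<Longrightarrow> p x = \<zero>\<^bsub>Q\<^esub> \<longleftrightarrow> x \<in> PIdl\<^bsub>S\<^esub> f"
    and as: "set as \<subseteq> carrier S" and x: "x \<in> carrier S"
  shows "p x \<in> list_span (regular_module Q) (map p as) \<longleftrightarrow> x \<in> list_span (regular_module S) (f # as)"
proof -
  interpret S: cring S by fact
  interpret Q: cring Q by fact
  interpret p: ring_hom_cring S Q p by (rule ring_hom_cringI') fact+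
  interpret M: module S "regular_module S" by (rule S.regular_module_module)
  show ?thesis using as x
  proof (induction as arbitrary: x)
    case Nil
    have "x \<in> list_span (regular_module S) [f] \<longleftrightarrow> x \<in> PIdl\<^bsub>S\<^esub> f"
      using S.list_span_singleton_regular[OF f] by simp
    then show ?case using ker[OF Nil(2)] by simp
  next
    case (Cons a as)
    then have a: "a \<in> carrier S" "set as \<subseteq> carrier S" "set (f # as) \<subseteq> carrier S" using f by auto
    note sub = M.submoduleE(1)[OF M.list_span_submodule[OF a(3)], simplified]
    have "p x \<in> list_span (regular_module Q) (map p (a # as)) \<longleftrightarrow>
      (\<exists>v\<in>carrier S. \<exists>w\<in>list_span (regular_module S) (f # as). x = a \<otimes>\<^bsub>S\<^esub> v \<oplus>\<^bsub>S\<^esub> w)"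
    proof
      assume "p x \<in> list_span (regular_module Q) (map p (a # as))"
      then obtain c d where cd: "c \<in> carrier Q" "d \<in> list_span (regular_module Q) (map p as)"
        "p x = p a \<otimes>\<^bsub>Q\<^esub> c \<oplus>\<^bsub>Q\<^esub> d" by auto
      obtain v where v: "v \<in> carrier S" "c = p v" using cd(1) surj by auto
      interpret N: module Q "regular_module Q" by (rule Q.regular_module_module)
      have pas: "set (map p as) \<subseteq> carrier Q" using a by auto
      have d: "d \<in> carrier Q" using N.submoduleE(1)[OF N.list_span_submodule[OF pas]] cd(2) by auto
      define w where "w = x \<ominus>\<^bsub>S\<^esub> a \<otimes>\<^bsub>S\<^esub> v"
      have w: "w \<in> carrier S" unfolding w_def using Cons.prems v a by simp
      have "p w = (p a \<otimes>\<^bsub>Q\<^esub> c \<oplus>\<^bsub>Q\<^esub> d) \<ominus>\<^bsub>Q\<^esub> p a \<otimes>\<^bsub>Q\<^esub> c"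
        unfolding w_def using Cons.prems v a cd(3) by (simp add: p.hom_minus_eq)
      also have "\<dots> = d" using d p.hom_closed[OF a(1)] cd(1) by algebra
      finally have "w \<in> list_span (regular_module S) (f # as)" using Cons.IH[OF a(2) w] cd(2) by simp
      moreover have "x = a \<otimes>\<^bsub>S\<^esub> v \<oplus>\<^bsub>S\<^esub> w"
        unfolding w_def using a(1) v(1) Cons.prems(2) by algebra
      ultimately show "\<exists>v\<in>carrier S. \<exists>w\<in>list_span (regular_module S) (f # as). x = a \<otimes>\<^bsub>S\<^esub> v \<oplus>\<^bsub>S\<^esub> w"
        using v(1) by blast
    next
      assume "\<exists>v\<in>carrier S. \<exists>w\<in>list_span (regular_module S) (f # as). x = a \<otimes>\<^bsub>S\<^esub> v \<oplus>\<^bsub>S\<^esub> w"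
      then obtain v w where vw: "v \<in> carrier S" "w \<in> list_span (regular_module S) (f # as)"
        "x = a \<otimes>\<^bsub>S\<^esub> v \<oplus>\<^bsub>S\<^esub> w" by blast
      have w: "w \<in> carrier S" using vw(2) sub by auto
      have "p w \<in> list_span (regular_module Q) (map p as)" using Cons.IH[OF a(2) w] vw(2) by simp
      moreover have "p x = p a \<otimes>\<^bsub>Q\<^esub> p v \<oplus>\<^bsub>Q\<^esub> p w" using vw w a by simp
      ultimately show "p x \<in> list_span (regular_module Q) (map p (a # as))"
        using p.hom_closed[OF vw(1)] by auto
    qed
    also have "\<dots> \<longleftrightarrow> x \<in> list_span (regular_module S) (f # a # as)"
      using S.list_span_Cons_regular[OF f a(1,2), of x] by blast
    finally show ?case .
  qed
qed

text \<open>All conditions are checked on preimages in \<open>S\<close>, which contain f: chains of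
  ideals become chains of \<open>bsub\<close> sets, and primes and maximal ideals contract to
  \<open>B\<close>. The number \<open>d\<close> is kept because the quotient is finite over
  \<open>B\<close>.\<close>

theorem (in finite_free_mod) cm_ring_quotient:
  assumes cm: "cm_ring B d"
  shows "cm_ring (S Quot PIdl\<^bsub>S\<^esub> f) d"
proof -
  define Q p where "Q = S Quot PIdl\<^bsub>S\<^esub> f" and "p = (\<lambda>x. PIdl\<^bsub>S\<^esub> f +>\<^bsub>S\<^esub> x)"
  have Q: "cring Q" "p \<in> ring_hom S Q" and surj: "p ` carrier S = carrier Q"
    and ker: "\<And>x. x \<in> carrier S \<Longrightarrow> p x = \<zero>\<^bsub>Q\<^esub> \<longleftrightarrow> x \<in> PIdl\<^bsub>S\<^esub> f"
    using quotient_hom unfolding Q_def p_def by auto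
  interpret Q: cring Q by fact
  interpret p: ring_hom_cring S Q p by (rule ring_hom_cringI'[OF S.is_cring Q])
  have N: "noetherian_ring B" and dim: "\<And>l P. prime_chain B l P \<Longrightarrow> l \<le> d"
    and reg: "\<And>M q::nat. maximalideal M B \<Longrightarrow> q \<ge> 1 \<Longrightarrow> \<exists>gs. set gs \<subseteq> M \<and> length gs = d \<and>
        weakly_regular (regular_module B) (map (\<lambda>g. g [^]\<^bsub>B\<^esub> q) gs)"
    using cm unfolding cm_ring_def by auto
  define pre where "pre I = {x \<in> carrier S. p x \<in> I}" for I
  have pre_f: "f \<in> pre I" if "ideal I Q" for I
    using ker[OF f_closed] S.cgenideal_self[OF f_closed] f_closed
      additive_subgroup.zero_closed[OF ideal.axioms(1)[OF that]] unfolding pre_def by auto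
  have image_pre: "I = p ` pre I" if "I \<subseteq> carrier Q" for I
  proof -
    have "I \<subseteq> p ` carrier S" using that surj by simp
    then show ?thesis unfolding pre_def by blast
  qed
  have sub: "I \<subseteq> carrier Q" if "ideal I Q" for I
    using ideal.Icarr[OF that] by blast
  show ?thesis unfolding Q_def[symmetric] cm_ring_def
  proof (intro conjI allI impI)
    show "cring Q" by fact
    show "noetherian_ring Q"
    proof (rule Q.trivial_ideal_chain_imp_noetherian)
      fix C assume C: "C \<noteq> {}" "subset.chain {I. ideal I Q} C"
      have Ci: "I \<in> C \<Longrightarrow> ideal I Q" for I using C unfolding pred_on.chain_def by auto
      have "\<exists>T\<in>pre ` C. \<forall>T'\<in>pre ` C. T' \<subseteq> T"
      proof (rule bsub_chain_max[OF N])
        fix T assume "T \<in> pre ` C"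
        then obtain I where I: "I \<in> C" "T = pre I" by auto
        show "bsub T" unfolding I(2)
          by (rule bsub_ideal) (use p.ideal_vimage[OF Ci[OF I(1)]] pre_f[OF Ci[OF I(1)]] in \<open>auto simp: pre_def\<close>)
      next
        fix T T' assume "T \<in> pre ` C" "T' \<in> pre ` C"
        then obtain I I' where I: "I \<in> C" "I' \<in> C" "T = pre I" "T' = pre I'" by auto
        then have "I \<subseteq> I' \<or> I' \<subseteq> I" using C unfolding pred_on.chain_def by auto
        then show "T \<subseteq> T' \<or> T' \<subseteq> T" unfolding I pre_def by auto
      qed (use C in simp)
      then obtain I where I: "I \<in> C" "\<forall>I'\<in>C. pre I' \<subseteq> pre I" by auto
      have "I' \<subseteq> I" if I': "I' \<in> C" for I'
      proof -
        have "p ` pre I' \<subseteq> p ` pre I" using I I' by blast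
        then show ?thesis using image_pre[OF sub[OF Ci[OF I']]] image_pre[OF sub[OF Ci[OF I(1)]]] by simp
      qed
      then have "\<Union>C = I" using I(1) by blast
      then show "\<Union>C \<in> C" using I(1) by simp
    qed
  next
    fix l P assume P: "prime_chain Q l P"
    have Pi: "i \<le> l \<Longrightarrow> primeideal (P i) Q" for i using P unfolding prime_chain_def by auto
    have "prime_chain S l (\<lambda>i. pre (P i))"
      unfolding prime_chain_def
    proof (intro conjI allI impI)
      fix i assume "i \<le> l"
      then show "primeideal (pre (P i)) S" unfolding pre_def by (intro p.primeideal_vimage Pi)
    next
      fix i assume i: "i < l"
      then have "P i \<subset> P (Suc i)" "P i \<subseteq> carrier Q" "P (Suc i) \<subseteq> carrier Q"
        using P sub[OF primeideal.axioms(1)[OF Pi]] unfolding prime_chain_def by auto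
      then have "P i \<noteq> P (Suc i)" "pre (P i) \<subseteq> pre (P (Suc i))" "p ` pre (P i) = P i" "p ` pre (P (Suc i)) = P (Suc i)"
        using image_pre[of "P i", symmetric] image_pre[of "P (Suc i)", symmetric] by (auto simp: pre_def)
      then show "pre (P i) \<subset> pre (P (Suc i))" unfolding psubset_eq by metis
    qed
    then have "prime_chain B l (\<lambda>i. {b \<in> carrier B. \<phi> b \<in> pre (P i)})"
      by (rule prime_chain_contraction[OF N]) (rule pre_f[OF primeideal.axioms(1)[OF Pi]], simp)
    then show "l \<le> d" by (rule dim)
  next
    fix M and q :: nat assume "maximalideal M Q \<and> q \<ge> 1"
    then have M: "maximalideal M Q" and q: "q \<ge> 1" by auto
    have iM: "maximalideal (pre M) S" unfolding pre_def by (rule p.maximalideal_vimage[OF M surj])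
    have "f \<in> pre M" by (rule pre_f[OF maximalideal.axioms(1)[OF M]])
    from reg[OF maximal_contraction[OF N iM this] q]
    obtain gs where gs: "set gs \<subseteq> {b \<in> carrier B. \<phi> b \<in> pre M}" "length gs = d"
      "weakly_regular (regular_module B) (map (\<lambda>g. g [^]\<^bsub>B\<^esub> q) gs)" by blast
    define bs where "bs = map (\<lambda>g. g [^]\<^bsub>B\<^esub> q) gs"
    have gsc: "set gs \<subseteq> carrier B" using gs by auto
    then have bs: "set bs \<subseteq> carrier B" unfolding bs_def by auto
    have eq: "map (\<lambda>g. g [^]\<^bsub>Q\<^esub> q) (map (\<lambda>g. p (\<phi> g)) gs) = map p (map \<phi> bs)"
      unfolding bs_def using gsc by (auto simp: p.hom_pow \<phi>.hom_pow)
    have "weakly_regular (regular_module Q) (map p (map \<phi> bs))"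
      unfolding weakly_regular_def
    proof (intro allI impI ballI)
      fix i y assume i: "i < length (map p (map \<phi> bs))" and "y \<in> carrier (regular_module Q)"
        and mem: "map p (map \<phi> bs) ! i \<odot>\<^bsub>regular_module Q\<^esub> y \<in> list_span (regular_module Q) (take i (map p (map \<phi> bs)))"
      then obtain x where x: "x \<in> carrier S" "y = p x" using surj by auto
      have t: "set (map \<phi> (take i bs)) \<subseteq> carrier S" using bs set_take_subset[of i bs] by auto
      have bi: "bs ! i \<in> carrier B" using i bs nth_mem by auto
      have ls: "p x \<in> list_span (regular_module Q) (map p (map \<phi> (take i bs))) \<longleftrightarrow>
          x \<in> list_span (regular_module S) (f # map \<phi> (take i bs))" if "x \<in> carrier S" for x
        by (rule list_span_surj_hom[OF S.is_cring Q surj f_closed ker t that])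
      have "p (\<phi> (bs ! i) \<otimes>\<^bsub>S\<^esub> x) \<in> list_span (regular_module Q) (map p (map \<phi> (take i bs)))"
        using mem i bi x by (simp add: take_map)
      then have "\<phi> (bs ! i) \<otimes>\<^bsub>S\<^esub> x \<in> list_span (regular_module S) (f # map \<phi> (take i bs))"
        using ls[of "\<phi> (bs ! i) \<otimes>\<^bsub>S\<^esub> x"] bi x by blast
      then have "x \<in> list_span (regular_module S) (f # map \<phi> (take i bs))"
        using weakly_regular_lift[OF bs gs(3)[folded bs_def] _ x(1)] i by simp
      then show "y \<in> list_span (regular_module Q) (take i (map p (map \<phi> bs)))"
        using ls[OF x(1)] x by (simp add: take_map)
    qed
    then show "\<exists>gs. set gs \<subseteq> M \<and> length gs = d \<and> weakly_regular (regular_module Q) (map (\<lambda>g. g [^]\<^bsub>Q\<^esub> q) gs)"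
      using gs(1,2) unfolding eq[symmetric]
      by (intro exI[of _ "map (\<lambda>g. p (\<phi> g)) gs"]) (auto simp: pre_def)
  qed
qed

text \<open>The start of the induction: the zero ideal is the only prime, and the empty sequence
  serves every maximal ideal.\<close>

lemma cm_ring_field: "field F \<Longrightarrow> cm_ring F 0"
proof -
  assume "field F"
  then interpret field F .
  show ?thesis unfolding cm_ring_def
  proof (intro conjI allI impI)
    show "cring F" by (rule is_cring)
    show "noetherian_ring F"
    proof (rule noetherian_ringI)
      fix I assume "ideal I F"
      then have "I \<in> {{\<zero>\<^bsub>F\<^esub>}, carrier F}" using all_ideals by blast
      then consider "I = Idl\<^bsub>F\<^esub> {\<zero>\<^bsub>F\<^esub>}" | "I = Idl\<^bsub>F\<^esub> {\<one>\<^bsub>F\<^esub>}"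
        unfolding genideal_zero genideal_one by blast
      then show "\<exists>A\<subseteq>carrier F. finite A \<and> I = Idl\<^bsub>F\<^esub> A"
      proof cases
        case 1
        then show ?thesis by (intro exI[of _ "{\<zero>\<^bsub>F\<^esub>}"]) simp
      next
        case 2
        then show ?thesis by (intro exI[of _ "{\<one>\<^bsub>F\<^esub>}"]) simp
      qed
    qed
  next
    fix l P assume P: "prime_chain F l P"
    show "l \<le> 0"
    proof (rule ccontr)
      assume "\<not> l \<le> 0"
      then have *: "primeideal (P 0) F" "primeideal (P (Suc 0)) F" "P 0 \<subset> P (Suc 0)"
        using P unfolding prime_chain_def by auto
      have "P (Suc 0) \<noteq> carrier F" using primeideal.I_notcarr[OF *(2)] by auto
      then have "P (Suc 0) = {\<zero>\<^bsub>F\<^esub>}" "P 0 = {\<zero>\<^bsub>F\<^esub>} \<or> P 0 = carrier F"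
        using all_ideals primeideal.axioms(1)[OF *(1)] primeideal.axioms(1)[OF *(2)] by auto
      then show False using *(3) by auto
    qed
  next
    fix M and q :: nat
    show "\<exists>gs. set gs \<subseteq> M \<and> length gs = 0 \<and> weakly_regular (regular_module F) (map (\<lambda>g. g [^]\<^bsub>F\<^esub> q) gs)"
      by (auto simp: weakly_regular_def)
  qed
qed

text \<open>The map from \<open>B\<close> to \<open>S\<close> may vary with f, as it does for
  coordinates adapted to f. A chain without its bottom prime contains a nonzero f and so has length
  at most \<open>d\<close>; in a maximal ideal, a power of a nonzero element is followed by a lift
  of a sequence from \<open>B\<close>. The nonunit \<open>g0\<close> ensures that maximal ideals are
  not zero.\<close>

theorem cm_ring_Suc:
  fixes S :: "('a, 'n) ring_scheme" and d :: nat and B :: "('b, 'm) ring_scheme"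
  assumes "domain S" and g0: "g0 \<in> carrier S" "g0 \<noteq> \<zero>\<^bsub>S\<^esub>" "g0 \<notin> Units S"
    and cmB: "cm_ring B d"
    and ff: "\<And>f. f \<in> carrier S \<Longrightarrow> f \<noteq> \<zero>\<^bsub>S\<^esub> \<Longrightarrow> \<exists>\<phi> \<beta> D. finite_free_mod B S \<phi> \<beta> D f"
  shows "cm_ring S (Suc d)"
proof -
  interpret domain S by fact
  have N: "noetherian_ring B" and dim: "\<And>l P. prime_chain B l P \<Longrightarrow> l \<le> d"
    and reg: "\<And>M q::nat. maximalideal M B \<Longrightarrow> q \<ge> 1 \<Longrightarrow> \<exists>gs. set gs \<subseteq> M \<and> length gs = d \<and>
        weakly_regular (regular_module B) (map (\<lambda>g. g [^]\<^bsub>B\<^esub> q) gs)"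
    using cmB unfolding cm_ring_def by auto
  have zero: "ideal I S \<Longrightarrow> \<zero>\<^bsub>S\<^esub> \<in> I" for I
    using additive_subgroup.zero_closed[OF ideal.axioms(1)] by auto
  show ?thesis unfolding cm_ring_def
  proof (intro conjI allI impI)
    show "cring S" by (rule is_cring)
    show "noetherian_ring S"
    proof (rule trivial_ideal_chain_imp_noetherian)
      fix C assume C: "C \<noteq> {}" "subset.chain {I. ideal I S} C"
      have Ci: "I \<in> C \<Longrightarrow> ideal I S" for I using C unfolding pred_on.chain_def by auto
      have lin: "I \<in> C \<Longrightarrow> J \<in> C \<Longrightarrow> I \<subseteq> J \<or> J \<subseteq> I" for I J using C unfolding pred_on.chain_def by auto
      have "\<exists>T\<in>C. \<forall>I\<in>C. I \<subseteq> T"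
      proof (cases "\<exists>I\<in>C. I \<noteq> {\<zero>\<^bsub>S\<^esub>}")
        case False
        then have "\<forall>I\<in>C. I = {\<zero>\<^bsub>S\<^esub>}" by simp
        moreover obtain T where "T \<in> C" using C(1) by auto
        ultimately show ?thesis by (intro bexI[of _ T]) auto
      next
        case True
        then obtain I0 where "I0 \<in> C" "I0 \<noteq> {\<zero>\<^bsub>S\<^esub>}" by auto
        then obtain f where I0: "I0 \<in> C" "f \<in> I0" "f \<noteq> \<zero>\<^bsub>S\<^esub>" using zero[OF Ci[of I0]] by auto
        have "f \<in> carrier S" by (rule ideal.Icarr[OF Ci[OF I0(1)] I0(2)])
        then obtain \<phi> \<beta> D where "finite_free_mod B S \<phi> \<beta> D f" using ff I0(3) by blast
        then interpret F: finite_free_mod B S \<phi> \<beta> D f .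
        \<comment> \<open>Only the members above \<open>I0\<close> matter for a maximum, and modulo
          the fixed nonzero f in \<open>I0\<close> they are submodules over
          \<open>B\<close>.\<close>
        have "\<exists>T\<in>{I\<in>C. I0 \<subseteq> I}. \<forall>I\<in>{I\<in>C. I0 \<subseteq> I}. I \<subseteq> T"
        proof (rule F.bsub_chain_max[OF N])
          show "{I\<in>C. I0 \<subseteq> I} \<noteq> {}" using I0 by auto
          show "F.bsub T" if "T \<in> {I\<in>C. I0 \<subseteq> I}" for T
            using that I0 by (intro F.bsub_ideal Ci) auto
          show "T \<subseteq> T' \<or> T' \<subseteq> T" if "T \<in> {I\<in>C. I0 \<subseteq> I}" "T' \<in> {I\<in>C. I0 \<subseteq> I}" for T T'
            using that lin by simp
        qed
        then obtain T where "T \<in> C" "I0 \<subseteq> T" "\<forall>I\<in>C. I0 \<subseteq> I \<longrightarrow> I \<subseteq> T" by blast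
        then show ?thesis using lin[OF _ I0(1)] by blast
      qed
      then obtain T where T: "T \<in> C" "\<forall>I\<in>C. I \<subseteq> T" by blast
      then have "\<Union>C = T" by blast
      then show "\<Union>C \<in> C" using T by simp
    qed
  next
    fix l P assume P: "prime_chain S l P"
    show "l \<le> Suc d"
    proof (cases l)
      case (Suc l')
      have P1: "P 0 \<subset> P (Suc 0)" "primeideal (P 0) S" "primeideal (P (Suc 0)) S"
        using P Suc unfolding prime_chain_def by auto
      \<comment> \<open>Being outside \<open>P 0\<close> makes f nonzero, and all primes from index
        1 on contain it. The one inclusion that is lost accounts for \<open>Suc d\<close>.\<close>
      obtain f where f: "f \<in> P (Suc 0)" "f \<notin> P 0" using P1(1) by auto
      have f': "f \<in> carrier S" "f \<noteq> \<zero>\<^bsub>S\<^esub>"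
        using f zero[OF primeideal.axioms(1)[OF P1(2)]] ideal.Icarr[OF primeideal.axioms(1)[OF P1(3)]] by auto
      then obtain \<phi> \<beta> D where "finite_free_mod B S \<phi> \<beta> D f" using ff by blast
      then interpret F: finite_free_mod B S \<phi> \<beta> D f .
      have "prime_chain S l' (\<lambda>i. P (Suc i))" using P Suc unfolding prime_chain_def by auto
      from dim[OF F.prime_chain_contraction[OF N this f(1)]] have "l' \<le> d" .
      then show ?thesis using Suc by simp
    qed simp
  next
    fix M and q :: nat assume "maximalideal M S \<and> q \<ge> 1"
    then have M: "maximalideal M S" and q: "q \<ge> 1" by auto
    have Mi: "ideal M S" by (rule maximalideal.axioms(1)[OF M])
    have "\<exists>f\<in>M. f \<noteq> \<zero>\<^bsub>S\<^esub>"
    proof (rule ccontr)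
      assume none: "\<not> ?thesis"
      then have "g0 \<notin> M" using g0 by auto
      then obtain c where c: "c \<in> carrier S" "\<one>\<^bsub>S\<^esub> \<ominus>\<^bsub>S\<^esub> g0 \<otimes>\<^bsub>S\<^esub> c \<in> M"
        using M g0(1) unfolding maximalideal_iff by blast
      then have "\<one>\<^bsub>S\<^esub> \<ominus>\<^bsub>S\<^esub> g0 \<otimes>\<^bsub>S\<^esub> c = \<zero>\<^bsub>S\<^esub>" using none by blast
      then have "g0 \<otimes>\<^bsub>S\<^esub> c = \<one>\<^bsub>S\<^esub>" using r_right_minus_eq[of "\<one>\<^bsub>S\<^esub>" "g0 \<otimes>\<^bsub>S\<^esub> c"] c g0(1) by simp
      moreover from this have "c \<otimes>\<^bsub>S\<^esub> g0 = \<one>\<^bsub>S\<^esub>" using c g0(1) by (simp add: m_comm)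
      ultimately have "g0 \<in> Units S" using c g0(1) unfolding Units_def by blast
      then show False using g0(3) by simp
    qed
    then obtain f where f: "f \<in> M" "f \<noteq> \<zero>\<^bsub>S\<^esub>" by blast
    have fc: "f \<in> carrier S" using f(1) ideal.Icarr[OF Mi] by simp
    \<comment> \<open>Coordinates over \<open>B\<close> are taken modulo f^q, not modulo f, since
      the first member of the regular sequence of powers is f^q.\<close>
    define h where "h = f [^]\<^bsub>S\<^esub> q"
    have h: "h \<in> carrier S" "h \<noteq> \<zero>\<^bsub>S\<^esub>" "h \<in> M"
    proof -
      show "h \<in> carrier S" unfolding h_def using fc by simp
      have "f [^]\<^bsub>S\<^esub> i \<noteq> \<zero>\<^bsub>S\<^esub>" for i :: nat
        by (induction i) (use fc f(2) integral_iff in auto)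
      then show "h \<noteq> \<zero>\<^bsub>S\<^esub>" unfolding h_def .
      obtain k where "q = Suc k" using q by (cases q) auto
      then show "h \<in> M" unfolding h_def using ideal.I_l_closed[OF Mi f(1)] fc by auto
    qed
    then obtain \<phi> \<beta> D where "finite_free_mod B S \<phi> \<beta> D h" using ff by blast
    then interpret F: finite_free_mod B S \<phi> \<beta> D h .
    from reg[OF F.maximal_contraction[OF N M h(3)] q]
    obtain gs where gs: "set gs \<subseteq> {b \<in> carrier B. \<phi> b \<in> M}" "length gs = d"
      "weakly_regular (regular_module B) (map (\<lambda>g. g [^]\<^bsub>B\<^esub> q) gs)" by blast
    have gsc: "set gs \<subseteq> carrier B" using gs by auto
    then have eq: "map (\<lambda>g. g [^]\<^bsub>S\<^esub> q) (f # map \<phi> gs) = h # map \<phi> (map (\<lambda>g. g [^]\<^bsub>B\<^esub> q) gs)"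
      by (auto simp: h_def F.\<phi>.hom_pow)
    have "weakly_regular (regular_module S) (h # map \<phi> (map (\<lambda>g. g [^]\<^bsub>B\<^esub> q) gs))"
    proof (rule F.weakly_regular_Cons[OF _ gs(3)])
      show "set (map (\<lambda>g. g [^]\<^bsub>B\<^esub> q) gs) \<subseteq> carrier B" using gsc by auto
      show "x = \<zero>\<^bsub>S\<^esub>" if "x \<in> carrier S" "h \<otimes>\<^bsub>S\<^esub> x = \<zero>\<^bsub>S\<^esub>" for x
        using that h integral_iff[of h x] by simp
    qed
    then have "weakly_regular (regular_module S) (map (\<lambda>g. g [^]\<^bsub>S\<^esub> q) (f # map \<phi> gs))"
      unfolding eq .
    moreover have "set (f # map \<phi> gs) \<subseteq> M" "length (f # map \<phi> gs) = Suc d" using gs(1,2) f(1) by auto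
    ultimately show "\<exists>gs. set gs \<subseteq> M \<and> length gs = Suc d \<and> weakly_regular (regular_module S) (map (\<lambda>g. g [^]\<^bsub>S\<^esub> q) gs)"
      by blast
  qed
qed

section \<open>Power series and polynomials as one family of rings\<close>

text \<open>A monomial has finitely many divisors; this makes the convolution
  \<open>series_mult\<close> a finite sum for power series too.\<close>

lemma finite_submultisets: "finite {a. a \<subseteq># m}"
proof (induction m)
  case (add x m)
  have "{a. a \<subseteq># add_mset x m} \<subseteq> {a. a \<subseteq># m} \<union> add_mset x ` {a. a \<subseteq># m}"
  proof
    fix a assume a: "a \<in> {a. a \<subseteq># add_mset x m}"
    show "a \<in> {a. a \<subseteq># m} \<union> add_mset x ` {a. a \<subseteq># m}"
    proof (cases "x \<in># a")
      case True
      then obtain a' where "a = add_mset x a'" by (metis mset_add)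
      then show ?thesis using a by auto
    next
      case False
      have "count a y \<le> count m y" for y
        using a False by (cases "y = x") (auto simp: subseteq_mset_def not_in_iff dest: spec[of _ y])
      then show ?thesis by (auto simp: subseteq_mset_def)
    qed
  qed
  then show ?case using add.IH by (meson finite_UnI finite_imageI finite_subset)
qed simp

lemma mset_diff_diff: "a \<subseteq># m \<Longrightarrow> m - (m - a) = a"
  by (simp add: multiset_eq_iff subseteq_mset_def)

context abelian_monoid
begin

lemma finsum_Sigma:
  assumes "finite A" "\<And>i. i \<in> A \<Longrightarrow> finite (B i)"
    and "\<And>i j. i \<in> A \<Longrightarrow> j \<in> B i \<Longrightarrow> g i j \<in> carrier G"
  shows "(\<Oplus>i\<in>A. \<Oplus>j\<in>B i. g i j) = (\<Oplus>p\<in>Sigma A B. g (fst p) (snd p))"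
  using assms
proof (induction A rule: finite_induct)
  case (insert x A)
  have x: "(\<Oplus>p\<in>Pair x ` B x. g (fst p) (snd p)) = (\<Oplus>j\<in>B x. g x j)"
    using insert by (subst add.finprod_reindex) (auto simp: inj_on_def)
  have S: "Sigma (insert x A) B = Pair x ` B x \<union> Sigma A B" by auto
  have "(\<Oplus>p\<in>Sigma (insert x A) B. g (fst p) (snd p))
      = (\<Oplus>p\<in>Pair x ` B x. g (fst p) (snd p)) \<oplus> (\<Oplus>p\<in>Sigma A B. g (fst p) (snd p))"
    unfolding S using insert by (intro finsum_Un_disjoint) auto
  also have "\<dots> = (\<Oplus>i\<in>insert x A. \<Oplus>j\<in>B i. g i j)"
    unfolding x using insert by (subst finsum_insert) (auto intro!: finsum_closed)
  finally show ?case by simp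
qed simp

lemma finsum_swap:
  assumes "finite A" "finite B" and g: "\<And>i j. i \<in> A \<Longrightarrow> j \<in> B \<Longrightarrow> g i j \<in> carrier G"
  shows "(\<Oplus>i\<in>A. \<Oplus>j\<in>B. g i j) = (\<Oplus>j\<in>B. \<Oplus>i\<in>A. g i j)"
  using assms(1) g
proof (induction A rule: finite_induct)
  case empty
  then show ?case by simp
next
  case (insert x A)
  then have "(\<Oplus>j\<in>B. \<Oplus>i\<in>insert x A. g i j) = (\<Oplus>j\<in>B. g x j \<oplus> (\<Oplus>i\<in>A. g i j))"
    by (intro finsum_cong') (auto intro!: finsum_closed)
  also have "\<dots> = (\<Oplus>j\<in>B. g x j) \<oplus> (\<Oplus>j\<in>B. \<Oplus>i\<in>A. g i j)"
    using insert by (intro finsum_addf) (auto intro!: finsum_closed)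
  also have "\<dots> = (\<Oplus>i\<in>insert x A. \<Oplus>j\<in>B. g i j)"
    using insert by (subst finsum_insert) (auto intro!: finsum_closed)
  finally show ?case by simp
qed

lemma finsum_single:
  assumes "finite A" "i \<in> A" "f i \<in> carrier G" "\<And>j. j \<in> A \<Longrightarrow> j \<noteq> i \<Longrightarrow> f j = \<zero>"
  shows "(\<Oplus>j\<in>A. f j) = f i"
proof -
  have "(\<Oplus>j\<in>A. f j) = (\<Oplus>j\<in>{i}. f j)"
    by (rule add.finprod_mono_neutral_cong_right) (use assms in fastforce)+
  then show ?thesis using assms(3) by simp
qed

lemma finsum_all_zero: "(\<And>i. i \<in> A \<Longrightarrow> f i = \<zero>) \<Longrightarrow> (\<Oplus>i\<in>A. f i) = \<zero>"
  by (rule add.finprod_one_eqI)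

end

definition monomials :: "nat \<Rightarrow> nat multiset set" where
  "monomials n = {m. set_mset m \<subseteq> {..<n}}"

lemma monomials_plus [simp]: "a + b \<in> monomials n \<longleftrightarrow> a \<in> monomials n \<and> b \<in> monomials n"
  by (auto simp: monomials_def)

lemma monomials_empty [simp]: "{#} \<in> monomials n" by (simp add: monomials_def)

lemma monomials_add_mset [simp]: "add_mset i a \<in> monomials n \<longleftrightarrow> i < n \<and> a \<in> monomials n"
  by (auto simp: monomials_def)

lemma monomials_submset: "m \<in> monomials n \<Longrightarrow> a \<subseteq># m \<Longrightarrow> a \<in> monomials n"
  unfolding monomials_def using set_mset_mono by fastforce

text \<open>With b true this is the polynomial ring, given by finite support, and with b false the
  power series ring. The operations are the same, so each fact is proved for both rings at
  once.\<close>

definition series_ring :: "('a, 'c) ring_scheme \<Rightarrow> bool \<Rightarrow> nat \<Rightarrow> (nat multiset \<Rightarrow> 'a) ring" where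
  "series_ring K b n =
     (power_series_ring K n)\<lparr>carrier := {f \<in> carrier (power_series_ring K n). b \<longrightarrow> finite {m. f m \<noteq> \<zero>\<^bsub>K\<^esub>}}\<rparr>"

lemma series_ring_False: "series_ring K False n = power_series_ring K n"
  by (simp add: series_ring_def power_series_ring_def)

context cring
begin

lemma series_carrier_iff:
  "f \<in> carrier (series_ring R b n) \<longleftrightarrow> (\<forall>m. f m \<in> carrier R) \<and> (\<forall>m. f m \<noteq> \<zero> \<longrightarrow> m \<in> monomials n) \<and>
    (b \<longrightarrow> finite {m. f m \<noteq> \<zero>})"
  by (auto simp: series_ring_def power_series_ring_def monomials_def)

lemma series_coeff_closed [simp]: "f \<in> carrier (series_ring R b n) \<Longrightarrow> f m \<in> carrier R"
  by (simp add: series_carrier_iff)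

lemma series_monomials: "f \<in> carrier (series_ring R b n) \<Longrightarrow> f m \<noteq> \<zero> \<Longrightarrow> m \<in> monomials n"
  by (simp add: series_carrier_iff)

lemma series_finite: "f \<in> carrier (series_ring R True n) \<Longrightarrow> finite {m. f m \<noteq> \<zero>}"
  by (simp add: series_carrier_iff)

lemma series_zero: "\<zero>\<^bsub>series_ring R b n\<^esub> = (\<lambda>m. \<zero>)"
  unfolding series_ring_def power_series_ring_def by (simp add: indexed_const_def)

lemma series_one: "\<one>\<^bsub>series_ring R b n\<^esub> = (\<lambda>m. if m = {#} then \<one> else \<zero>)"
  unfolding series_ring_def power_series_ring_def by (simp add: indexed_const_def)

lemma series_add: "f \<oplus>\<^bsub>series_ring R b n\<^esub> g = (\<lambda>m. f m \<oplus> g m)"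
  unfolding series_ring_def power_series_ring_def by (simp add: indexed_padd_def)

lemma series_times: "f \<otimes>\<^bsub>series_ring R b n\<^esub> g = series_mult R f g"
  unfolding series_ring_def power_series_ring_def by simp

lemmas series_ring_ops [simp] = series_zero series_one series_add series_times

lemma series_mult_closed':
  "(\<And>m. f m \<in> carrier R) \<Longrightarrow> (\<And>m. g m \<in> carrier R) \<Longrightarrow> series_mult R f g m \<in> carrier R"
  unfolding series_mult_def by (intro finsum_closed) auto

text \<open>The support of a product lies in the sum of the supports.\<close>

lemma series_mult_nonzero:
  assumes "series_mult R f g m \<noteq> \<zero>" and c: "\<And>m. f m \<in> carrier R" "\<And>m. g m \<in> carrier R"
  shows "\<exists>a c. m = a + c \<and> f a \<noteq> \<zero> \<and> g c \<noteq> \<zero>"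
proof -
  have "\<exists>a. a \<subseteq># m \<and> f a \<otimes> g (m - a) \<noteq> \<zero>"
  proof (rule ccontr)
    assume "\<not> ?thesis"
    then have "series_mult R f g m = \<zero>"
      unfolding series_mult_def by (intro finsum_all_zero) auto
    then show False using assms by simp
  qed
  then obtain a where a: "a \<subseteq># m" "f a \<otimes> g (m - a) \<noteq> \<zero>" by auto
  then have "f a \<noteq> \<zero>" "g (m - a) \<noteq> \<zero>" using c by auto
  then show ?thesis using a(1) by (intro exI[of _ a] exI[of _ "m - a"]) auto
qed

lemma series_mult_comm:
  assumes c: "\<And>m. f m \<in> carrier R" "\<And>m. g m \<in> carrier R"
  shows "series_mult R f g = series_mult R g f"
proof
  fix m :: "nat multiset"
  have im: "(\<lambda>a. m - a) ` {a. a \<subseteq># m} = {a. a \<subseteq># m}"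
  proof
    show "{a. a \<subseteq># m} \<subseteq> (\<lambda>a. m - a) ` {a. a \<subseteq># m}"
    proof
      fix a assume "a \<in> {a. a \<subseteq># m}"
      then have "a = m - (m - a)" "m - a \<subseteq># m" by (auto simp: mset_diff_diff)
      then show "a \<in> (\<lambda>a. m - a) ` {a. a \<subseteq># m}" by blast
    qed
  qed auto
  have inj: "inj_on (\<lambda>a. m - a) {a. a \<subseteq># m}"
    by (rule inj_onI) (metis mset_diff_diff mem_Collect_eq)
  have "series_mult R f g m = (\<Oplus>a\<in>(\<lambda>a. m - a) ` {a. a \<subseteq># m}. f a \<otimes> g (m - a))"
    unfolding series_mult_def im ..
  also have "\<dots> = (\<Oplus>a\<in>{a. a \<subseteq># m}. f (m - a) \<otimes> g (m - (m - a)))"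
    by (rule add.finprod_reindex[OF _ inj]) (use c in auto)
  also have "\<dots> = series_mult R g f m"
    unfolding series_mult_def
    by (rule finsum_cong') (use c in \<open>auto simp: m_comm mset_diff_diff\<close>)
  finally show "series_mult R f g m = series_mult R g f m" .
qed

text \<open>Both sides are sums over the factorizations of m into three parts; the map (b, d) -> (b
  + d, b) matches the two ways of listing them.\<close>

lemma series_mult_assoc:
  assumes c: "\<And>m. f m \<in> carrier R" "\<And>m. g m \<in> carrier R" "\<And>m. h m \<in> carrier R"
  shows "series_mult R (series_mult R f g) h = series_mult R f (series_mult R g h)"
proof
  fix m :: "nat multiset"
  let ?D = "\<lambda>m :: nat multiset. {a. a \<subseteq># m}"
  note fin = finite_submultisets
  define S where "S = Sigma (?D m) (\<lambda>b. ?D (m - b))"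
  have finS: "finite S" unfolding S_def using fin by auto
  have "series_mult R (series_mult R f g) h m = (\<Oplus>a\<in>?D m. \<Oplus>b\<in>?D a. f b \<otimes> g (a - b) \<otimes> h (m - a))"
    unfolding series_mult_def
  proof (rule finsum_cong')
    fix a
    show "(\<Oplus>b\<in>?D a. f b \<otimes> g (a - b)) \<otimes> h (m - a) = (\<Oplus>b\<in>?D a. f b \<otimes> g (a - b) \<otimes> h (m - a))"
      by (rule finsum_ldistr) (use c fin in auto)
  qed (use c in \<open>auto intro!: finsum_closed\<close>)
  also have "\<dots> = (\<Oplus>p\<in>Sigma (?D m) ?D. f (snd p) \<otimes> g (fst p - snd p) \<otimes> h (m - fst p))"
    by (rule finsum_Sigma) (use c fin in auto)
  also have "Sigma (?D m) ?D = (\<lambda>p. (fst p + snd p, fst p)) ` S"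
  proof
    show "Sigma (?D m) ?D \<subseteq> (\<lambda>p. (fst p + snd p, fst p)) ` S"
    proof
      fix p assume "p \<in> Sigma (?D m) ?D"
      then obtain a b where p: "p = (a, b)" "a \<subseteq># m" "b \<subseteq># a" by auto
      then have "b \<subseteq># m" by (auto intro: subset_mset.trans)
      moreover have "a - b \<subseteq># m - b" using p by (simp add: subset_eq_diff_conv)
      ultimately have "(b, a - b) \<in> S" unfolding S_def by simp
      moreover have "p = (\<lambda>p. (fst p + snd p, fst p)) (b, a - b)" using p by simp
      ultimately show "p \<in> (\<lambda>p. (fst p + snd p, fst p)) ` S" by blast
    qed
    show "(\<lambda>p. (fst p + snd p, fst p)) ` S \<subseteq> Sigma (?D m) ?D"
    proof
      fix p assume "p \<in> (\<lambda>p. (fst p + snd p, fst p)) ` S"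
      then obtain b d where bd: "p = (b + d, b)" "b \<subseteq># m" "d \<subseteq># m - b" unfolding S_def by auto
      then have "b + d \<subseteq># m" by (metis add.commute subset_mset.le_diff_conv2)
      then show "p \<in> Sigma (?D m) ?D" using bd by simp
    qed
  qed
  also have "(\<Oplus>p\<in>(\<lambda>p. (fst p + snd p, fst p)) ` S. f (snd p) \<otimes> g (fst p - snd p) \<otimes> h (m - fst p))
    = (\<Oplus>p\<in>S. f (fst p) \<otimes> g (fst p + snd p - fst p) \<otimes> h (m - (fst p + snd p)))"
    by (subst add.finprod_reindex) (use c in \<open>auto simp: inj_on_def\<close>)
  also have "\<dots> = (\<Oplus>p\<in>S. f (fst p) \<otimes> (g (snd p) \<otimes> h (m - fst p - snd p)))"
    by (rule finsum_cong') (use c in \<open>auto simp: m_assoc diff_diff_add_mset\<close>)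
  also have "\<dots> = (\<Oplus>b\<in>?D m. \<Oplus>d\<in>?D (m - b). f b \<otimes> (g d \<otimes> h (m - b - d)))"
    unfolding S_def by (rule finsum_Sigma[symmetric]) (use c fin in auto)
  also have "\<dots> = series_mult R f (series_mult R g h) m"
    unfolding series_mult_def
  proof (rule finsum_cong')
    fix b
    show "(\<Oplus>d\<in>?D (m - b). f b \<otimes> (g d \<otimes> h (m - b - d))) = f b \<otimes> (\<Oplus>d\<in>?D (m - b). g d \<otimes> h (m - b - d))"
      by (rule finsum_rdistr[symmetric]) (use c fin in auto)
  qed (use c in \<open>auto intro!: finsum_closed\<close>)
  finally show "series_mult R (series_mult R f g) h m = series_mult R f (series_mult R g h) m" .
qed

lemma series_mult_in_carrier:
  assumes f: "f \<in> carrier (series_ring R b n)" and g: "g \<in> carrier (series_ring R b n)"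
  shows "series_mult R f g \<in> carrier (series_ring R b n)"
proof -
  have c: "\<And>m. f m \<in> carrier R" "\<And>m. g m \<in> carrier R" using f g by auto
  show ?thesis unfolding series_carrier_iff
  proof (intro conjI allI impI)
    show "series_mult R f g m \<in> carrier R" for m by (rule series_mult_closed'[OF c])
    show "m \<in> monomials n" if nz: "series_mult R f g m \<noteq> \<zero>" for m
    proof -
      obtain a d where "m = a + d" "f a \<noteq> \<zero>" "g d \<noteq> \<zero>" using series_mult_nonzero[OF nz c] by auto
      then show ?thesis using series_monomials[OF f] series_monomials[OF g] by simp
    qed
    assume b: b
    have "{m. series_mult R f g m \<noteq> \<zero>} \<subseteq> (\<lambda>(a, d). a + d) ` ({m. f m \<noteq> \<zero>} \<times> {m. g m \<noteq> \<zero>})"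
      using series_mult_nonzero[OF _ c] by fastforce
    then show "finite {m. series_mult R f g m \<noteq> \<zero>}"
      by (rule finite_subset) (use f g b in \<open>auto simp: series_carrier_iff\<close>)
  qed
qed

lemma series_ring_cring: "cring (series_ring R b n)"
proof (rule cringI)
  have fin: "finite {m. f m \<noteq> \<zero>} \<Longrightarrow> finite {m. g m \<noteq> \<zero>} \<Longrightarrow> finite {m. f m \<oplus> g m \<noteq> \<zero>}"
    for f g :: "nat multiset \<Rightarrow> 'a"
    by (rule finite_subset[of _ "{m. f m \<noteq> \<zero>} \<union> {m. g m \<noteq> \<zero>}"]) auto
  show "abelian_group (series_ring R b n)"
  proof (rule abelian_groupI)
    fix f g assume f: "f \<in> carrier (series_ring R b n)" and g: "g \<in> carrier (series_ring R b n)"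
    show "f \<oplus>\<^bsub>series_ring R b n\<^esub> g \<in> carrier (series_ring R b n)"
      unfolding series_carrier_iff series_ring_ops
    proof (intro conjI allI impI)
      show "f m \<oplus> g m \<in> carrier R" for m using f g by simp
      show "m \<in> monomials n" if "f m \<oplus> g m \<noteq> \<zero>" for m
      proof -
        have "f m \<noteq> \<zero> \<or> g m \<noteq> \<zero>" using that by auto
        then show ?thesis using series_monomials[OF f] series_monomials[OF g] by auto
      qed
      show "finite {m. f m \<oplus> g m \<noteq> \<zero>}" if b
        using fin[of f g] f g that by (simp add: series_carrier_iff)
    qed
    show "f \<oplus>\<^bsub>series_ring R b n\<^esub> g = g \<oplus>\<^bsub>series_ring R b n\<^esub> f"
      using f g by (auto simp: series_carrier_iff a_comm)
    fix h assume h: "h \<in> carrier (series_ring R b n)"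
    show "f \<oplus>\<^bsub>series_ring R b n\<^esub> g \<oplus>\<^bsub>series_ring R b n\<^esub> h = f \<oplus>\<^bsub>series_ring R b n\<^esub> (g \<oplus>\<^bsub>series_ring R b n\<^esub> h)"
      using f g h by (auto simp: series_carrier_iff a_assoc)
  next
    fix f assume f: "f \<in> carrier (series_ring R b n)"
    show "\<exists>g\<in>carrier (series_ring R b n). g \<oplus>\<^bsub>series_ring R b n\<^esub> f = \<zero>\<^bsub>series_ring R b n\<^esub>"
    proof (rule bexI[of _ "\<lambda>m. \<ominus> f m"])
      show "(\<lambda>m. \<ominus> f m) \<oplus>\<^bsub>series_ring R b n\<^esub> f = \<zero>\<^bsub>series_ring R b n\<^esub>"
        using f by (auto simp: series_carrier_iff l_neg)
      have "\<ominus> f m \<noteq> \<zero> \<Longrightarrow> f m \<noteq> \<zero>" for m by auto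
      moreover from this have "finite {m. f m \<noteq> \<zero>} \<Longrightarrow> finite {m. \<ominus> f m \<noteq> \<zero>}"
        by (elim finite_subset[rotated]) auto
      ultimately show "(\<lambda>m. \<ominus> f m) \<in> carrier (series_ring R b n)"
        using f unfolding series_carrier_iff by auto
    qed
    show "\<zero>\<^bsub>series_ring R b n\<^esub> \<oplus>\<^bsub>series_ring R b n\<^esub> f = f"
      using f by (auto simp: series_carrier_iff)
  qed (auto simp: series_carrier_iff)
  show "comm_monoid (series_ring R b n)"
  proof (rule comm_monoidI)
    fix f g assume f: "f \<in> carrier (series_ring R b n)" and g: "g \<in> carrier (series_ring R b n)"
    show "f \<otimes>\<^bsub>series_ring R b n\<^esub> g \<in> carrier (series_ring R b n)"
      using series_mult_in_carrier[OF f g] by simp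
    show "f \<otimes>\<^bsub>series_ring R b n\<^esub> g = g \<otimes>\<^bsub>series_ring R b n\<^esub> f"
      using f g series_mult_comm[of f g] by simp
    fix h assume h: "h \<in> carrier (series_ring R b n)"
    show "f \<otimes>\<^bsub>series_ring R b n\<^esub> g \<otimes>\<^bsub>series_ring R b n\<^esub> h = f \<otimes>\<^bsub>series_ring R b n\<^esub> (g \<otimes>\<^bsub>series_ring R b n\<^esub> h)"
      using f g h series_mult_assoc[of f g h] by simp
  next
    fix f assume f: "f \<in> carrier (series_ring R b n)"
    have "series_mult R (\<lambda>m. if m = {#} then \<one> else \<zero>) f m = f m" for m
      unfolding series_mult_def
      by (subst finsum_single[of _ "{#}"]) (use f finite_submultisets in auto)
    then show "\<one>\<^bsub>series_ring R b n\<^esub> \<otimes>\<^bsub>series_ring R b n\<^esub> f = f" by auto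
  qed (auto simp: series_carrier_iff)
  fix f g h assume c: "f \<in> carrier (series_ring R b n)" "g \<in> carrier (series_ring R b n)" "h \<in> carrier (series_ring R b n)"
  have "series_mult R (\<lambda>m. f m \<oplus> g m) h m = series_mult R f h m \<oplus> series_mult R g h m" for m
  proof -
    have "series_mult R (\<lambda>m. f m \<oplus> g m) h m = (\<Oplus>a\<in>{a. a \<subseteq># m}. f a \<otimes> h (m - a) \<oplus> g a \<otimes> h (m - a))"
      unfolding series_mult_def by (rule finsum_cong') (use c in \<open>auto simp: l_distr\<close>)
    also have "\<dots> = series_mult R f h m \<oplus> series_mult R g h m"
      unfolding series_mult_def by (rule finsum_addf) (use c in auto)
    finally show ?thesis .
  qed
  then show "(f \<oplus>\<^bsub>series_ring R b n\<^esub> g) \<otimes>\<^bsub>series_ring R b n\<^esub> h =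
      f \<otimes>\<^bsub>series_ring R b n\<^esub> h \<oplus>\<^bsub>series_ring R b n\<^esub> g \<otimes>\<^bsub>series_ring R b n\<^esub> h" by auto
qed

lemma series_uminus:
  assumes "f \<in> carrier (series_ring R b n)"
  shows "\<ominus>\<^bsub>series_ring R b n\<^esub> f = (\<lambda>m. \<ominus> f m)"
proof -
  interpret S: cring "series_ring R b n" by (rule series_ring_cring)
  have "f \<oplus>\<^bsub>series_ring R b n\<^esub> (\<ominus>\<^bsub>series_ring R b n\<^esub> f) = \<zero>\<^bsub>series_ring R b n\<^esub>"
    using assms by (rule S.r_neg)
  then have "f m \<oplus> (\<ominus>\<^bsub>series_ring R b n\<^esub> f) m = \<zero>" for m by (simp add: fun_eq_iff)
  moreover have "(\<ominus>\<^bsub>series_ring R b n\<^esub> f) m \<in> carrier R" for m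
    using S.a_inv_closed[OF assms] by simp
  ultimately show ?thesis using assms minus_equality[of _ "f _"]
    by (intro ext) (metis a_comm series_coeff_closed)
qed

lemma series_minus:
  assumes "f \<in> carrier (series_ring R b n)" "g \<in> carrier (series_ring R b n)"
  shows "f \<ominus>\<^bsub>series_ring R b n\<^esub> g = (\<lambda>m. f m \<ominus> g m)"
  using assms by (simp add: a_minus_def series_uminus)

lemma series_finsum:
  assumes "finite A" "F \<in> A \<rightarrow> carrier (series_ring R b n)"
  shows "(\<Oplus>\<^bsub>series_ring R b n\<^esub>i\<in>A. F i) m = (\<Oplus>i\<in>A. F i m)"
proof -
  interpret S: cring "series_ring R b n" by (rule series_ring_cring)
  show ?thesis using assms
  proof (induction A rule: finite_induct)
    case (insert x A)
    then have "(\<Oplus>i\<in>insert x A. F i m) = F x m \<oplus> (\<Oplus>i\<in>A. F i m)"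
      by (intro finsum_insert) (auto simp: Pi_def)
    moreover have "(\<Oplus>\<^bsub>series_ring R b n\<^esub>i\<in>insert x A. F i) = F x \<oplus>\<^bsub>series_ring R b n\<^esub> (\<Oplus>\<^bsub>series_ring R b n\<^esub>i\<in>A. F i)"
      using insert by (intro S.finsum_insert) auto
    ultimately show ?case using insert by simp
  qed simp
qed

lemma series_monom_closed [simp]:
  "c \<in> carrier R \<Longrightarrow> a \<in> monomials n \<Longrightarrow> series_monom R c a \<in> carrier (series_ring R b n)"
  by (auto simp: series_monom_def series_carrier_iff)

lemma series_monom_mult:
  assumes c: "c \<in> carrier R" "\<And>m. f m \<in> carrier R"
  shows "series_mult R (series_monom R c a) f m = (if a \<subseteq># m then c \<otimes> f (m - a) else \<zero>)"
proof (cases "a \<subseteq># m")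
  case True
  then show ?thesis unfolding series_mult_def
    by (subst finsum_single[of _ a]) (use c finite_submultisets in \<open>auto simp: series_monom_def\<close>)
next
  case False
  then show ?thesis unfolding series_mult_def
    by (subst finsum_all_zero) (use c in \<open>auto simp: series_monom_def\<close>)
qed

lemma series_monom_mult_monom:
  assumes "c \<in> carrier R" "d \<in> carrier R"
  shows "series_mult R (series_monom R c a) (series_monom R d a') = series_monom R (c \<otimes> d) (a + a')"
proof
  fix m :: "nat multiset"
  show "series_mult R (series_monom R c a) (series_monom R d a') m = series_monom R (c \<otimes> d) (a + a') m"
  proof (cases "m = a + a'")
    case True
    then show ?thesis using assms by (subst series_monom_mult) (auto simp: series_monom_def)
  next
    case False
    moreover have "m - a \<noteq> a'" if "a \<subseteq># m" using False that by auto
    ultimately show ?thesis using assms by (subst series_monom_mult) (auto simp: series_monom_def)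
  qed
qed

text \<open>Induction on a finite set containing the support, removing one term at a time; a single
  term is a constant multiplied successively by its variables.\<close>

lemma finite_support_in_indexed_pset:
  assumes "finite A" "{m. f m \<noteq> \<zero>} \<subseteq> A" "\<And>m. f m \<in> carrier R" "A \<subseteq> monomials n"
  shows "f \<in> indexed_pset {..<n} (carrier R)"
  using assms
proof (induction A arbitrary: f rule: finite_induct)
  case empty
  then have "f = indexed_const \<zero>" by (auto simp: indexed_const_def)
  then show ?case by (auto intro: indexed_pset.indexed_const)
next
  case (insert a A)
  have mon: "series_monom R c a \<in> indexed_pset {..<n} (carrier R)" if "c \<in> carrier R" for c
    using \<open>insert a A \<subseteq> monomials n\<close>[THEN subsetD, OF insertI1]
  proof (induction a)
    case empty
    have "series_monom R c {#} = indexed_const c" by (auto simp: series_monom_def indexed_const_def)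
    then show ?case using that by (auto intro: indexed_pset.indexed_const)
  next
    case (add i a)
    have "series_monom R c (add_mset i a) = indexed_pmult (series_monom R c a) i"
    proof
      fix m
      show "series_monom R c (add_mset i a) m = indexed_pmult (series_monom R c a) i m"
        by (cases "i \<in># m") (auto simp: series_monom_def indexed_pmult_def)
    qed
    then show ?case using add by (auto intro: indexed_pset.indexed_pmult)
  qed
  define g where "g = f(a := \<zero>)"
  have "g \<in> indexed_pset {..<n} (carrier R)"
    by (rule insert.IH) (use insert.prems in \<open>auto simp: g_def\<close>)
  moreover have "f = indexed_padd g (series_monom R (f a) a)"
    using insert.prems by (auto simp: g_def indexed_padd_def series_monom_def)
  ultimately show ?case using mon[of "f a"] insert.prems(2)
    by (metis indexed_pset.indexed_padd)
qed

text \<open>The inductively generated carrier consists of the finitely supported functions.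
  Multiplication by a variable is a product with a monomial, so closure under products covers that
  generation rule.\<close>

lemma polynomial_ring_eq: "polynomial_ring R n = series_ring R True n"
proof -
  have "indexed_pset {..<n} (carrier R) = carrier (series_ring R True n)"
  proof
    show "indexed_pset {..<n} (carrier R) \<subseteq> carrier (series_ring R True n)"
    proof
      fix f assume "f \<in> indexed_pset {..<n} (carrier R)"
      then show "f \<in> carrier (series_ring R True n)"
      proof induction
        case (indexed_const k)
        have "finite {m. indexed_const k m \<noteq> \<zero>}"
          by (rule finite_subset[of _ "{{#}}"]) (auto simp: indexed_const_def)
        then show ?case using indexed_const by (auto simp: series_carrier_iff indexed_const_def)
      next
        case (indexed_padd P Q)
        interpret S: cring "series_ring R True n" by (rule series_ring_cring)
        show ?case using S.a_closed[OF indexed_padd.IH] by (simp add: indexed_padd_def)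
      next
        case (indexed_pmult P i)
        interpret S: cring "series_ring R True n" by (rule series_ring_cring)
        have "indexed_pmult P i = series_mult R (series_monom R \<one> {#i#}) P"
          using indexed_pmult by (auto simp: series_monom_mult indexed_pmult_def)
        then show ?case using indexed_pmult by (auto intro!: series_mult_in_carrier)
      qed
    qed
    show "carrier (series_ring R True n) \<subseteq> indexed_pset {..<n} (carrier R)"
    proof
      fix f assume f: "f \<in> carrier (series_ring R True n)"
      show "f \<in> indexed_pset {..<n} (carrier R)"
        by (rule finite_support_in_indexed_pset[of "{m. f m \<noteq> \<zero>}"])
          (use f in \<open>auto simp: series_carrier_iff\<close>)
    qed
  qed
  then show ?thesis unfolding polynomial_ring_def series_ring_def by simp
qed

end

section \<open>A weighted change of coordinates\<close>

lemma replicate_mset_add: "replicate_mset (i + j) x = replicate_mset i x + replicate_mset j x"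
  by (induction i) simp_all

text \<open>The variables are x_0, ..., x_k. As x_k has weight 1, the power x_k^(d i) has the weight
  of x_i, and positive weights leave only finitely many monomials of each weight.\<close>

locale weighted_series = cring +
  fixes k :: nat and d :: "nat \<Rightarrow> nat"
  assumes d_last: "d k = 1" and d_pos: "d i \<ge> 1"
begin

definition wt :: "nat multiset \<Rightarrow> nat" where "wt m = (\<Sum>i\<in>#m. d i)"

lemma wt_simps [simp]: "wt {#} = 0" "wt (add_mset i m) = d i + wt m" "wt (a + c) = wt a + wt c"
  by (simp_all add: wt_def)

lemma wt_replicate [simp]: "wt (replicate_mset j i) = j * d i"
  by (induction j) simp_all

lemma count_le_wt: "count m i \<le> wt m"
proof (induction m)
  case (add x m)
  then show ?case using d_pos[of x] by (cases "x = i") auto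
qed simp

text \<open>Variables other than x_k add to the weight but not to the exponent of x_k. So among the
  monomials of one weight, the power of x_k is the only one whose x_k-exponent equals the
  weight.\<close>

lemma wt_eq_count: "wt m = count m k \<Longrightarrow> m = replicate_mset (wt m) k"
proof (induction m)
  case (add x m)
  show ?case
  proof (cases "x = k")
    case True
    then show ?thesis using add d_last by auto
  next
    case False
    then have "d x + wt m = count m k" using add.prems by simp
    then show ?thesis using count_le_wt[of m k] d_pos[of x] by simp
  qed
qed simp

text \<open>Positive weights bound each exponent by the weight.\<close>

lemma finite_wt_le: "finite {m \<in> monomials n. wt m \<le> v}"
proof (rule finite_subset[OF _ finite_submultisets])
  show "{m \<in> monomials n. wt m \<le> v} \<subseteq> {m. m \<subseteq># repeat_mset v (mset_set {..<n})}"
  proof clarify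
    fix m assume m: "m \<in> monomials n" "wt m \<le> v"
    have "count m i \<le> count (repeat_mset v (mset_set {..<n})) i" for i
    proof (cases "i < n")
      case True
      then show ?thesis using count_le_wt[of m i] m(2) by simp
    next
      case False
      then have "i \<notin># m" using m(1) unfolding monomials_def by auto
      then show ?thesis by (simp add: count_eq_zero_iff[symmetric] not_in_iff)
    qed
    then show "m \<subseteq># repeat_mset v (mset_set {..<n})" by (simp add: subseteq_mset_def)
  qed
qed

abbreviation "N \<equiv> Suc k"

abbreviation "P \<equiv> series_ring R True N"

definition wset :: "nat \<Rightarrow> nat multiset set" where "wset v = {m \<in> monomials N. wt m = v}"

lemma finite_wset [simp]: "finite (wset v)"
  by (rule finite_subset[OF _ finite_wt_le[of N v]]) (auto simp: wset_def)

lemma finite_wt_eq [simp]: "finite {m \<in> monomials N. wt m = v}"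
  using finite_wset unfolding wset_def .

text \<open>The exponent \<open>d i\<close> makes the image of the \<open>i\<close>-th variable homogeneous of weight \<open>d i\<close>.\<close>

definition lin :: "'a \<Rightarrow> nat \<Rightarrow> nat multiset \<Rightarrow> 'a" where
  "lin e i = (if i = k then series_monom R \<one> {#k#}
     else series_monom R \<one> {#i#} \<oplus>\<^bsub>P\<^esub> series_monom R e (replicate_mset (d i) k))"

text \<open>The image of the monomial m under x_i -> \<open>lin e i\<close>. It is a polynomial,
  even when the substitution acts on power series.\<close>

definition lpow :: "'a \<Rightarrow> nat multiset \<Rightarrow> nat multiset \<Rightarrow> 'a" where
  "lpow e m = (\<Otimes>\<^bsub>P\<^esub>i\<in>{..<N}. lin e i [^]\<^bsub>P\<^esub> count m i)"

sublocale P: cring P by (rule series_ring_cring)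

lemma replicate_monomials [simp]: "replicate_mset j k \<in> monomials N"
  by (auto simp: monomials_def)

lemma lin_closed [simp]: "e \<in> carrier R \<Longrightarrow> i < N \<Longrightarrow> lin e i \<in> carrier P"
  unfolding lin_def by (auto simp del: series_ring_ops intro!: P.a_closed)

lemma lpow_closed [simp]: "e \<in> carrier R \<Longrightarrow> lpow e m \<in> carrier P"
  unfolding lpow_def by (rule P.finprod_closed) (auto simp del: series_ring_ops)

lemma lpow_coeff_closed [simp]: "e \<in> carrier R \<Longrightarrow> lpow e m a \<in> carrier R"
  using series_coeff_closed[OF lpow_closed] .

lemma lpow_empty: "lpow e {#} = \<one>\<^bsub>P\<^esub>"
  unfolding lpow_def by (simp del: series_ring_ops)

lemma lpow_plus: "e \<in> carrier R \<Longrightarrow> lpow e (a + c) = lpow e a \<otimes>\<^bsub>P\<^esub> lpow e c"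
proof -
  assume e: "e \<in> carrier R"
  have "lpow e (a + c) = (\<Otimes>\<^bsub>P\<^esub>i\<in>{..<N}. lin e i [^]\<^bsub>P\<^esub> count a i \<otimes>\<^bsub>P\<^esub> lin e i [^]\<^bsub>P\<^esub> count c i)"
    unfolding lpow_def
    by (rule P.finprod_cong') (use e in \<open>auto simp del: series_ring_ops simp: P.nat_pow_mult\<close>)
  also have "\<dots> = lpow e a \<otimes>\<^bsub>P\<^esub> lpow e c"
    unfolding lpow_def by (rule P.finprod_multf) (use e in \<open>auto simp del: series_ring_ops\<close>)
  finally show ?thesis .
qed

lemma lpow_single: "e \<in> carrier R \<Longrightarrow> i < N \<Longrightarrow> lpow e {#i#} = lin e i"
proof -
  assume e: "e \<in> carrier R" and i: "i < N"
  have "lpow e {#i#} = (\<Otimes>\<^bsub>P\<^esub>j\<in>{..<N}. if i = j then lin e j else \<one>\<^bsub>P\<^esub>)"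
    unfolding lpow_def
    by (rule P.finprod_cong') (use e in \<open>auto simp del: series_ring_ops\<close>)
  also have "\<dots> = lin e i"
    by (rule P.finprod_singleton) (use e i in \<open>auto simp del: series_ring_ops\<close>)
  finally show ?thesis .
qed

lemma lpow_add_mset: "e \<in> carrier R \<Longrightarrow> i < N \<Longrightarrow> lpow e (add_mset i a) = series_mult R (lin e i) (lpow e a)"
  using lpow_plus[of e "{#i#}" a] lpow_single[of e i] by simp

lemma lin_homogeneous: "lin e i a \<noteq> \<zero> \<Longrightarrow> e \<in> carrier R \<Longrightarrow> wt a = d i"
  unfolding lin_def by (auto simp: series_monom_def d_last split: if_splits)

text \<open>Each factor \<open>lin e i\<close> is homogeneous of weight \<open>d i\<close>, and
  weights add in products.\<close>

lemma lpow_homogeneous: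
  assumes e: "e \<in> carrier R" and m: "m \<in> monomials N"
  shows "lpow e m a \<noteq> \<zero> \<Longrightarrow> wt a = wt m"
  using m
proof (induction m arbitrary: a)
  case empty
  then show ?case by (auto simp: lpow_empty split: if_splits)
next
  case (add i m)
  then have i: "i < N" "m \<in> monomials N" by auto
  obtain x y where xy: "a = x + y" "lin e i x \<noteq> \<zero>" "lpow e m y \<noteq> \<zero>"
    using series_mult_nonzero[of "lin e i" "lpow e m" a] add.prems(1) e i
      series_coeff_closed[OF lin_closed[OF e i(1)]]
    by (auto simp: lpow_add_mset)
  then show ?case using lin_homogeneous[OF xy(2) e] add.IH[OF xy(3) i(2)] by simp
qed

text \<open>A pure power of x_k arises in only one way: every factor x_i + x_k^(d i) must contribute
  its second term. This coefficient is what makes the transformed series regular in x_k.\<close>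

lemma lpow_last:
  "m \<in> monomials N \<Longrightarrow> lpow \<one> m (replicate_mset (wt m) k) = \<one>"
proof (induction m)
  case (add i m)
  then have i: "i < N" "m \<in> monomials N" by auto
  let ?r = "replicate_mset (wt (add_mset i m)) k"
  have lp: "lpow \<one> m y \<in> carrier R" for y by simp
  show ?case
  proof (cases "i = k")
    case True
    have "series_mult R (lin \<one> i) (lpow \<one> m) ?r = lpow \<one> m (replicate_mset (wt m) k)"
      unfolding lin_def using True d_last by (subst if_P[OF True]) (simp add: series_monom_mult)
    then show ?thesis using add.IH i by (simp add: lpow_add_mset)
  next
    case False
    have c: "series_monom R \<one> {#i#} \<in> carrier P" "series_monom R \<one> (replicate_mset (d i) k) \<in> carrier P"
      using i by auto
    have "lpow \<one> (add_mset i m) = (series_monom R \<one> {#i#} \<oplus>\<^bsub>P\<^esub> series_monom R \<one> (replicate_mset (d i) k)) \<otimes>\<^bsub>P\<^esub> lpow \<one> m"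
      using False i unfolding lin_def by (simp add: lpow_add_mset lin_def)
    also have "\<dots> = series_monom R \<one> {#i#} \<otimes>\<^bsub>P\<^esub> lpow \<one> m \<oplus>\<^bsub>P\<^esub> series_monom R \<one> (replicate_mset (d i) k) \<otimes>\<^bsub>P\<^esub> lpow \<one> m"
      by (rule P.l_distr[OF c]) simp
    finally have "lpow \<one> (add_mset i m) ?r =
      series_mult R (series_monom R \<one> {#i#}) (lpow \<one> m) ?r \<oplus> series_mult R (series_monom R \<one> (replicate_mset (d i) k)) (lpow \<one> m) ?r"
      by simp
    moreover have "\<not> {#i#} \<subseteq># ?r" using False by auto
    moreover have "?r = replicate_mset (d i) k + replicate_mset (wt m) k" by (simp add: replicate_mset_add)
    ultimately show ?thesis using add.IH i lp by (simp add: series_monom_mult)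
  qed
qed (simp add: lpow_empty)

text \<open>By homogeneity the coefficient at m receives contributions only from monomials of the
  same weight. The sum is therefore finite and the substitution needs no convergence argument for
  power series.\<close>

definition subst :: "'a \<Rightarrow> (nat multiset \<Rightarrow> 'a) \<Rightarrow> nat multiset \<Rightarrow> 'a" where
  "subst e f m = (\<Oplus>a\<in>wset (wt m). f a \<otimes> lpow e a m)"

text \<open>Coefficients at several monomials can then be written over one common finite index set;
  the added terms vanish by homogeneity.\<close>

lemma subst_wider:
  assumes e: "e \<in> carrier R" and f: "\<And>m. f m \<in> carrier R" and x: "wt x \<le> v"
  shows "subst e f x = (\<Oplus>a\<in>{a \<in> monomials N. wt a \<le> v}. f a \<otimes> lpow e a x)"
  unfolding subst_def
proof (rule add.finprod_mono_neutral_cong_left)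
  show "finite {a \<in> monomials N. wt a \<le> v}" by (rule finite_wt_le)
  show "wset (wt x) \<subseteq> {a \<in> monomials N. wt a \<le> v}" using x by (auto simp: wset_def)
  fix a assume "a \<in> {a \<in> monomials N. wt a \<le> v} - wset (wt x)"
  then have a: "a \<in> monomials N" "wt a \<noteq> wt x" by (auto simp: wset_def)
  then have "lpow e a x = \<zero>" using lpow_homogeneous[OF e a(1), of x] by auto
  then show "f a \<otimes> lpow e a x = \<zero>" using f by simp
qed (use e f in auto)

lemma subst_nonzero:
  assumes "subst e f m \<noteq> \<zero>" and f: "\<And>m. f m \<in> carrier R" and e: "e \<in> carrier R"
  shows "\<exists>a\<in>monomials N. f a \<noteq> \<zero> \<and> wt a = wt m \<and> lpow e a m \<noteq> \<zero>"
proof (rule ccontr)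
  assume none: "\<not> ?thesis"
  have "subst e f m = \<zero>" unfolding subst_def
  proof (rule finsum_all_zero)
    fix a assume "a \<in> wset (wt m)"
    then have "f a = \<zero> \<or> lpow e a m = \<zero>" using none by (auto simp: wset_def)
    then show "f a \<otimes> lpow e a m = \<zero>" using f e by auto
  qed
  then show False using assms(1) by simp
qed

lemma subst_closed:
  assumes f: "f \<in> carrier (series_ring R b N)" and e: "e \<in> carrier R"
  shows "subst e f \<in> carrier (series_ring R b N)"
  unfolding series_carrier_iff
proof (intro conjI allI impI)
  have c: "f m \<in> carrier R" for m using f by simp
  show "subst e f m \<in> carrier R" for m
    unfolding subst_def using c e by (intro finsum_closed) auto
  show "m \<in> monomials N" if "subst e f m \<noteq> \<zero>" for m
    using subst_nonzero[OF that c e] series_monomials[OF lpow_closed[OF e]] by blast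
  assume b: b
  have "{m. subst e f m \<noteq> \<zero>} \<subseteq> (\<Union>a\<in>{a. f a \<noteq> \<zero>}. {m. lpow e a m \<noteq> \<zero>})"
  proof
    fix m assume "m \<in> {m. subst e f m \<noteq> \<zero>}"
    then obtain a where "f a \<noteq> \<zero>" "lpow e a m \<noteq> \<zero>" using subst_nonzero[of e f m, OF _ c e] by auto
    then show "m \<in> (\<Union>a\<in>{a. f a \<noteq> \<zero>}. {m. lpow e a m \<noteq> \<zero>})" by blast
  qed
  then show "finite {m. subst e f m \<noteq> \<zero>}"
    by (rule finite_subset) (use b f e series_finite[OF lpow_closed[OF e]] in \<open>auto simp: series_carrier_iff\<close>)
qed

lemma subst_add:
  assumes f: "\<And>m. f m \<in> carrier R" and g: "\<And>m. g m \<in> carrier R" and e: "e \<in> carrier R"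
  shows "subst e (\<lambda>m. f m \<oplus> g m) m = subst e f m \<oplus> subst e g m"
proof -
  have "subst e (\<lambda>m. f m \<oplus> g m) m = (\<Oplus>a\<in>wset (wt m). f a \<otimes> lpow e a m \<oplus> g a \<otimes> lpow e a m)"
    unfolding subst_def by (rule finsum_cong') (use assms in \<open>auto simp: l_distr\<close>)
  also have "\<dots> = subst e f m \<oplus> subst e g m"
    unfolding subst_def by (rule finsum_addf) (use assms in auto)
  finally show ?thesis .
qed

lemma subst_monom:
  assumes "c \<in> carrier R" "e \<in> carrier R" "a \<in> monomials N"
  shows "subst e (series_monom R c a) m = c \<otimes> lpow e a m"
proof (cases "wt a = wt m")
  case True
  then show ?thesis unfolding subst_def
    by (subst finsum_single[of _ a]) (use assms in \<open>auto simp: wset_def series_monom_def\<close>)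
next
  case False
  then have "lpow e a m = \<zero>" using lpow_homogeneous[OF assms(2,3), of m] by auto
  moreover have "subst e (series_monom R c a) m = \<zero>" unfolding subst_def
    by (rule finsum_all_zero) (use assms False in \<open>auto simp: wset_def series_monom_def\<close>)
  ultimately show ?thesis using assms by simp
qed

lemma finsum_product:
  assumes "finite A" "finite B" "\<And>a. a \<in> A \<Longrightarrow> f a \<in> carrier R" "\<And>a. a \<in> B \<Longrightarrow> g a \<in> carrier R"
  shows "(\<Oplus>a\<in>A. f a) \<otimes> (\<Oplus>b\<in>B. g b) = (\<Oplus>a\<in>A. \<Oplus>b\<in>B. f a \<otimes> g b)"
proof -
  have "(\<Oplus>a\<in>A. f a) \<otimes> (\<Oplus>b\<in>B. g b) = (\<Oplus>a\<in>A. f a \<otimes> (\<Oplus>b\<in>B. g b))"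
    by (rule finsum_ldistr) (use assms in \<open>auto intro!: finsum_closed\<close>)
  also have "\<dots> = (\<Oplus>a\<in>A. \<Oplus>b\<in>B. f a \<otimes> g b)"
    by (rule finsum_cong') (use assms in \<open>auto intro!: finsum_rdistr finsum_closed\<close>)
  finally show ?thesis .
qed

text \<open>Both sides are expanded into sums over pairs of monomials from \<open>F\<close>, those
  of weight at most wt m; on the left a pair is a monomial with one of its divisors, on the right a
  pair of factors. The images of monomials multiply by \<open>lpow_plus\<close>.\<close>

lemma subst_mult:
  assumes f: "\<And>m. f m \<in> carrier R" and g: "\<And>m. g m \<in> carrier R" and e: "e \<in> carrier R"
  shows "subst e (series_mult R f g) m = series_mult R (subst e f) (subst e g) m"
proof -
  define F where "F = {a \<in> monomials N. wt a \<le> wt m}"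
  let ?D = "\<lambda>m :: nat multiset. {a. a \<subseteq># m}"
  have fF: "finite F" unfolding F_def by (rule finite_wt_le)
  note fin = finite_submultisets fF
  have c: "lpow e a x \<in> carrier R" for a x using e by simp
  let ?h = "\<lambda>a b. f a \<otimes> g b \<otimes> lpow e (a + b) m"
  have "series_mult R (subst e f) (subst e g) m =
    (\<Oplus>x\<in>?D m. (\<Oplus>a\<in>F. f a \<otimes> lpow e a x) \<otimes> (\<Oplus>b\<in>F. g b \<otimes> lpow e b (m - x)))"
    unfolding series_mult_def
  proof (rule finsum_cong')
    fix x assume "x \<in> ?D m"
    then have "m = x + (m - x)" by simp
    then have "wt m = wt x + wt (m - x)" using wt_simps(3)[of x "m - x"] by simp
    then have x: "wt x \<le> wt m" "wt (m - x) \<le> wt m" by auto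
    show "subst e f x \<otimes> subst e g (m - x) = (\<Oplus>a\<in>F. f a \<otimes> lpow e a x) \<otimes> (\<Oplus>b\<in>F. g b \<otimes> lpow e b (m - x))"
      unfolding F_def subst_wider[where f = f, OF e f x(1)] subst_wider[where f = g, OF e g x(2)] ..
  qed (use f g c in \<open>auto intro!: finsum_closed\<close>)
  also have "\<dots> = (\<Oplus>x\<in>?D m. \<Oplus>a\<in>F. \<Oplus>b\<in>F. (f a \<otimes> lpow e a x) \<otimes> (g b \<otimes> lpow e b (m - x)))"
    by (rule finsum_cong') (use f g c fin in \<open>auto intro!: finsum_closed finsum_product\<close>)
  also have "\<dots> = (\<Oplus>a\<in>F. \<Oplus>x\<in>?D m. \<Oplus>b\<in>F. (f a \<otimes> lpow e a x) \<otimes> (g b \<otimes> lpow e b (m - x)))"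
    by (rule finsum_swap) (use f g c fin in \<open>auto intro!: finsum_closed\<close>)
  also have "\<dots> = (\<Oplus>a\<in>F. \<Oplus>b\<in>F. ?h a b)"
  proof (rule finsum_cong')
    fix a assume "a \<in> F"
    have "(\<Oplus>x\<in>?D m. \<Oplus>b\<in>F. (f a \<otimes> lpow e a x) \<otimes> (g b \<otimes> lpow e b (m - x)))
      = (\<Oplus>b\<in>F. \<Oplus>x\<in>?D m. (f a \<otimes> lpow e a x) \<otimes> (g b \<otimes> lpow e b (m - x)))"
      by (rule finsum_swap) (use f g c fin in auto)
    also have "\<dots> = (\<Oplus>b\<in>F. ?h a b)"
    proof (rule finsum_cong')
      fix b assume "b \<in> F"
      have "(\<Oplus>x\<in>?D m. (f a \<otimes> lpow e a x) \<otimes> (g b \<otimes> lpow e b (m - x)))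
        = (\<Oplus>x\<in>?D m. f a \<otimes> g b \<otimes> (lpow e a x \<otimes> lpow e b (m - x)))"
        by (rule finsum_cong') (use f g c in \<open>auto simp: m_ac\<close>)
      also have "\<dots> = f a \<otimes> g b \<otimes> (\<Oplus>x\<in>?D m. lpow e a x \<otimes> lpow e b (m - x))"
        by (rule finsum_rdistr[symmetric]) (use f g c fin in auto)
      also have "(\<Oplus>x\<in>?D m. lpow e a x \<otimes> lpow e b (m - x)) = lpow e (a + b) m"
        by (simp add: lpow_plus[OF e] series_mult_def)
      finally show "(\<Oplus>x\<in>?D m. (f a \<otimes> lpow e a x) \<otimes> (g b \<otimes> lpow e b (m - x))) = ?h a b" .
    qed (use f g c in auto)
    finally show "(\<Oplus>x\<in>?D m. \<Oplus>b\<in>F. (f a \<otimes> lpow e a x) \<otimes> (g b \<otimes> lpow e b (m - x))) = (\<Oplus>b\<in>F. ?h a b)" .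
  qed (use f g c in \<open>auto intro!: finsum_closed\<close>)
  also have "\<dots> = (\<Oplus>p\<in>F \<times> F. ?h (fst p) (snd p))"
    by (rule finsum_Sigma) (use f g c fin in auto)
  \<comment> \<open>Pairs of total weight above wt m contribute nothing at m, by
    homogeneity.\<close>
  also have "\<dots> = (\<Oplus>p\<in>{p \<in> F \<times> F. fst p + snd p \<in> F}. ?h (fst p) (snd p))"
  proof (rule add.finprod_mono_neutral_cong_right)
    fix p assume "p \<in> F \<times> F - {p \<in> F \<times> F. fst p + snd p \<in> F}"
    then have p: "fst p + snd p \<in> monomials N" "wt (fst p + snd p) \<noteq> wt m" by (auto simp: F_def)
    then have "lpow e (fst p + snd p) m = \<zero>" using lpow_homogeneous[OF e p(1), of m] by auto
    then show "?h (fst p) (snd p) = \<zero>" using f g by simp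
  qed (use f g c fin in auto)
  finally have rhs: "series_mult R (subst e f) (subst e g) m = \<dots>" .
  have im: "Sigma F ?D = (\<lambda>p. (fst p + snd p, fst p)) ` {p \<in> F \<times> F. fst p + snd p \<in> F}"
  proof
    show "Sigma F ?D \<subseteq> (\<lambda>p. (fst p + snd p, fst p)) ` {p \<in> F \<times> F. fst p + snd p \<in> F}"
    proof
      fix q assume "q \<in> Sigma F ?D"
      then obtain x a where q: "q = (x, a)" "x \<in> F" "a \<subseteq># x" by auto
      then have xe: "x = a + (x - a)" by simp
      then have "a + (x - a) \<in> F" using q(2) by simp
      then have "a \<in> F" "x - a \<in> F" unfolding F_def by (auto simp del: subset_mset.add_diff_inverse)
      then have "(a, x - a) \<in> {p \<in> F \<times> F. fst p + snd p \<in> F}" using \<open>a + (x - a) \<in> F\<close> by simp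
      moreover have "q = (\<lambda>p. (fst p + snd p, fst p)) (a, x - a)" using q xe by simp
      ultimately show "q \<in> (\<lambda>p. (fst p + snd p, fst p)) ` {p \<in> F \<times> F. fst p + snd p \<in> F}" by blast
    qed
  qed auto
  have "subst e (series_mult R f g) m = (\<Oplus>x\<in>F. series_mult R f g x \<otimes> lpow e x m)"
    unfolding F_def by (rule subst_wider[OF e series_mult_closed'[OF f g] order_refl])
  also have "\<dots> = (\<Oplus>x\<in>F. (\<Oplus>a\<in>?D x. f a \<otimes> g (x - a)) \<otimes> lpow e x m)"
    unfolding series_mult_def ..
  also have "\<dots> = (\<Oplus>x\<in>F. \<Oplus>a\<in>?D x. f a \<otimes> g (x - a) \<otimes> lpow e x m)"
    by (rule finsum_cong') (use f g c fin in \<open>auto intro!: finsum_closed finsum_ldistr\<close>)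
  also have "\<dots> = (\<Oplus>p\<in>Sigma F ?D. f (snd p) \<otimes> g (fst p - snd p) \<otimes> lpow e (fst p) m)"
    by (rule finsum_Sigma) (use f g c fin in auto)
  also have "\<dots> = (\<Oplus>p\<in>{p \<in> F \<times> F. fst p + snd p \<in> F}. ?h (fst p) (snd p))"
    unfolding im by (subst add.finprod_reindex) (use f g c in \<open>auto simp: inj_on_def\<close>)
  finally show ?thesis unfolding rhs .
qed

lemma subst_ring_hom:
  assumes e: "e \<in> carrier R"
  shows "subst e \<in> ring_hom (series_ring R b N) (series_ring R b N)"
proof (rule ring_hom_memI)
  fix f assume f: "f \<in> carrier (series_ring R b N)"
  show "subst e f \<in> carrier (series_ring R b N)" by (rule subst_closed[OF f e])
  fix g assume g: "g \<in> carrier (series_ring R b N)"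
  show "subst e (f \<oplus>\<^bsub>series_ring R b N\<^esub> g) = subst e f \<oplus>\<^bsub>series_ring R b N\<^esub> subst e g"
    using subst_add[of f g e] f g e by auto
  show "subst e (f \<otimes>\<^bsub>series_ring R b N\<^esub> g) = subst e f \<otimes>\<^bsub>series_ring R b N\<^esub> subst e g"
    using subst_mult[of f g e] f g e by auto
next
  have "\<one>\<^bsub>series_ring R b N\<^esub> = series_monom R \<one> {#}" by (auto simp: series_monom_def)
  then show "subst e \<one>\<^bsub>series_ring R b N\<^esub> = \<one>\<^bsub>series_ring R b N\<^esub>"
    using subst_monom[of \<one> e "{#}"] e lpow_empty[of e] by (auto simp del: series_times)
qed

lemma lpow_replicate:
  assumes e: "e \<in> carrier R" shows "lpow e (replicate_mset j k) = series_monom R \<one> (replicate_mset j k)"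
proof (induction j)
  case 0
  then show ?case by (auto simp: lpow_empty series_monom_def)
next
  case (Suc j)
  have "lin e k = series_monom R \<one> {#k#}" by (simp add: lin_def)
  then show ?case using Suc e by (simp add: lpow_add_mset series_monom_mult_monom)
qed

text \<open>Since x_k is fixed, x_i + e x_k^(d i) is sent to (x_i - e x_k^(d i)) + e x_k^(d i) =
  x_i; products follow by induction on the monomial.\<close>

lemma subst_lpow:
  assumes e: "e \<in> carrier R" and a: "a \<in> monomials N"
  shows "subst (\<ominus> e) (lpow e a) = series_monom R \<one> a"
  using a
proof (induction a)
  case empty
  have "subst (\<ominus> e) \<one>\<^bsub>P\<^esub> = \<one>\<^bsub>P\<^esub>"
    by (rule ring_hom_one[OF subst_ring_hom]) (use e in simp)
  then show ?case by (auto simp: lpow_empty series_monom_def)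
next
  case (add i a)
  then have i: "i < N" "a \<in> monomials N" by auto
  have e': "\<ominus> e \<in> carrier R" using e by simp
  have lin: "subst (\<ominus> e) (lin e i) = series_monom R \<one> {#i#}"
  proof (cases "i = k")
    case True
    have "subst (\<ominus> e) (series_monom R \<one> {#k#}) m = series_monom R \<one> {#k#} m" for m
      using lpow_single[OF e', of k] e' by (subst subst_monom) (auto simp: lin_def series_monom_def)
    then show ?thesis using True by (auto simp: lin_def)
  next
    case False
    have "subst (\<ominus> e) (lin e i) m = series_monom R \<one> {#i#} m" for m
    proof -
      let ?r = "replicate_mset (d i) k"
      have "subst (\<ominus> e) (lin e i) m = subst (\<ominus> e) (series_monom R \<one> {#i#}) m \<oplus> subst (\<ominus> e) (series_monom R e ?r) m"
        using False e by (simp add: lin_def subst_add series_monom_def)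
      also have "\<dots> = lin (\<ominus> e) i m \<oplus> e \<otimes> series_monom R \<one> ?r m"
        using i e e' series_coeff_closed[OF lin_closed[OF e' i(1)], of m] lpow_single[OF e' i(1)] lpow_replicate[OF e', of "d i"]
        by (simp add: subst_monom)
      also have "\<dots> = series_monom R \<one> {#i#} m"
        using False e by (auto simp: lin_def series_monom_def l_neg r_neg a_assoc)
      finally show ?thesis .
    qed
    then show ?thesis by auto
  qed
  have "subst (\<ominus> e) (lpow e (add_mset i a)) m = series_mult R (subst (\<ominus> e) (lin e i)) (subst (\<ominus> e) (lpow e a)) m" for m
    using e e' i series_coeff_closed[OF lin_closed[OF e i(1)]] by (simp add: lpow_add_mset subst_mult)
  then show ?case using lin add.IH i by (auto simp: series_monom_mult_monom)
qed

text \<open>Within one weight both substitutions are finite sums, so they may be interchanged, which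
  reduces the claim to monomials.\<close>

lemma subst_inverse:
  assumes f: "f \<in> carrier (series_ring R b N)" and e: "e \<in> carrier R"
  shows "subst (\<ominus> e) (subst e f) = f"
proof
  fix m :: "nat multiset"
  let ?W = "wset (wt m)"
  have e': "\<ominus> e \<in> carrier R" using e by simp
  have c: "f m \<in> carrier R" for m using f by simp
  have "subst (\<ominus> e) (subst e f) m = (\<Oplus>x\<in>?W. (\<Oplus>a\<in>?W. f a \<otimes> lpow e a x) \<otimes> lpow (\<ominus> e) x m)"
    unfolding subst_def[of "\<ominus> e"]
    by (rule finsum_cong') (use c e e' in \<open>auto simp: subst_def wset_def intro!: finsum_closed\<close>)
  also have "\<dots> = (\<Oplus>x\<in>?W. \<Oplus>a\<in>?W. f a \<otimes> lpow e a x \<otimes> lpow (\<ominus> e) x m)"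
    by (rule finsum_cong') (use c e e' in \<open>auto intro!: finsum_closed finsum_ldistr\<close>)
  also have "\<dots> = (\<Oplus>a\<in>?W. \<Oplus>x\<in>?W. f a \<otimes> lpow e a x \<otimes> lpow (\<ominus> e) x m)"
    by (rule finsum_swap) (use c e e' in auto)
  also have "\<dots> = (\<Oplus>a\<in>?W. f a \<otimes> subst (\<ominus> e) (lpow e a) m)"
  proof (rule finsum_cong')
    fix a
    have "(\<Oplus>x\<in>?W. f a \<otimes> lpow e a x \<otimes> lpow (\<ominus> e) x m) = (\<Oplus>x\<in>?W. f a \<otimes> (lpow e a x \<otimes> lpow (\<ominus> e) x m))"
      by (rule finsum_cong') (use c e e' in \<open>auto simp: m_assoc\<close>)
    also have "\<dots> = f a \<otimes> subst (\<ominus> e) (lpow e a) m"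
      unfolding subst_def by (rule finsum_rdistr[symmetric]) (use c e e' in auto)
    finally show "(\<Oplus>x\<in>?W. f a \<otimes> lpow e a x \<otimes> lpow (\<ominus> e) x m) = f a \<otimes> subst (\<ominus> e) (lpow e a) m" .
  qed (use c e e' series_coeff_closed[OF subst_closed[OF lpow_closed[OF e] e']] in auto)
  also have "\<dots> = (\<Oplus>a\<in>?W. if a = m then f a else \<zero>)"
    by (rule finsum_cong') (use c e in \<open>auto simp: subst_lpow wset_def series_monom_def\<close>)
  also have "\<dots> = f m"
  proof (cases "m \<in> monomials N")
    case True
    then show ?thesis by (subst finsum_single[of _ m]) (use c in \<open>auto simp: wset_def\<close>)
  next
    case False
    then have "f m = \<zero>" using series_monomials[OF f] by auto
    then show ?thesis by (subst finsum_all_zero) auto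
  qed
  finally show "subst (\<ominus> e) (subst e f) m = f m" .
qed

end

section \<open>Weierstrass division\<close>

text \<open>The hypothesis on \<open>g\<close> is regularity in x_k: x_k^D has a unit coefficient,
  and \<open>D\<close> is the maximal weight of \<open>g\<close> for polynomials and the minimal
  weight for power series.\<close>

locale weierstrass_series = weighted_series +
  fixes b :: bool and D :: nat and g :: "nat multiset \<Rightarrow> 'a"
  assumes g_closed: "g \<in> carrier (series_ring R b (Suc k))"
    and g_unit: "g (replicate_mset D k) \<in> Units R"
    and g_wt: "g m \<noteq> \<zero> \<Longrightarrow> (if b then wt m \<le> D else D \<le> wt m)"
begin

abbreviation "S \<equiv> series_ring R b N"

sublocale S: cring S by (rule series_ring_cring)

definition top where "top = replicate_mset D k"

lemma wt_top [simp]: "wt top = D" "count top k = D" "top \<in> monomials N"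
  by (simp_all add: top_def d_last)

text \<open>Solving \<open>(u g)(m + top) = h(m + top)\<close> for \<open>u\<close> is a triangular system with respect to this
  relation; for polynomials \<open>V\<close> bounds the weights that occur.\<close>

definition prec :: "nat \<Rightarrow> (nat multiset \<times> nat multiset) set" where
  "prec V = inv_image (less_than <*lex*> less_than) (\<lambda>m. (if b then V - wt m else wt m, wt m - count m k))"

lemma wf_prec: "wf (prec V)"
  unfolding prec_def by (intro wf_inv_image wf_lex_prod wf_less_than)

lemma prec_irrefl: "(m, m) \<notin> prec V"
  by (rule wf_not_refl[OF wf_prec])

text \<open>Write r for the complementary factor, so wt a + wt r = wt m + D. If r has weight
  different from \<open>D\<close>, then a is heavier than m for polynomials and lighter for power
  series. If r has weight \<open>D\<close>, it is not x_k^D, so it has a smaller exponent of x_k,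
  and a has a larger one than m at equal weight.\<close>

lemma prec_if:
  assumes a: "a \<subseteq># m + top" "a \<noteq> m" and nz: "g (m + top - a) \<noteq> \<zero>" and V: "b \<Longrightarrow> wt a \<le> V"
  shows "(a, m) \<in> prec V"
proof -
  define r where "r = m + top - a"
  have eq: "a + r = m + top" using a(1) unfolding r_def by simp
  have w: "wt a + wt r = wt m + D" using arg_cong[OF eq, of wt] by simp
  have ck: "count a k + count r k = count m k + D"
    using arg_cong[OF eq, of "\<lambda>m. count m k"] by simp
  have le: "count a k \<le> wt a" "count m k \<le> wt m" "count r k \<le> wt r" by (rule count_le_wt)+
  have "r \<noteq> top" using eq a(2) by auto
  then have "wt r = D \<Longrightarrow> count r k < D"
    using wt_eq_count[of r] le(3) unfolding top_def by (cases "count r k = D") auto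
  moreover have "if b then wt r \<le> D else D \<le> wt r" using g_wt[of r] nz unfolding r_def by blast
  ultimately show ?thesis using w ck le V unfolding prec_def
    by (cases "wt r = D") (auto split: if_splits)
qed

text \<open>At a minimal m of the support of \<open>u\<close>, every other contribution to the
  coefficient at m + top comes from a smaller index and vanishes, so u m times the unit g top is
  zero.\<close>

lemma division_unique:
  assumes u: "u \<in> carrier S" and z: "\<And>m. series_mult R u g (m + top) = \<zero>"
  shows "u = \<zero>\<^bsub>S\<^esub>"
proof (rule ccontr)
  assume "u \<noteq> \<zero>\<^bsub>S\<^esub>"
  then obtain m0 where m0: "m0 \<in> {m. u m \<noteq> \<zero>}" by auto
  define V where "V = (if b then Max (wt ` {m. u m \<noteq> \<zero>}) else 0)"
  have V: "wt a \<le> V" if b "u a \<noteq> \<zero>" for a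
    using that u unfolding V_def by (auto simp: series_carrier_iff intro!: Max_ge)
  obtain m where m: "m \<in> {m. u m \<noteq> \<zero>}" and min: "\<And>a. (a, m) \<in> prec V \<Longrightarrow> a \<notin> {m. u m \<noteq> \<zero>}"
    using wfE_min[OF wf_prec m0] by blast
  have "series_mult R u g (m + top) = u m \<otimes> g (m + top - m)"
    unfolding series_mult_def
  proof (rule finsum_single[OF finite_submultisets])
    fix a assume "a \<in> {a. a \<subseteq># m + top}" "a \<noteq> m"
    then have "u a = \<zero> \<or> g (m + top - a) = \<zero>"
      using min prec_if[of a m V] V[of a] by blast
    then show "u a \<otimes> g (m + top - a) = \<zero>" using u g_closed by auto
  qed (use u g_closed in auto)
  then have "u m \<otimes> g top = \<zero>" using z[of m] by simp
  then have "u m \<otimes> g top \<otimes> inv (g top) = \<zero>" using g_unit unfolding top_def by simp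
  then have "u m = \<zero>" using u g_unit series_coeff_closed[OF g_closed] unfolding top_def by (simp add: m_assoc)
  then show False using m by simp
qed

text \<open>The equation at m + top determines u m from the values of \<open>u\<close> at smaller
  indices, since the coefficient g top of u m is a unit; \<open>u\<close> is built by well-founded
  recursion.\<close>

lemma division_exists:
  assumes h: "h \<in> carrier S"
  shows "\<exists>u\<in>carrier S. \<forall>m. series_mult R u g (m + top) = h (m + top)"
proof -
  define V where "V = (if b then Max (wt ` {m. h m \<noteq> \<zero>}) else 0)"
  have V: "wt a \<le> V" if b "h a \<noteq> \<zero>" for a
    using that h unfolding V_def by (auto simp: series_carrier_iff intro!: Max_ge)
  \<comment> \<open>For polynomials, unknowns of weight above \<open>V\<close> are set to zero,
    which keeps \<open>u\<close> finitely supported; for power series all monomials are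
    unknowns.\<close>
  define I where "I = {m \<in> monomials N. b \<longrightarrow> wt m \<le> V}"
  define A where "A m = {a \<in> I. a \<subseteq># m + top \<and> (a, m) \<in> prec V}" for m
  \<comment> \<open>The guard \<open>a \<in> A m\<close> inside the summand makes it the same
    function when \<open>u\<close> is replaced by its restriction \<open>cut\<close> to the
    predecessors of m, so the recursion equation unfolds by equality of functions.\<close>
  define step where "step u m = (if m \<in> I then inv (g top) \<otimes> (h (m + top) \<ominus>
      (\<Oplus>a\<in>A m. (if a \<in> A m then u a else \<zero>) \<otimes> g (m + top - a))) else \<zero>)" for u m
  define u where "u = wfrec (prec V) step"
  have u_eq: "u m = step u m" for m
  proof -
    have "u m = step (cut u (prec V) m) m" unfolding u_def by (rule wfrec[OF wf_prec])
    also have "\<dots> = step u m"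
    proof -
      have "(\<lambda>a. (if a \<in> A m then cut u (prec V) m a else \<zero>) \<otimes> g (m + top - a)) =
        (\<lambda>a. (if a \<in> A m then u a else \<zero>) \<otimes> g (m + top - a))"
        by (auto simp: A_def cut_apply)
      then show ?thesis unfolding step_def by simp
    qed
    finally show ?thesis .
  qed
  have gc: "g m \<in> carrier R" "h m \<in> carrier R" for m using g_closed h by auto
  have gu: "g top \<in> Units R" using g_unit unfolding top_def .
  have finA: "finite (A m)" for m
    by (rule finite_subset[OF _ finite_submultisets[of "m + top"]]) (auto simp: A_def)
  have uc: "u m \<in> carrier R" for m
    using wf_prec[of V]
  proof (induction m rule: wf_induct_rule)
    case (less m)
    then have "(if a \<in> A m then u a else \<zero>) \<otimes> g (m + top - a) \<in> carrier R" for a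
      using gc by (auto simp: A_def)
    then have "(\<Oplus>a\<in>A m. (if a \<in> A m then u a else \<zero>) \<otimes> g (m + top - a)) \<in> carrier R"
      by (intro finsum_closed) auto
    then show ?case unfolding u_eq[of m] step_def using gc gu by auto
  qed
  have uI: "u m \<noteq> \<zero> \<Longrightarrow> m \<in> I" for m using u_eq[of m] by (auto simp: step_def split: if_splits)
  have uS: "u \<in> carrier S" unfolding series_carrier_iff
  proof (intro conjI allI impI)
    show "m \<in> monomials N" if "u m \<noteq> \<zero>" for m using uI[OF that] unfolding I_def by simp
    assume b
    then have "{m. u m \<noteq> \<zero>} \<subseteq> {m \<in> monomials N. wt m \<le> V}" using uI unfolding I_def by auto
    then show "finite {m. u m \<noteq> \<zero>}" by (rule finite_subset[OF _ finite_wt_le])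
  qed (rule uc)
  have ugS: "series_mult R u g \<in> carrier S" using S.m_closed[OF uS g_closed] by simp
  have "series_mult R u g (m + top) = h (m + top)" for m
  proof (cases "m \<in> I")
    case True
    let ?s = "\<Oplus>a\<in>A m. u a \<otimes> g (m + top - a)"
    have sc: "?s \<in> carrier R" using gc uc by (intro finsum_closed) auto
    have "series_mult R u g (m + top) = (\<Oplus>a\<in>insert m (A m). u a \<otimes> g (m + top - a))"
      unfolding series_mult_def
    proof (rule add.finprod_mono_neutral_cong_right[OF finite_submultisets])
      show "insert m (A m) \<subseteq> {a. a \<subseteq># m + top}" by (auto simp: A_def)
      fix a assume a: "a \<in> {a. a \<subseteq># m + top} - insert m (A m)"
      have "u a = \<zero> \<or> g (m + top - a) = \<zero>"
      proof (rule ccontr)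
        assume nz: "\<not> ?thesis"
        then have "a \<in> I" using uI by blast
        then have "(a, m) \<in> prec V" using prec_if[of a m V] a nz by (auto simp: I_def)
        then show False using a \<open>a \<in> I\<close> by (auto simp: A_def)
      qed
      then show "u a \<otimes> g (m + top - a) = \<zero>" using gc uc by auto
    qed (use gc uc in auto)
    also have "\<dots> = u m \<otimes> g top \<oplus> ?s"
      using gc uc finA prec_irrefl by (subst finsum_insert) (auto simp: A_def)
    also have "u m = inv (g top) \<otimes> (h (m + top) \<ominus> ?s)"
    proof -
      have "(\<Oplus>a\<in>A m. (if a \<in> A m then u a else \<zero>) \<otimes> g (m + top - a)) = ?s"
        by (rule finsum_cong') (use gc uc in auto)
      then show ?thesis using True by (simp add: u_eq[of m] step_def)
    qed
    also have "inv (g top) \<otimes> (h (m + top) \<ominus> ?s) \<otimes> g top = h (m + top) \<ominus> ?s"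
      using gc sc gu by (simp add: m_comm m_assoc[symmetric])
    also have "h (m + top) \<ominus> ?s \<oplus> ?s = h (m + top)" using gc sc by (simp add: a_minus_def a_assoc l_neg)
    finally show ?thesis .
  next
    case False
    show ?thesis
    proof (cases "m \<in> monomials N")
      case m: False
      then have "m + top \<notin> monomials N" by simp
      then show ?thesis using series_monomials[OF ugS] series_monomials[OF h] by metis
    next
      case m: True
      \<comment> \<open>This case occurs only for polynomials. Both sides vanish: \<open>h\<close>
        has weights at most \<open>V\<close>, and terms of the product have weights at most V +
        D.\<close>
      then have bV: b "wt m > V" using False unfolding I_def by auto
      then have "h (m + top) = \<zero>" using V[of "m + top"] by fastforce
      moreover have "series_mult R u g (m + top) = \<zero>"
      proof (rule ccontr)
        assume "\<not> ?thesis"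
        then obtain a r where ar: "m + top = a + r" "u a \<noteq> \<zero>" "g r \<noteq> \<zero>"
          using series_mult_nonzero[of u g "m + top"] uc gc by auto
        have "wt m + D = wt a + wt r" using arg_cong[OF ar(1), of wt] by simp
        moreover have "wt a \<le> V" using uI[OF ar(2)] bV by (simp add: I_def)
        moreover have "wt r \<le> D" using g_wt[OF ar(3)] bV by simp
        ultimately show False using bV by simp
      qed
      ultimately show ?thesis by simp
    qed
  qed
  then show ?thesis using uS by blast
qed

text \<open>The remainders of the division. The coefficients of 1, x_k, ..., x_k^(D-1) will be the
  \<open>D\<close> coordinates over the ring in one variable less.\<close>

definition low :: "(nat multiset \<Rightarrow> 'a) set" where
  "low = {r \<in> carrier S. \<forall>m. r m \<noteq> \<zero> \<longrightarrow> count m k < D}"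

lemma low_shift: "r \<in> low \<Longrightarrow> r (m + top) = \<zero>"
proof (rule ccontr)
  assume "r \<in> low" "r (m + top) \<noteq> \<zero>"
  then have "count (m + top) k < D" unfolding low_def by blast
  then show False by simp
qed

text \<open>A monomial has exponent at least \<open>D\<close> in x_k exactly when \<open>top\<close>
  divides it.\<close>

lemma low_iff: "r \<in> carrier S \<Longrightarrow> r \<in> low \<longleftrightarrow> (\<forall>m. r (m + top) = \<zero>)"
proof
  assume r: "r \<in> carrier S" and z: "\<forall>m. r (m + top) = \<zero>"
  have "count m k < D" if "r m \<noteq> \<zero>" for m
  proof (rule ccontr)
    assume "\<not> count m k < D"
    then have "top \<subseteq># m" unfolding top_def by (auto simp: subseteq_mset_def)
    then show False using z[rule_format, of "m - top"] that by simp
  qed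
  then show "r \<in> low" using r unfolding low_def by blast
qed (use low_shift in blast)

text \<open>The quotient is chosen to match \<open>h\<close> at all multiples of \<open>top\<close>,
  so that the difference has none of these monomials left.\<close>

lemma division: "h \<in> carrier S \<Longrightarrow> \<exists>u\<in>carrier S. \<exists>r\<in>low. h = u \<otimes>\<^bsub>S\<^esub> g \<oplus>\<^bsub>S\<^esub> r"
proof -
  assume h: "h \<in> carrier S"
  obtain u where u: "u \<in> carrier S" "\<And>m. series_mult R u g (m + top) = h (m + top)"
    using division_exists[OF h] by blast
  define r where "r = h \<ominus>\<^bsub>S\<^esub> u \<otimes>\<^bsub>S\<^esub> g"
  have ug: "u \<otimes>\<^bsub>S\<^esub> g \<in> carrier S" by (rule S.m_closed[OF u(1) g_closed])
  have r: "r \<in> carrier S" unfolding r_def by (rule S.minus_closed[OF h ug])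
  have "r (m + top) = \<zero>" for m
    unfolding r_def series_minus[OF h ug] using u(2) h by (simp add: a_minus_def r_neg)
  then have "r \<in> low" using low_iff[OF r] by blast
  moreover have "h = u \<otimes>\<^bsub>S\<^esub> g \<oplus>\<^bsub>S\<^esub> r" unfolding r_def using h ug
    by (metis S.a_comm S.add.inv_solve_right' S.minus_closed S.minus_eq)
  ultimately show ?thesis using u(1) by blast
qed

text \<open>The difference of the quotients times \<open>g\<close> is a difference of remainders and
  so vanishes at all multiples of \<open>top\<close>; \<open>division_unique\<close> then makes the
  quotients equal.\<close>

lemma division_eq:
  assumes u: "u \<in> carrier S" "u' \<in> carrier S" and r: "r \<in> low" "r' \<in> low"
    and eq: "u \<otimes>\<^bsub>S\<^esub> g \<oplus>\<^bsub>S\<^esub> r = u' \<otimes>\<^bsub>S\<^esub> g \<oplus>\<^bsub>S\<^esub> r'"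
  shows "r = r'"
proof -
  have rc: "r \<in> carrier S" "r' \<in> carrier S" using r unfolding low_def by auto
  note c = u rc g_closed
  have d: "(u \<ominus>\<^bsub>S\<^esub> u') \<otimes>\<^bsub>S\<^esub> g = r' \<ominus>\<^bsub>S\<^esub> r"
  proof -
    have "(u \<ominus>\<^bsub>S\<^esub> u') \<otimes>\<^bsub>S\<^esub> g = (u \<otimes>\<^bsub>S\<^esub> g \<oplus>\<^bsub>S\<^esub> r) \<ominus>\<^bsub>S\<^esub> u' \<otimes>\<^bsub>S\<^esub> g \<ominus>\<^bsub>S\<^esub> r"
      using c by (simp add: a_minus_def S.l_distr S.l_minus S.a_ac S.r_neg S.r_neg1 S.r_neg2 del: series_ring_ops)
    also have "\<dots> = r' \<ominus>\<^bsub>S\<^esub> r"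
      unfolding eq using c by (simp add: a_minus_def S.a_ac S.r_neg S.r_neg1 S.r_neg2 S.l_neg del: series_ring_ops)
    finally show ?thesis .
  qed
  have "u \<ominus>\<^bsub>S\<^esub> u' = \<zero>\<^bsub>S\<^esub>"
  proof (rule division_unique)
    show "u \<ominus>\<^bsub>S\<^esub> u' \<in> carrier S" by (rule S.minus_closed[OF u])
    fix m
    have "series_mult R (u \<ominus>\<^bsub>S\<^esub> u') g (m + top) = r' (m + top) \<ominus> r (m + top)"
      using fun_cong[OF d, of "m + top"] by (simp only: series_times series_minus[OF rc(2,1)])
    also have "\<dots> = \<zero> \<ominus> \<zero>" using low_shift[OF r(1)] low_shift[OF r(2)] by (simp only:)
    finally show "series_mult R (u \<ominus>\<^bsub>S\<^esub> u') g (m + top) = \<zero>" by (simp add: a_minus_def)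
  qed
  then have "r' \<ominus>\<^bsub>S\<^esub> r = \<zero>\<^bsub>S\<^esub>" using d S.l_null[OF g_closed] by (simp del: series_ring_ops)
  then show ?thesis using S.r_right_minus_eq[OF rc(2,1)] by blast
qed

definition rem :: "(nat multiset \<Rightarrow> 'a) \<Rightarrow> nat multiset \<Rightarrow> 'a" where
  "rem h = (THE r. r \<in> low \<and> (\<exists>u\<in>carrier S. h = u \<otimes>\<^bsub>S\<^esub> g \<oplus>\<^bsub>S\<^esub> r))"

lemma remI: "r \<in> low \<Longrightarrow> u \<in> carrier S \<Longrightarrow> rem (u \<otimes>\<^bsub>S\<^esub> g \<oplus>\<^bsub>S\<^esub> r) = r"
  unfolding rem_def by (rule the_equality) (use division_eq in blast)+

lemma nonzerodivisor: "u \<in> carrier S \<Longrightarrow> u \<otimes>\<^bsub>S\<^esub> g = \<zero>\<^bsub>S\<^esub> \<Longrightarrow> u = \<zero>\<^bsub>S\<^esub>"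
  by (rule division_unique) auto

end

text \<open>The smaller ring omits the last variable x_k and has the same operations on coefficient
  functions, so it sits inside the larger one as a subset.\<close>

lemma (in cring) series_ring_subset:
  "carrier (series_ring R b k) \<subseteq> carrier (series_ring R b (Suc k))"
proof -
  have "monomials k \<subseteq> monomials (Suc k)" by (auto simp: monomials_def)
  then show ?thesis unfolding series_carrier_iff subset_iff by blast
qed

text \<open>The automorphism \<open>subst \<one>\<close> carries S/fS to S/gS, where division by
  \<open>g\<close> gives unique remainders, and the j-th coordinate is the coefficient of x_k^j in
  the remainder. The ring in the first k variables is embedded by the inverse
  \<open>subst (\<ominus> \<one>)\<close>, so that after the coordinate change its elements act by
  plain multiplication.\<close>

theorem (in weierstrass_series) finite_free:
  assumes f: "f \<in> carrier (series_ring R b (Suc k))" and gf: "g = subst \<one> f"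
  shows "finite_free_mod (series_ring R b k) (series_ring R b (Suc k)) (subst (\<ominus> \<one>))
    (\<lambda>h j m. if m \<in> monomials k then rem (subst \<one> h) (m + replicate_mset j k) else \<zero>) D f"
proof -
  define B where "B = series_ring R b k"
  interpret B: cring B unfolding B_def by (rule series_ring_cring)
  have BS: "carrier B \<subseteq> carrier S" unfolding B_def by (rule series_ring_subset)
  have one: "\<one> \<in> carrier R" "\<ominus> \<one> \<in> carrier R" by auto
  interpret \<sigma>: ring_hom_cring S S "subst \<one>" by (rule ring_hom_cringI'[OF S.is_cring S.is_cring subst_ring_hom[OF one(1)]])
  interpret \<tau>: ring_hom_cring S S "subst (\<ominus> \<one>)" by (rule ring_hom_cringI'[OF S.is_cring S.is_cring subst_ring_hom[OF one(2)]])
  have \<tau>\<sigma>: "subst (\<ominus> \<one>) (subst \<one> h) = h" if "h \<in> carrier S" for h by (rule subst_inverse[OF that one(1)])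
  have \<sigma>\<tau>: "subst \<one> (subst (\<ominus> \<one>) h) = h" if "h \<in> carrier S" for h
    using subst_inverse[OF that one(2)] by simp
  define \<beta> where "\<beta> h j = (\<lambda>m. if m \<in> monomials k then rem (subst \<one> h) (m + replicate_mset j k) else \<zero>)" for h j
  note [simp del] = series_ring_ops
  have div: "\<exists>u\<in>carrier S. subst \<one> h = u \<otimes>\<^bsub>S\<^esub> g \<oplus>\<^bsub>S\<^esub> rem (subst \<one> h) \<and> rem (subst \<one> h) \<in> low" if "h \<in> carrier S" for h
    using division[OF \<sigma>.hom_closed[OF that]] remI by metis
  have lowc: "r \<in> low \<Longrightarrow> r \<in> carrier S" for r unfolding low_def by simp
  show ?thesis unfolding \<beta>_def[symmetric] B_def[symmetric]
  proof (unfold_locales)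
    show "subst (\<ominus> \<one>) \<in> ring_hom B S"
    proof (rule ring_hom_memI)
      show "subst (\<ominus> \<one>) x \<in> carrier S" if "x \<in> carrier B" for x using that BS by auto
      show "subst (\<ominus> \<one>) (x \<otimes>\<^bsub>B\<^esub> y) = subst (\<ominus> \<one>) x \<otimes>\<^bsub>S\<^esub> subst (\<ominus> \<one>) y" if "x \<in> carrier B" "y \<in> carrier B" for x y
        using \<tau>.hom_mult[of x y] that BS by (auto simp: B_def series_times)
      show "subst (\<ominus> \<one>) (x \<oplus>\<^bsub>B\<^esub> y) = subst (\<ominus> \<one>) x \<oplus>\<^bsub>S\<^esub> subst (\<ominus> \<one>) y" if "x \<in> carrier B" "y \<in> carrier B" for x y
        using \<tau>.hom_add[of x y] that BS by (auto simp: B_def series_add)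
      show "subst (\<ominus> \<one>) \<one>\<^bsub>B\<^esub> = \<one>\<^bsub>S\<^esub>" using \<tau>.hom_one by (simp add: B_def series_one)
    qed
    show "f \<in> carrier S" by (rule f)
  next
    fix h j assume h: "h \<in> carrier S" and j: "j < D"
    have r: "rem (subst \<one> h) \<in> carrier S" using div[OF h] lowc by blast
    have "finite {m. \<beta> h j m \<noteq> \<zero>}" if b
    proof (rule finite_subset)
      show "{m. \<beta> h j m \<noteq> \<zero>} \<subseteq> (\<lambda>m. m - replicate_mset j k) ` {m. rem (subst \<one> h) m \<noteq> \<zero>}"
      proof
        fix m assume "m \<in> {m. \<beta> h j m \<noteq> \<zero>}"
        then have "m + replicate_mset j k \<in> {m. rem (subst \<one> h) m \<noteq> \<zero>}" by (auto simp: \<beta>_def split: if_splits)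
        moreover have "m = (m + replicate_mset j k) - replicate_mset j k" by simp
        ultimately show "m \<in> (\<lambda>m. m - replicate_mset j k) ` {m. rem (subst \<one> h) m \<noteq> \<zero>}" by blast
      qed
    qed (use r that in \<open>simp add: series_carrier_iff\<close>)
    then show "\<beta> h j \<in> carrier B"
      unfolding B_def series_carrier_iff using series_coeff_closed[OF r] by (auto simp: \<beta>_def split: if_splits)
  next
    fix h h' j assume h: "h \<in> carrier S" "h' \<in> carrier S" and j: "j < D"
    obtain u where u: "u \<in> carrier S" "subst \<one> h = u \<otimes>\<^bsub>S\<^esub> g \<oplus>\<^bsub>S\<^esub> rem (subst \<one> h)" "rem (subst \<one> h) \<in> low"
      using div[OF h(1)] by blast
    obtain u' where u': "u' \<in> carrier S" "subst \<one> h' = u' \<otimes>\<^bsub>S\<^esub> g \<oplus>\<^bsub>S\<^esub> rem (subst \<one> h')" "rem (subst \<one> h') \<in> low"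
      using div[OF h(2)] by blast
    define r r' where "r = rem (subst \<one> h)" and "r' = rem (subst \<one> h')"
    have rc: "r \<in> carrier S" "r' \<in> carrier S" using lowc u u' by (auto simp: r_def r'_def)
    have "subst \<one> (h \<oplus>\<^bsub>S\<^esub> h') = (u \<otimes>\<^bsub>S\<^esub> g \<oplus>\<^bsub>S\<^esub> r) \<oplus>\<^bsub>S\<^esub> (u' \<otimes>\<^bsub>S\<^esub> g \<oplus>\<^bsub>S\<^esub> r')"
      using u(2) u'(2) h unfolding r_def r'_def by simp
    also have "\<dots> = (u \<oplus>\<^bsub>S\<^esub> u') \<otimes>\<^bsub>S\<^esub> g \<oplus>\<^bsub>S\<^esub> (r \<oplus>\<^bsub>S\<^esub> r')"
      using u(1) u'(1) rc g_closed by (simp add: S.l_distr S.a_ac)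
    finally have "rem (subst \<one> (h \<oplus>\<^bsub>S\<^esub> h')) = r \<oplus>\<^bsub>S\<^esub> r'"
      using remI[of "r \<oplus>\<^bsub>S\<^esub> r'" "u \<oplus>\<^bsub>S\<^esub> u'"] u(1) u'(1) u(3) u'(3) rc
      by (simp add: low_iff r_def r'_def) (simp add: low_shift series_add)
    then show "\<beta> (h \<oplus>\<^bsub>S\<^esub> h') j = \<beta> h j \<oplus>\<^bsub>B\<^esub> \<beta> h' j"
      by (auto simp: \<beta>_def B_def series_add r_def r'_def)
  next
    fix c h j assume c: "c \<in> carrier B" and h: "h \<in> carrier S" and j: "j < D"
    have cS: "c \<in> carrier S" using c BS by auto
    obtain u where u: "u \<in> carrier S" "subst \<one> h = u \<otimes>\<^bsub>S\<^esub> g \<oplus>\<^bsub>S\<^esub> rem (subst \<one> h)" "rem (subst \<one> h) \<in> low"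
      using div[OF h] by blast
    define r where "r = rem (subst \<one> h)"
    have rc: "r \<in> carrier S" using lowc u by (auto simp: r_def)
    have cr: "c m \<in> carrier R" "r m \<in> carrier R" for m using c rc by (auto simp: B_def)
    \<comment> \<open>Elements of \<open>B\<close> do not involve x_k, so multiplying a remainder by
      c does not raise its degree in x_k and yields a remainder again.\<close>
    have c0: "count m k = 0" if "c m \<noteq> \<zero>" for m
      using series_monomials[OF c[unfolded B_def] that] by (auto simp: monomials_def count_eq_zero_iff)
    have "subst \<one> (subst (\<ominus> \<one>) c \<otimes>\<^bsub>S\<^esub> h) = c \<otimes>\<^bsub>S\<^esub> (u \<otimes>\<^bsub>S\<^esub> g \<oplus>\<^bsub>S\<^esub> r)"
      using u(2) h cS unfolding r_def by (simp add: \<sigma>\<tau>)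
    also have "\<dots> = (c \<otimes>\<^bsub>S\<^esub> u) \<otimes>\<^bsub>S\<^esub> g \<oplus>\<^bsub>S\<^esub> (c \<otimes>\<^bsub>S\<^esub> r)"
      using u(1) rc cS g_closed by (simp add: S.r_distr S.m_assoc)
    finally have eq: "subst \<one> (subst (\<ominus> \<one>) c \<otimes>\<^bsub>S\<^esub> h) = (c \<otimes>\<^bsub>S\<^esub> u) \<otimes>\<^bsub>S\<^esub> g \<oplus>\<^bsub>S\<^esub> (c \<otimes>\<^bsub>S\<^esub> r)" .
    have "c \<otimes>\<^bsub>S\<^esub> r \<in> low"
    proof -
      have "count m k < D" if nz: "series_mult R c r m \<noteq> \<zero>" for m
      proof -
        obtain x y where "m = x + y" "c x \<noteq> \<zero>" "r y \<noteq> \<zero>" using series_mult_nonzero[OF nz cr] by auto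
        then show ?thesis using c0 u(3) by (auto simp: low_def r_def)
      qed
      then show ?thesis unfolding low_def using S.m_closed[OF cS rc] by (simp add: series_times)
    qed
    then have rem: "rem (subst \<one> (subst (\<ominus> \<one>) c \<otimes>\<^bsub>S\<^esub> h)) = c \<otimes>\<^bsub>S\<^esub> r"
      unfolding eq using remI u(1) cS by simp
    define s where "s = \<beta> h j"
    have s: "s m = (if m \<in> monomials k then r (m + replicate_mset j k) else \<zero>)" for m by (simp add: s_def \<beta>_def r_def)
    have sc: "s m \<in> carrier R" for m using cr by (simp add: s)
    have "\<beta> (subst (\<ominus> \<one>) c \<otimes>\<^bsub>S\<^esub> h) j m = series_mult R c s m" for m
    proof (cases "m \<in> monomials k")
      case True
      \<comment> \<open>A divisor of m x_k^j that does not divide m involves x_k, where c vanishes;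
        only the divisors of m contribute.\<close>
      have "series_mult R c r (m + replicate_mset j k) = series_mult R c s m"
        unfolding series_mult_def
      proof (rule add.finprod_mono_neutral_cong_right[OF finite_submultisets])
        show "{a. a \<subseteq># m} \<subseteq> {a. a \<subseteq># m + replicate_mset j k}" by (auto intro: subset_mset.trans)
        fix a assume "a \<in> {a. a \<subseteq># m + replicate_mset j k} - {a. a \<subseteq># m}"
        then have a: "a \<subseteq># m + replicate_mset j k" "\<not> a \<subseteq># m" by auto
        then obtain i where i: "count a i > count m i" by (auto simp: subseteq_mset_def not_le)
        moreover have "count a i \<le> count m i + (if i = k then j else 0)"
          using a(1)[unfolded subseteq_mset_def, rule_format, of i] by simp
        ultimately have "i = k" by (cases "i = k") auto
        then have "c a = \<zero>" using c0[of a] i by (metis not_less_zero)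
        then show "c a \<otimes> r (m + replicate_mset j k - a) = \<zero>" using cr by simp
      next
        fix a assume "a \<in> {a. a \<subseteq># m}"
        then have a: "a \<subseteq># m" by simp
        then have "m - a \<in> monomials k" by (intro monomials_submset[OF True]) simp
        moreover have "m + replicate_mset j k - a = m - a + replicate_mset j k"
          using a by simp
        ultimately show "c a \<otimes> r (m + replicate_mset j k - a) = c a \<otimes> s (m - a)" by (simp add: s)
      qed (use cr in auto)
      then show ?thesis using True rem by (simp add: \<beta>_def series_times)
    next
      case False
      have "series_mult R c s m = \<zero>"
      proof (rule ccontr)
        assume nz: "series_mult R c s m \<noteq> \<zero>"
        obtain x y where "m = x + y" "c x \<noteq> \<zero>" "s y \<noteq> \<zero>" using series_mult_nonzero[OF nz cr(1) sc] by auto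
        then show False using False series_monomials[OF c[unfolded B_def]] by (auto simp: s split: if_splits)
      qed
      then show ?thesis using False by (simp add: \<beta>_def)
    qed
    then show "\<beta> (subst (\<ominus> \<one>) c \<otimes>\<^bsub>S\<^esub> h) j = c \<otimes>\<^bsub>B\<^esub> \<beta> h j"
      by (auto simp: B_def series_times s_def)
  next
    fix h assume h: "h \<in> carrier S"
    obtain u where u: "u \<in> carrier S" "subst \<one> h = u \<otimes>\<^bsub>S\<^esub> g \<oplus>\<^bsub>S\<^esub> rem (subst \<one> h)" "rem (subst \<one> h) \<in> low"
      using div[OF h] by blast
    define r where "r = rem (subst \<one> h)"
    have rc: "r \<in> carrier S" using lowc u by (auto simp: r_def)
    have "(\<forall>j<D. \<beta> h j = \<zero>\<^bsub>B\<^esub>) \<longleftrightarrow> r = \<zero>\<^bsub>S\<^esub>"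
    proof
      assume z: "\<forall>j<D. \<beta> h j = \<zero>\<^bsub>B\<^esub>"
      have "r m = \<zero>" for m
      proof (rule ccontr)
        assume nz: "r m \<noteq> \<zero>"
        define j where "j = count m k"
        have j: "j < D" using u(3) nz by (auto simp: low_def r_def j_def)
        have m: "m \<in> monomials N" using series_monomials[OF rc nz] .
        \<comment> \<open>Removing x_k, whose exponent in m is exactly j, leaves a monomial of
          \<open>B\<close>; thus every nonzero coefficient of r is seen by one of the
          coordinates.\<close>
        have "m - replicate_mset j k \<in> monomials k"
        proof -
          have "i < k" if "i \<in># m - replicate_mset j k" for i
          proof -
            have "count (m - replicate_mset j k) k = 0" by (simp add: j_def)
            then have "i \<noteq> k" using that by (metis not_in_iff)
            moreover have "i \<in># m" using that by (rule in_diffD)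
            ultimately show ?thesis using m by (auto simp: monomials_def less_Suc_eq)
          qed
          then show ?thesis by (auto simp: monomials_def)
        qed
        moreover have "m - replicate_mset j k + replicate_mset j k = m"
          unfolding j_def by (rule subset_mset.diff_add) (auto simp: subseteq_mset_def)
        ultimately have "\<beta> h j (m - replicate_mset j k) = r m" by (simp add: \<beta>_def r_def)
        then show False using z j nz by (simp add: B_def series_zero)
      qed
      then show "r = \<zero>\<^bsub>S\<^esub>" by (auto simp: series_zero)
    next
      assume "r = \<zero>\<^bsub>S\<^esub>"
      then show "\<forall>j<D. \<beta> h j = \<zero>\<^bsub>B\<^esub>" unfolding r_def by (auto simp: \<beta>_def series_zero B_def)
    qed
    also have "\<dots> \<longleftrightarrow> h \<in> PIdl\<^bsub>S\<^esub> f"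
    proof
      assume "r = \<zero>\<^bsub>S\<^esub>"
      then have "subst \<one> h = u \<otimes>\<^bsub>S\<^esub> g" using u(1,2) g_closed unfolding r_def by simp
      then have "subst (\<ominus> \<one>) (subst \<one> h) = subst (\<ominus> \<one>) (u \<otimes>\<^bsub>S\<^esub> subst \<one> f)" using gf by simp
      then have "h = subst (\<ominus> \<one>) u \<otimes>\<^bsub>S\<^esub> f" using h u(1) f by (simp add: \<tau>\<sigma>)
      then show "h \<in> PIdl\<^bsub>S\<^esub> f" using u(1) \<tau>.hom_closed[OF u(1)] unfolding cgenideal_def by blast
    next
      assume "h \<in> PIdl\<^bsub>S\<^esub> f"
      then obtain x where x: "x \<in> carrier S" "h = x \<otimes>\<^bsub>S\<^esub> f" unfolding cgenideal_def by blast
      have "subst \<one> h = subst \<one> x \<otimes>\<^bsub>S\<^esub> g \<oplus>\<^bsub>S\<^esub> \<zero>\<^bsub>S\<^esub>" using x f g_closed unfolding gf by simp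
      moreover have "\<zero>\<^bsub>S\<^esub> \<in> low" unfolding low_def using S.zero_closed by (simp add: series_zero)
      ultimately show "r = \<zero>\<^bsub>S\<^esub>" using remI[of "\<zero>\<^bsub>S\<^esub>" "subst \<one> x"] x(1) unfolding r_def by simp
    qed
    finally show "(\<forall>j<D. \<beta> h j = \<zero>\<^bsub>B\<^esub>) \<longleftrightarrow> h \<in> PIdl\<^bsub>S\<^esub> f" .
  next
    fix c assume c: "\<forall>j<D. c j \<in> carrier B"
    \<comment> \<open>The remainder with the prescribed coordinates, that is the sum of c_j x_k^j
      for j < D; the exponent of x_k in m selects j.\<close>
    define r where "r m = (if count m k < D then c (count m k) (m - replicate_mset (count m k) k) else \<zero>)" for m
    have nz: "\<exists>j<D. \<exists>x. c j x \<noteq> \<zero> \<and> m = x + replicate_mset j k" if "r m \<noteq> \<zero>" for m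
    proof -
      have "count m k < D" "c (count m k) (m - replicate_mset (count m k) k) \<noteq> \<zero>"
        using that by (auto simp: r_def split: if_splits)
      moreover have "m = m - replicate_mset (count m k) k + replicate_mset (count m k) k"
        by (rule subset_mset.diff_add[symmetric]) (auto simp: subseteq_mset_def)
      ultimately show ?thesis by blast
    qed
    have rS: "r \<in> carrier S" unfolding series_carrier_iff
    proof (intro conjI allI impI)
      show "r m \<in> carrier R" for m using c by (auto simp: r_def B_def)
      show "m \<in> monomials N" if "r m \<noteq> \<zero>" for m
      proof -
        obtain j x where jx: "j < D" "c j x \<noteq> \<zero>" "m = x + replicate_mset j k" using nz[OF \<open>r m \<noteq> \<zero>\<close>] by blast
        then have "c j \<in> carrier S" using c BS by blast
        then show ?thesis using series_monomials[of "c j" b N x] jx(2,3) by simp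
      qed
      assume b
      have "{m. r m \<noteq> \<zero>} \<subseteq> (\<Union>j<D. (\<lambda>x. x + replicate_mset j k) ` {x. c j x \<noteq> \<zero>})"
      proof
        fix m assume "m \<in> {m. r m \<noteq> \<zero>}"
        then obtain j x where "j < D" "c j x \<noteq> \<zero>" "m = x + replicate_mset j k" using nz by blast
        then show "m \<in> (\<Union>j<D. (\<lambda>x. x + replicate_mset j k) ` {x. c j x \<noteq> \<zero>})" by blast
      qed
      then show "finite {m. r m \<noteq> \<zero>}"
        by (rule finite_subset) (use c \<open>b\<close> in \<open>auto simp: B_def series_carrier_iff\<close>)
    qed
    have rl: "r \<in> low" unfolding low_def using rS by (auto simp: r_def split: if_splits)
    have "subst \<one> (subst (\<ominus> \<one>) r) = \<zero>\<^bsub>S\<^esub> \<otimes>\<^bsub>S\<^esub> g \<oplus>\<^bsub>S\<^esub> r" using rS g_closed by (simp add: \<sigma>\<tau>)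
    then have rem: "rem (subst \<one> (subst (\<ominus> \<one>) r)) = r" using remI[OF rl S.zero_closed] by simp
    have "\<beta> (subst (\<ominus> \<one>) r) j = c j" if j: "j < D" for j
    proof
      fix m
      show "\<beta> (subst (\<ominus> \<one>) r) j m = c j m"
      proof (cases "m \<in> monomials k")
        case True
        then have "count m k = 0" by (auto simp: monomials_def count_eq_zero_iff)
        then show ?thesis using True rem j by (simp add: \<beta>_def r_def)
      next
        case False
        then have "c j m = \<zero>" using series_monomials[of "c j" b k m] c j unfolding B_def by auto
        then show ?thesis using False by (simp add: \<beta>_def)
      qed
    qed
    then show "\<exists>h\<in>carrier S. \<forall>j<D. \<beta> h j = c j" using \<tau>.hom_closed[OF rS] by blast
  qed
qed

section \<open>Cohen-Macaulayness of the polynomial and power series rings\<close>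

text \<open>Weights that single out one monomial: the last variable has weight \<open>1\<close>, and each earlier
  variable outweighs the later exponents (the lexicographic order, realised by weights).\<close>

lemma extremal_weights:
  assumes "A \<subseteq> monomials n" "A \<noteq> {}" "b \<Longrightarrow> finite A"
  shows "\<exists>d a. (\<forall>i. d i \<ge> (1::nat)) \<and> d (n - 1) = 1 \<and> a \<in> A \<and>
    (\<forall>m\<in>A. m \<noteq> a \<longrightarrow> (if b then (\<Sum>i\<in>#m. d i) < (\<Sum>i\<in>#a. d i) else (\<Sum>i\<in>#a. d i) < (\<Sum>i\<in>#m. d i)))"
  using assms
proof (induction n arbitrary: A)
  case 0
  then have "A = {{#}}" by (auto simp: monomials_def)
  then show ?case by (intro exI[of _ "\<lambda>_. 1"] exI[of _ "{#}"]) auto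
next
  case (Suc n)
  define pr where "pr m = filter_mset (\<lambda>i. i \<noteq> n) m" for m
  have eq: "m = pr m + replicate_mset (count m n) n" for m
    by (rule multiset_eqI) (simp add: pr_def)
  have "pr m \<in> monomials n" if "m \<in> A" for m
    using subsetD[OF Suc.prems(1) that] by (auto simp: pr_def monomials_def less_Suc_eq)
  then have "pr ` A \<subseteq> monomials n" by blast
  moreover have "pr ` A \<noteq> {}" "b \<Longrightarrow> finite (pr ` A)" using Suc.prems by auto
  ultimately obtain d' a' where d': "\<forall>i. d' i \<ge> (1::nat)" and a': "a' \<in> pr ` A"
    and ext: "\<And>m. m \<in> pr ` A \<Longrightarrow> m \<noteq> a' \<Longrightarrow>
      (if b then (\<Sum>i\<in>#m. d' i) < (\<Sum>i\<in>#a'. d' i) else (\<Sum>i\<in>#a'. d' i) < (\<Sum>i\<in>#m. d' i))"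
    using Suc.IH[of "pr ` A"] by metis
  define C where "C = {m \<in> A. pr m = a'}"
  have C: "C \<noteq> {}" using a' by (auto simp: C_def)
  \<comment> \<open>Ties in the earlier variables are broken by the last exponent: the largest one
    for finite support, and otherwise the smallest one, which exists for infinite support
    too.\<close>
  have "\<exists>a\<in>C. \<forall>m\<in>C. if b then count m n \<le> count a n else count a n \<le> count m n"
  proof (cases b)
    case True
    then have fin: "finite ((\<lambda>m. count m n) ` C)" using Suc.prems(3) by (simp add: C_def)
    have "Max ((\<lambda>m. count m n) ` C) \<in> (\<lambda>m. count m n) ` C" using fin C by (intro Max_in) auto
    then obtain a where "a \<in> C" "Max ((\<lambda>m. count m n) ` C) = count a n" by auto
    then show ?thesis using Max_ge[OF fin] True by (intro bexI[of _ a]) auto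
  next
    case False
    obtain a where "a \<in> C" "\<forall>m. m \<in> C \<longrightarrow> count a n \<le> count m n"
      using ex_has_least_nat[of "\<lambda>m. m \<in> C" _ "\<lambda>m. count m n"] C by blast
    then show ?thesis using False by auto
  qed
  then obtain a where a: "a \<in> C" "\<And>m. m \<in> C \<Longrightarrow> if b then count m n \<le> count a n else count a n \<le> count m n"
    by blast
  \<comment> \<open>The scale \<open>w\<close> exceeds every last exponent that could upset the
    comparison: all of them when the weight is maximized, and only that of a when it is minimized,
    since a large last exponent of another monomial then helps.\<close>
  define w where "w = Suc (if b then Max ((\<lambda>m. count m n) ` A) else count a n)"
  have w: "count m n < w" if "m \<in> A" "b" for m
    using that Suc.prems(3) unfolding w_def by (auto intro!: Max_ge simp: less_Suc_eq_le)
  define d where "d i = (if i = n then 1 else w * d' i)" for i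
  have W: "(\<Sum>i\<in>#m. d i) = w * (\<Sum>i\<in>#pr m. d' i) + count m n" for m
    by (induction m) (auto simp: pr_def d_def algebra_simps)
  have "if b then (\<Sum>i\<in>#m. d i) < (\<Sum>i\<in>#a. d i) else (\<Sum>i\<in>#a. d i) < (\<Sum>i\<in>#m. d i)" if m: "m \<in> A" "m \<noteq> a" for m
  proof (cases "pr m = a'")
    case True
    have "pr a = a'" using a(1) by (simp add: C_def)
    then have "count m n \<noteq> count a n" using m(2) True eq[of m] eq[of a] by metis
    then show ?thesis using a(2)[of m] m(1) True \<open>pr a = a'\<close> unfolding W by (auto simp: C_def)
  next
    case False
    have aa: "pr a = a'" "a \<in> A" using a(1) by (auto simp: C_def)
    have e: "if b then (\<Sum>i\<in>#pr m. d' i) < (\<Sum>i\<in>#a'. d' i) else (\<Sum>i\<in>#a'. d' i) < (\<Sum>i\<in>#pr m. d' i)"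
      using ext[of "pr m"] m False by auto
    show ?thesis
    proof (cases b)
      case True
      then have "w * Suc (\<Sum>i\<in>#pr m. d' i) \<le> w * (\<Sum>i\<in>#a'. d' i)" using e by (intro mult_le_mono2) simp
      then show ?thesis using True w[OF m(1) True] unfolding W aa by simp
    next
      case nb: False
      then have "w * Suc (\<Sum>i\<in>#a'. d' i) \<le> w * (\<Sum>i\<in>#pr m. d' i)" using e by (intro mult_le_mono2) simp
      moreover have "count a n < w" using nb by (simp add: w_def)
      ultimately show ?thesis using nb unfolding W aa by simp
    qed
  qed
  moreover have "\<forall>i. d i \<ge> 1"
  proof
    fix i
    have "1 \<le> d' i" "1 \<le> w" using d' by (auto simp: w_def)
    then have "1 * 1 \<le> w * d' i" by (intro mult_le_mono)
    then show "d i \<ge> 1" by (simp add: d_def)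
  qed
  moreover have "d (Suc n - 1) = 1" "a \<in> A" using a(1) by (auto simp: d_def C_def)
  ultimately show ?case by blast
qed

context field
begin

text \<open>\<open>D\<close> is the weight of the monomial a singled out by
  \<open>extremal_weights\<close>. No other monomial of \<open>f\<close> has this weight, so after
  the substitution x_k^D has the coefficient f a, which is a unit in a field. Homogeneity keeps all
  other weights on the required side of \<open>D\<close>.\<close>

lemma weierstrass_coordinates:
  assumes f: "f \<in> carrier (series_ring R b (Suc k))" and nz: "f \<noteq> \<zero>\<^bsub>series_ring R b (Suc k)\<^esub>"
  shows "\<exists>d D. weierstrass_series R k d b D (weighted_series.subst R k d \<one> f)"
proof -
  define A where "A = {m. f m \<noteq> \<zero>}"
  have "A \<subseteq> monomials (Suc k)" "A \<noteq> {}" "b \<Longrightarrow> finite A"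
    using f nz by (auto simp: A_def series_carrier_iff)
  from extremal_weights[where b = b, OF this] obtain d a where d: "\<forall>i. d i \<ge> (1::nat)" "d k = 1" and a: "a \<in> A"
    and ext: "\<And>m. m \<in> A \<Longrightarrow> m \<noteq> a \<Longrightarrow>
      (if b then (\<Sum>i\<in>#m. d i) < (\<Sum>i\<in>#a. d i) else (\<Sum>i\<in>#a. d i) < (\<Sum>i\<in>#m. d i))"
    by auto
  interpret W: weighted_series R k d
    by unfold_locales (use d in auto)
  have ext': "if b then W.wt m \<le> W.wt a else W.wt a \<le> W.wt m" "W.wt m = W.wt a \<Longrightarrow> m = a" if "m \<in> A" for m
    using ext[OF that] unfolding W.wt_def by (cases "m = a"; auto split: if_splits)+
  have fc: "f m \<in> carrier R" for m using f by simp
  have am: "a \<in> monomials (Suc k)" using series_monomials[OF f] a by (simp add: A_def)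
  have "weierstrass_series R k d b (W.wt a) (W.subst \<one> f)"
  proof
    show "W.subst \<one> f \<in> carrier (series_ring R b (Suc k))" by (rule W.subst_closed[OF f one_closed])
    have "W.subst \<one> f (replicate_mset (W.wt a) k) = f a \<otimes> W.lpow \<one> a (replicate_mset (W.wt a) k)"
      unfolding W.subst_def
    proof (rule finsum_single)
      fix c assume "c \<in> W.wset (W.wt (replicate_mset (W.wt a) k))" "c \<noteq> a"
      then have "W.wt c = W.wt a" using d(2) by (simp add: W.wset_def)
      then have "f c = \<zero>" using ext'(2)[of c] \<open>c \<noteq> a\<close> by (auto simp: A_def)
      then show "f c \<otimes> W.lpow \<one> c (replicate_mset (W.wt a) k) = \<zero>" by simp
    qed (use am fc d(2) in \<open>auto simp: W.wset_def\<close>)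
    also have "\<dots> = f a" using W.lpow_last[OF am] fc by simp
    finally show "W.subst \<one> f (replicate_mset (W.wt a) k) \<in> Units R"
      using a fc field_Units by (simp add: A_def)
    fix m assume "W.subst \<one> f m \<noteq> \<zero>"
    then obtain c where "f c \<noteq> \<zero>" "W.wt c = W.wt m" using W.subst_nonzero[of \<one> f m, OF _ fc one_closed] by blast
    then show "if b then W.wt m \<le> W.wt a else W.wt a \<le> W.wt m" using ext'(1)[of c] by (cases b) (simp_all add: A_def)
  qed
  then show ?thesis by blast
qed

lemma series_finite_free:
  assumes f: "f \<in> carrier (series_ring R b (Suc k))" and nz: "f \<noteq> \<zero>\<^bsub>series_ring R b (Suc k)\<^esub>"
  shows "\<exists>\<phi> \<beta> D. finite_free_mod (series_ring R b k) (series_ring R b (Suc k)) \<phi> \<beta> D f"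
proof -
  obtain d D where "weierstrass_series R k d b D (weighted_series.subst R k d \<one> f)"
    using weierstrass_coordinates[OF assms] by blast
  from weierstrass_series.finite_free[OF this f refl] show ?thesis by blast
qed

text \<open>A coordinate change makes the nonzero factor regular in the last variable, and
  uniqueness of division then cancels it. The passage to \<open>Suc n\<close> variables provides a
  last variable even for n = 0.\<close>

lemma series_domain: "domain (series_ring R b n)"
proof -
  interpret S: cring "series_ring R b n" by (rule series_ring_cring)
  have one: "\<one>\<^bsub>series_ring R b n\<^esub> \<noteq> \<zero>\<^bsub>series_ring R b n\<^esub>"
  proof
    assume "\<one>\<^bsub>series_ring R b n\<^esub> = \<zero>\<^bsub>series_ring R b n\<^esub>"
    then have "\<one>\<^bsub>series_ring R b n\<^esub> {#} = \<zero>\<^bsub>series_ring R b n\<^esub> {#}" by (rule fun_cong)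
    then show False by simp
  qed
  have sub: "carrier (series_ring R b n) \<subseteq> carrier (series_ring R b (Suc n))" by (rule series_ring_subset)
  show ?thesis
  proof (unfold_locales)
    fix f x assume fx: "f \<otimes>\<^bsub>series_ring R b n\<^esub> x = \<zero>\<^bsub>series_ring R b n\<^esub>"
      and f: "f \<in> carrier (series_ring R b n)" and x: "x \<in> carrier (series_ring R b n)"
    show "f = \<zero>\<^bsub>series_ring R b n\<^esub> \<or> x = \<zero>\<^bsub>series_ring R b n\<^esub>"
    proof (rule disjCI)
      assume x0: "x \<noteq> \<zero>\<^bsub>series_ring R b n\<^esub>"
      have f': "f \<in> carrier (series_ring R b (Suc n))" and x': "x \<in> carrier (series_ring R b (Suc n))"
        using f x sub by auto
      obtain d D where "weierstrass_series R n d b D (weighted_series.subst R n d \<one> x)"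
        using weierstrass_coordinates[OF x'] x0 by auto
      then interpret W: weierstrass_series R n d b D "weighted_series.subst R n d \<one> x" .
      note hom = W.subst_ring_hom[OF one_closed, of b]
      interpret \<sigma>: ring_hom_cring W.S W.S "W.subst \<one>"
        by (rule ring_hom_cringI'[OF W.S.is_cring W.S.is_cring hom])
      have "f \<otimes>\<^bsub>W.S\<^esub> x = \<zero>\<^bsub>W.S\<^esub>" using fx by simp
      then have "W.subst \<one> f \<otimes>\<^bsub>W.S\<^esub> W.subst \<one> x = \<zero>\<^bsub>W.S\<^esub>"
        using \<sigma>.hom_mult[OF f' x'] \<sigma>.hom_zero by (simp del: series_ring_ops)
      then have "W.subst \<one> f = \<zero>\<^bsub>W.S\<^esub>" by (rule W.nonzerodivisor[OF \<sigma>.hom_closed[OF f']])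
      then have "f = W.subst (\<ominus> \<one>) \<zero>\<^bsub>W.S\<^esub>" using W.subst_inverse[OF f' one_closed] by simp
      also have "\<dots> = \<zero>\<^bsub>W.S\<^esub>"
        using ring_hom_zero[OF W.subst_ring_hom[of "\<ominus> \<one>" b] W.S.ring_axioms W.S.ring_axioms] by simp
      finally show "f = \<zero>\<^bsub>series_ring R b n\<^esub>" by simp
    qed
  qed (rule one)
qed

lemma series_field_0: "field (series_ring R b 0)"
proof -
  interpret D: domain "series_ring R b 0" by (rule series_domain)
  show ?thesis
  proof (rule D.cring_fieldI2)
    show "\<zero>\<^bsub>series_ring R b 0\<^esub> \<noteq> \<one>\<^bsub>series_ring R b 0\<^esub>" by (rule D.zero_not_one)
    fix f assume f: "f \<in> carrier (series_ring R b 0)" "f \<noteq> \<zero>\<^bsub>series_ring R b 0\<^esub>"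
    have e: "m = {#}" if "f m \<noteq> \<zero>" for m using series_monomials[OF f(1) that] by (simp add: monomials_def)
    define c where "c = f {#}"
    have fc: "f = series_monom R c {#}"
    proof
      show "f m = series_monom R c {#} m" for m using e[of m] by (cases "m = {#}") (auto simp: c_def series_monom_def)
    qed
    have c: "c \<in> carrier R" "c \<noteq> \<zero>"
    proof -
      show "c \<in> carrier R" using f(1) by (simp add: c_def)
      obtain m where "f m \<noteq> \<zero>" using f(2) by auto
      then show "c \<noteq> \<zero>" using e[of m] by (simp add: c_def)
    qed
    then have ci: "inv c \<in> carrier R" "c \<otimes> inv c = \<one>" using field_Units by auto
    show "\<exists>x\<in>carrier (series_ring R b 0). f \<otimes>\<^bsub>series_ring R b 0\<^esub> x = \<one>\<^bsub>series_ring R b 0\<^esub>"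
    proof (rule bexI)
      show "series_monom R (inv c) {#} \<in> carrier (series_ring R b 0)" using ci by simp
      show "f \<otimes>\<^bsub>series_ring R b 0\<^esub> series_monom R (inv c) {#} = \<one>\<^bsub>series_ring R b 0\<^esub>"
        unfolding fc using c ci by (simp add: series_monom_mult_monom) (auto simp: series_monom_def)
    qed
  qed
qed

text \<open>In the step, every nonzero f has its own Weierstrass coordinates, and the last variable
  is the nonzero nonunit that \<open>cm_ring_Suc\<close> asks for.\<close>

theorem series_cm_ring: "cm_ring (series_ring R b n) n"
proof (induction n)
  case 0
  show ?case by (rule cm_ring_field[OF series_field_0])
next
  case (Suc k)
  define t where "t = series_monom R \<one> {#k#}"
  have t: "t \<in> carrier (series_ring R b (Suc k))" by (simp add: t_def)
  show ?case
  proof (rule cm_ring_Suc[OF series_domain t _ _ Suc])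
    show "t \<noteq> \<zero>\<^bsub>series_ring R b (Suc k)\<^esub>"
    proof
      assume "t = \<zero>\<^bsub>series_ring R b (Suc k)\<^esub>"
      then have "t {#k#} = \<zero>\<^bsub>series_ring R b (Suc k)\<^esub> {#k#}" by (rule fun_cong)
      then show False by (simp add: t_def series_monom_def)
    qed
    show "t \<notin> Units (series_ring R b (Suc k))"
    proof
      assume "t \<in> Units (series_ring R b (Suc k))"
      then obtain x where x: "x \<in> carrier (series_ring R b (Suc k))"
        "t \<otimes>\<^bsub>series_ring R b (Suc k)\<^esub> x = \<one>\<^bsub>series_ring R b (Suc k)\<^esub>" unfolding Units_def by blast
      from fun_cong[OF x(2), of "{#}"] have "series_mult R t x {#} = \<one>" by simp
      then show False using x(1) by (simp add: t_def series_monom_mult)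
    qed
    show "\<exists>\<phi> \<beta> D. finite_free_mod (series_ring R b k) (series_ring R b (Suc k)) \<phi> \<beta> D f"
      if "f \<in> carrier (series_ring R b (Suc k))" "f \<noteq> \<zero>\<^bsub>series_ring R b (Suc k)\<^esub>" for f
      by (rule series_finite_free[OF that])
  qed
qed

text \<open>With no variables every nonzero element is a unit, so n is positive here and n - 1 is a
  genuine difference.\<close>

theorem series_quotient_cm_ring:
  assumes f: "f \<in> carrier (series_ring R b n)" "f \<noteq> \<zero>\<^bsub>series_ring R b n\<^esub>" "f \<notin> Units (series_ring R b n)"
  shows "cm_ring (series_ring R b n Quot PIdl\<^bsub>series_ring R b n\<^esub> f) (n - 1)"
proof (cases n)
  case 0
  then have "f \<in> Units (series_ring R b n)" using field.field_Units[OF series_field_0, of b] f(1,2) by simp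
  then show ?thesis using f(3) by simp
next
  case (Suc k)
  then obtain \<phi> \<beta> D where "finite_free_mod (series_ring R b k) (series_ring R b n) \<phi> \<beta> D f"
    using series_finite_free[of f b k] f by blast
  then interpret F: finite_free_mod "series_ring R b k" "series_ring R b n" \<phi> \<beta> D f .
  show ?thesis using F.cm_ring_quotient[OF series_cm_ring] Suc by simp
qed

end

section \<open>Maximal Cohen-Macaulay modules by localization\<close>

context module
begin

lemma submodule_finsum:
  assumes N: "submodule N R M" and "finite G" "G \<subseteq> N" "c \<in> G \<rightarrow> carrier R"
  shows "(\<Oplus>\<^bsub>M\<^esub>g\<in>G. c g \<odot>\<^bsub>M\<^esub> g) \<in> N"
  using assms(2-)
proof (induction G rule: finite_induct)
  case empty
  then show ?case using submodule_zero[OF N] by simp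
next
  case (insert x G)
  note N' = submoduleE[OF N]
  have "(\<Oplus>\<^bsub>M\<^esub>g\<in>insert x G. c g \<odot>\<^bsub>M\<^esub> g) = c x \<odot>\<^bsub>M\<^esub> x \<oplus>\<^bsub>M\<^esub> (\<Oplus>\<^bsub>M\<^esub>g\<in>G. c g \<odot>\<^bsub>M\<^esub> g)"
    using insert N'(1) by (intro M.finsum_insert) (auto simp: Pi_iff)
  also have "\<dots> \<in> N" using insert N'(4,5) by auto
  finally show ?case .
qed

lemma combinations_submodule:
  assumes G: "finite G" "G \<subseteq> carrier M"
  defines "Sp \<equiv> {(\<Oplus>\<^bsub>M\<^esub>g\<in>G. c g \<odot>\<^bsub>M\<^esub> g) | c. c \<in> G \<rightarrow> carrier R}"
  shows "submodule Sp R M" "G \<subseteq> Sp"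
proof -
  have smult: "a \<odot>\<^bsub>M\<^esub> x \<in> Sp" if a: "a \<in> carrier R" and "x \<in> Sp" for a x
  proof -
    obtain c where c: "c \<in> G \<rightarrow> carrier R" "x = (\<Oplus>\<^bsub>M\<^esub>g\<in>G. c g \<odot>\<^bsub>M\<^esub> g)" using \<open>x \<in> Sp\<close> unfolding Sp_def by blast
    have "a \<odot>\<^bsub>M\<^esub> x = (\<Oplus>\<^bsub>M\<^esub>g\<in>G. a \<odot>\<^bsub>M\<^esub> (c g \<odot>\<^bsub>M\<^esub> g))"
      unfolding c(2) by (rule finsum_smult_ldistr) (use G a c in auto)
    also have "\<dots> = (\<Oplus>\<^bsub>M\<^esub>g\<in>G. (a \<otimes> c g) \<odot>\<^bsub>M\<^esub> g)"
    proof (rule M.finsum_cong')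
      fix g assume g: "g \<in> G"
      then have "g \<in> carrier M" "c g \<in> carrier R" using G c by auto
      then show "a \<odot>\<^bsub>M\<^esub> (c g \<odot>\<^bsub>M\<^esub> g) = (a \<otimes> c g) \<odot>\<^bsub>M\<^esub> g" using a by (simp add: smult_assoc1)
    qed (use G a c in auto)
    finally show ?thesis unfolding Sp_def using a c by (auto intro!: exI[of _ "\<lambda>g. a \<otimes> c g"])
  qed
  have sub: "Sp \<subseteq> carrier M" unfolding Sp_def using G by (auto intro!: M.finsum_closed)
  show "submodule Sp R M"
  proof (rule submoduleI)
    have "(\<Oplus>\<^bsub>M\<^esub>g\<in>G. \<zero> \<odot>\<^bsub>M\<^esub> g) = \<zero>\<^bsub>M\<^esub>" using G by (intro M.finsum_all_zero) auto
    then show "\<zero>\<^bsub>M\<^esub> \<in> Sp" unfolding Sp_def by (force intro!: exI[of _ "\<lambda>g. \<zero>"])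
    show "\<ominus>\<^bsub>M\<^esub> x \<in> Sp" if "x \<in> Sp" for x
      using smult[of "\<ominus> \<one>" x] that sub by (auto simp: smult_l_minus)
    fix x y assume "x \<in> Sp" "y \<in> Sp"
    then obtain c d where c: "c \<in> G \<rightarrow> carrier R" "x = (\<Oplus>\<^bsub>M\<^esub>g\<in>G. c g \<odot>\<^bsub>M\<^esub> g)"
      and d: "d \<in> G \<rightarrow> carrier R" "y = (\<Oplus>\<^bsub>M\<^esub>g\<in>G. d g \<odot>\<^bsub>M\<^esub> g)" unfolding Sp_def by blast
    have "x \<oplus>\<^bsub>M\<^esub> y = (\<Oplus>\<^bsub>M\<^esub>g\<in>G. c g \<odot>\<^bsub>M\<^esub> g \<oplus>\<^bsub>M\<^esub> d g \<odot>\<^bsub>M\<^esub> g)"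
      unfolding c(2) d(2) by (rule M.finsum_addf[symmetric]) (use G c d in auto)
    also have "\<dots> = (\<Oplus>\<^bsub>M\<^esub>g\<in>G. (c g \<oplus> d g) \<odot>\<^bsub>M\<^esub> g)"
    proof (rule M.finsum_cong')
      fix g assume g: "g \<in> G"
      then have "g \<in> carrier M" "c g \<in> carrier R" "d g \<in> carrier R" using G c d by auto
      then show "c g \<odot>\<^bsub>M\<^esub> g \<oplus>\<^bsub>M\<^esub> d g \<odot>\<^bsub>M\<^esub> g = (c g \<oplus> d g) \<odot>\<^bsub>M\<^esub> g" by (simp add: smult_l_distr)
    qed (use G c d in \<open>auto intro!: smult_closed\<close>)
    finally show "x \<oplus>\<^bsub>M\<^esub> y \<in> Sp" unfolding Sp_def using c d by (auto intro!: exI[of _ "\<lambda>g. c g \<oplus> d g"])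
  qed (use sub smult in auto)
  show "G \<subseteq> Sp"
  proof
    fix x assume x: "x \<in> G"
    let ?c = "\<lambda>g. if g = x then \<one> else \<zero>"
    have "(\<Oplus>\<^bsub>M\<^esub>g\<in>G. ?c g \<odot>\<^bsub>M\<^esub> g) = ?c x \<odot>\<^bsub>M\<^esub> x"
      by (rule M.finsum_single) (use G x in auto)
    then have "x = (\<Oplus>\<^bsub>M\<^esub>g\<in>G. ?c g \<odot>\<^bsub>M\<^esub> g)" using G x by auto
    moreover have "?c \<in> G \<rightarrow> carrier R" by simp
    ultimately show "x \<in> Sp" unfolding Sp_def by (intro CollectI exI[of _ ?c] conjI)
  qed
qed

text \<open>Finite generation becomes a test on submodules, which can be pulled back along maps, so
  linear combinations need not be transported.\<close>

lemma finitely_generated_iff: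
  "finitely_generated_module R M \<longleftrightarrow>
    (\<exists>G. finite G \<and> G \<subseteq> carrier M \<and> (\<forall>N. submodule N R M \<longrightarrow> G \<subseteq> N \<longrightarrow> carrier M \<subseteq> N))"
proof
  assume "finitely_generated_module R M"
  then obtain G where G: "finite G" "G \<subseteq> carrier M"
    "\<forall>x\<in>carrier M. \<exists>c\<in>G \<rightarrow> carrier R. x = (\<Oplus>\<^bsub>M\<^esub>g\<in>G. c g \<odot>\<^bsub>M\<^esub> g)"
    unfolding finitely_generated_module_def by blast
  have "carrier M \<subseteq> N" if N: "submodule N R M" "G \<subseteq> N" for N
    using G(3) submodule_finsum[OF N(1) G(1) N(2)] by auto
  then show "\<exists>G. finite G \<and> G \<subseteq> carrier M \<and> (\<forall>N. submodule N R M \<longrightarrow> G \<subseteq> N \<longrightarrow> carrier M \<subseteq> N)"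
    using G by blast
next
  assume "\<exists>G. finite G \<and> G \<subseteq> carrier M \<and> (\<forall>N. submodule N R M \<longrightarrow> G \<subseteq> N \<longrightarrow> carrier M \<subseteq> N)"
  then obtain G where G: "finite G" "G \<subseteq> carrier M"
    and gen: "\<And>N. submodule N R M \<Longrightarrow> G \<subseteq> N \<Longrightarrow> carrier M \<subseteq> N" by blast
  have "carrier M \<subseteq> {(\<Oplus>\<^bsub>M\<^esub>g\<in>G. c g \<odot>\<^bsub>M\<^esub> g) | c. c \<in> G \<rightarrow> carrier R}"
    by (rule gen[OF combinations_submodule[OF G]])
  then show "finitely_generated_module R M" unfolding finitely_generated_module_def using G by blast
qed

end

text \<open>\<open>A\<close> and \<open>M\<close> behave like the localizations of \<open>R\<close> and of \<open>R\<close> with scalars acting through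
  \<open>q\<close>-th powers, at the maximal ideal \<open>I\<close>; this includes the case of a local ring \<open>R = A\<close>.\<close>

locale localized_powers = R: cring R + A: cring A + M: module A M
  for R :: "('r, 'x) ring_scheme" and A :: "('a, 'y) ring_scheme" and M :: "('a, 'b, 'z) module_scheme" +
  fixes I :: "'r set" and q :: nat and \<iota> :: "'r \<Rightarrow> 'a" and j :: "'r \<Rightarrow> 'b" and d :: nat
  assumes I: "maximalideal I R" and q: "q \<ge> 1" and cm: "cm_ring R d"
    and hom: "\<iota> \<in> ring_hom R A"
    and unit: "\<And>s. s \<in> carrier R - I \<Longrightarrow> \<iota> s \<in> Units A"
    and frac: "\<And>x. x \<in> carrier A \<Longrightarrow> \<exists>a\<in>carrier R. \<exists>s\<in>carrier R - I. \<iota> s \<otimes>\<^bsub>A\<^esub> x = \<iota> a"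
    and ker: "\<And>a. a \<in> carrier R \<Longrightarrow> \<iota> a = \<zero>\<^bsub>A\<^esub> \<Longrightarrow> \<exists>s\<in>carrier R - I. s \<otimes>\<^bsub>R\<^esub> a = \<zero>\<^bsub>R\<^esub>"
    and j_closed: "\<And>x. x \<in> carrier R \<Longrightarrow> j x \<in> carrier M"
    and j_add: "\<And>x y. x \<in> carrier R \<Longrightarrow> y \<in> carrier R \<Longrightarrow> j (x \<oplus>\<^bsub>R\<^esub> y) = j x \<oplus>\<^bsub>M\<^esub> j y"
    and j_smult: "\<And>a x. a \<in> carrier R \<Longrightarrow> x \<in> carrier R \<Longrightarrow> \<iota> a \<odot>\<^bsub>M\<^esub> j x = j (a [^]\<^bsub>R\<^esub> q \<otimes>\<^bsub>R\<^esub> x)"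
    and j_frac: "\<And>y. y \<in> carrier M \<Longrightarrow> \<exists>x\<in>carrier R. \<exists>s\<in>carrier R - I. \<iota> s \<odot>\<^bsub>M\<^esub> y = j x"
    and j_ker: "\<And>x. x \<in> carrier R \<Longrightarrow> j x = \<zero>\<^bsub>M\<^esub> \<Longrightarrow> \<exists>s\<in>carrier R - I. s \<otimes>\<^bsub>R\<^esub> x = \<zero>\<^bsub>R\<^esub>"
begin

sublocale \<iota>: ring_hom_cring R A \<iota>
  by (rule ring_hom_cringI'[OF R.is_cring A.is_cring hom])

lemma prime_I: "primeideal I R" by (rule R.maximalideal_prime[OF I])

lemma U_closed:
  "\<one>\<^bsub>R\<^esub> \<in> carrier R - I" "s \<in> carrier R - I \<Longrightarrow> t \<in> carrier R - I \<Longrightarrow> s \<otimes>\<^bsub>R\<^esub> t \<in> carrier R - I"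
  "s \<in> carrier R - I \<Longrightarrow> s [^]\<^bsub>R\<^esub> (k::nat) \<in> carrier R - I"
proof -
  interpret I: primeideal I R by (rule prime_I)
  show one: "\<one>\<^bsub>R\<^esub> \<in> carrier R - I" using I.I_notcarr I.one_imp_carrier by auto
  show mult: "s \<in> carrier R - I \<Longrightarrow> t \<in> carrier R - I \<Longrightarrow> s \<otimes>\<^bsub>R\<^esub> t \<in> carrier R - I" for s t
    using I.I_prime[of s t] by auto
  show "s \<in> carrier R - I \<Longrightarrow> s [^]\<^bsub>R\<^esub> (k::nat) \<in> carrier R - I"
  proof (induction k)
    case 0
    show ?case using one by simp
  next
    case (Suc k)
    then show ?case using mult[of "s [^]\<^bsub>R\<^esub> k" s] by simp
  qed
qed

lemma frac_eq: "s \<in> carrier R - I \<Longrightarrow> x \<in> carrier A \<Longrightarrow> \<iota> s \<otimes>\<^bsub>A\<^esub> x = y \<Longrightarrow> x = inv\<^bsub>A\<^esub> (\<iota> s) \<otimes>\<^bsub>A\<^esub> y"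
  using unit[of s] by (auto simp: A.m_assoc[symmetric])

lemma ideal_frac:
  assumes J: "ideal J A" and x: "x \<in> carrier A" "s \<in> carrier R - I" "\<iota> s \<otimes>\<^bsub>A\<^esub> x \<in> J"
  shows "x \<in> J"
  using frac_eq[OF x(2,1) refl] ideal.I_l_closed[OF J x(3), of "inv\<^bsub>A\<^esub> (\<iota> s)"] unit[OF x(2)] by simp

definition contr :: "'a set \<Rightarrow> 'r set" where "contr J = {a \<in> carrier R. \<iota> a \<in> J}"

text \<open>Every element of \<open>A\<close> is a unit times an element from \<open>R\<close>, so
  an ideal of \<open>A\<close> is determined by its contraction.\<close>

lemma contr_reflects:
  assumes J: "ideal J A" and J': "ideal J' A" and sub: "contr J \<subseteq> contr J'"
  shows "J \<subseteq> J'"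
proof
  fix x assume x: "x \<in> J"
  then have xc: "x \<in> carrier A" using ideal.Icarr[OF J] by simp
  obtain a s where as: "a \<in> carrier R" "s \<in> carrier R - I" "\<iota> s \<otimes>\<^bsub>A\<^esub> x = \<iota> a" using frac[OF xc] by blast
  have "\<iota> a \<in> J" using as ideal.I_l_closed[OF J x, of "\<iota> s"] by simp
  then have "\<iota> a \<in> J'" using sub as(1) unfolding contr_def by blast
  then show "x \<in> J'" using ideal_frac[OF J' xc as(2)] as(3) by simp
qed

text \<open>A chain of ideals of \<open>A\<close> contracts to a chain in \<open>R\<close>, whose
  union is one of its members; \<open>contr_reflects\<close> brings this back to
  \<open>A\<close>.\<close>

lemma noetherian: "noetherian_ring A"
proof (rule A.trivial_ideal_chain_imp_noetherian)
  fix C assume C: "C \<noteq> {}" "subset.chain {J. ideal J A} C"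
  have Ci: "J \<in> C \<Longrightarrow> ideal J A" for J using C unfolding pred_on.chain_def by auto
  have "\<Union>(contr ` C) \<in> contr ` C"
  proof (rule noetherian_ring.ideal_chain_is_trivial)
    show "noetherian_ring R" using cm unfolding cm_ring_def by simp
    show "subset.chain {J. ideal J R} (contr ` C)"
      unfolding pred_on.chain_def
    proof (intro conjI ballI subsetI)
      fix J assume "J \<in> contr ` C"
      then show "J \<in> {J. ideal J R}" using \<iota>.ideal_vimage[OF Ci] unfolding contr_def by auto
    next
      fix J J' assume "J \<in> contr ` C" "J' \<in> contr ` C"
      then obtain T T' where T: "T \<in> C" "T' \<in> C" "J = contr T" "J' = contr T'" by auto
      then have "T \<subseteq> T' \<or> T' \<subseteq> T" using C unfolding pred_on.chain_def by auto
      then show "(\<subset>)\<^sup>=\<^sup>= J J' \<or> (\<subset>)\<^sup>=\<^sup>= J' J" unfolding T contr_def by auto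
    qed
  qed (use C in simp)
  then obtain T where T: "T \<in> C" "\<Union>(contr ` C) = contr T" by auto
  have "J \<subseteq> T" if "J \<in> C" for J
    by (rule contr_reflects[OF Ci Ci]) (use that T in auto)
  then have "\<Union>C = T" using T(1) by blast
  then show "\<Union>C \<in> C" using T(1) by simp
qed

text \<open>The extension of \<open>I\<close> to \<open>A\<close>, written as the fractions with
  numerator in \<open>I\<close>.\<close>

definition mx :: "'a set" where
  "mx = {x \<in> carrier A. \<exists>a\<in>I. \<exists>s\<in>carrier R - I. \<iota> s \<otimes>\<^bsub>A\<^esub> x = \<iota> a}"

lemma I_sub: "a \<in> I \<Longrightarrow> a \<in> carrier R"
  using ideal.Icarr[OF maximalideal.axioms(1)[OF I]] .

text \<open>A fraction with numerator outside \<open>I\<close> is a unit, so a proper ideal is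
  contained in \<open>mx\<close>; what remains is that \<open>mx\<close> is a proper ideal.\<close>

lemma mx_maximal: "maximalideal mx A"
  and mx_unit: "x \<in> carrier A \<Longrightarrow> x \<notin> mx \<Longrightarrow> x \<in> Units A"
proof -
  interpret I: primeideal I R by (rule prime_I)
  show units: "x \<in> Units A" if x: "x \<in> carrier A" "x \<notin> mx" for x
  proof -
    obtain a s where as: "a \<in> carrier R" "s \<in> carrier R - I" "\<iota> s \<otimes>\<^bsub>A\<^esub> x = \<iota> a" using frac[OF x(1)] by blast
    then have "a \<in> carrier R - I" using x unfolding mx_def by blast
    then have "inv\<^bsub>A\<^esub> (\<iota> s) \<otimes>\<^bsub>A\<^esub> \<iota> a \<in> Units A" using unit as(2) by (intro A.Units_m_closed A.Units_inv_Units) auto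
    then show ?thesis using frac_eq[OF as(2) x(1) as(3)] by simp
  qed
  have idl: "ideal mx A"
  proof (rule idealI[OF A.ring_axioms])
    have mult: "y \<otimes>\<^bsub>A\<^esub> x \<in> mx" if x: "x \<in> mx" and y: "y \<in> carrier A" for x y
    proof -
      obtain a s where as: "x \<in> carrier A" "a \<in> I" "s \<in> carrier R - I" "\<iota> s \<otimes>\<^bsub>A\<^esub> x = \<iota> a" using x unfolding mx_def by blast
      obtain c t where ct: "c \<in> carrier R" "t \<in> carrier R - I" "\<iota> t \<otimes>\<^bsub>A\<^esub> y = \<iota> c" using frac[OF y] by blast
      have "\<iota> (t \<otimes>\<^bsub>R\<^esub> s) \<otimes>\<^bsub>A\<^esub> (y \<otimes>\<^bsub>A\<^esub> x) = (\<iota> t \<otimes>\<^bsub>A\<^esub> y) \<otimes>\<^bsub>A\<^esub> (\<iota> s \<otimes>\<^bsub>A\<^esub> x)"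
        using as(1,3) ct(2) y by (simp add: A.m_ac)
      also have "\<dots> = \<iota> (c \<otimes>\<^bsub>R\<^esub> a)" using as ct I_sub by simp
      finally show ?thesis unfolding mx_def
        using as ct y U_closed(2)[OF ct(2) as(3)] I.I_l_closed[OF as(2) ct(1)] by blast
    qed
    show "y \<otimes>\<^bsub>A\<^esub> x \<in> mx" if "x \<in> mx" "y \<in> carrier A" for x y by (rule mult[OF that])
    then show "x \<otimes>\<^bsub>A\<^esub> y \<in> mx" if "x \<in> mx" "y \<in> carrier A" for x y
      using mult[OF that] that by (simp add: A.m_comm mx_def)
    show "subgroup mx (add_monoid A)"
    proof (rule A.add.subgroupI)
      show "mx \<subseteq> carrier A" by (auto simp: mx_def)
      have "\<iota> \<one>\<^bsub>R\<^esub> \<otimes>\<^bsub>A\<^esub> \<zero>\<^bsub>A\<^esub> = \<iota> \<zero>\<^bsub>R\<^esub>" by simp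
      then have "\<zero>\<^bsub>A\<^esub> \<in> mx" unfolding mx_def using U_closed(1) I.zero_closed by blast
      then show "mx \<noteq> {}" by auto
      show "\<ominus>\<^bsub>A\<^esub> x \<in> mx" if x: "x \<in> mx" for x
        using mult[OF x, of "\<ominus>\<^bsub>A\<^esub> \<one>\<^bsub>A\<^esub>"] x by (simp add: A.l_minus mx_def)
      fix x y assume x: "x \<in> mx" and y: "y \<in> mx"
      obtain a s where as: "x \<in> carrier A" "a \<in> I" "s \<in> carrier R - I" "\<iota> s \<otimes>\<^bsub>A\<^esub> x = \<iota> a" using x unfolding mx_def by blast
      obtain c t where ct: "y \<in> carrier A" "c \<in> I" "t \<in> carrier R - I" "\<iota> t \<otimes>\<^bsub>A\<^esub> y = \<iota> c" using y unfolding mx_def by blast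
      have "\<iota> (s \<otimes>\<^bsub>R\<^esub> t) \<otimes>\<^bsub>A\<^esub> (x \<oplus>\<^bsub>A\<^esub> y) = \<iota> t \<otimes>\<^bsub>A\<^esub> (\<iota> s \<otimes>\<^bsub>A\<^esub> x) \<oplus>\<^bsub>A\<^esub> \<iota> s \<otimes>\<^bsub>A\<^esub> (\<iota> t \<otimes>\<^bsub>A\<^esub> y)"
        using as(1,3) ct(1,3) by (simp add: A.m_ac A.r_distr)
      also have "\<dots> = \<iota> (t \<otimes>\<^bsub>R\<^esub> a \<oplus>\<^bsub>R\<^esub> s \<otimes>\<^bsub>R\<^esub> c)" using as ct I_sub by simp
      finally have "\<iota> (s \<otimes>\<^bsub>R\<^esub> t) \<otimes>\<^bsub>A\<^esub> (x \<oplus>\<^bsub>A\<^esub> y) = \<iota> (t \<otimes>\<^bsub>R\<^esub> a \<oplus>\<^bsub>R\<^esub> s \<otimes>\<^bsub>R\<^esub> c)" .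
      moreover have "t \<otimes>\<^bsub>R\<^esub> a \<oplus>\<^bsub>R\<^esub> s \<otimes>\<^bsub>R\<^esub> c \<in> I"
        using as ct I.I_l_closed by (intro I.a_closed) auto
      ultimately show "x \<oplus>\<^bsub>A\<^esub> y \<in> mx" unfolding mx_def
        using as(1) ct(1) U_closed(2)[OF as(3) ct(3)] by blast
    qed
  qed
  have one: "\<one>\<^bsub>A\<^esub> \<notin> mx"
  proof
    \<comment> \<open>Then some s outside \<open>I\<close> and some a in \<open>I\<close> agree in
      \<open>A\<close>, hence in \<open>R\<close> after multiplication by some t outside
      \<open>I\<close>; this puts t s into the prime \<open>I\<close>.\<close>
    assume "\<one>\<^bsub>A\<^esub> \<in> mx"
    then obtain a s where as: "a \<in> I" "s \<in> carrier R - I" "\<iota> s = \<iota> a" unfolding mx_def by auto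
    have ac: "a \<in> carrier R" using I_sub[OF as(1)] .
    have "\<iota> (s \<ominus>\<^bsub>R\<^esub> a) = \<zero>\<^bsub>A\<^esub>" using as ac by (simp add: a_minus_def A.r_neg)
    then obtain t where t: "t \<in> carrier R - I" "t \<otimes>\<^bsub>R\<^esub> (s \<ominus>\<^bsub>R\<^esub> a) = \<zero>\<^bsub>R\<^esub>" using ker[of "s \<ominus>\<^bsub>R\<^esub> a"] as ac by auto
    have "t \<otimes>\<^bsub>R\<^esub> s = t \<otimes>\<^bsub>R\<^esub> (s \<ominus>\<^bsub>R\<^esub> a) \<oplus>\<^bsub>R\<^esub> t \<otimes>\<^bsub>R\<^esub> a"
      using as(2) t(1) ac by (simp add: a_minus_def R.r_distr R.a_assoc R.r_minus R.l_neg)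
    also have "\<dots> = t \<otimes>\<^bsub>R\<^esub> a" using t ac by simp
    also have "\<dots> \<in> I" using I.I_l_closed as(1) t(1) by simp
    finally show False using U_closed(2)[OF t(1) as(2)] by simp
  qed
  show "maximalideal mx A" unfolding A.maximalideal_iff
  proof (intro conjI ballI impI idl one)
    fix x assume x: "x \<in> carrier A" "x \<notin> mx"
    then have "\<one>\<^bsub>A\<^esub> \<ominus>\<^bsub>A\<^esub> x \<otimes>\<^bsub>A\<^esub> inv\<^bsub>A\<^esub> x = \<zero>\<^bsub>A\<^esub>" using units[OF x] by (simp add: a_minus_def A.r_neg)
    then have "\<one>\<^bsub>A\<^esub> \<ominus>\<^bsub>A\<^esub> x \<otimes>\<^bsub>A\<^esub> inv\<^bsub>A\<^esub> x \<in> mx"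
      using additive_subgroup.zero_closed[OF ideal.axioms(1)[OF idl]] by (simp only:)
    then show "\<exists>c\<in>carrier A. \<one>\<^bsub>A\<^esub> \<ominus>\<^bsub>A\<^esub> x \<otimes>\<^bsub>A\<^esub> c \<in> mx"
      using A.Units_inv_closed[OF units[OF x]] by blast
  qed
qed

lemma maximal_unique: "maximalideal J A \<Longrightarrow> J = mx"
proof -
  assume J: "maximalideal J A"
  interpret J: maximalideal J A by fact
  have "J \<subseteq> mx"
  proof
    fix x assume x: "x \<in> J"
    show "x \<in> mx"
    proof (rule ccontr)
      assume "x \<notin> mx"
      then have "x \<in> Units A" using mx_unit x by auto
      then have "inv\<^bsub>A\<^esub> x \<otimes>\<^bsub>A\<^esub> x \<in> J" using J.I_l_closed[OF x, of "inv\<^bsub>A\<^esub> x"] by simp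
      then have "\<one>\<^bsub>A\<^esub> \<in> J" using \<open>x \<in> Units A\<close> by simp
      then show False using J.one_imp_carrier J.I_notcarr by simp
    qed
  qed
  moreover have "mx \<subseteq> carrier A" "mx \<noteq> carrier A"
    using maximalideal.I_notcarr[OF mx_maximal] by (auto simp: mx_def)
  ultimately show "J = mx" using J.I_maximal[OF maximalideal.axioms(1)[OF mx_maximal]] by blast
qed

lemma is_local: "local_ring A" and max_ideal_eq: "max_ideal A = mx"
proof -
  show "local_ring A" unfolding local_ring_def using A.is_cring mx_maximal maximal_unique by blast
  show "max_ideal A = mx" unfolding max_ideal_def
  proof (rule the_equality)
    show "maximalideal mx A" by (rule mx_maximal)
    show "J = mx" if "maximalideal J A" for J by (rule maximal_unique[OF that])
  qed
qed

lemma j_zero: "j \<zero>\<^bsub>R\<^esub> = \<zero>\<^bsub>M\<^esub>"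
  using j_add[of "\<zero>\<^bsub>R\<^esub>" "\<zero>\<^bsub>R\<^esub>"] j_closed[of "\<zero>\<^bsub>R\<^esub>"] by simp

lemma j_uminus: "x \<in> carrier R \<Longrightarrow> j (\<ominus>\<^bsub>R\<^esub> x) = \<ominus>\<^bsub>M\<^esub> j x"
  using j_add[of "\<ominus>\<^bsub>R\<^esub> x" x] j_zero j_closed by (simp add: M.M.minus_equality R.l_neg)

lemma smult_cancel:
  assumes s: "s \<in> carrier R - I" and y: "y \<in> carrier M"
  shows "inv\<^bsub>A\<^esub> (\<iota> s) \<odot>\<^bsub>M\<^esub> (\<iota> s \<odot>\<^bsub>M\<^esub> y) = y" "\<iota> s \<odot>\<^bsub>M\<^esub> (inv\<^bsub>A\<^esub> (\<iota> s) \<odot>\<^bsub>M\<^esub> y) = y"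
  using unit[OF s] s y by (auto simp: M.smult_assoc1[symmetric])

lemma submodule_frac:
  assumes N: "submodule N A M" and s: "s \<in> carrier R - I" and y: "y \<in> carrier M"
  shows "\<iota> s \<odot>\<^bsub>M\<^esub> y \<in> N \<longleftrightarrow> y \<in> N"
  using smult_cancel(1)[OF s y] M.submoduleE(4)[OF N] unit[OF s] s by (metis A.Units_closed A.Units_inv_closed)

abbreviation "qs \<equiv> map (\<lambda>g. g [^]\<^bsub>R\<^esub> q)"

text \<open>Denominators of a combination of the \<iota> g are cleared. As \<iota> g acts on images
  of elements of \<open>R\<close> through g^q, the corresponding span in \<open>R\<close> is that of
  the q-th powers.\<close>

lemma list_span_frac:
  assumes "set gs \<subseteq> carrier R" and "y \<in> carrier M"
  shows "y \<in> list_span M (map \<iota> gs) \<longleftrightarrow>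
    (\<exists>s\<in>carrier R - I. \<exists>x\<in>list_span (regular_module R) (qs gs). \<iota> s \<odot>\<^bsub>M\<^esub> y = j x)"
  using assms
proof (induction gs arbitrary: y)
  case Nil
  have "y = \<zero>\<^bsub>M\<^esub> \<longleftrightarrow> (\<exists>s\<in>carrier R - I. \<iota> s \<odot>\<^bsub>M\<^esub> y = \<zero>\<^bsub>M\<^esub>)"
  proof
    assume "y = \<zero>\<^bsub>M\<^esub>"
    then show "\<exists>s\<in>carrier R - I. \<iota> s \<odot>\<^bsub>M\<^esub> y = \<zero>\<^bsub>M\<^esub>" using U_closed(1) by (intro bexI[of _ "\<one>\<^bsub>R\<^esub>"]) auto
  next
    assume "\<exists>s\<in>carrier R - I. \<iota> s \<odot>\<^bsub>M\<^esub> y = \<zero>\<^bsub>M\<^esub>"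
    then obtain s where s: "s \<in> carrier R - I" "\<iota> s \<odot>\<^bsub>M\<^esub> y = \<zero>\<^bsub>M\<^esub>" by blast
    then show "y = \<zero>\<^bsub>M\<^esub>" using smult_cancel(1)[OF s(1) Nil(2)] unit[OF s(1)] by simp
  qed
  then show ?case by (simp add: j_zero)
next
  case (Cons g gs)
  then have g: "g \<in> carrier R" "set gs \<subseteq> carrier R" by auto
  interpret N: module R "regular_module R" by (rule R.regular_module_module)
  have qc: "set (qs gs) \<subseteq> carrier R" using g by auto
  note sub = N.list_span_submodule[OF qc]
  have c: "x \<in> list_span (regular_module R) (qs gs) \<Longrightarrow> x \<in> carrier R" for x
    using N.submoduleE(1)[OF sub] by auto
  have \<iota>c: "set (map \<iota> gs) \<subseteq> carrier A" using g by auto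
  note subM = M.list_span_submodule[OF \<iota>c]
  show ?case
  proof
    assume "y \<in> list_span M (map \<iota> (g # gs))"
    then obtain v w where vw: "v \<in> carrier M" "w \<in> list_span M (map \<iota> gs)" "y = \<iota> g \<odot>\<^bsub>M\<^esub> v \<oplus>\<^bsub>M\<^esub> w" by auto
    have w: "w \<in> carrier M" using vw(2) M.submoduleE(1)[OF subM] by auto
    obtain s x where s: "s \<in> carrier R - I" "x \<in> carrier R" "\<iota> s \<odot>\<^bsub>M\<^esub> v = j x" using j_frac[OF vw(1)] by blast
    obtain t z where t: "t \<in> carrier R - I" "z \<in> list_span (regular_module R) (qs gs)" "\<iota> t \<odot>\<^bsub>M\<^esub> w = j z"
      using Cons.IH[OF g(2) w] vw(2) by blast
    have zc: "z \<in> carrier R" using c[OF t(2)] .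
    have "\<iota> (s \<otimes>\<^bsub>R\<^esub> t) \<odot>\<^bsub>M\<^esub> y = \<iota> g \<odot>\<^bsub>M\<^esub> (\<iota> t \<odot>\<^bsub>M\<^esub> (\<iota> s \<odot>\<^bsub>M\<^esub> v)) \<oplus>\<^bsub>M\<^esub> \<iota> s \<odot>\<^bsub>M\<^esub> (\<iota> t \<odot>\<^bsub>M\<^esub> w)"
      using s(1) t(1) vw(1,3) w g by (simp add: M.smult_r_distr M.smult_assoc1[symmetric] A.m_ac)
    also have "\<dots> = j (g [^]\<^bsub>R\<^esub> q \<otimes>\<^bsub>R\<^esub> (t [^]\<^bsub>R\<^esub> q \<otimes>\<^bsub>R\<^esub> x) \<oplus>\<^bsub>R\<^esub> s [^]\<^bsub>R\<^esub> q \<otimes>\<^bsub>R\<^esub> z)"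
      using s t zc g by (simp add: j_smult j_add)
    finally have eq: "\<iota> (s \<otimes>\<^bsub>R\<^esub> t) \<odot>\<^bsub>M\<^esub> y = \<dots>" .
    have "s [^]\<^bsub>R\<^esub> q \<otimes>\<^bsub>R\<^esub> z \<in> list_span (regular_module R) (qs gs)"
      using N.submoduleE(4)[OF sub _ t(2), of "s [^]\<^bsub>R\<^esub> q"] s(1) by simp
    then have "g [^]\<^bsub>R\<^esub> q \<otimes>\<^bsub>R\<^esub> (t [^]\<^bsub>R\<^esub> q \<otimes>\<^bsub>R\<^esub> x) \<oplus>\<^bsub>R\<^esub> s [^]\<^bsub>R\<^esub> q \<otimes>\<^bsub>R\<^esub> z \<in> list_span (regular_module R) (qs (g # gs))"
      using t(1) s(2) by auto
    then show "\<exists>s\<in>carrier R - I. \<exists>x\<in>list_span (regular_module R) (qs (g # gs)). \<iota> s \<odot>\<^bsub>M\<^esub> y = j x"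
      using eq U_closed(2)[OF s(1) t(1)] by blast
  next
    assume "\<exists>s\<in>carrier R - I. \<exists>x\<in>list_span (regular_module R) (qs (g # gs)). \<iota> s \<odot>\<^bsub>M\<^esub> y = j x"
    then obtain s x z where s: "s \<in> carrier R - I" "x \<in> carrier R" "z \<in> list_span (regular_module R) (qs gs)"
      "\<iota> s \<odot>\<^bsub>M\<^esub> y = j (g [^]\<^bsub>R\<^esub> q \<otimes>\<^bsub>R\<^esub> x \<oplus>\<^bsub>R\<^esub> z)" by auto
    have zc: "z \<in> carrier R" using c[OF s(3)] .
    have inv: "inv\<^bsub>A\<^esub> (\<iota> s) \<in> carrier A" using unit[OF s(1)] by simp
    define w where "w = inv\<^bsub>A\<^esub> (\<iota> s) \<odot>\<^bsub>M\<^esub> j z"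
    have w: "w \<in> carrier M" unfolding w_def using inv j_closed[OF zc] by simp
    have "\<iota> s \<odot>\<^bsub>M\<^esub> w = j z" unfolding w_def by (rule smult_cancel(2)[OF s(1) j_closed[OF zc]])
    then have wN: "w \<in> list_span M (map \<iota> gs)" using Cons.IH[OF g(2) w] s by blast
    have "y = inv\<^bsub>A\<^esub> (\<iota> s) \<odot>\<^bsub>M\<^esub> (\<iota> s \<odot>\<^bsub>M\<^esub> y)" using smult_cancel(1)[OF s(1) Cons.prems(2)] by simp
    also have "\<dots> = inv\<^bsub>A\<^esub> (\<iota> s) \<odot>\<^bsub>M\<^esub> (\<iota> g \<odot>\<^bsub>M\<^esub> j x \<oplus>\<^bsub>M\<^esub> j z)" unfolding s(4) using g s(2) zc by (simp add: j_add j_smult)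
    also have "\<dots> = \<iota> g \<odot>\<^bsub>M\<^esub> (inv\<^bsub>A\<^esub> (\<iota> s) \<odot>\<^bsub>M\<^esub> j x) \<oplus>\<^bsub>M\<^esub> w"
      unfolding w_def using inv g j_closed[OF s(2)] j_closed[OF zc]
      by (simp add: M.smult_r_distr M.smult_assoc1[symmetric] A.m_comm)
    finally have y: "y = \<iota> g \<odot>\<^bsub>M\<^esub> (inv\<^bsub>A\<^esub> (\<iota> s) \<odot>\<^bsub>M\<^esub> j x) \<oplus>\<^bsub>M\<^esub> w" .
    have "inv\<^bsub>A\<^esub> (\<iota> s) \<odot>\<^bsub>M\<^esub> j x \<in> carrier M" using inv j_closed[OF s(2)] by simp
    then show "y \<in> list_span M (map \<iota> (g # gs))" using y wN unfolding list.map list_span.simps by blast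
  qed
qed

text \<open>Because \<iota> t acts as t^q, denominators appear as q-th powers on the side of
  \<open>R\<close>. The relation from \<open>j_ker\<close> carries only a single factor t and has to
  be brought to this form.\<close>

lemma j_in_list_span:
  assumes gs: "set gs \<subseteq> carrier R" and x: "x \<in> carrier R"
  shows "j x \<in> list_span M (map \<iota> gs) \<longleftrightarrow>
    (\<exists>t\<in>carrier R - I. t [^]\<^bsub>R\<^esub> q \<otimes>\<^bsub>R\<^esub> x \<in> list_span (regular_module R) (qs gs))"
proof
  interpret N: module R "regular_module R" by (rule R.regular_module_module)
  have qc: "set (qs gs) \<subseteq> carrier R" using gs by auto
  note sub = N.list_span_submodule[OF qc]
  assume "j x \<in> list_span M (map \<iota> gs)"
  then obtain s z where s: "s \<in> carrier R - I" "z \<in> list_span (regular_module R) (qs gs)" "\<iota> s \<odot>\<^bsub>M\<^esub> j x = j z"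
    using list_span_frac[OF gs j_closed[OF x]] by blast
  have zc: "z \<in> carrier R" using s(2) N.submoduleE(1)[OF sub] by auto
  have sx: "s [^]\<^bsub>R\<^esub> q \<otimes>\<^bsub>R\<^esub> x \<in> carrier R" using s(1) x by simp
  have "j (s [^]\<^bsub>R\<^esub> q \<otimes>\<^bsub>R\<^esub> x \<ominus>\<^bsub>R\<^esub> z) = \<zero>\<^bsub>M\<^esub>"
    using s x zc sx j_closed[OF zc] by (simp add: a_minus_def j_add j_uminus j_smult[symmetric] M.M.r_neg)
  then obtain t where t: "t \<in> carrier R - I" "t \<otimes>\<^bsub>R\<^esub> (s [^]\<^bsub>R\<^esub> q \<otimes>\<^bsub>R\<^esub> x \<ominus>\<^bsub>R\<^esub> z) = \<zero>\<^bsub>R\<^esub>"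
    using j_ker[of "s [^]\<^bsub>R\<^esub> q \<otimes>\<^bsub>R\<^esub> x \<ominus>\<^bsub>R\<^esub> z"] sx zc by auto
  have tc: "t \<in> carrier R" using t by simp
  have "t \<otimes>\<^bsub>R\<^esub> (s [^]\<^bsub>R\<^esub> q \<otimes>\<^bsub>R\<^esub> x) \<ominus>\<^bsub>R\<^esub> t \<otimes>\<^bsub>R\<^esub> z = \<zero>\<^bsub>R\<^esub>"
    using t(2) tc sx zc by (simp add: a_minus_def R.r_distr R.r_minus)
  then have tz: "t \<otimes>\<^bsub>R\<^esub> (s [^]\<^bsub>R\<^esub> q \<otimes>\<^bsub>R\<^esub> x) = t \<otimes>\<^bsub>R\<^esub> z"
    using R.r_right_minus_eq tc sx zc by simp
  \<comment> \<open>Multiplying the relation by t^(q-1) completes its factor t to t^q; this uses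
    that q is positive.\<close>
  obtain k where k: "q = Suc k" using q by (cases q) auto
  have "(t \<otimes>\<^bsub>R\<^esub> s) [^]\<^bsub>R\<^esub> q \<otimes>\<^bsub>R\<^esub> x = t [^]\<^bsub>R\<^esub> q \<otimes>\<^bsub>R\<^esub> (s [^]\<^bsub>R\<^esub> q \<otimes>\<^bsub>R\<^esub> x)"
    using s(1) tc x by (simp add: R.nat_pow_distrib R.m_assoc)
  also have "\<dots> = t [^]\<^bsub>R\<^esub> k \<otimes>\<^bsub>R\<^esub> (t \<otimes>\<^bsub>R\<^esub> (s [^]\<^bsub>R\<^esub> q \<otimes>\<^bsub>R\<^esub> x))"
    unfolding k using s(1) tc x by (simp add: R.m_assoc)
  also have "\<dots> = (t [^]\<^bsub>R\<^esub> k \<otimes>\<^bsub>R\<^esub> t) \<otimes>\<^bsub>R\<^esub> z"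
    unfolding tz using tc zc by (simp add: R.m_assoc)
  also have "\<dots> \<in> list_span (regular_module R) (qs gs)"
    using N.submoduleE(4)[OF sub _ s(2), of "t [^]\<^bsub>R\<^esub> k \<otimes>\<^bsub>R\<^esub> t"] tc by simp
  finally show "\<exists>t\<in>carrier R - I. t [^]\<^bsub>R\<^esub> q \<otimes>\<^bsub>R\<^esub> x \<in> list_span (regular_module R) (qs gs)"
    using U_closed(2)[OF t(1) s(1)] by blast
next
  assume "\<exists>t\<in>carrier R - I. t [^]\<^bsub>R\<^esub> q \<otimes>\<^bsub>R\<^esub> x \<in> list_span (regular_module R) (qs gs)"
  then obtain t where t: "t \<in> carrier R - I" "t [^]\<^bsub>R\<^esub> q \<otimes>\<^bsub>R\<^esub> x \<in> list_span (regular_module R) (qs gs)" by blast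
  then show "j x \<in> list_span M (map \<iota> gs)"
    using list_span_frac[OF gs j_closed[OF x]] j_smult[of t x] x by blast
qed

text \<open>The sequence is taken from \<open>cm_ring\<close> for the exponent q at hand, so its
  q-th powers are weakly regular on \<open>R\<close>; clearing denominators turns this into
  regularity of the elements themselves on \<open>M\<close>.\<close>

lemma regular_sequence_exists:
  "\<exists>as. regular_sequence A M as \<and> set as \<subseteq> mx \<and> length as = d"
proof -
  interpret I: primeideal I R by (rule prime_I)
  obtain gs where gs: "set gs \<subseteq> I" "length gs = d" "weakly_regular (regular_module R) (qs gs)"
    using cm I q unfolding cm_ring_def by blast
  have gc: "set gs \<subseteq> carrier R" using gs(1) I_sub by blast
  have regular: "regular_sequence A M (map \<iota> gs)"
    unfolding M.regular_sequence_iff weakly_regular_def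
  proof (intro conjI allI impI ballI)
    show "set (map \<iota> gs) \<subseteq> carrier A" using gc by auto
  next
    fix i y assume i: "i < length (map \<iota> gs)" and y: "y \<in> carrier M"
      and mem: "map \<iota> gs ! i \<odot>\<^bsub>M\<^esub> y \<in> list_span M (take i (map \<iota> gs))"
    have t: "set (take i gs) \<subseteq> carrier R" using gc set_take_subset by fast
    have gi: "gs ! i \<in> carrier R" using gc i nth_mem by force
    have "set (map \<iota> (take i gs)) \<subseteq> carrier A" using t by auto
    note N = M.list_span_submodule[OF this]
    obtain x s where xs: "x \<in> carrier R" "s \<in> carrier R - I" "\<iota> s \<odot>\<^bsub>M\<^esub> y = j x" using j_frac[OF y] by blast
    have "\<iota> s \<odot>\<^bsub>M\<^esub> (\<iota> (gs ! i) \<odot>\<^bsub>M\<^esub> y) \<in> list_span M (map \<iota> (take i gs))"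
      using mem i xs M.submoduleE(4)[OF N] by (simp add: take_map)
    moreover have "\<iota> s \<odot>\<^bsub>M\<^esub> (\<iota> (gs ! i) \<odot>\<^bsub>M\<^esub> y) = \<iota> (gs ! i) \<odot>\<^bsub>M\<^esub> (\<iota> s \<odot>\<^bsub>M\<^esub> y)"
      using xs(1,2) gi y by (simp add: M.smult_assoc1[symmetric] A.m_comm)
    ultimately have "j (gs ! i [^]\<^bsub>R\<^esub> q \<otimes>\<^bsub>R\<^esub> x) \<in> list_span M (map \<iota> (take i gs))"
      using xs gi by (simp add: j_smult)
    then obtain t' where t': "t' \<in> carrier R - I"
      "t' [^]\<^bsub>R\<^esub> q \<otimes>\<^bsub>R\<^esub> (gs ! i [^]\<^bsub>R\<^esub> q \<otimes>\<^bsub>R\<^esub> x) \<in> list_span (regular_module R) (qs (take i gs))"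
      using j_in_list_span[OF t, of "gs ! i [^]\<^bsub>R\<^esub> q \<otimes>\<^bsub>R\<^esub> x"] gi xs(1) by auto
    have "gs ! i [^]\<^bsub>R\<^esub> q \<otimes>\<^bsub>R\<^esub> (t' [^]\<^bsub>R\<^esub> q \<otimes>\<^bsub>R\<^esub> x) \<in> list_span (regular_module R) (take i (qs gs))"
      using t' gi xs(1) by (simp add: R.m_lcomm take_map)
    then have "t' [^]\<^bsub>R\<^esub> q \<otimes>\<^bsub>R\<^esub> x \<in> list_span (regular_module R) (take i (qs gs))"
      using gs(3) i t'(1) xs(1) unfolding weakly_regular_def by simp
    then have "j x \<in> list_span M (map \<iota> (take i gs))"
      using j_in_list_span[OF t xs(1)] t'(1) by (auto simp: take_map)
    then show "y \<in> list_span M (take i (map \<iota> gs))"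
      using submodule_frac[OF N xs(2) y] xs(3) by (simp add: take_map)
  next
    \<comment> \<open>Otherwise the image of \<one> lies in the span, so some t^q with t outside
      \<open>I\<close> lies in the ideal generated by the g^q, which is contained in
      \<open>I\<close>.\<close>
    show "list_span M (map \<iota> gs) \<noteq> carrier M"
    proof
      assume "list_span M (map \<iota> gs) = carrier M"
      then have "j \<one>\<^bsub>R\<^esub> \<in> list_span M (map \<iota> gs)" using j_closed by simp
      then obtain t where t: "t \<in> carrier R - I" "t [^]\<^bsub>R\<^esub> q \<in> list_span (regular_module R) (qs gs)"
        using j_in_list_span[OF gc R.one_closed] by auto
      interpret N: module R "regular_module R" by (rule R.regular_module_module)
      have "list_span (regular_module R) (qs gs) \<subseteq> I"
      proof (rule N.list_span_minimal)
        show "submodule I R (regular_module R)"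
        proof (rule N.submoduleI)
          fix a assume a: "a \<in> I"
          then have "\<ominus>\<^bsub>regular_module R\<^esub> a = (\<ominus>\<^bsub>R\<^esub> \<one>\<^bsub>R\<^esub>) \<otimes>\<^bsub>R\<^esub> a"
            using N.smult_l_minus[of "\<one>\<^bsub>R\<^esub>" a] I_sub[OF a] by simp
          then show "\<ominus>\<^bsub>regular_module R\<^esub> a \<in> I" using I.I_l_closed[OF a] by simp
        qed (use I.I_l_closed I_sub I.zero_closed in auto)
        fix a x assume "a \<in> set (qs gs)" "x \<in> carrier (regular_module R)"
        then obtain g where g: "g \<in> set gs" "a = g [^]\<^bsub>R\<^esub> q" and x: "x \<in> carrier R" by auto
        obtain k where k: "q = Suc k" using q by (cases q) auto
        have "g \<in> I" "g \<in> carrier R" using g gs(1) I_sub by auto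
        then have "a \<in> I" unfolding g(2) k using I.I_l_closed[of g "g [^]\<^bsub>R\<^esub> k"] by simp
        then show "a \<odot>\<^bsub>regular_module R\<^esub> x \<in> I" using I.I_r_closed x by simp
      qed
      then show False using t U_closed(3)[OF t(1), of q] by auto
    qed
  qed
  moreover have "set (map \<iota> gs) \<subseteq> mx"
  proof
    fix x assume "x \<in> set (map \<iota> gs)"
    then obtain g where g: "g \<in> I" "g \<in> carrier R" "x = \<iota> g" using gs(1) gc by auto
    then have "\<iota> \<one>\<^bsub>R\<^esub> \<otimes>\<^bsub>A\<^esub> x = \<iota> g" by simp
    then show "x \<in> mx" unfolding mx_def using g U_closed(1) by blast
  qed
  ultimately show ?thesis using gs(2) by (intro exI[of _ "map \<iota> gs"]) auto
qed

lemma krull_dim_le: "krull_dim A \<le> enat d"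
  unfolding krull_dim_def
proof (rule Sup_least)
  fix x assume "x \<in> {enat l |l. \<exists>P :: nat \<Rightarrow> 'a set. (\<forall>i\<le>l. primeideal (P i) A) \<and> (\<forall>i<l. P i \<subset> P (Suc i))}"
  then obtain l and P :: "nat \<Rightarrow> 'a set" where x: "x = enat l" and P: "\<forall>i\<le>l. primeideal (P i) A" "\<forall>i<l. P i \<subset> P (Suc i)" by blast
  have "prime_chain R l (\<lambda>i. contr (P i))"
    unfolding prime_chain_def
  proof (intro conjI allI impI)
    fix i assume "i \<le> l"
    then show "primeideal (contr (P i)) R" unfolding contr_def using P(1) by (intro \<iota>.primeideal_vimage) auto
  next
    fix i assume i: "i < l"
    then have Pi: "ideal (P i) A" "ideal (P (Suc i)) A" "P i \<subset> P (Suc i)"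
      using P(2) primeideal.axioms(1)[OF P(1)[rule_format, of i]] primeideal.axioms(1)[OF P(1)[rule_format, of "Suc i"]]
      by auto
    have "contr (P i) \<subseteq> contr (P (Suc i))" using Pi(3) unfolding contr_def by auto
    moreover have "\<not> contr (P (Suc i)) \<subseteq> contr (P i)" using contr_reflects[OF Pi(2,1)] Pi(3) by blast
    ultimately show "contr (P i) \<subset> contr (P (Suc i))" by blast
  qed
  then show "x \<le> enat d" using cm unfolding cm_ring_def x by auto
qed

text \<open>The inequalities d \<le> depth \<le> dim \<le> d come from the sequence transferred from
  \<open>R\<close>, from the chain of primes attached to any regular sequence, and from contracting
  chains of primes to \<open>R\<close>.\<close>

theorem mcm:
  assumes fg: "finitely_generated_module A M"
  shows "mcm_local A M"
proof -
  have "depth A M = krull_dim A"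
  proof (rule antisym)
    \<comment> \<open>\<open>M\<close> is nonzero, so its depth is not given by the convention that
      assigns \<infinity> to the zero module.\<close>
    have "j \<one>\<^bsub>R\<^esub> \<noteq> \<zero>\<^bsub>M\<^esub>"
    proof
      assume "j \<one>\<^bsub>R\<^esub> = \<zero>\<^bsub>M\<^esub>"
      then obtain s where s: "s \<in> carrier R - I" "s \<otimes>\<^bsub>R\<^esub> \<one>\<^bsub>R\<^esub> = \<zero>\<^bsub>R\<^esub>" using j_ker[of "\<one>\<^bsub>R\<^esub>"] by auto
      then have "s = \<zero>\<^bsub>R\<^esub>" by simp
      then show False
        using s(1) additive_subgroup.zero_closed[OF ideal.axioms(1)[OF maximalideal.axioms(1)[OF I]]] by simp
    qed
    then have ne: "carrier M \<noteq> {\<zero>\<^bsub>M\<^esub>}" using j_closed[of "\<one>\<^bsub>R\<^esub>"] by auto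
    show "depth A M \<le> krull_dim A"
      unfolding depth_def if_not_P[OF ne]
    proof (rule Sup_least)
      fix x assume "x \<in> {enat (length as) |as. regular_sequence A M as \<and> set as \<subseteq> max_ideal A}"
      then obtain as where as: "x = enat (length as)" "regular_sequence A M as" by blast
      then obtain P where P: "prime_chain A (length as) P"
        using M.regular_sequence_prime_chain[of as] unfolding M.regular_sequence_iff by blast
      show "x \<le> krull_dim A" unfolding krull_dim_def as(1)
        by (rule Sup_upper) (use P in \<open>auto simp: prime_chain_def\<close>)
    qed
    obtain as where as: "regular_sequence A M as" "set as \<subseteq> mx" "length as = d"
      using regular_sequence_exists by blast
    have "enat d \<le> depth A M"
      unfolding depth_def if_not_P[OF ne] as(3)[symmetric]
      by (rule Sup_upper) (use as max_ideal_eq in auto)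
    then show "krull_dim A \<le> depth A M" using krull_dim_le by simp
  qed
  then show ?thesis
    unfolding mcm_local_def using noetherian is_local M.module_axioms fg
    by (auto intro: module.intro)
qed

end

section \<open>Localization of a module at a multiplicative set\<close>

locale localization = module +
  fixes U :: "'a set"
  assumes U_sub: "U \<subseteq> carrier R" and U_one: "\<one> \<in> U"
    and U_mult: "\<And>s t. s \<in> U \<Longrightarrow> t \<in> U \<Longrightarrow> s \<otimes> t \<in> U"
begin

lemma U_carrier: "s \<in> U \<Longrightarrow> s \<in> carrier R" using U_sub by auto

abbreviation "fm \<equiv> loc_frac R M U"
abbreviation "fr \<equiv> loc_frac R (regular_module R) U"

lemma loc_rel_equiv: "equiv (carrier M \<times> U) (loc_rel R M U)"
proof (rule equivI)
  show "loc_rel R M U \<subseteq> (carrier M \<times> U) \<times> (carrier M \<times> U)" unfolding loc_rel_def by auto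
  show "refl_on (carrier M \<times> U) (loc_rel R M U)"
    unfolding refl_on_def loc_rel_def using U_one by auto
  show "sym (loc_rel R M U)"
    unfolding sym_def loc_rel_def by (auto intro: sym)
  show "trans (loc_rel R M U)"
  proof (rule transI)
    fix p1 p2 p3 assume "(p1, p2) \<in> loc_rel R M U" "(p2, p3) \<in> loc_rel R M U"
    then obtain x s y t z w u v where p: "p1 = (x, s)" "p2 = (y, t)" "p3 = (z, w)"
      and c: "x \<in> carrier M" "y \<in> carrier M" "z \<in> carrier M"
      and us: "s \<in> U" "t \<in> U" "w \<in> U" "u \<in> U" "v \<in> U"
      and eq: "u \<odot>\<^bsub>M\<^esub> (t \<odot>\<^bsub>M\<^esub> x) = u \<odot>\<^bsub>M\<^esub> (s \<odot>\<^bsub>M\<^esub> y)" "v \<odot>\<^bsub>M\<^esub> (w \<odot>\<^bsub>M\<^esub> y) = v \<odot>\<^bsub>M\<^esub> (t \<odot>\<^bsub>M\<^esub> z)"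
      unfolding loc_rel_def by blast
    note uc = us[THEN U_carrier]
    \<comment> \<open>Besides the two witnesses u and v, the middle denominator t is needed as a
      factor so that both given relations can be applied.\<close>
    have "(u \<otimes> v \<otimes> t) \<odot>\<^bsub>M\<^esub> (w \<odot>\<^bsub>M\<^esub> x) = (v \<otimes> w) \<odot>\<^bsub>M\<^esub> (u \<odot>\<^bsub>M\<^esub> (t \<odot>\<^bsub>M\<^esub> x))"
      using c uc by (simp add: smult_assoc1[symmetric] R.m_ac)
    also have "\<dots> = (u \<otimes> s) \<odot>\<^bsub>M\<^esub> (v \<odot>\<^bsub>M\<^esub> (w \<odot>\<^bsub>M\<^esub> y))"
      unfolding eq(1) using c uc by (simp add: smult_assoc1[symmetric] R.m_ac)
    also have "\<dots> = (u \<otimes> v \<otimes> t) \<odot>\<^bsub>M\<^esub> (s \<odot>\<^bsub>M\<^esub> z)"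
      unfolding eq(2) using c uc by (simp add: smult_assoc1[symmetric] R.m_ac)
    finally have "\<exists>u\<in>U. u \<odot>\<^bsub>M\<^esub> (w \<odot>\<^bsub>M\<^esub> x) = u \<odot>\<^bsub>M\<^esub> (s \<odot>\<^bsub>M\<^esub> z)"
      using us U_mult by (intro bexI[of _ "u \<otimes> v \<otimes> t"]) auto
    then show "(p1, p3) \<in> loc_rel R M U" unfolding p loc_rel_def using c us by auto
  qed
qed

lemma fm_eq_iff:
  assumes "x \<in> carrier M" "y \<in> carrier M" "s \<in> U" "t \<in> U"
  shows "fm x s = fm y t \<longleftrightarrow> (\<exists>u\<in>U. u \<odot>\<^bsub>M\<^esub> (t \<odot>\<^bsub>M\<^esub> x) = u \<odot>\<^bsub>M\<^esub> (s \<odot>\<^bsub>M\<^esub> y))"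
  unfolding loc_frac_def using eq_equiv_class_iff[OF loc_rel_equiv, of "(x, s)" "(y, t)"] assms
  by (auto simp: loc_rel_def)

lemma fm_eqI:
  assumes "x \<in> carrier M" "y \<in> carrier M" "s \<in> U" "t \<in> U" "t \<odot>\<^bsub>M\<^esub> x = s \<odot>\<^bsub>M\<^esub> y"
  shows "fm x s = fm y t"
  unfolding fm_eq_iff[OF assms(1-4)] using U_one assms(5) by auto

lemma fm_mem: "(y, t) \<in> fm x s \<Longrightarrow> y \<in> carrier M \<and> t \<in> U \<and> x \<in> carrier M \<and> s \<in> U \<and> fm y t = fm x s"
proof -
  assume m: "(y, t) \<in> fm x s"
  then have "((x, s), (y, t)) \<in> loc_rel R M U" by (simp add: loc_frac_def)
  then have "fm x s = fm y t" unfolding loc_frac_def by (rule equiv_class_eq[OF loc_rel_equiv])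
  then show ?thesis using m unfolding loc_frac_def loc_rel_def by auto
qed

lemma fm_self: "x \<in> carrier M \<Longrightarrow> s \<in> U \<Longrightarrow> (x, s) \<in> fm x s"
  unfolding loc_frac_def using equiv_class_self[OF loc_rel_equiv, of "(x, s)"] by auto

lemma loc_carrier: "carrier (loc_module R M U) = {fm x s | x s. x \<in> carrier M \<and> s \<in> U}"
  unfolding loc_module_def quotient_def loc_frac_def by auto

lemma fm_in: "x \<in> carrier M \<Longrightarrow> s \<in> U \<Longrightarrow> fm x s \<in> carrier (loc_module R M U)"
  unfolding loc_carrier by blast

text \<open>Another choice of representatives gives an equal fraction, with the product of the two
  equality witnesses as witness; so the union in \<open>loc_add\<close> is a union of copies of one
  set.\<close>

lemma loc_add_fm:
  assumes x: "x \<in> carrier M" "s \<in> U" and y: "y \<in> carrier M" "t \<in> U"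
  shows "loc_add R M U (fm x s) (fm y t) = fm (t \<odot>\<^bsub>M\<^esub> x \<oplus>\<^bsub>M\<^esub> s \<odot>\<^bsub>M\<^esub> y) (s \<otimes> t)"
proof -
  have const: "fm (t' \<odot>\<^bsub>M\<^esub> x' \<oplus>\<^bsub>M\<^esub> s' \<odot>\<^bsub>M\<^esub> y') (s' \<otimes> t') = fm (t \<odot>\<^bsub>M\<^esub> x \<oplus>\<^bsub>M\<^esub> s \<odot>\<^bsub>M\<^esub> y) (s \<otimes> t)"
    if "(x', s') \<in> fm x s" "(y', t') \<in> fm y t" for x' s' y' t'
  proof -
    have c: "x' \<in> carrier M" "s' \<in> U" "y' \<in> carrier M" "t' \<in> U" using fm_mem that by auto
    have "fm x' s' = fm x s" "fm y' t' = fm y t" using fm_mem that by auto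
    then obtain u v where u: "u \<in> U" "u \<odot>\<^bsub>M\<^esub> (s \<odot>\<^bsub>M\<^esub> x') = u \<odot>\<^bsub>M\<^esub> (s' \<odot>\<^bsub>M\<^esub> x)"
      and v: "v \<in> U" "v \<odot>\<^bsub>M\<^esub> (t \<odot>\<^bsub>M\<^esub> y') = v \<odot>\<^bsub>M\<^esub> (t' \<odot>\<^bsub>M\<^esub> y)"
      using fm_eq_iff[OF c(1) x(1) c(2) x(2)] fm_eq_iff[OF c(3) y(1) c(4) y(2)] by blast
    note uc = U_carrier[OF u(1)] U_carrier[OF v(1)] U_carrier[OF x(2)] U_carrier[OF y(2)] U_carrier[OF c(2)] U_carrier[OF c(4)]
    have "(u \<otimes> v) \<odot>\<^bsub>M\<^esub> ((s \<otimes> t) \<odot>\<^bsub>M\<^esub> (t' \<odot>\<^bsub>M\<^esub> x' \<oplus>\<^bsub>M\<^esub> s' \<odot>\<^bsub>M\<^esub> y'))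
      = (v \<otimes> t \<otimes> t') \<odot>\<^bsub>M\<^esub> (u \<odot>\<^bsub>M\<^esub> (s \<odot>\<^bsub>M\<^esub> x')) \<oplus>\<^bsub>M\<^esub> (u \<otimes> s \<otimes> s') \<odot>\<^bsub>M\<^esub> (v \<odot>\<^bsub>M\<^esub> (t \<odot>\<^bsub>M\<^esub> y'))"
      using uc c by (simp add: smult_r_distr smult_assoc1[symmetric] R.m_ac)
    also have "\<dots> = (u \<otimes> v) \<odot>\<^bsub>M\<^esub> ((s' \<otimes> t') \<odot>\<^bsub>M\<^esub> (t \<odot>\<^bsub>M\<^esub> x \<oplus>\<^bsub>M\<^esub> s \<odot>\<^bsub>M\<^esub> y))"
      unfolding u(2) v(2) using uc x y by (simp add: smult_r_distr smult_assoc1[symmetric] R.m_ac)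
    finally show ?thesis
      by (subst fm_eq_iff) (use uc x y c u v U_mult in auto)
  qed
  have "loc_add R M U (fm x s) (fm y t) = (\<Union>p\<in>fm x s. \<Union>r\<in>fm y t. fm (t \<odot>\<^bsub>M\<^esub> x \<oplus>\<^bsub>M\<^esub> s \<odot>\<^bsub>M\<^esub> y) (s \<otimes> t))"
    unfolding loc_add_def using const by (intro SUP_cong refl) (auto simp: split_beta)
  also have "\<dots> = fm (t \<odot>\<^bsub>M\<^esub> x \<oplus>\<^bsub>M\<^esub> s \<odot>\<^bsub>M\<^esub> y) (s \<otimes> t)"
    using fm_self[OF x] fm_self[OF y] by (auto simp del: UN_simps)
  finally show ?thesis .
qed

end

text \<open>The ring is localized as a module over itself, so the facts on fractions proved for
  modules also apply to \<open>loc_ring\<close>.\<close>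

lemma (in module) localization_regular: "localization R M U \<Longrightarrow> localization R (regular_module R) U"
  by (simp add: localization_def R.regular_module_module localization_axioms_def)

context localization
begin

lemma loc_smult_fm:
  assumes a: "a \<in> carrier R" "s \<in> U" and y: "y \<in> carrier M" "t \<in> U"
  shows "loc_smult R M U (fr a s) (fm y t) = fm (a \<odot>\<^bsub>M\<^esub> y) (s \<otimes> t)"
proof -
  interpret L: localization R "regular_module R" U by (rule localization_regular[OF localization_axioms])
  have const: "fm (a' \<odot>\<^bsub>M\<^esub> y') (s' \<otimes> t') = fm (a \<odot>\<^bsub>M\<^esub> y) (s \<otimes> t)"
    if "(a', s') \<in> fr a s" "(y', t') \<in> fm y t" for a' s' y' t'
  proof -
    have c: "a' \<in> carrier R" "s' \<in> U" "y' \<in> carrier M" "t' \<in> U" using fm_mem L.fm_mem that by auto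
    have "fr a' s' = fr a s" "fm y' t' = fm y t" using fm_mem L.fm_mem that by auto
    then obtain u v where u: "u \<in> U" "u \<otimes> (s \<otimes> a') = u \<otimes> (s' \<otimes> a)"
      and v: "v \<in> U" "v \<odot>\<^bsub>M\<^esub> (t \<odot>\<^bsub>M\<^esub> y') = v \<odot>\<^bsub>M\<^esub> (t' \<odot>\<^bsub>M\<^esub> y)"
      using L.fm_eq_iff[of a' a s' s] a c fm_eq_iff[OF c(3) y(1) c(4) y(2)] by auto
    note uc = U_carrier[OF u(1)] U_carrier[OF v(1)] U_carrier[OF a(2)] U_carrier[OF y(2)] U_carrier[OF c(2)] U_carrier[OF c(4)]
    have "(u \<otimes> v) \<odot>\<^bsub>M\<^esub> ((s \<otimes> t) \<odot>\<^bsub>M\<^esub> (a' \<odot>\<^bsub>M\<^esub> y'))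
      = (u \<otimes> (s \<otimes> a')) \<odot>\<^bsub>M\<^esub> (v \<odot>\<^bsub>M\<^esub> (t \<odot>\<^bsub>M\<^esub> y'))"
      using uc c by (simp add: smult_assoc1[symmetric] R.m_ac)
    also have "\<dots> = (u \<otimes> v) \<odot>\<^bsub>M\<^esub> ((s' \<otimes> t') \<odot>\<^bsub>M\<^esub> (a \<odot>\<^bsub>M\<^esub> y))"
      unfolding u(2) v(2) using uc a y by (simp add: smult_assoc1[symmetric] R.m_ac)
    finally show ?thesis
      by (subst fm_eq_iff) (use uc a y c u v U_mult in auto)
  qed
  have "loc_smult R M U (fr a s) (fm y t) = (\<Union>p\<in>fr a s. \<Union>r\<in>fm y t. fm (a \<odot>\<^bsub>M\<^esub> y) (s \<otimes> t))"
    unfolding loc_smult_def using const by (intro SUP_cong refl) (auto simp: split_beta)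
  also have "\<dots> = fm (a \<odot>\<^bsub>M\<^esub> y) (s \<otimes> t)"
    using L.fm_self[of a s] a fm_self[OF y] by (auto simp del: UN_simps)
  finally show ?thesis .
qed

lemma loc_module_ops:
  "\<zero>\<^bsub>loc_module R M U\<^esub> = fm \<zero>\<^bsub>M\<^esub> \<one>"
  "x \<oplus>\<^bsub>loc_module R M U\<^esub> y = loc_add R M U x y"
  "a \<odot>\<^bsub>loc_module R M U\<^esub> x = loc_smult R M U a x"
  by (simp_all add: loc_module_def)

lemma loc_module_abelian_group: "abelian_group (loc_module R M U)"
proof (rule abelian_groupI)
  fix p assume "p \<in> carrier (loc_module R M U)"
  then obtain x s where p: "p = fm x s" "x \<in> carrier M" "s \<in> U" unfolding loc_carrier by blast
  note pc = U_carrier[OF p(3)]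
  show "\<zero>\<^bsub>loc_module R M U\<^esub> \<oplus>\<^bsub>loc_module R M U\<^esub> p = p"
    unfolding loc_module_ops p(1) using p pc U_one by (subst loc_add_fm) (auto intro!: fm_eqI)
  have "fm (\<ominus>\<^bsub>M\<^esub> x) s \<oplus>\<^bsub>loc_module R M U\<^esub> p = \<zero>\<^bsub>loc_module R M U\<^esub>"
    unfolding loc_module_ops p(1) using p pc U_one U_mult
    by (simp add: loc_add_fm smult_r_minus M.l_neg) (rule fm_eqI, auto)
  then show "\<exists>r\<in>carrier (loc_module R M U). r \<oplus>\<^bsub>loc_module R M U\<^esub> p = \<zero>\<^bsub>loc_module R M U\<^esub>"
    using p by (intro bexI[of _ "fm (\<ominus>\<^bsub>M\<^esub> x) s"]) (auto intro: fm_in)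
  fix p' assume "p' \<in> carrier (loc_module R M U)"
  then obtain y t where p': "p' = fm y t" "y \<in> carrier M" "t \<in> U" unfolding loc_carrier by blast
  note pc' = U_carrier[OF p'(3)]
  show "p \<oplus>\<^bsub>loc_module R M U\<^esub> p' \<in> carrier (loc_module R M U)"
    unfolding loc_module_ops p(1) p'(1) using p p' pc pc' U_mult by (subst loc_add_fm) (auto intro!: fm_in)
  show "p \<oplus>\<^bsub>loc_module R M U\<^esub> p' = p' \<oplus>\<^bsub>loc_module R M U\<^esub> p"
    unfolding loc_module_ops p(1) p'(1) using p p' pc pc' U_mult
    by (simp add: loc_add_fm M.a_comm R.m_comm)
  fix p'' assume "p'' \<in> carrier (loc_module R M U)"
  then obtain z w where p'': "p'' = fm z w" "z \<in> carrier M" "w \<in> U" unfolding loc_carrier by blast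
  note pc'' = U_carrier[OF p''(3)]
  show "p \<oplus>\<^bsub>loc_module R M U\<^esub> p' \<oplus>\<^bsub>loc_module R M U\<^esub> p'' = p \<oplus>\<^bsub>loc_module R M U\<^esub> (p' \<oplus>\<^bsub>loc_module R M U\<^esub> p'')"
    unfolding loc_module_ops p(1) p'(1) p''(1) using p p' p'' pc pc' pc'' U_mult
    by (simp add: loc_add_fm smult_r_distr smult_assoc1[symmetric] R.m_ac M.a_ac)
qed (simp add: loc_module_ops fm_in U_one)

lemma loc_ring_ops:
  "carrier (loc_ring R U) = {fr a s | a s. a \<in> carrier R \<and> s \<in> U}"
  "\<zero>\<^bsub>loc_ring R U\<^esub> = fr \<zero> \<one>" "\<one>\<^bsub>loc_ring R U\<^esub> = fr \<one> \<one>"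
  "x \<oplus>\<^bsub>loc_ring R U\<^esub> y = loc_add R (regular_module R) U x y"
  "x \<otimes>\<^bsub>loc_ring R U\<^esub> y = loc_smult R (regular_module R) U x y"
  by (auto simp: loc_ring_def Let_def quotient_def loc_frac_def)

lemma fr_in: "a \<in> carrier R \<Longrightarrow> s \<in> U \<Longrightarrow> fr a s \<in> carrier (loc_ring R U)"
  unfolding loc_ring_ops by blast

lemma fr_add:
  "a \<in> carrier R \<Longrightarrow> s \<in> U \<Longrightarrow> c \<in> carrier R \<Longrightarrow> t \<in> U \<Longrightarrow>
    fr a s \<oplus>\<^bsub>loc_ring R U\<^esub> fr c t = fr (t \<otimes> a \<oplus> s \<otimes> c) (s \<otimes> t)"
  unfolding loc_ring_ops using localization.loc_add_fm[OF localization_regular[OF localization_axioms], of a s c t]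
  by simp

lemma fr_mult:
  "a \<in> carrier R \<Longrightarrow> s \<in> U \<Longrightarrow> c \<in> carrier R \<Longrightarrow> t \<in> U \<Longrightarrow>
    fr a s \<otimes>\<^bsub>loc_ring R U\<^esub> fr c t = fr (a \<otimes> c) (s \<otimes> t)"
  unfolding loc_ring_ops using localization.loc_smult_fm[OF localization_regular[OF localization_axioms], of a s c t]
  by simp

lemma fr_eqI:
  assumes "a \<in> carrier R" "c \<in> carrier R" "s \<in> U" "t \<in> U" "t \<otimes> a = s \<otimes> c"
  shows "fr a s = fr c t"
  using localization.fm_eqI[OF localization_regular[OF localization_axioms], of a c s t] assms by simp

lemma loc_smult_eq:
  "a \<in> carrier R \<Longrightarrow> s \<in> U \<Longrightarrow> y \<in> carrier M \<Longrightarrow> t \<in> U \<Longrightarrow>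
    fr a s \<odot>\<^bsub>loc_module R M U\<^esub> fm y t = fm (a \<odot>\<^bsub>M\<^esub> y) (s \<otimes> t)"
  unfolding loc_module_ops by (rule loc_smult_fm)

lemma loc_add_eq:
  "x \<in> carrier M \<Longrightarrow> s \<in> U \<Longrightarrow> y \<in> carrier M \<Longrightarrow> t \<in> U \<Longrightarrow>
    fm x s \<oplus>\<^bsub>loc_module R M U\<^esub> fm y t = fm (t \<odot>\<^bsub>M\<^esub> x \<oplus>\<^bsub>M\<^esub> s \<odot>\<^bsub>M\<^esub> y) (s \<otimes> t)"
  unfolding loc_module_ops by (rule loc_add_fm)

lemma loc_ring_cring: "cring (loc_ring R U)"
proof (rule cringI)
  \<comment> \<open>The additive part of \<open>loc_ring\<close> is that of the localized regular
    module, so its group laws are already available.\<close>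
  have eq: "carrier (loc_ring R U) = carrier (loc_module R (regular_module R) U)"
    "\<zero>\<^bsub>loc_ring R U\<^esub> = \<zero>\<^bsub>loc_module R (regular_module R) U\<^esub>"
    "add (loc_ring R U) = add (loc_module R (regular_module R) U)"
    by (simp_all add: loc_ring_def loc_module_def Let_def)
  have "abelian_group (loc_module R (regular_module R) U)"
    by (rule localization.loc_module_abelian_group[OF localization_regular[OF localization_axioms]])
  then interpret L: abelian_group "loc_module R (regular_module R) U" .
  show "abelian_group (loc_ring R U)"
  proof (rule abelian_groupI, unfold eq)
    show "\<exists>y\<in>carrier (loc_module R (regular_module R) U). y \<oplus>\<^bsub>loc_module R (regular_module R) U\<^esub> x = \<zero>\<^bsub>loc_module R (regular_module R) U\<^esub>"
      if "x \<in> carrier (loc_module R (regular_module R) U)" for x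
      using that L.l_neg by blast
    show "x \<oplus>\<^bsub>loc_module R (regular_module R) U\<^esub> y = y \<oplus>\<^bsub>loc_module R (regular_module R) U\<^esub> x"
      if "x \<in> carrier (loc_module R (regular_module R) U)" "y \<in> carrier (loc_module R (regular_module R) U)" for x y
      by (rule L.a_comm[OF that])
  qed (auto simp: L.a_assoc)
  show "comm_monoid (loc_ring R U)"
  proof (rule comm_monoidI)
    fix p assume "p \<in> carrier (loc_ring R U)"
    then obtain a s where p: "p = fr a s" "a \<in> carrier R" "s \<in> U" unfolding loc_ring_ops by blast
    note pc = U_carrier[OF p(3)]
    show "\<one>\<^bsub>loc_ring R U\<^esub> \<otimes>\<^bsub>loc_ring R U\<^esub> p = p"
      unfolding loc_ring_ops(3) p(1) using p pc U_one by (simp add: fr_mult)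
    fix p' assume "p' \<in> carrier (loc_ring R U)"
    then obtain c t where p': "p' = fr c t" "c \<in> carrier R" "t \<in> U" unfolding loc_ring_ops by blast
    note pc' = U_carrier[OF p'(3)]
    show "p \<otimes>\<^bsub>loc_ring R U\<^esub> p' \<in> carrier (loc_ring R U)"
      unfolding p p' using p p' U_mult by (simp add: fr_mult fr_in)
    show "p \<otimes>\<^bsub>loc_ring R U\<^esub> p' = p' \<otimes>\<^bsub>loc_ring R U\<^esub> p"
      unfolding p p' using p p' pc pc' by (simp add: fr_mult R.m_comm)
    fix p'' assume "p'' \<in> carrier (loc_ring R U)"
    then obtain e w where p'': "p'' = fr e w" "e \<in> carrier R" "w \<in> U" unfolding loc_ring_ops by blast
    note pc'' = U_carrier[OF p''(3)]
    show "p \<otimes>\<^bsub>loc_ring R U\<^esub> p' \<otimes>\<^bsub>loc_ring R U\<^esub> p'' = p \<otimes>\<^bsub>loc_ring R U\<^esub> (p' \<otimes>\<^bsub>loc_ring R U\<^esub> p'')"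
      unfolding p p' p'' using p p' p'' pc pc' pc'' U_mult by (simp add: fr_mult R.m_assoc)
  qed (simp add: loc_ring_ops(3) fr_in U_one)
  fix p p' p'' assume "p \<in> carrier (loc_ring R U)" "p' \<in> carrier (loc_ring R U)" "p'' \<in> carrier (loc_ring R U)"
  then obtain a s c t e w where p: "p = fr a s" "a \<in> carrier R" "s \<in> U" and p': "p' = fr c t" "c \<in> carrier R" "t \<in> U"
    and p'': "p'' = fr e w" "e \<in> carrier R" "w \<in> U" unfolding loc_ring_ops by blast
  note pc = U_carrier[OF p(3)] U_carrier[OF p'(3)] U_carrier[OF p''(3)]
  show "(p \<oplus>\<^bsub>loc_ring R U\<^esub> p') \<otimes>\<^bsub>loc_ring R U\<^esub> p'' = p \<otimes>\<^bsub>loc_ring R U\<^esub> p'' \<oplus>\<^bsub>loc_ring R U\<^esub> p' \<otimes>\<^bsub>loc_ring R U\<^esub> p''"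
    unfolding p(1) p'(1) p''(1) using p(2,3) p'(2,3) p''(2,3) pc U_mult
    by (simp add: fr_mult fr_add, intro fr_eqI) (auto simp: R.l_distr R.r_distr R.m_ac)
qed

lemma loc_module_module: "module (loc_ring R U) (loc_module R M U)"
proof (rule moduleI[OF loc_ring_cring loc_module_abelian_group])
  fix p x assume "p \<in> carrier (loc_ring R U)" "x \<in> carrier (loc_module R M U)"
  then obtain a s y w where p: "p = fr a s" "a \<in> carrier R" "s \<in> U"
    and x: "x = fm y w" "y \<in> carrier M" "w \<in> U" unfolding loc_ring_ops loc_carrier by blast
  note pc = U_carrier[OF p(3)] U_carrier[OF x(3)]
  show "p \<odot>\<^bsub>loc_module R M U\<^esub> x \<in> carrier (loc_module R M U)"
    unfolding p x using p x U_mult by (simp add: loc_smult_eq fm_in)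
  {
    fix p' assume "p' \<in> carrier (loc_ring R U)"
    then obtain c t where p': "p' = fr c t" "c \<in> carrier R" "t \<in> U" unfolding loc_ring_ops by blast
    note pc = pc U_carrier[OF p'(3)]
    show "(p \<oplus>\<^bsub>loc_ring R U\<^esub> p') \<odot>\<^bsub>loc_module R M U\<^esub> x = p \<odot>\<^bsub>loc_module R M U\<^esub> x \<oplus>\<^bsub>loc_module R M U\<^esub> p' \<odot>\<^bsub>loc_module R M U\<^esub> x"
      unfolding p(1) p'(1) x(1) using p(2,3) p'(2,3) x(2,3) pc U_mult
      by (simp add: fr_add loc_smult_eq loc_add_eq, intro fm_eqI)
        (auto simp: smult_l_distr smult_r_distr smult_assoc1[symmetric] R.m_ac)
    show "(p \<otimes>\<^bsub>loc_ring R U\<^esub> p') \<odot>\<^bsub>loc_module R M U\<^esub> x = p \<odot>\<^bsub>loc_module R M U\<^esub> (p' \<odot>\<^bsub>loc_module R M U\<^esub> x)"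
      unfolding p(1) p'(1) x(1) using p(2,3) p'(2,3) x(2,3) pc U_mult
      by (simp add: fr_mult loc_smult_eq smult_assoc1 R.m_assoc)
  }
  fix x' assume "x' \<in> carrier (loc_module R M U)"
  then obtain z v where x': "x' = fm z v" "z \<in> carrier M" "v \<in> U" unfolding loc_carrier by blast
  note pc = pc U_carrier[OF x'(3)]
  show "p \<odot>\<^bsub>loc_module R M U\<^esub> (x \<oplus>\<^bsub>loc_module R M U\<^esub> x') = p \<odot>\<^bsub>loc_module R M U\<^esub> x \<oplus>\<^bsub>loc_module R M U\<^esub> p \<odot>\<^bsub>loc_module R M U\<^esub> x'"
    unfolding p(1) x(1) x'(1) using p(2,3) x(2,3) x'(2,3) pc U_mult
    by (simp add: loc_smult_eq loc_add_eq, intro fm_eqI)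
      (auto simp: smult_l_distr smult_r_distr smult_assoc1[symmetric] R.m_ac)
next
  fix x assume "x \<in> carrier (loc_module R M U)"
  then obtain y w where x: "x = fm y w" "y \<in> carrier M" "w \<in> U" unfolding loc_carrier by blast
  show "\<one>\<^bsub>loc_ring R U\<^esub> \<odot>\<^bsub>loc_module R M U\<^esub> x = x"
    unfolding loc_ring_ops(3) x(1) using x U_carrier[OF x(3)] U_one by (simp add: loc_smult_eq)
qed

lemma fr_hom: "(\<lambda>a. fr a \<one>) \<in> ring_hom R (loc_ring R U)"
  by (rule ring_hom_memI) (use U_one in \<open>simp_all add: fr_in fr_mult fr_add loc_ring_ops(3)\<close>)

text \<open>For a submodule \<open>N\<close> of the localization, the x with x/1 in \<open>N\<close>
  form a submodule of \<open>M\<close>. If it contains the generators it is all of \<open>M\<close>,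
  and the scalars 1/s then give every fraction.\<close>

lemma loc_finitely_generated:
  assumes "finitely_generated_module R M"
  shows "finitely_generated_module (loc_ring R U) (loc_module R M U)"
proof -
  interpret L: module "loc_ring R U" "loc_module R M U" by (rule loc_module_module)
  obtain G where G: "finite G" "G \<subseteq> carrier M"
    and gen: "\<And>N. submodule N R M \<Longrightarrow> G \<subseteq> N \<Longrightarrow> carrier M \<subseteq> N"
    using assms finitely_generated_iff by blast
  show ?thesis unfolding L.finitely_generated_iff
  proof (intro exI conjI allI impI)
    show "finite ((\<lambda>x. fm x \<one>) ` G)" using G by simp
    show "(\<lambda>x. fm x \<one>) ` G \<subseteq> carrier (loc_module R M U)" using G U_one fm_in by auto
    fix N assume N: "submodule N (loc_ring R U) (loc_module R M U)" "(\<lambda>x. fm x \<one>) ` G \<subseteq> N"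
    note N' = L.submoduleE[OF N(1)] L.submodule_zero[OF N(1)]
    have sm: "fm (a \<odot>\<^bsub>M\<^esub> x) \<one> \<in> N" if "a \<in> carrier R" "x \<in> carrier M" "fm x \<one> \<in> N" for a x
      using N'(4)[OF fr_in[OF that(1) U_one] that(3)] that U_one by (simp add: loc_smult_eq)
    have "submodule {x \<in> carrier M. fm x \<one> \<in> N} R M"
    proof (rule submoduleI)
      show "\<zero>\<^bsub>M\<^esub> \<in> {x \<in> carrier M. fm x \<one> \<in> N}" using N'(7) by (simp add: loc_module_ops)
      show "\<ominus>\<^bsub>M\<^esub> x \<in> {x \<in> carrier M. fm x \<one> \<in> N}" if "x \<in> {x \<in> carrier M. fm x \<one> \<in> N}" for x
        using sm[of "\<ominus> \<one>" x] that by (simp add: smult_l_minus)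
      show "x \<oplus>\<^bsub>M\<^esub> y \<in> {x \<in> carrier M. fm x \<one> \<in> N}"
        if "x \<in> {x \<in> carrier M. fm x \<one> \<in> N}" "y \<in> {x \<in> carrier M. fm x \<one> \<in> N}" for x y
        using N'(5)[of "fm x \<one>" "fm y \<one>"] that U_one by (simp add: loc_add_eq)
    qed (use sm in auto)
    moreover have "G \<subseteq> {x \<in> carrier M. fm x \<one> \<in> N}" using G N(2) by auto
    ultimately have all: "carrier M \<subseteq> {x \<in> carrier M. fm x \<one> \<in> N}" by (rule gen)
    show "carrier (loc_module R M U) \<subseteq> N"
    proof
      fix p assume "p \<in> carrier (loc_module R M U)"
      then obtain x s where p: "p = fm x s" "x \<in> carrier M" "s \<in> U" unfolding loc_carrier by blast
      have "fm x \<one> \<in> N" using all p(2) by blast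
      then have "fr \<one> s \<odot>\<^bsub>loc_module R M U\<^esub> fm x \<one> \<in> N" using N'(4)[OF fr_in[OF R.one_closed p(3)]] by blast
      then show "p \<in> N" unfolding p(1) using p U_one U_carrier[OF p(3)] by (simp add: loc_smult_eq)
    qed
  qed
qed

end

section \<open>The maximal Cohen-Macaulay property of the push-forward of a ring\<close>

lemma frobenius_ring_simps [simp]:
  "carrier (frobenius_ring p e A) = carrier A" "\<zero>\<^bsub>frobenius_ring p e A\<^esub> = \<zero>\<^bsub>A\<^esub>"
  "x \<oplus>\<^bsub>frobenius_ring p e A\<^esub> y = x \<oplus>\<^bsub>A\<^esub> y"
  "a \<odot>\<^bsub>frobenius_ring p e A\<^esub> x = a [^]\<^bsub>A\<^esub> (p ^ e) \<otimes>\<^bsub>A\<^esub> x"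
  by (simp_all add: frobenius_pushforward_def regular_module_def with_smult_def)

text \<open>The definition distinguishes local from non-local rings. Both cases are instances of
  \<open>localized_powers\<close>: the identity maps for a local ring, and the maps into the
  localization at a maximal ideal otherwise.\<close>

theorem cm_ring_frobenius_mcm:
  assumes cm: "cm_ring A d" and F: "module A (frobenius_ring p e A)"
    and fg: "finitely_generated_module A (frobenius_ring p e A)" and p: "p > 0"
  shows "maximal_cohen_macaulay A (frobenius_ring p e A)"
proof -
  interpret A: cring A using cm unfolding cm_ring_def by simp
  interpret F: module A "frobenius_ring p e A" by fact
  define q where "q = p ^ e"
  have q: "q \<ge> 1" using p by (simp add: q_def)
  show ?thesis unfolding maximal_cohen_macaulay_def
  proof (intro conjI)
    show "noetherian_ring A" using cm unfolding cm_ring_def by simp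
    show "if local_ring A then mcm_local A (frobenius_ring p e A)
      else \<forall>I. maximalideal I A \<and> I \<in> Supp A (frobenius_ring p e A) \<longrightarrow>
        mcm_local (ring_at A I) (module_at A (frobenius_ring p e A) I)"
    proof (split if_split, intro conjI impI allI)
      assume loc: "local_ring A"
      then obtain I where I: "maximalideal I A" "\<And>J. maximalideal J A \<Longrightarrow> J = I"
        unfolding local_ring_def by blast
      have one: "\<one>\<^bsub>A\<^esub> \<in> carrier A - I" using I(1) unfolding A.maximalideal_iff by auto
      interpret L: localized_powers A A "frobenius_ring p e A" I q "\<lambda>x. x" "\<lambda>x. x" d
      proof (intro localized_powers.intro localized_powers_axioms.intro)
        show "maximalideal I A" by fact
        \<comment> \<open>A nonunit generates a proper ideal, which lies in some maximal ideal, and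
          \<open>I\<close> is the only one.\<close>
        show "s \<in> Units A" if s: "s \<in> carrier A - I" for s
        proof (rule ccontr)
          assume "s \<notin> Units A"
          have "ideal (PIdl\<^bsub>A\<^esub> s) A" using s by (intro A.cgenideal_ideal) auto
          moreover have "PIdl\<^bsub>A\<^esub> s \<inter> {\<one>\<^bsub>A\<^esub>} = {}"
          proof (rule ccontr)
            assume "PIdl\<^bsub>A\<^esub> s \<inter> {\<one>\<^bsub>A\<^esub>} \<noteq> {}"
            then obtain x where x: "x \<in> carrier A" "x \<otimes>\<^bsub>A\<^esub> s = \<one>\<^bsub>A\<^esub>" unfolding cgenideal_def by auto
            then have "s \<otimes>\<^bsub>A\<^esub> x = \<one>\<^bsub>A\<^esub>" using s by (simp add: A.m_comm)
            then have "s \<in> Units A" using x s unfolding Units_def by blast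
            then show False using \<open>s \<notin> Units A\<close> by simp
          qed
          ultimately obtain M where "maximalideal M A" "PIdl\<^bsub>A\<^esub> s \<subseteq> M"
            using A.exists_maximal_above[of "PIdl\<^bsub>A\<^esub> s"] by auto
          then have "s \<in> I" using I(2) A.cgenideal_self[of s] s by blast
          then show False using s by simp
        qed
        show "\<exists>a\<in>carrier A. \<exists>s\<in>carrier A - I. s \<otimes>\<^bsub>A\<^esub> x = a" if "x \<in> carrier A" for x
          using that one by (intro bexI[of _ x] bexI[of _ "\<one>\<^bsub>A\<^esub>"]) auto
        show "\<exists>s\<in>carrier A - I. s \<otimes>\<^bsub>A\<^esub> x = \<zero>\<^bsub>A\<^esub>" if "x \<in> carrier A" "x = \<zero>\<^bsub>A\<^esub>" for x
          using that one by (intro bexI[of _ "\<one>\<^bsub>A\<^esub>"]) auto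
        then show "\<exists>s\<in>carrier A - I. s \<otimes>\<^bsub>A\<^esub> x = \<zero>\<^bsub>A\<^esub>" if "x \<in> carrier A" "x = \<zero>\<^bsub>frobenius_ring p e A\<^esub>" for x
          using that by simp
        show "\<exists>x\<in>carrier A. \<exists>s\<in>carrier A - I. s \<odot>\<^bsub>frobenius_ring p e A\<^esub> y = x"
          if "y \<in> carrier (frobenius_ring p e A)" for y
          using that one by (intro bexI[of _ y] bexI[of _ "\<one>\<^bsub>A\<^esub>"]) auto
      qed (use cm q A.is_cring F in \<open>auto simp: q_def ring_hom_def\<close>)
      show "mcm_local A (frobenius_ring p e A)" by (rule L.mcm[OF fg])
    next
      fix I assume "maximalideal I A \<and> I \<in> Supp A (frobenius_ring p e A)"
      then have I: "maximalideal I A" by simp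
      interpret I: primeideal I A by (rule A.maximalideal_prime[OF I])
      have one: "\<one>\<^bsub>A\<^esub> \<in> carrier A - I" using I.I_notcarr I.one_imp_carrier by auto
      have mult: "s \<otimes>\<^bsub>A\<^esub> t \<in> carrier A - I" if "s \<in> carrier A - I" "t \<in> carrier A - I" for s t
        using that I.I_prime by auto
      have pow: "s [^]\<^bsub>A\<^esub> (k::nat) \<in> carrier A - I" if "s \<in> carrier A - I" for s k
      proof (induction k)
        case (Suc k)
        then show ?case using mult[OF Suc that] by simp
      qed (use one in simp)
      interpret W: localization A "frobenius_ring p e A" "carrier A - I"
        by unfold_locales (use one mult in auto)
      interpret C: cring "ring_at A I" by (rule W.loc_ring_cring)
      interpret N: module "ring_at A I" "module_at A (frobenius_ring p e A) I" by (rule W.loc_module_module)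
      interpret L: localized_powers A "ring_at A I" "module_at A (frobenius_ring p e A) I" I q
        "\<lambda>a. W.fr a \<one>\<^bsub>A\<^esub>" "\<lambda>x. W.fm x \<one>\<^bsub>A\<^esub>" d
      proof (intro localized_powers.intro localized_powers_axioms.intro)
        show "maximalideal I A" by fact
        show "(\<lambda>a. W.fr a \<one>\<^bsub>A\<^esub>) \<in> ring_hom A (ring_at A I)" by (rule W.fr_hom)
        show "W.fr s \<one>\<^bsub>A\<^esub> \<in> Units (ring_at A I)" if s: "s \<in> carrier A - I" for s
        proof -
          have "W.fr s \<one>\<^bsub>A\<^esub> \<otimes>\<^bsub>ring_at A I\<^esub> W.fr \<one>\<^bsub>A\<^esub> s = \<one>\<^bsub>ring_at A I\<^esub>"
            unfolding W.loc_ring_ops(3) using s one by (simp add: W.fr_mult) (rule W.fr_eqI, auto)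
          moreover from this have "W.fr \<one>\<^bsub>A\<^esub> s \<otimes>\<^bsub>ring_at A I\<^esub> W.fr s \<one>\<^bsub>A\<^esub> = \<one>\<^bsub>ring_at A I\<^esub>"
            using C.m_comm W.fr_in s one by (metis Diff_iff A.one_closed)
          ultimately show ?thesis unfolding Units_def using W.fr_in s one by blast
        qed
        show "\<exists>a\<in>carrier A. \<exists>s\<in>carrier A - I. W.fr s \<one>\<^bsub>A\<^esub> \<otimes>\<^bsub>ring_at A I\<^esub> x = W.fr a \<one>\<^bsub>A\<^esub>"
          if x: "x \<in> carrier (ring_at A I)" for x
        proof -
          obtain a s where as: "x = W.fr a s" "a \<in> carrier A" "s \<in> carrier A - I" using x unfolding W.loc_ring_ops by blast
          have "W.fr s \<one>\<^bsub>A\<^esub> \<otimes>\<^bsub>ring_at A I\<^esub> x = W.fr a \<one>\<^bsub>A\<^esub>"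
            unfolding as(1) using as(2,3) one by (simp add: W.fr_mult) (rule W.fr_eqI, auto)
          then show ?thesis using as by blast
        qed
        show "\<exists>s\<in>carrier A - I. s \<otimes>\<^bsub>A\<^esub> a = \<zero>\<^bsub>A\<^esub>" if a: "a \<in> carrier A" "W.fr a \<one>\<^bsub>A\<^esub> = \<zero>\<^bsub>ring_at A I\<^esub>" for a
        proof -
          interpret W': localization A "regular_module A" "carrier A - I"
            by (rule F.localization_regular[OF W.localization_axioms])
          show ?thesis using a one W'.fm_eq_iff[of a "\<zero>\<^bsub>A\<^esub>" "\<one>\<^bsub>A\<^esub>" "\<one>\<^bsub>A\<^esub>"] by (auto simp: W.loc_ring_ops(2))
        qed
        show "W.fm x \<one>\<^bsub>A\<^esub> \<in> carrier (module_at A (frobenius_ring p e A) I)" if "x \<in> carrier A" for x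
          using that one by (intro W.fm_in) auto
        show "W.fm (x \<oplus>\<^bsub>A\<^esub> y) \<one>\<^bsub>A\<^esub> = W.fm x \<one>\<^bsub>A\<^esub> \<oplus>\<^bsub>module_at A (frobenius_ring p e A) I\<^esub> W.fm y \<one>\<^bsub>A\<^esub>"
          if "x \<in> carrier A" "y \<in> carrier A" for x y
          using that one by (subst W.loc_add_eq) auto
        show "W.fr a \<one>\<^bsub>A\<^esub> \<odot>\<^bsub>module_at A (frobenius_ring p e A) I\<^esub> W.fm x \<one>\<^bsub>A\<^esub> = W.fm (a [^]\<^bsub>A\<^esub> q \<otimes>\<^bsub>A\<^esub> x) \<one>\<^bsub>A\<^esub>"
          if "a \<in> carrier A" "x \<in> carrier A" for a x
          using that one by (subst W.loc_smult_eq) (auto simp: q_def)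
        show "\<exists>x\<in>carrier A. \<exists>s\<in>carrier A - I. W.fr s \<one>\<^bsub>A\<^esub> \<odot>\<^bsub>module_at A (frobenius_ring p e A) I\<^esub> y = W.fm x \<one>\<^bsub>A\<^esub>"
          if y: "y \<in> carrier (module_at A (frobenius_ring p e A) I)" for y
        proof -
          obtain x s where xs: "y = W.fm x s" "x \<in> carrier A" "s \<in> carrier A - I" using y unfolding W.loc_carrier by auto
          have "W.fr s \<one>\<^bsub>A\<^esub> \<odot>\<^bsub>module_at A (frobenius_ring p e A) I\<^esub> y = W.fm x \<one>\<^bsub>A\<^esub>"
            unfolding xs(1) using xs(2,3) one by (simp add: W.loc_smult_eq) (rule W.fm_eqI, auto)
          then show ?thesis using xs by blast
        qed
        show "\<exists>s\<in>carrier A - I. s \<otimes>\<^bsub>A\<^esub> x = \<zero>\<^bsub>A\<^esub>"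
          if x: "x \<in> carrier A" "W.fm x \<one>\<^bsub>A\<^esub> = \<zero>\<^bsub>module_at A (frobenius_ring p e A) I\<^esub>" for x
        proof -
          \<comment> \<open>Equality of fractions in the push-forward provides a scalar u acting as
            multiplication by u^q; this power is again outside \<open>I\<close> and is the
            multiplier sought.\<close>
          obtain u where u: "u \<in> carrier A - I" "u [^]\<^bsub>A\<^esub> q \<otimes>\<^bsub>A\<^esub> x = \<zero>\<^bsub>A\<^esub>"
            using x one W.fm_eq_iff[of x "\<zero>\<^bsub>A\<^esub>" "\<one>\<^bsub>A\<^esub>" "\<one>\<^bsub>A\<^esub>"] by (auto simp: W.loc_module_ops q_def)
          then show ?thesis using pow by blast
        qed
      qed (use cm q A.is_cring C.is_cring N.module_axioms W.loc_module_module in auto)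
      show "mcm_local (ring_at A I) (module_at A (frobenius_ring p e A) I)"
        by (rule L.mcm[OF W.loc_finitely_generated[OF fg]])
    qed
  qed (use F fg in auto)
qed

section \<open>The push-forward as a cokernel\<close>

text \<open>Lets the cokernel, whose operations are defined on cosets, receive its module axioms
  from the push-forward along a bijection.\<close>

lemma module_transport:
  assumes M: "module A M" and bij: "bij_betw h (carrier M) (carrier N)"
    and add: "\<And>x y. x \<in> carrier M \<Longrightarrow> y \<in> carrier M \<Longrightarrow> h (x \<oplus>\<^bsub>M\<^esub> y) = h x \<oplus>\<^bsub>N\<^esub> h y"
    and smult: "\<And>a x. a \<in> carrier A \<Longrightarrow> x \<in> carrier M \<Longrightarrow> h (a \<odot>\<^bsub>M\<^esub> x) = a \<odot>\<^bsub>N\<^esub> h x"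
    and zero: "h \<zero>\<^bsub>M\<^esub> = \<zero>\<^bsub>N\<^esub>"
  shows "module A N"
proof -
  interpret M: module A M by fact
  have cN: "carrier N = h ` carrier M" using bij by (simp add: bij_betw_def)
  show ?thesis
  proof (rule moduleI)
    show "cring A" by (rule M.R.is_cring)
    show "abelian_group N"
    proof (rule abelian_groupI)
      show "\<zero>\<^bsub>N\<^esub> \<in> carrier N" unfolding cN zero[symmetric] by simp
      fix y assume "y \<in> carrier N"
      then obtain x where x: "y = h x" "x \<in> carrier M" unfolding cN by auto
      show "\<zero>\<^bsub>N\<^esub> \<oplus>\<^bsub>N\<^esub> y = y" using x add[of "\<zero>\<^bsub>M\<^esub>" x] zero by simp
      show "\<exists>z\<in>carrier N. z \<oplus>\<^bsub>N\<^esub> y = \<zero>\<^bsub>N\<^esub>"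
        using x add[of "\<ominus>\<^bsub>M\<^esub> x" x] zero unfolding cN by (intro bexI[of _ "h (\<ominus>\<^bsub>M\<^esub> x)"]) (auto simp: M.M.l_neg)
      fix y' assume "y' \<in> carrier N"
      then obtain x' where x': "y' = h x'" "x' \<in> carrier M" unfolding cN by auto
      show "y \<oplus>\<^bsub>N\<^esub> y' \<in> carrier N" unfolding cN x(1) x'(1) add[OF x(2) x'(2), symmetric] using x x' by simp
      show "y \<oplus>\<^bsub>N\<^esub> y' = y' \<oplus>\<^bsub>N\<^esub> y"
        unfolding x(1) x'(1) add[OF x(2) x'(2), symmetric] add[OF x'(2) x(2), symmetric]
        using M.M.a_comm[OF x(2) x'(2)] by simp
      fix y'' assume "y'' \<in> carrier N"
      then obtain x'' where x'': "y'' = h x''" "x'' \<in> carrier M" unfolding cN by auto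
      show "y \<oplus>\<^bsub>N\<^esub> y' \<oplus>\<^bsub>N\<^esub> y'' = y \<oplus>\<^bsub>N\<^esub> (y' \<oplus>\<^bsub>N\<^esub> y'')"
        using x x' x'' by (simp add: add[symmetric] M.M.a_assoc)
    qed
  next
    fix a y assume a: "a \<in> carrier A" and "y \<in> carrier N"
    then obtain x where x: "y = h x" "x \<in> carrier M" unfolding cN by auto
    show "a \<odot>\<^bsub>N\<^esub> y \<in> carrier N" unfolding cN x(1) using a x(2) by (simp add: smult[symmetric])
    show "(a \<oplus>\<^bsub>A\<^esub> b) \<odot>\<^bsub>N\<^esub> y = a \<odot>\<^bsub>N\<^esub> y \<oplus>\<^bsub>N\<^esub> b \<odot>\<^bsub>N\<^esub> y" if "b \<in> carrier A" for b
      using a x that by (simp add: smult[symmetric] add[symmetric] M.smult_l_distr)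
    show "(a \<otimes>\<^bsub>A\<^esub> b) \<odot>\<^bsub>N\<^esub> y = a \<odot>\<^bsub>N\<^esub> (b \<odot>\<^bsub>N\<^esub> y)" if "b \<in> carrier A" for b
      using a x that by (simp add: smult[symmetric] M.smult_assoc1)
    fix y' assume "y' \<in> carrier N"
    then obtain x' where x': "y' = h x'" "x' \<in> carrier M" unfolding cN by auto
    show "a \<odot>\<^bsub>N\<^esub> (y \<oplus>\<^bsub>N\<^esub> y') = a \<odot>\<^bsub>N\<^esub> y \<oplus>\<^bsub>N\<^esub> a \<odot>\<^bsub>N\<^esub> y'"
      using a x x' by (simp add: smult[symmetric] add[symmetric] M.smult_r_distr)
  next
    fix y assume "y \<in> carrier N"
    then obtain x where x: "y = h x" "x \<in> carrier M" unfolding cN by auto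
    show "\<one>\<^bsub>A\<^esub> \<odot>\<^bsub>N\<^esub> y = y" using x smult[of "\<one>\<^bsub>A\<^esub>" x] by simp
  qed
qed

text \<open>Additivity of the q-th power is the distributive law for a sum of scalars; the other
  axioms hold by commutativity.\<close>

lemma frobenius_ring_module:
  assumes "cring A" and "\<And>a b. a \<in> carrier A \<Longrightarrow> b \<in> carrier A \<Longrightarrow>
      (a \<oplus>\<^bsub>A\<^esub> b) [^]\<^bsub>A\<^esub> (p ^ e) = a [^]\<^bsub>A\<^esub> (p ^ e) \<oplus>\<^bsub>A\<^esub> b [^]\<^bsub>A\<^esub> (p ^ e)"
  shows "module A (frobenius_ring p e A)"
proof -
  interpret A: cring A by fact
  show ?thesis
  proof (rule moduleI)
    show "abelian_group (frobenius_ring p e A)"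
    proof (rule abelian_groupI)
      fix x assume "x \<in> carrier (frobenius_ring p e A)"
      then show "\<exists>y\<in>carrier (frobenius_ring p e A). y \<oplus>\<^bsub>frobenius_ring p e A\<^esub> x = \<zero>\<^bsub>frobenius_ring p e A\<^esub>"
        by (intro bexI[of _ "\<ominus>\<^bsub>A\<^esub> x"]) (auto simp: A.l_neg)
    qed (auto simp: A.a_ac)
  qed (use assms in \<open>auto simp: A.l_distr A.r_distr A.m_ac A.nat_pow_distrib A.nat_pow_one\<close>)
qed

lemma restrict_scalars_simps [simp]:
  "carrier (restrict_scalars h M) = carrier M" "\<zero>\<^bsub>restrict_scalars h M\<^esub> = \<zero>\<^bsub>M\<^esub>"
  "x \<oplus>\<^bsub>restrict_scalars h M\<^esub> y = x \<oplus>\<^bsub>M\<^esub> y" "a \<odot>\<^bsub>restrict_scalars h M\<^esub> x = h a \<odot>\<^bsub>M\<^esub> x"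
  by (simp_all add: restrict_scalars_def with_smult_def)

lemma restrict_scalars_module:
  assumes A: "cring A" and h: "h \<in> ring_hom A B" and M: "module B M"
  shows "module A (restrict_scalars h M)"
proof -
  interpret M: module B M by fact
  note h' = ring_hom_closed[OF h] ring_hom_add[OF h] ring_hom_mult[OF h] ring_hom_one[OF h]
  show ?thesis
  proof (rule moduleI[OF A])
    show "abelian_group (restrict_scalars h M)"
    proof (rule abelian_groupI)
      fix x assume "x \<in> carrier (restrict_scalars h M)"
      then show "\<exists>y\<in>carrier (restrict_scalars h M). y \<oplus>\<^bsub>restrict_scalars h M\<^esub> x = \<zero>\<^bsub>restrict_scalars h M\<^esub>"
        by (intro bexI[of _ "\<ominus>\<^bsub>M\<^esub> x"]) (auto simp: M.M.l_neg)
    qed (auto simp: M.M.a_ac)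
  qed (auto simp: h' M.smult_l_distr M.smult_r_distr M.smult_assoc1)
qed

lemma descend_scalars_simps [simp]:
  "carrier (descend_scalars M) = carrier M" "\<zero>\<^bsub>descend_scalars M\<^esub> = \<zero>\<^bsub>M\<^esub>"
  "x \<oplus>\<^bsub>descend_scalars M\<^esub> y = x \<oplus>\<^bsub>M\<^esub> y" "V \<odot>\<^bsub>descend_scalars M\<^esub> x = (THE y. \<forall>a\<in>V. a \<odot>\<^bsub>M\<^esub> x = y)"
  by (simp_all add: descend_scalars_def with_smult_def)

text \<open>Collects what the comparison with the cokernel uses: the q-th power is additive, and
  each s is a sum of c_i^q i with unique coordinates c. The latter says that \<open>D\<close> is a
  basis of the push-forward of \<open>S\<close>.\<close>

locale frobenius_free = S: cring S for S :: "('a, 'c) ring_scheme" +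
  fixes p e :: nat and D :: "'a set" and f :: 'a and R :: "'a set ring"
  assumes R_eq: "R = S Quot (PIdl\<^bsub>S\<^esub> f)" and p_pos: "p > 0"
    and frob: "\<And>a b. a \<in> carrier S \<Longrightarrow> b \<in> carrier S \<Longrightarrow>
      (a \<oplus>\<^bsub>S\<^esub> b) [^]\<^bsub>S\<^esub> (p ^ e) = a [^]\<^bsub>S\<^esub> (p ^ e) \<oplus>\<^bsub>S\<^esub> b [^]\<^bsub>S\<^esub> (p ^ e)"
    and D: "finite D" "D \<subseteq> carrier S" and f: "f \<in> carrier S"
    and basis: "\<And>s. s \<in> carrier S \<Longrightarrow>
      \<exists>!c. c \<in> D \<rightarrow>\<^sub>E carrier S \<and> s = (\<Oplus>\<^bsub>S\<^esub>i\<in>D. c i [^]\<^bsub>S\<^esub> (p ^ e) \<otimes>\<^bsub>S\<^esub> i)"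
begin

abbreviation "q \<equiv> p ^ e"
abbreviation "I \<equiv> PIdl\<^bsub>S\<^esub> f"
abbreviation "\<pi> \<equiv> (\<lambda>s. I +>\<^bsub>S\<^esub> s)"

lemma I_ideal: "ideal I S" by (rule S.cgenideal_ideal[OF f])

sublocale I: ideal I S by (rule I_ideal)

lemma R_cring: "cring R" unfolding R_eq by (rule I.quotient_is_cring[OF S.is_cring])

sublocale R: cring R by (rule R_cring)

sublocale \<pi>: ring_hom_cring S R \<pi>
  by (rule ring_hom_cringI'[OF S.is_cring R_cring I.rcos_ring_hom[folded R_eq]])

lemma R_carrier: "carrier R = \<pi> ` carrier S"
  unfolding R_eq by (auto simp: FactRing_def A_RCOSETS_def')

lemma F_module: "module S (frobenius_ring p e S)"
  by (rule frobenius_ring_module[OF S.is_cring frob])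

lemma FR_module: "module R (frobenius_ring p e R)"
proof (rule frobenius_ring_module[OF R_cring])
  fix a b assume "a \<in> carrier R" "b \<in> carrier R"
  then obtain x y where xy: "x \<in> carrier S" "y \<in> carrier S" "a = \<pi> x" "b = \<pi> y" unfolding R_carrier by auto
  show "(a \<oplus>\<^bsub>R\<^esub> b) [^]\<^bsub>R\<^esub> q = a [^]\<^bsub>R\<^esub> q \<oplus>\<^bsub>R\<^esub> b [^]\<^bsub>R\<^esub> q"
    unfolding xy(3,4) using xy(1,2) \<pi>.hom_pow[of "x \<oplus>\<^bsub>S\<^esub> y" q] frob[OF xy(1,2)]
    by (simp add: \<pi>.hom_pow)
qed

definition comb :: "('a \<Rightarrow> 'a) \<Rightarrow> 'a" where "comb c = (\<Oplus>\<^bsub>S\<^esub>i\<in>D. c i [^]\<^bsub>S\<^esub> q \<otimes>\<^bsub>S\<^esub> i)"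

definition co :: "'a \<Rightarrow> 'a \<Rightarrow> 'a" where "co s = coordinates S (frobenius_ring p e S) D s"

text \<open>The push-forward changes the scalar action and keeps the addition, so finite sums agree
  with those of \<open>S\<close>.\<close>

lemma finsum_F:
  assumes "finite A" "g \<in> A \<rightarrow> carrier S"
  shows "finsum (frobenius_ring p e S) g A = finsum S g A"
proof -
  interpret F: module S "frobenius_ring p e S" by (rule F_module)
  show ?thesis using assms
  proof (induction A rule: finite_induct)
    case (insert x A)
    then show ?case by (simp add: F.M.finsum_insert S.finsum_insert Pi_iff)
  qed simp
qed

lemma comb_closed: "c \<in> D \<rightarrow>\<^sub>E carrier S \<Longrightarrow> comb c \<in> carrier S"
  unfolding comb_def using D by (intro S.finsum_closed) auto

lemma coordinates_comb:
  "c \<in> D \<rightarrow>\<^sub>E carrier S \<Longrightarrow>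
    (\<Oplus>\<^bsub>frobenius_ring p e S\<^esub>i\<in>D. c i \<odot>\<^bsub>frobenius_ring p e S\<^esub> i) = comb c"
  unfolding comb_def using D by (subst finsum_F) auto

lemma co_eqI:
  assumes "c \<in> D \<rightarrow>\<^sub>E carrier S" "s = comb c" shows "co s = c"
proof -
  have s: "s \<in> carrier S" using comb_closed assms by simp
  have eq: "(c \<in> D \<rightarrow>\<^sub>E carrier S \<and> s = (\<Oplus>\<^bsub>frobenius_ring p e S\<^esub>i\<in>D. c i \<odot>\<^bsub>frobenius_ring p e S\<^esub> i))
    \<longleftrightarrow> (c \<in> D \<rightarrow>\<^sub>E carrier S \<and> s = comb c)" for c
    using coordinates_comb by metis
  have "\<exists>!c. c \<in> D \<rightarrow>\<^sub>E carrier S \<and> s = comb c" using basis[OF s] unfolding comb_def .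
  then show ?thesis unfolding co_def coordinates_def eq using assms by (intro the1_equality) auto
qed

text \<open>Together with \<open>co_eqI\<close> this makes \<open>co\<close> and \<open>comb\<close>
  mutually inverse: \<open>co\<close> is the coordinate map from the push-forward to
  \<open>free_module S D\<close>.\<close>

lemma co:
  assumes "s \<in> carrier S" shows "co s \<in> D \<rightarrow>\<^sub>E carrier S" "comb (co s) = s"
proof -
  obtain c where c: "c \<in> D \<rightarrow>\<^sub>E carrier S" "s = comb c" using basis[OF assms] unfolding comb_def by blast
  then show "co s \<in> D \<rightarrow>\<^sub>E carrier S" "comb (co s) = s" using co_eqI[OF c] by auto
qed

lemma co_coeff: "s \<in> carrier S \<Longrightarrow> i \<in> D \<Longrightarrow> co s i \<in> carrier S"
  using co(1) by auto

lemma co_add: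
  assumes x: "x \<in> carrier S" and y: "y \<in> carrier S"
  shows "co (x \<oplus>\<^bsub>S\<^esub> y) = (\<lambda>i\<in>D. co x i \<oplus>\<^bsub>S\<^esub> co y i)"
proof (rule co_eqI)
  show "(\<lambda>i\<in>D. co x i \<oplus>\<^bsub>S\<^esub> co y i) \<in> D \<rightarrow>\<^sub>E carrier S" using co_coeff x y by auto
  have "comb (\<lambda>i\<in>D. co x i \<oplus>\<^bsub>S\<^esub> co y i) =
    (\<Oplus>\<^bsub>S\<^esub>i\<in>D. co x i [^]\<^bsub>S\<^esub> q \<otimes>\<^bsub>S\<^esub> i \<oplus>\<^bsub>S\<^esub> co y i [^]\<^bsub>S\<^esub> q \<otimes>\<^bsub>S\<^esub> i)"
    unfolding comb_def
  proof (rule S.finsum_cong')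
    fix i assume i: "i \<in> D"
    then have c: "i \<in> carrier S" "co x i \<in> carrier S" "co y i \<in> carrier S" using D co_coeff x y by auto
    show "(\<lambda>i\<in>D. co x i \<oplus>\<^bsub>S\<^esub> co y i) i [^]\<^bsub>S\<^esub> q \<otimes>\<^bsub>S\<^esub> i
      = co x i [^]\<^bsub>S\<^esub> q \<otimes>\<^bsub>S\<^esub> i \<oplus>\<^bsub>S\<^esub> co y i [^]\<^bsub>S\<^esub> q \<otimes>\<^bsub>S\<^esub> i"
      using i c by (simp add: frob S.l_distr)
  qed (use D co_coeff x y in auto)
  also have "\<dots> = comb (co x) \<oplus>\<^bsub>S\<^esub> comb (co y)"
    unfolding comb_def by (rule S.finsum_addf) (use D co_coeff x y in auto)
  finally show "x \<oplus>\<^bsub>S\<^esub> y = comb (\<lambda>i\<in>D. co x i \<oplus>\<^bsub>S\<^esub> co y i)" using co(2) x y by simp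
qed

text \<open>Linearity of \<open>co\<close> for the twisted action: multiplication by a^q on elements
  becomes multiplication by a on coordinates.\<close>

lemma co_smult:
  assumes a: "a \<in> carrier S" and x: "x \<in> carrier S"
  shows "co (a [^]\<^bsub>S\<^esub> q \<otimes>\<^bsub>S\<^esub> x) = (\<lambda>i\<in>D. a \<otimes>\<^bsub>S\<^esub> co x i)"
proof (rule co_eqI)
  show "(\<lambda>i\<in>D. a \<otimes>\<^bsub>S\<^esub> co x i) \<in> D \<rightarrow>\<^sub>E carrier S" using co_coeff x a by auto
  have "comb (\<lambda>i\<in>D. a \<otimes>\<^bsub>S\<^esub> co x i) = (\<Oplus>\<^bsub>S\<^esub>i\<in>D. a [^]\<^bsub>S\<^esub> q \<otimes>\<^bsub>S\<^esub> (co x i [^]\<^bsub>S\<^esub> q \<otimes>\<^bsub>S\<^esub> i))"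
    unfolding comb_def
  proof (rule S.finsum_cong')
    fix i assume i: "i \<in> D"
    then have c: "i \<in> carrier S" "co x i \<in> carrier S" using D co_coeff x by auto
    show "(\<lambda>i\<in>D. a \<otimes>\<^bsub>S\<^esub> co x i) i [^]\<^bsub>S\<^esub> q \<otimes>\<^bsub>S\<^esub> i = a [^]\<^bsub>S\<^esub> q \<otimes>\<^bsub>S\<^esub> (co x i [^]\<^bsub>S\<^esub> q \<otimes>\<^bsub>S\<^esub> i)"
      using i c a by (simp add: S.nat_pow_distrib S.m_assoc)
  qed (use D co_coeff x a in auto)
  also have "\<dots> = a [^]\<^bsub>S\<^esub> q \<otimes>\<^bsub>S\<^esub> comb (co x)"
    unfolding comb_def by (rule S.finsum_rdistr[symmetric]) (use D co_coeff x a in auto)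
  finally show "a [^]\<^bsub>S\<^esub> q \<otimes>\<^bsub>S\<^esub> x = comb (\<lambda>i\<in>D. a \<otimes>\<^bsub>S\<^esub> co x i)" using co(2) x by simp
qed

lemma co_zero: "co \<zero>\<^bsub>S\<^esub> = (\<lambda>i\<in>D. \<zero>\<^bsub>S\<^esub>)"
proof -
  have "\<zero>\<^bsub>S\<^esub> [^]\<^bsub>S\<^esub> q = \<zero>\<^bsub>S\<^esub>" using p_pos by (intro S.nat_pow_zero) simp
  then have "co \<zero>\<^bsub>S\<^esub> = (\<lambda>i\<in>D. \<zero>\<^bsub>S\<^esub> \<otimes>\<^bsub>S\<^esub> co \<zero>\<^bsub>S\<^esub> i)" using co_smult[of "\<zero>\<^bsub>S\<^esub>" "\<zero>\<^bsub>S\<^esub>"] by simp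
  also have "\<dots> = (\<lambda>i\<in>D. \<zero>\<^bsub>S\<^esub>)" using co_coeff[of "\<zero>\<^bsub>S\<^esub>"] by (intro restrict_ext) simp
  finally show ?thesis .
qed

lemma co_finsum:
  assumes "finite A" "g \<in> A \<rightarrow> carrier S" and i: "i \<in> D"
  shows "co (\<Oplus>\<^bsub>S\<^esub>j\<in>A. g j) i = (\<Oplus>\<^bsub>S\<^esub>j\<in>A. co (g j) i)"
  using assms(1,2)
proof (induction A rule: finite_induct)
  case empty
  then show ?case using i by (simp add: co_zero)
next
  case (insert x A)
  have "(\<Oplus>\<^bsub>S\<^esub>j\<in>insert x A. co (g j) i) = co (g x) i \<oplus>\<^bsub>S\<^esub> (\<Oplus>\<^bsub>S\<^esub>j\<in>A. co (g j) i)"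
    using insert co_coeff[OF _ i] by (intro S.finsum_insert) auto
  moreover have "(\<Oplus>\<^bsub>S\<^esub>j\<in>insert x A. g j) = g x \<oplus>\<^bsub>S\<^esub> (\<Oplus>\<^bsub>S\<^esub>j\<in>A. g j)"
    using insert by (intro S.finsum_insert) auto
  ultimately show ?case using insert i by (simp add: co_add S.finsum_closed)
qed

abbreviation "V \<equiv> free_module S D"
abbreviation "Mat \<equiv> frobenius_matrix p e S D f"
abbreviation "C \<equiv> Cok S D Mat"

lemma V_simps [simp]:
  "carrier V = D \<rightarrow>\<^sub>E carrier S" "v \<oplus>\<^bsub>V\<^esub> w = (\<lambda>i\<in>D. v i \<oplus>\<^bsub>S\<^esub> w i)" "a \<odot>\<^bsub>V\<^esub> v = (\<lambda>i\<in>D. a \<otimes>\<^bsub>S\<^esub> v i)"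
  by (simp_all add: free_module_def)

text \<open>By commutativity f (v_j^q j) = v_j^q (f j), and the coordinates of f j form column j of
  the matrix.\<close>

lemma mat_vec_eq:
  assumes v: "v \<in> D \<rightarrow>\<^sub>E carrier S"
  shows "mat_vec S D Mat v = co (f \<otimes>\<^bsub>S\<^esub> comb v)"
proof
  fix i
  have vc: "j \<in> D \<Longrightarrow> v j \<in> carrier S" for j using v by auto
  have Dc: "j \<in> D \<Longrightarrow> j \<in> carrier S" for j using D by auto
  show "mat_vec S D Mat v i = co (f \<otimes>\<^bsub>S\<^esub> comb v) i"
  proof (cases "i \<in> D")
    case False
    have "f \<otimes>\<^bsub>S\<^esub> comb v \<in> carrier S" using comb_closed[OF v] f by simp
    then show ?thesis using False PiE_arb[OF co(1) False] by (simp add: mat_vec_def)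
  next
    case True
    have "f \<otimes>\<^bsub>S\<^esub> comb v = (\<Oplus>\<^bsub>S\<^esub>j\<in>D. f \<otimes>\<^bsub>S\<^esub> (v j [^]\<^bsub>S\<^esub> q \<otimes>\<^bsub>S\<^esub> j))"
      unfolding comb_def by (rule S.finsum_rdistr) (use D f vc Dc in auto)
    also have "\<dots> = (\<Oplus>\<^bsub>S\<^esub>j\<in>D. v j [^]\<^bsub>S\<^esub> q \<otimes>\<^bsub>S\<^esub> (f \<otimes>\<^bsub>S\<^esub> j))"
      by (rule S.finsum_cong') (use f vc Dc in \<open>auto simp: S.m_lcomm\<close>)
    finally have "co (f \<otimes>\<^bsub>S\<^esub> comb v) i = (\<Oplus>\<^bsub>S\<^esub>j\<in>D. co (v j [^]\<^bsub>S\<^esub> q \<otimes>\<^bsub>S\<^esub> (f \<otimes>\<^bsub>S\<^esub> j)) i)"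
      using co_finsum[OF D(1) _ True, of "\<lambda>j. v j [^]\<^bsub>S\<^esub> q \<otimes>\<^bsub>S\<^esub> (f \<otimes>\<^bsub>S\<^esub> j)"] f vc Dc by auto
    also have "\<dots> = (\<Oplus>\<^bsub>S\<^esub>j\<in>D. co (f \<otimes>\<^bsub>S\<^esub> j) i \<otimes>\<^bsub>S\<^esub> v j)"
    proof (rule S.finsum_cong')
      fix j assume j: "j \<in> D"
      have c: "co (f \<otimes>\<^bsub>S\<^esub> j) i \<in> carrier S" using f Dc[OF j] True by (intro co_coeff) auto
      have "co (v j [^]\<^bsub>S\<^esub> q \<otimes>\<^bsub>S\<^esub> (f \<otimes>\<^bsub>S\<^esub> j)) i = v j \<otimes>\<^bsub>S\<^esub> co (f \<otimes>\<^bsub>S\<^esub> j) i"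
        using co_smult[OF vc[OF j], of "f \<otimes>\<^bsub>S\<^esub> j"] f Dc[OF j] True by simp
      then show "co (v j [^]\<^bsub>S\<^esub> q \<otimes>\<^bsub>S\<^esub> (f \<otimes>\<^bsub>S\<^esub> j)) i = co (f \<otimes>\<^bsub>S\<^esub> j) i \<otimes>\<^bsub>S\<^esub> v j"
        using S.m_comm[OF vc[OF j] c] by simp
    qed (use f vc Dc True co_coeff in auto)
    also have "\<dots> = mat_vec S D Mat v i"
      using True by (simp add: mat_vec_def frobenius_matrix_def rep_matrix_def co_def)
    finally show ?thesis by simp
  qed
qed

text \<open>Every element of fS is f times \<open>comb\<close> of a coordinate vector, so the image
  of the matrix is the coordinate picture of fS and the cokernel that of S/fS.\<close>

lemma image_mat: "mat_vec S D Mat ` carrier V = co ` I"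
proof
  show "mat_vec S D Mat ` carrier V \<subseteq> co ` I"
  proof
    fix w assume "w \<in> mat_vec S D Mat ` carrier V"
    then obtain v where v: "v \<in> D \<rightarrow>\<^sub>E carrier S" "w = mat_vec S D Mat v" by auto
    have "f \<otimes>\<^bsub>S\<^esub> comb v \<in> I"
      using I.I_r_closed[OF S.cgenideal_self[OF f] comb_closed[OF v(1)]] .
    then show "w \<in> co ` I" unfolding v(2) mat_vec_eq[OF v(1)] by blast
  qed
  show "co ` I \<subseteq> mat_vec S D Mat ` carrier V"
  proof
    fix w assume "w \<in> co ` I"
    then obtain x where x: "x \<in> carrier S" "w = co (x \<otimes>\<^bsub>S\<^esub> f)" unfolding cgenideal_def by auto
    then have "w = mat_vec S D Mat (co x)" using mat_vec_eq[OF co(1)[OF x(1)]] co(2)[OF x(1)] f by (simp add: S.m_comm)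
    then show "w \<in> mat_vec S D Mat ` carrier V" using co(1)[OF x(1)] by simp
  qed
qed

lemma C_simps:
  "carrier C = a_rcosets\<^bsub>V\<^esub> (co ` I)" "\<zero>\<^bsub>C\<^esub> = co ` I" "v \<oplus>\<^bsub>C\<^esub> w = v <+>\<^bsub>V\<^esub> w"
  "a \<odot>\<^bsub>C\<^esub> v = (\<Union>x\<in>v. (co ` I) +>\<^bsub>V\<^esub> (a \<odot>\<^bsub>V\<^esub> x))"
  unfolding Cok_def image_mat by (simp_all add: module_quot_def)

text \<open>Elements of S/fS and of the cokernel are both cosets, hence sets; the isomorphism is the
  direct image under \<open>co\<close>, with no choice of representatives.\<close>

lemma co_coset:
  assumes s: "s \<in> carrier S" shows "co ` \<pi> s = (co ` I) +>\<^bsub>V\<^esub> co s"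
proof -
  have "co ` \<pi> s = (\<lambda>x. co (x \<oplus>\<^bsub>S\<^esub> s)) ` I" unfolding a_r_coset_def' by auto
  also have "\<dots> = (\<lambda>x. co x \<oplus>\<^bsub>V\<^esub> co s) ` I"
    using s by (intro image_cong refl) (simp add: co_add)
  also have "\<dots> = (co ` I) +>\<^bsub>V\<^esub> co s" unfolding a_r_coset_def' by auto
  finally show ?thesis .
qed

lemma coset_sub: "s \<in> carrier S \<Longrightarrow> \<pi> s \<subseteq> carrier S"
  using I.a_Hcarr unfolding a_r_coset_def' by auto

lemma image_bij: "bij_betw (image co) (carrier R) (carrier C)"
proof -
  have inj: "inj_on co (carrier S)"
    by (rule inj_onI) (metis co(2))
  have "inj_on (image co) (carrier R)"
  proof (rule inj_onI)
    fix A B assume "A \<in> carrier R" "B \<in> carrier R" "co ` A = co ` B"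
    then show "A = B" using inj_on_image_eq_iff[OF inj] coset_sub unfolding R_carrier by auto
  qed
  moreover have "image co ` carrier R = carrier C"
  proof -
    have "image co ` carrier R = (\<lambda>s. (co ` I) +>\<^bsub>V\<^esub> co s) ` carrier S"
      unfolding R_carrier image_image by (intro image_cong refl co_coset)
    also have "\<dots> = (\<lambda>v. (co ` I) +>\<^bsub>V\<^esub> v) ` (co ` carrier S)" by (simp add: image_image)
    also have "co ` carrier S = D \<rightarrow>\<^sub>E carrier S"
    proof
      show "co ` carrier S \<subseteq> D \<rightarrow>\<^sub>E carrier S" using co(1) by blast
      show "D \<rightarrow>\<^sub>E carrier S \<subseteq> co ` carrier S"
      proof
        fix v assume v: "v \<in> D \<rightarrow>\<^sub>E carrier S"
        then have "v = co (comb v)" using co_eqI by simp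
        then show "v \<in> co ` carrier S" using comb_closed[OF v] by blast
      qed
    qed
    also have "(\<lambda>v. (co ` I) +>\<^bsub>V\<^esub> v) ` (D \<rightarrow>\<^sub>E carrier S) = carrier C"
      unfolding C_simps A_RCOSETS_def' by auto
    finally show ?thesis .
  qed
  ultimately show ?thesis unfolding bij_betw_def by blast
qed

lemma image_add:
  assumes "A \<in> carrier R" "B \<in> carrier R"
  shows "co ` (A \<oplus>\<^bsub>R\<^esub> B) = co ` A \<oplus>\<^bsub>C\<^esub> co ` B"
proof -
  have sub: "A \<subseteq> carrier S" "B \<subseteq> carrier S" using assms coset_sub unfolding R_carrier by auto
  have "A \<oplus>\<^bsub>R\<^esub> B = (\<lambda>(x, y). x \<oplus>\<^bsub>S\<^esub> y) ` (A \<times> B)" unfolding R_eq by (auto simp: FactRing_def set_add_def')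
  then have "co ` (A \<oplus>\<^bsub>R\<^esub> B) = (\<lambda>(x, y). co (x \<oplus>\<^bsub>S\<^esub> y)) ` (A \<times> B)" by (auto simp: image_image split_beta)
  also have "\<dots> = (\<lambda>(x, y). co x \<oplus>\<^bsub>V\<^esub> co y) ` (A \<times> B)"
    using sub by (intro image_cong refl) (auto simp: co_add subset_iff)
  also have "\<dots> = co ` A \<oplus>\<^bsub>C\<^esub> co ` B" unfolding C_simps set_add_def' by auto
  finally show ?thesis .
qed

text \<open>Any member of the coset \<open>A\<close> may serve as its representative, so the union
  that defines the scalar action on the cokernel runs over copies of one set.\<close>

lemma image_smult:
  assumes a: "a \<in> carrier S" and A: "A \<in> carrier R"
  shows "co ` (\<pi> a [^]\<^bsub>R\<^esub> q \<otimes>\<^bsub>R\<^esub> A) = a \<odot>\<^bsub>C\<^esub> co ` A"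
proof -
  obtain x where x: "x \<in> carrier S" "A = \<pi> x" using A unfolding R_carrier by auto
  have eq: "\<pi> a [^]\<^bsub>R\<^esub> q \<otimes>\<^bsub>R\<^esub> A = \<pi> (a [^]\<^bsub>S\<^esub> q \<otimes>\<^bsub>S\<^esub> y)" if y: "y \<in> A" for y
  proof -
    have yc: "y \<in> carrier S" using y x coset_sub by auto
    have A_eq: "A = \<pi> y" unfolding x(2) by (rule I.a_repr_independence'[OF y[unfolded x(2)] x(1)])
    show ?thesis unfolding A_eq using a yc by (simp add: \<pi>.hom_pow)
  qed
  have "a \<odot>\<^bsub>C\<^esub> co ` A = (\<Union>y\<in>A. (co ` I) +>\<^bsub>V\<^esub> (a \<odot>\<^bsub>V\<^esub> co y))" unfolding C_simps by simp
  also have "\<dots> = (\<Union>y\<in>A. co ` (\<pi> a [^]\<^bsub>R\<^esub> q \<otimes>\<^bsub>R\<^esub> A))"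
  proof (rule SUP_cong[OF refl])
    fix y assume y: "y \<in> A"
    then have yc: "y \<in> carrier S" using x coset_sub by auto
    have "co ` (\<pi> a [^]\<^bsub>R\<^esub> q \<otimes>\<^bsub>R\<^esub> A) = (co ` I) +>\<^bsub>V\<^esub> co (a [^]\<^bsub>S\<^esub> q \<otimes>\<^bsub>S\<^esub> y)"
      unfolding eq[OF y] using a yc by (intro co_coset) simp
    then show "(co ` I) +>\<^bsub>V\<^esub> (a \<odot>\<^bsub>V\<^esub> co y) = co ` (\<pi> a [^]\<^bsub>R\<^esub> q \<otimes>\<^bsub>R\<^esub> A)"
      using co_smult[OF a yc] by simp
  qed
  also have "\<dots> = co ` (\<pi> a [^]\<^bsub>R\<^esub> q \<otimes>\<^bsub>R\<^esub> A)"
  proof -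
    have "x \<in> A" unfolding x(2) by (rule I.a_rcos_self[OF x(1)])
    then show ?thesis by blast
  qed
  finally show ?thesis by simp
qed

lemma image_zero: "co ` \<zero>\<^bsub>R\<^esub> = \<zero>\<^bsub>C\<^esub>"
  unfolding C_simps R_eq by (simp add: FactRing_def)

abbreviation "RM \<equiv> restrict_scalars \<pi> (frobenius_ring p e R)"

theorem iso_S: "module_isomorphic S RM C"
proof -
  have RM: "module S RM" by (rule restrict_scalars_module[OF S.is_cring I.rcos_ring_hom[folded R_eq] FR_module])
  have "module S C"
    by (rule module_transport[OF RM, of "image co"]) (use image_bij image_add image_smult image_zero in auto)
  moreover have "image co \<in> module_isos S RM C"
    unfolding module_isos_def using image_bij image_add image_smult by auto
  ultimately show ?thesis using RM unfolding module_isomorphic_def by blast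
qed

text \<open>This gives meaning to \<open>descend_scalars\<close> on the cokernel. An element of fS
  acts through the q-th power of zero, which is zero because q is positive.\<close>

theorem C_annihilated: "annihilates I C"
  unfolding annihilates_def
proof (intro ballI)
  fix a v assume a: "a \<in> I" and "v \<in> carrier C"
  then have "v \<in> image co ` carrier R" using bij_betw_imp_surj_on[OF image_bij] by simp
  then obtain A where A: "A \<in> carrier R" "v = co ` A" by (rule imageE)
  have ac: "a \<in> carrier S" using a by simp
  have "\<pi> a = \<zero>\<^bsub>R\<^esub>" using I.coset_eq_zero_iff[OF ac] a by (simp add: R_eq)
  then have "\<pi> a [^]\<^bsub>R\<^esub> q = \<zero>\<^bsub>R\<^esub>" using R.nat_pow_zero[of q] p_pos by simp
  then show "a \<odot>\<^bsub>C\<^esub> v = \<zero>\<^bsub>C\<^esub>" using image_smult[OF ac A(1)] A image_zero by simp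
qed

theorem iso_R: "module_isomorphic R (frobenius_ring p e R) (descend_scalars C)"
proof -
  have smult: "co ` (W \<odot>\<^bsub>frobenius_ring p e R\<^esub> A) = W \<odot>\<^bsub>descend_scalars C\<^esub> co ` A"
    if W: "W \<in> carrier R" and A: "A \<in> carrier R" for W A
  proof -
    obtain x where x: "x \<in> carrier S" "W = \<pi> x" using W unfolding R_carrier by auto
    \<comment> \<open>All representatives of the scalar \<open>W\<close> act in the same way, so the
      definite description in \<open>descend_scalars\<close> denotes this common value.\<close>
    have all: "a \<odot>\<^bsub>C\<^esub> co ` A = co ` (W [^]\<^bsub>R\<^esub> q \<otimes>\<^bsub>R\<^esub> A)" if a: "a \<in> W" for a
    proof -
      have ac: "a \<in> carrier S" using a x coset_sub by auto
      have W_eq: "W = \<pi> a" unfolding x(2) by (rule I.a_repr_independence'[OF a[unfolded x(2)] x(1)])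
      show ?thesis unfolding W_eq by (rule image_smult[OF ac A, symmetric])
    qed
    have "x \<in> W" unfolding x(2) by (rule I.a_rcos_self[OF x(1)])
    then have "(THE y. \<forall>a\<in>W. a \<odot>\<^bsub>C\<^esub> co ` A = y) = co ` (W [^]\<^bsub>R\<^esub> q \<otimes>\<^bsub>R\<^esub> A)"
      using all by (intro the_equality) auto
    then show ?thesis by simp
  qed
  have "module R (descend_scalars C)"
    by (rule module_transport[OF FR_module, of "image co"]) (use image_bij image_add smult image_zero in auto)
  moreover have "image co \<in> module_isos R (frobenius_ring p e R) (descend_scalars C)"
    unfolding module_isos_def using image_bij image_add smult by auto
  ultimately show ?thesis using FR_module unfolding module_isomorphic_def by blast
qed

text \<open>The classes of the elements of \<open>D\<close> generate: each s is a sum of terms c_i^q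
  i, and such a term is the scalar c_i applied to i.\<close>

theorem FR_finitely_generated: "finitely_generated_module R (frobenius_ring p e R)"
proof -
  interpret F: module S "frobenius_ring p e S" by (rule F_module)
  interpret FR: module R "frobenius_ring p e R" by (rule FR_module)
  show ?thesis unfolding FR.finitely_generated_iff
  proof (intro exI conjI allI impI)
    show "finite (\<pi> ` D)" using D by simp
    show "\<pi> ` D \<subseteq> carrier (frobenius_ring p e R)" using D unfolding frobenius_ring_simps R_carrier by auto
    fix N assume N: "submodule N R (frobenius_ring p e R)" "\<pi> ` D \<subseteq> N"
    note N' = FR.submoduleE[OF N(1)] FR.submodule_zero[OF N(1)]
    define T where "T = {s \<in> carrier S. \<pi> s \<in> N}"
    have sm: "a [^]\<^bsub>S\<^esub> q \<otimes>\<^bsub>S\<^esub> s \<in> T" if "a \<in> carrier S" "s \<in> T" for a s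
      using N'(4)[of "\<pi> a" "\<pi> s"] that by (simp add: T_def \<pi>.hom_pow)
    have ad: "s \<oplus>\<^bsub>S\<^esub> t \<in> T" if "s \<in> T" "t \<in> T" for s t
      using N'(5)[of "\<pi> s" "\<pi> t"] that by (simp add: T_def)
    have z: "\<zero>\<^bsub>S\<^esub> \<in> T" using N'(7) by (simp add: T_def)
    have sum: "(\<Oplus>\<^bsub>S\<^esub>i\<in>E. c i [^]\<^bsub>S\<^esub> q \<otimes>\<^bsub>S\<^esub> i) \<in> T" if "finite E" "E \<subseteq> D" "c \<in> D \<rightarrow> carrier S" for E c
      using that(1,2)
    proof (induction E rule: finite_induct)
      case empty
      then show ?case using z by simp
    next
      case (insert x E)
      have "(\<Oplus>\<^bsub>S\<^esub>i\<in>insert x E. c i [^]\<^bsub>S\<^esub> q \<otimes>\<^bsub>S\<^esub> i) =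
          c x [^]\<^bsub>S\<^esub> q \<otimes>\<^bsub>S\<^esub> x \<oplus>\<^bsub>S\<^esub> (\<Oplus>\<^bsub>S\<^esub>i\<in>E. c i [^]\<^bsub>S\<^esub> q \<otimes>\<^bsub>S\<^esub> i)"
        using insert that(3) D by (intro S.finsum_insert) (auto simp: Pi_iff subset_iff)
      moreover have "x \<in> T" using insert N(2) D by (auto simp: T_def)
      ultimately show ?case using insert that(3) sm[of "c x" x] ad by auto
    qed
    show "carrier (frobenius_ring p e R) \<subseteq> N"
    proof
      fix W assume "W \<in> carrier (frobenius_ring p e R)"
      then obtain s where s: "s \<in> carrier S" "W = \<pi> s" unfolding frobenius_ring_simps R_carrier by auto
      have "comb (co s) \<in> T" unfolding comb_def using sum[OF D(1) subset_refl] co(1)[OF s(1)] by auto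
      then show "W \<in> N" using co(2)[OF s(1)] s by (simp add: T_def)
    qed
  qed
qed

theorem FR_mcm: "cm_ring R d \<Longrightarrow> maximal_cohen_macaulay R (frobenius_ring p e R)"
  by (rule cm_ring_frobenius_mcm[OF _ FR_module FR_finitely_generated p_pos])

end

section \<open>The Frobenius on power series and polynomials\<close>

context cring
begin

lemma binomial:
  assumes a: "a \<in> carrier R" and b: "b \<in> carrier R"
  shows "(a \<oplus> b) [^] (n::nat) = (\<Oplus>k\<in>{..n}. [(n choose k)] \<cdot> (a [^] k \<otimes> b [^] (n - k)))"
proof (induction n)
  case 0
  then show ?case using a b by simp
next
  case (Suc n)
  let ?t = "\<lambda>n k. [(n choose k)] \<cdot> (a [^] k \<otimes> b [^] (n - k))"
  have c: "[m] \<cdot> (a [^] i \<otimes> b [^] j) \<in> carrier R" for m i j :: nat using a b by simp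
  have ma: "[m] \<cdot> (a [^] i \<otimes> b [^] j) \<otimes> a = [m] \<cdot> (a [^] Suc i \<otimes> b [^] j)" for m i j :: nat
    using a b by (subst add_pow_ldistr) (auto simp: m_ac intro!: arg_cong[where f = "\<lambda>x. [m] \<cdot> x"])
  have mb: "[m] \<cdot> (a [^] i \<otimes> b [^] j) \<otimes> b = [m] \<cdot> (a [^] i \<otimes> b [^] Suc j)" for m i j :: nat
    using a b by (subst add_pow_ldistr) (auto simp: m_assoc)
  let ?A = "\<Oplus>k\<in>{..n}. [(n choose k)] \<cdot> (a [^] Suc k \<otimes> b [^] (n - k))"
  let ?B = "\<Oplus>k\<in>{..n}. [(n choose Suc k)] \<cdot> (a [^] Suc k \<otimes> b [^] (n - k))"
  have Ac: "?A \<in> carrier R" and Bc: "?B \<in> carrier R" by (intro finsum_closed Pi_I c)+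
  have bc: "b [^] Suc n \<in> carrier R" using b by simp
  have "(\<Oplus>k\<in>{..n}. ?t n k) \<otimes> a = (\<Oplus>k\<in>{..n}. ?t n k \<otimes> a)"
    by (rule finsum_ldistr) (use a in \<open>auto intro: c\<close>)
  also have "\<dots> = ?A"
    by (rule finsum_cong') (simp_all only: ma, intro Pi_I c)
  finally have 1: "(\<Oplus>k\<in>{..n}. ?t n k) \<otimes> a = ?A" .
  have "(\<Oplus>k\<in>{..n}. ?t n k) \<otimes> b = (\<Oplus>k\<in>{..n}. ?t n k \<otimes> b)"
    by (rule finsum_ldistr) (use b in \<open>auto intro: c\<close>)
  also have "\<dots> = (\<Oplus>k\<in>{..n}. [(n choose k)] \<cdot> (a [^] k \<otimes> b [^] (Suc n - k)))"
    by (rule finsum_cong') (auto simp only: mb Suc_diff_le atMost_iff intro!: Pi_I c)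
  also have "\<dots> = (\<Oplus>k\<in>{..Suc n}. [(n choose k)] \<cdot> (a [^] k \<otimes> b [^] (Suc n - k)))"
    using a b c by (subst finsum_Suc) (auto simp: binomial_eq_0 intro!: finsum_closed r_zero[symmetric])
  also have "\<dots> = ?B \<oplus> b [^] Suc n"
    using a b c by (subst finsum_Suc2) auto
  finally have 2: "(\<Oplus>k\<in>{..n}. ?t n k) \<otimes> b = ?B \<oplus> b [^] Suc n" .
  have tc: "(\<Oplus>k\<in>{..n}. ?t n k) \<in> carrier R" by (intro finsum_closed Pi_I c)
  have "(a \<oplus> b) [^] Suc n = (\<Oplus>k\<in>{..n}. ?t n k) \<otimes> a \<oplus> (\<Oplus>k\<in>{..n}. ?t n k) \<otimes> b"
    using Suc a b tc by (simp add: r_distr)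
  also have "\<dots> = (?A \<oplus> ?B) \<oplus> b [^] Suc n" unfolding 1 2 using Ac Bc bc by (simp add: a_assoc)
  also have "?A \<oplus> ?B = (\<Oplus>k\<in>{..n}. [(n choose k)] \<cdot> (a [^] Suc k \<otimes> b [^] (n - k)) \<oplus> [(n choose Suc k)] \<cdot> (a [^] Suc k \<otimes> b [^] (n - k)))"
    by (rule finsum_addf[symmetric]) (intro Pi_I c)+
  also have "\<dots> = (\<Oplus>k\<in>{..n}. [(Suc n choose Suc k)] \<cdot> (a [^] Suc k \<otimes> b [^] (Suc n - Suc k)))"
    by (rule finsum_cong') (use a b c in \<open>auto simp: add.nat_pow_mult\<close>)
  also have "\<dots> \<oplus> b [^] Suc n = (\<Oplus>k\<in>{..Suc n}. ?t (Suc n) k)"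
    using a b c by (subst finsum_Suc2) auto
  finally show ?case .
qed

text \<open>For exponent p all inner binomial coefficients are divisible by p, and p^e is reached by
  iteration.\<close>

lemma frobenius_add:
  fixes p e :: nat
  assumes p: "Factorial_Ring.prime p" and char: "\<And>x. x \<in> carrier R \<Longrightarrow> [p] \<cdot> x = \<zero>"
    and a: "a \<in> carrier R" and b: "b \<in> carrier R"
  shows "(a \<oplus> b) [^] (p ^ e) = a [^] (p ^ e) \<oplus> b [^] (p ^ e)"
proof -
  have mult: "[m] \<cdot> x = \<zero>" if "p dvd m" "x \<in> carrier R" for m :: nat and x
  proof -
    obtain k where "m = p * k" using \<open>p dvd m\<close> by blast
    then have "[m] \<cdot> x = [k] \<cdot> ([p] \<cdot> x)" using that(2) by (simp add: add.nat_pow_pow mult.commute)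
    then show ?thesis using char[OF that(2)] by simp
  qed
  have one: "(a \<oplus> b) [^] p = a [^] p \<oplus> b [^] p" if a: "a \<in> carrier R" and b: "b \<in> carrier R" for a b
  proof -
    have p0: "p \<noteq> 0" "p > 1" using p prime_gt_1_nat by (auto simp: prime_gt_0_nat)
    have "(a \<oplus> b) [^] p = (\<Oplus>k\<in>{..p}. [(p choose k)] \<cdot> (a [^] k \<otimes> b [^] (p - k)))" by (rule binomial[OF a b])
    also have "\<dots> = (\<Oplus>k\<in>{0, p}. [(p choose k)] \<cdot> (a [^] k \<otimes> b [^] (p - k)))"
    proof (rule add.finprod_mono_neutral_cong_right)
      fix k assume "k \<in> {..p} - {0, p}"
      then have "p dvd (p choose k)" using p by (intro dvd_choose_prime) auto
      then show "[(p choose k)] \<cdot> (a [^] k \<otimes> b [^] (p - k)) = \<zero>" using a b by (intro mult) auto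
    qed (use a b in auto)
    also have "\<dots> = a [^] p \<oplus> b [^] p"
      using a b p0 by (subst finsum_insert) (auto simp: a_comm)
    finally show ?thesis .
  qed
  show ?thesis
  proof (induction e)
    case 0
    then show ?case using a b by (simp add: nat_pow_eone)
  next
    case (Suc e)
    have pw: "x [^] (p ^ Suc e) = (x [^] (p ^ e)) [^] p" if "x \<in> carrier R" for x
      using that by (simp add: nat_pow_pow mult.commute)
    show ?case using a b Suc by (simp only: pw a_closed one nat_pow_closed)
  qed
qed

text \<open>Covers finite sums; for a power series, an infinite sum of terms,
  \<open>series_pow_local\<close> provides the reduction to this case.\<close>

lemma finsum_frobenius:
  assumes frob: "\<And>a b. a \<in> carrier R \<Longrightarrow> b \<in> carrier R \<Longrightarrow> (a \<oplus> b) [^] (q::nat) = a [^] q \<oplus> b [^] q"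
    and q: "q > 0" and "finite A" "g \<in> A \<rightarrow> carrier R"
  shows "(\<Oplus>i\<in>A. g i) [^] q = (\<Oplus>i\<in>A. g i [^] q)"
  using assms(3,4)
proof (induction A rule: finite_induct)
  case empty
  then show ?case using q by (simp add: nat_pow_zero)
next
  case (insert x A)
  then show ?case by (simp add: finsum_insert frob Pi_iff finsum_closed)
qed

lemma series_add_pow:
  "x \<in> carrier (series_ring R b n) \<Longrightarrow> ([k] \<cdot>\<^bsub>series_ring R b n\<^esub> x) m = [(k::nat)] \<cdot> x m"
proof (induction k)
  interpret S: cring "series_ring R b n" by (rule series_ring_cring)
  {
    case 0
    then show ?case by (simp add: S.add.nat_pow_0)
  next
    case (Suc k)
    then show ?case by (simp add: S.add.nat_pow_Suc)
  }
qed

lemma series_monom_pow: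
  assumes "c \<in> carrier R" "a \<in> monomials n"
  shows "series_monom R c a [^]\<^bsub>series_ring R b n\<^esub> (k::nat) = series_monom R (c [^] k) (repeat_mset k a)"
proof (induction k)
  case 0
  then show ?case by (auto simp: series_monom_def)
next
  case (Suc k)
  then show ?case using assms by (simp add: series_monom_mult_monom union_commute)
qed

text \<open>A coefficient at a divisor of m involves only coefficients at divisors of m. To compute
  one coefficient of a power, the series may therefore be replaced by a finite truncation.\<close>

lemma series_pow_local:
  assumes "f \<in> carrier (series_ring R b n)" "g \<in> carrier (series_ring R b n)"
    and eq: "\<And>a. a \<subseteq># m \<Longrightarrow> f a = g a" and "a \<subseteq># m"
  shows "(f [^]\<^bsub>series_ring R b n\<^esub> (k::nat)) a = (g [^]\<^bsub>series_ring R b n\<^esub> k) a"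
  using assms(4)
proof (induction k arbitrary: a)
  case (Suc k)
  interpret S: cring "series_ring R b n" by (rule series_ring_cring)
  have fk: "f [^]\<^bsub>series_ring R b n\<^esub> k \<in> carrier (series_ring R b n)" "g [^]\<^bsub>series_ring R b n\<^esub> k \<in> carrier (series_ring R b n)"
    using assms(1,2) by auto
  have "series_mult R (f [^]\<^bsub>series_ring R b n\<^esub> k) f a = series_mult R (g [^]\<^bsub>series_ring R b n\<^esub> k) g a"
    unfolding series_mult_def
  proof (rule finsum_cong')
    fix x assume "x \<in> {x. x \<subseteq># a}"
    then have "a - x \<subseteq># a" "x \<subseteq># a" by auto
    then have "x \<subseteq># m" "a - x \<subseteq># m" using Suc.prems subset_mset.trans by blast+
    then show "(f [^]\<^bsub>series_ring R b n\<^esub> k) x \<otimes> f (a - x) = (g [^]\<^bsub>series_ring R b n\<^esub> k) x \<otimes> g (a - x)"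
      using Suc.IH eq by simp
  qed (use series_coeff_closed[OF fk(2)] assms(2) in auto)
  then show ?case by simp
qed simp

end

lemma repeat_mset_inject:
  assumes "q > 0" "repeat_mset q a = repeat_mset q c" shows "a = c"
proof (rule multiset_eqI)
  fix x
  have "q * count a x = q * count c x" using arg_cong[OF assms(2), of "\<lambda>m. count m x"] by simp
  then show "count a x = count c x" using assms(1) by simp
qed

lemma repeat_mset_monomials:
  assumes "q > 0" shows "repeat_mset q a \<in> monomials n \<longleftrightarrow> a \<in> monomials n"
proof -
  have "set_mset (repeat_mset q a) = set_mset a"
    using assms by (simp add: set_eq_iff flip: count_greater_zero_iff)
  then show ?thesis by (simp add: monomials_def)
qed

lemma subseteq_repeat_mset: "q > 0 \<Longrightarrow> m \<subseteq># repeat_mset q m"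
  by (simp add: subseteq_mset_def)

text \<open>Exponents below q are the remainders modulo q of the exponents of the whole
  monomial.\<close>

lemma mset_mod_unique:
  assumes eq: "repeat_mset q m + a = repeat_mset q m' + a'"
    and "\<And>i. count a i < q" "\<And>i. count a' i < q"
  shows "a = a'"
proof (rule multiset_eqI)
  fix x
  have "q * count m x + count a x = q * count m' x + count a' x"
    using arg_cong[OF eq, of "\<lambda>m. count m x"] by simp
  then have "(q * count m x + count a x) mod q = (q * count m' x + count a' x) mod q" by simp
  then show "count a x = count a' x" using assms(2,3)[of x] by simp
qed

text \<open>Division with remainder by q in every exponent; with \<open>mset_mod_unique\<close> it
  is the monomial half of the basis \<open>Delta\<close>.\<close>

lemma mset_div_mod:
  assumes q: "q > 0"
  shows "\<exists>m' a. m = repeat_mset q m' + a \<and> (\<forall>i. count a i < q)"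
proof (induction m)
  case empty
  then show ?case using q by (intro exI[of _ "{#}"]) auto
next
  case (add x m)
  then obtain m' a where m: "m = repeat_mset q m' + a" "\<forall>i. count a i < q" by blast
  show ?case
  proof (cases "count a x + 1 < q")
    case True
    then show ?thesis using m by (intro exI[of _ m'] exI[of _ "add_mset x a"]) auto
  next
    case False
    then have x: "count a x + 1 = q" using m(2)[rule_format, of x] by simp
    \<comment> \<open>The exponent of x in the remainder has reached q: it is reset to 0 and carried
      over to m'.\<close>
    have "add_mset x m = repeat_mset q (add_mset x m') + filter_mset (\<lambda>i. i \<noteq> x) a"
    proof (rule multiset_eqI)
      fix y
      show "count (add_mset x m) y = count (repeat_mset q (add_mset x m') + filter_mset (\<lambda>i. i \<noteq> x) a) y"
        using x unfolding m(1) by (cases "y = x") (auto simp: algebra_simps)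
    qed
    moreover have "\<forall>i. count (filter_mset (\<lambda>i. i \<noteq> x) a) i < q" using m(2) q by simp
    ultimately show ?thesis by blast
  qed
qed

locale char_p_field = field +
  fixes p e :: nat
  assumes prime: "Factorial_Ring.prime p" and char: "has_characteristic R p"
begin

abbreviation "q \<equiv> p ^ e"

lemma q_pos: "q > 0" using prime by (simp add: prime_gt_0_nat)

lemma char_mult: "x \<in> carrier R \<Longrightarrow> [p] \<cdot> x = \<zero>"
proof -
  assume x: "x \<in> carrier R"
  have "[p] \<cdot> \<one> = \<zero>" using char unfolding has_characteristic_def by simp
  then show ?thesis using x add_pow_ldistr[of \<one> x p] by simp
qed

lemmas frob = frobenius_add[OF prime char_mult]

lemma zero_pow: "\<zero> [^] q = \<zero>" using q_pos by (intro nat_pow_zero) simp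

lemma series_frob:
  assumes "f \<in> carrier (series_ring R b n)" "g \<in> carrier (series_ring R b n)"
  shows "(f \<oplus>\<^bsub>series_ring R b n\<^esub> g) [^]\<^bsub>series_ring R b n\<^esub> q =
    f [^]\<^bsub>series_ring R b n\<^esub> q \<oplus>\<^bsub>series_ring R b n\<^esub> g [^]\<^bsub>series_ring R b n\<^esub> q"
proof (rule cring.frobenius_add[OF series_ring_cring prime _ assms])
  fix x assume x: "x \<in> carrier (series_ring R b n)"
  show "[p] \<cdot>\<^bsub>series_ring R b n\<^esub> x = \<zero>\<^bsub>series_ring R b n\<^esub>"
    using series_add_pow[OF x] x char_mult by auto
qed

text \<open>Truncation to the divisors of x leaves a finite sum of terms, on which the q-th power is
  additive; it therefore raises coefficients and monomials to the q-th power separately.\<close>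

lemma series_pow_coeff:
  assumes f: "f \<in> carrier (series_ring R b n)"
  shows "(f [^]\<^bsub>series_ring R b n\<^esub> q) x =
    (\<Oplus>a\<in>{a \<in> monomials n. a \<subseteq># x}. if x = repeat_mset q a then f a [^] q else \<zero>)"
proof -
  interpret S: cring "series_ring R b n" by (rule series_ring_cring)
  define A where "A = {a \<in> monomials n. a \<subseteq># x}"
  have A: "finite A" unfolding A_def by (rule finite_subset[OF _ finite_submultisets[of x]]) auto
  define g where "g = (\<Oplus>\<^bsub>series_ring R b n\<^esub>a\<in>A. series_monom R (f a) a)"
  have mc: "a \<in> A \<Longrightarrow> series_monom R (f a) a \<in> carrier (series_ring R b n)" for a
    using f by (simp add: A_def)
  have g: "g \<in> carrier (series_ring R b n)" unfolding g_def using mc by (intro S.finsum_closed) auto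
  have fg: "f y = g y" if y: "y \<subseteq># x" for y
  proof -
    have "g y = (\<Oplus>a\<in>A. series_monom R (f a) a y)" unfolding g_def by (rule series_finsum[OF A]) (use mc in auto)
    also have "\<dots> = f y"
    proof (cases "y \<in> monomials n")
      case True
      then show ?thesis using f y
        by (subst finsum_single[OF A, of y]) (auto simp: A_def series_monom_def)
    next
      case False
      then have "f y = \<zero>" using series_monomials[OF f] by auto
      moreover have "(\<Oplus>a\<in>A. series_monom R (f a) a y) = \<zero>"
        using False by (intro finsum_all_zero) (auto simp: A_def series_monom_def)
      ultimately show ?thesis by simp
    qed
    finally show ?thesis by simp
  qed
  have "(f [^]\<^bsub>series_ring R b n\<^esub> q) x = (g [^]\<^bsub>series_ring R b n\<^esub> q) x"
    by (rule series_pow_local[OF f g fg]) auto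
  also have "g [^]\<^bsub>series_ring R b n\<^esub> q = (\<Oplus>\<^bsub>series_ring R b n\<^esub>a\<in>A. series_monom R (f a) a [^]\<^bsub>series_ring R b n\<^esub> q)"
    unfolding g_def by (rule S.finsum_frobenius[OF series_frob q_pos A]) (use mc in auto)
  also have "\<dots> x = (\<Oplus>a\<in>A. (series_monom R (f a) a [^]\<^bsub>series_ring R b n\<^esub> q) x)"
    by (rule series_finsum[OF A]) (use mc in auto)
  also have "\<dots> = (\<Oplus>a\<in>A. if x = repeat_mset q a then f a [^] q else \<zero>)"
  proof (rule finsum_cong')
    fix a assume "a \<in> A"
    then have "series_monom R (f a) a [^]\<^bsub>series_ring R b n\<^esub> q = series_monom R (f a [^] q) (repeat_mset q a)"
      using f by (intro series_monom_pow) (auto simp: A_def)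
    then show "(series_monom R (f a) a [^]\<^bsub>series_ring R b n\<^esub> q) x = (if x = repeat_mset q a then f a [^] q else \<zero>)"
      by (simp add: series_monom_def)
  qed (use f in auto)
  finally show ?thesis unfolding A_def .
qed

lemma series_pow_repeat:
  assumes f: "f \<in> carrier (series_ring R b n)"
  shows "(f [^]\<^bsub>series_ring R b n\<^esub> q) (repeat_mset q m) = f m [^] q"
proof (cases "m \<in> monomials n")
  case True
  have fin: "finite {a \<in> monomials n. a \<subseteq># repeat_mset q m}"
    by (rule finite_subset[OF _ finite_submultisets[of "repeat_mset q m"]]) auto
  have "m \<subseteq># repeat_mset q m" by (rule subseteq_repeat_mset[OF q_pos])
  then show ?thesis unfolding series_pow_coeff[OF f] using True f repeat_mset_inject[OF q_pos]
    by (subst finsum_single[OF fin, of m]) auto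
next
  case False
  have z: "f m = \<zero>" using series_monomials[OF f] False by auto
  have "repeat_mset q m \<noteq> repeat_mset q a" if "a \<in> monomials n" for a
    using repeat_mset_inject[OF q_pos, of m a] that False by auto
  then show ?thesis unfolding series_pow_coeff[OF f] z zero_pow by (intro finsum_all_zero) auto
qed

lemma series_pow_zero:
  assumes f: "f \<in> carrier (series_ring R b n)" and "\<And>m. x \<noteq> repeat_mset q m"
  shows "(f [^]\<^bsub>series_ring R b n\<^esub> q) x = \<zero>"
  unfolding series_pow_coeff[OF f] using assms(2) by (intro finsum_all_zero) auto

section \<open>Bases over the \<open>q\<close>-th powers\<close>

text \<open>The difference of x and y has q-th power zero by additivity, and a field has no nonzero
  nilpotents.\<close>

lemma pow_inject:
  assumes "x \<in> carrier R" "y \<in> carrier R" "x [^] q = y [^] q" shows "x = y"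
proof -
  have "((x \<ominus> y) \<oplus> y) [^] q = (x \<ominus> y) [^] q \<oplus> y [^] q" using assms(1,2) by (intro frob) auto
  moreover have "(x \<ominus> y) \<oplus> y = x" using assms(1,2) by (simp add: a_minus_def a_assoc l_neg)
  ultimately have "(x \<ominus> y) [^] q \<oplus> y [^] q = \<zero> \<oplus> y [^] q" using assms by simp
  then have z: "(x \<ominus> y) [^] q = \<zero>" using assms(1,2) by (simp del: l_zero)
  have "(x \<ominus> y) [^] k = \<zero> \<Longrightarrow> x \<ominus> y = \<zero>" for k :: nat
    by (induction k) (use assms(1,2) integral_iff in auto)
  then have "x \<ominus> y = \<zero>" using z by blast
  then show ?thesis using assms(1,2) by simp
qed

lemma powers_subfield: "subfield (powers_subfield R q) R"
proof -
  have "(\<lambda>x. x [^] q) \<in> ring_hom R R"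
    by (rule ring_hom_memI) (auto simp: frob nat_pow_distrib)
  then interpret h: ring_hom_ring R R "\<lambda>x. x [^] q" by (intro ring_hom_ringI2 ring_axioms)
  show ?thesis unfolding powers_subfield_def
    using h.img_is_subfield(2)[OF carrier_is_subfield] by simp
qed

lemma combine_map:
  assumes "distinct us" "set us \<subseteq> carrier R" "k \<in> set us \<rightarrow> carrier R"
  shows "combine (map k us) us = (\<Oplus>u\<in>set us. k u \<otimes> u)"
  using assms
proof (induction us)
  case (Cons u us)
  have "(\<Oplus>u\<in>set (u # us). k u \<otimes> u) = k u \<otimes> u \<oplus> (\<Oplus>u\<in>set us. k u \<otimes> u)"
    unfolding list.set by (rule finsum_insert) (use Cons.prems in auto)
  then show ?case using Cons by (auto simp: Pi_iff)
qed simp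

text \<open>Turns the recursive \<open>Span\<close> of a list into a sum over its set; distinctness
  allows the coefficients to be a function of the basis element.\<close>

lemma Span_finsum:
  assumes "distinct us" "set us \<subseteq> carrier R" "F \<subseteq> carrier R" "x \<in> Span F us"
  shows "\<exists>k\<in>set us \<rightarrow> F. x = (\<Oplus>u\<in>set us. k u \<otimes> u)"
  using assms
proof (induction us arbitrary: x)
  case (Cons u us)
  then obtain l v where lv: "l \<in> F" "v \<in> Span F us" "x = l \<otimes> u \<oplus> v"
    by (auto simp: line_extension_mem_iff)
  obtain k where k: "k \<in> set us \<rightarrow> F" "v = (\<Oplus>u\<in>set us. k u \<otimes> u)" using Cons lv(2) by auto
  have u: "u \<notin> set us" "u \<in> carrier R" using Cons.prems by auto
  have kc: "w \<in> set us \<Longrightarrow> k w \<in> carrier R" for w using k(1) Cons.prems(3) by auto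
  have "(\<Oplus>w\<in>set (u # us). (k(u := l)) w \<otimes> w) = (k(u := l)) u \<otimes> u \<oplus> (\<Oplus>w\<in>set us. (k(u := l)) w \<otimes> w)"
    unfolding list.set by (rule finsum_insert) (use u kc lv(1) Cons.prems(2,3) in auto)
  also have "(\<Oplus>w\<in>set us. (k(u := l)) w \<otimes> w) = v"
    unfolding k(2) by (rule finsum_cong') (use u kc Cons.prems in auto)
  finally have "x = (\<Oplus>w\<in>set (u # us). (k(u := l)) w \<otimes> w)" using lv(3) by simp
  moreover have "k(u := l) \<in> set (u # us) \<rightarrow> F" using k(1) lv(1) by auto
  ultimately show ?case by blast
qed simp

context
  fixes \<Lambda> :: "'a set"
  assumes \<Lambda>: "is_field_basis R (powers_subfield R q) \<Lambda>"
begin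

lemma basis_carrier: "finite \<Lambda>" "\<Lambda> \<subseteq> carrier R"
  using \<Lambda> independent_in_carrier unfolding is_field_basis_def by auto

text \<open>A coefficient in the subfield is c^q for some c, unique because the Frobenius is
  injective. A basis over the q-th powers thus yields coordinates in the whole field, the form used
  in \<open>frobenius_free\<close>.\<close>

lemma basis_coordinates:
  assumes x: "x \<in> carrier R"
  shows "\<exists>!c. c \<in> \<Lambda> \<rightarrow>\<^sub>E carrier R \<and> x = (\<Oplus>u\<in>\<Lambda>. c u [^] q \<otimes> u)"
proof -
  obtain us where us: "set us = \<Lambda>" "independent (powers_subfield R q) us" "Span (powers_subfield R q) us = carrier R"
    using \<Lambda> unfolding is_field_basis_def by blast
  have d: "distinct us" by (rule independent_distinct[OF powers_subfield us(2)])
  have F: "powers_subfield R q \<subseteq> carrier R" unfolding powers_subfield_def by auto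
  have Lc: "set us \<subseteq> carrier R" using us(1) basis_carrier by simp
  obtain k where k: "k \<in> \<Lambda> \<rightarrow> powers_subfield R q" "x = (\<Oplus>u\<in>\<Lambda>. k u \<otimes> u)"
    using Span_finsum[OF d Lc F, of x] x us by auto
  define c where "c = (\<lambda>u\<in>\<Lambda>. SOME y. y \<in> carrier R \<and> k u = y [^] q)"
  have c: "c u \<in> carrier R \<and> k u = c u [^] q" if "u \<in> \<Lambda>" for u
  proof -
    have "\<exists>y. y \<in> carrier R \<and> k u = y [^] q" using k(1) that unfolding powers_subfield_def by auto
    from someI_ex[OF this] show ?thesis using that by (simp add: c_def)
  qed
  have c_PiE: "c \<in> \<Lambda> \<rightarrow>\<^sub>E carrier R" using c by (auto simp: c_def)
  show ?thesis
  proof (rule ex1I[of _ c], intro conjI)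
    show "c \<in> \<Lambda> \<rightarrow>\<^sub>E carrier R" by (rule c_PiE)
    show "x = (\<Oplus>u\<in>\<Lambda>. c u [^] q \<otimes> u)"
      unfolding k(2) by (rule finsum_cong') (use c basis_carrier in \<open>auto simp: subset_iff\<close>)
  next
    fix c' assume c': "c' \<in> \<Lambda> \<rightarrow>\<^sub>E carrier R \<and> x = (\<Oplus>u\<in>\<Lambda>. c' u [^] q \<otimes> u)"
    then have c'c: "u \<in> \<Lambda> \<Longrightarrow> c' u \<in> carrier R" for u by auto
    have cc: "u \<in> \<Lambda> \<Longrightarrow> c u \<in> carrier R" for u using c by auto
    have Lm: "u \<in> \<Lambda> \<Longrightarrow> u \<in> carrier R" for u using basis_carrier by auto
    \<comment> \<open>Additivity makes the difference of the two coefficients a q-th power, so the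
      resulting relation has coefficients in the subfield and independence applies.\<close>
    define w where "w u = (c u \<ominus> c' u) [^] q" for u
    have w: "u \<in> \<Lambda> \<Longrightarrow> w u \<in> powers_subfield R q" for u
      unfolding w_def powers_subfield_def using cc c'c by auto
    have wc: "u \<in> \<Lambda> \<Longrightarrow> w u \<in> carrier R" for u unfolding w_def using cc c'c by auto
    have weq: "c u [^] q = w u \<oplus> c' u [^] q" if u: "u \<in> \<Lambda>" for u
    proof -
      have "c u = (c u \<ominus> c' u) \<oplus> c' u" using cc[OF u] c'c[OF u] by (simp add: a_minus_def a_assoc l_neg)
      then show ?thesis unfolding w_def using frob[of "c u \<ominus> c' u" "c' u"] cc[OF u] c'c[OF u] by simp
    qed
    have "x = (\<Oplus>u\<in>\<Lambda>. w u \<otimes> u \<oplus> c' u [^] q \<otimes> u)"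
      unfolding k(2) by (rule finsum_cong') (use c c'c wc Lm weq in \<open>auto simp: l_distr\<close>)
    also have "\<dots> = (\<Oplus>u\<in>\<Lambda>. w u \<otimes> u) \<oplus> (\<Oplus>u\<in>\<Lambda>. c' u [^] q \<otimes> u)"
      by (rule finsum_addf) (use c'c wc Lm in auto)
    finally have eq: "x = (\<Oplus>u\<in>\<Lambda>. w u \<otimes> u) \<oplus> x" using c' by simp
    have sc: "(\<Oplus>u\<in>\<Lambda>. w u \<otimes> u) \<in> carrier R" using wc Lm by (intro finsum_closed) auto
    have "(\<Oplus>u\<in>\<Lambda>. w u \<otimes> u) = \<zero>"
      using eq x sc by (metis add.r_cancel_one' )
    then have "combine (map w us) us = \<zero>"
      using combine_map[OF d Lc, of w] wc us(1) by auto
    moreover have "set (map w us) \<subseteq> powers_subfield R q" using w us(1) by auto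
    ultimately have "set (take (length us) (map w us)) \<subseteq> {\<zero>}"
      using independent_imp_trivial_combine[OF powers_subfield us(2)] by blast
    then have "w u = \<zero>" if "u \<in> \<Lambda>" for u using that us(1) by auto
    then have "c u [^] q = c' u [^] q" if "u \<in> \<Lambda>" for u using weq[OF that] c'c[OF that] that by simp
    then have "c' u = c u" if "u \<in> \<Lambda>" for u using pow_inject[OF cc[OF that] c'c[OF that]] that by simp
    then show "c' = c" using c' c_PiE by (intro PiE_ext[of c' \<Lambda> "\<lambda>_. carrier R" c]) simp_all
  qed
qed

text \<open>The coefficient of a zero basis element could be changed freely, giving zero two
  coordinate families. The fact is wanted so that a term of \<open>Delta\<close> determines its
  monomial.\<close>

lemma zero_not_basis: "\<zero> \<notin> \<Lambda>"
proof
  assume z: "\<zero> \<in> \<Lambda>"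
  have Lm: "u \<in> \<Lambda> \<Longrightarrow> u \<in> carrier R" for u using basis_carrier by auto
  have tz: "(\<lambda>u\<in>\<Lambda>. if u = \<zero> then y else \<zero>) u [^] q \<otimes> u = \<zero>"
    if "y \<in> carrier R" "u \<in> \<Lambda>" for y u using that Lm[OF that(2)] zero_pow by (cases "u = \<zero>") simp_all
  have sz: "(\<Oplus>u\<in>\<Lambda>. (\<lambda>u\<in>\<Lambda>. if u = \<zero> then y else \<zero>) u [^] q \<otimes> u) = \<zero>" if "y \<in> carrier R" for y
    by (rule finsum_all_zero) (rule tz[OF that])
  have mem: "(\<lambda>u\<in>\<Lambda>. if u = \<zero> then y else \<zero>) \<in> \<Lambda> \<rightarrow>\<^sub>E carrier R" if "y \<in> carrier R" for y using that by auto
  have "(\<lambda>u\<in>\<Lambda>. if u = \<zero> then \<zero> else \<zero>) = (\<lambda>u\<in>\<Lambda>. if u = \<zero> then \<one> else \<zero>)"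
    using the1_equality[OF basis_coordinates[OF zero_closed], OF conjI[OF mem[OF zero_closed] sz[OF zero_closed, symmetric]]]
      the1_equality[OF basis_coordinates[OF zero_closed], OF conjI[OF mem[OF one_closed] sz[OF one_closed, symmetric]]]
    by (rule trans[OF sym])
  from fun_cong[OF this, of \<zero>] show False using z by simp
qed

definition small :: "nat \<Rightarrow> nat multiset set" where
  "small n = {a \<in> monomials n. \<forall>i. count a i < q}"

lemma finite_small: "finite (small n)"
proof (rule finite_subset[OF _ finite_submultisets])
  show "small n \<subseteq> {m. m \<subseteq># repeat_mset q (mset_set {..<n})}"
  proof clarify
    fix a assume a: "a \<in> small n"
    have "count a i \<le> count (repeat_mset q (mset_set {..<n})) i" for i
    proof (cases "i < n")
      case True
      then show ?thesis using a by (simp add: small_def less_imp_le)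
    next
      case False
      then have "i \<notin># a" using a by (auto simp: small_def monomials_def)
      then show ?thesis by (metis le0 not_in_iff)
    qed
    then show "a \<subseteq># repeat_mset q (mset_set {..<n})" by (simp add: subseteq_mset_def)
  qed
qed

abbreviation "mono_of \<equiv> (\<lambda>z. series_monom R (fst z) (snd z))"

text \<open>Variables outside the first n have exponent 0, and q > 0 turns the bound q - 1 into
  strict inequality, the form in which remainders modulo q appear.\<close>

lemma Delta_eq: "Delta R n q \<Lambda> = mono_of ` (\<Lambda> \<times> small n)"
proof -
  have "(set_mset a \<subseteq> {..<n} \<and> (\<forall>i<n. count a i \<le> q - 1)) \<longleftrightarrow> a \<in> small n" for a
  proof
    assume a: "set_mset a \<subseteq> {..<n} \<and> (\<forall>i<n. count a i \<le> q - 1)"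
    have "count a i < q" for i
    proof (cases "i < n")
      case True
      then have "count a i \<le> q - 1" using a by blast
      then show ?thesis using le_less_trans[OF _ diff_less[OF zero_less_one q_pos]] by blast
    next
      case False
      then have "i \<notin># a" using a by auto
      then show ?thesis using q_pos by (metis not_in_iff)
    qed
    then show "a \<in> small n" using a by (simp add: small_def monomials_def)
  next
    assume a: "a \<in> small n"
    then have "count a i \<le> q - 1" for i
      using q_pos unfolding small_def by (metis (mono_tags, lifting) Suc_pred' less_Suc_eq_le mem_Collect_eq)
    then show "set_mset a \<subseteq> {..<n} \<and> (\<forall>i<n. count a i \<le> q - 1)" using a by (auto simp: small_def monomials_def)
  qed
  then have "Delta R n q \<Lambda> = {series_monom R c a |c a. c \<in> \<Lambda> \<and> a \<in> small n}" unfolding Delta_def by simp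
  also have "\<dots> = mono_of ` (\<Lambda> \<times> small n)" by (fastforce simp: image_def)
  finally show ?thesis .
qed

text \<open>A term with nonzero coefficient is supported at exactly one monomial, which recovers the
  exponent and then the coefficient.\<close>

lemma mono_of_inj: "inj_on mono_of (\<Lambda> \<times> small n)"
proof (rule inj_onI)
  fix z w assume z: "z \<in> \<Lambda> \<times> small n" and w: "w \<in> \<Lambda> \<times> small n" and eq: "mono_of z = mono_of w"
  have nz: "fst z \<noteq> \<zero>" using z zero_not_basis by auto
  from fun_cong[OF eq, of "snd z"] have "snd z = snd w"
    using nz by (auto simp: series_monom_def split: if_splits)
  moreover from this have "fst z = fst w" using fun_cong[OF eq, of "snd z"] by (simp add: series_monom_def)
  ultimately show "z = w" by (simp add: prod_eq_iff)
qed

text \<open>Since q-th powers are supported on exponents divisible by q, the summand of a basis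
  element with exponent a' reaches only exponents congruent to a' modulo q. Each residue a is thus
  left with a combination over \<Lambda> alone.\<close>

lemma combination_coeff:
  assumes c: "\<And>i. i \<in> Delta R n q \<Lambda> \<Longrightarrow> c i \<in> carrier (series_ring R b n)" and a: "a \<in> small n"
  shows "(\<Oplus>\<^bsub>series_ring R b n\<^esub>i\<in>Delta R n q \<Lambda>. c i [^]\<^bsub>series_ring R b n\<^esub> q \<otimes>\<^bsub>series_ring R b n\<^esub> i)
      (repeat_mset q m + a) = (\<Oplus>l\<in>\<Lambda>. c (series_monom R l a) m [^] q \<otimes> l)"
proof -
  let ?S = "series_ring R b n"
  let ?x = "repeat_mset q m + a"
  interpret S: cring ?S by (rule series_ring_cring)
  have fin: "finite \<Lambda>" "finite (small n)" using basis_carrier finite_small by auto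
  have Lm: "u \<in> \<Lambda> \<Longrightarrow> u \<in> carrier R" for u using basis_carrier by auto
  have mc: "series_monom R l a \<in> carrier ?S" if "l \<in> \<Lambda>" "a \<in> small n" for l a
    using that Lm by (auto simp: small_def)
  have cc: "c (series_monom R l a) \<in> carrier ?S" if "l \<in> \<Lambda>" "a \<in> small n" for l a
    using that by (intro c) (force simp: Delta_eq)
  let ?g = "\<lambda>l a'. (c (series_monom R l a') [^]\<^bsub>?S\<^esub> q \<otimes>\<^bsub>?S\<^esub> series_monom R l a') ?x"
  have gc: "?g l a' \<in> carrier R" if "l \<in> \<Lambda>" "a' \<in> small n" for l a'
    using series_coeff_closed[OF S.m_closed[OF S.nat_pow_closed[OF cc[OF that]] mc[OF that]]] .
  have g: "?g l a' = (if a' = a then c (series_monom R l a) m [^] q \<otimes> l else \<zero>)"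
    if l: "l \<in> \<Lambda>" and a': "a' \<in> small n" for l a'
  proof -
    let ?h = "c (series_monom R l a') [^]\<^bsub>?S\<^esub> q"
    have h: "?h \<in> carrier ?S" using cc[OF l a'] by (rule S.nat_pow_closed)
    have "?g l a' = series_mult R (series_monom R l a') ?h ?x"
      using S.m_comm[OF h mc[OF l a']] by simp
    also have "\<dots> = (if a' \<subseteq># ?x then l \<otimes> ?h (?x - a') else \<zero>)"
      by (rule series_monom_mult[OF Lm[OF l] series_coeff_closed[OF h]])
    also have "\<dots> = (if a' = a then c (series_monom R l a) m [^] q \<otimes> l else \<zero>)"
    proof (cases "a' = a")
      case True
      have "?h (repeat_mset q m) = c (series_monom R l a') m [^] q"
        by (rule series_pow_repeat[OF cc[OF l a']])
      then show ?thesis using True Lm[OF l] series_coeff_closed[OF cc[OF l a']] by (simp add: m_comm)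
    next
      case False
      have "?h (?x - a') = \<zero>" if sub: "a' \<subseteq># ?x"
      proof (rule series_pow_zero[OF cc[OF l a']])
        fix m' show "?x - a' \<noteq> repeat_mset q m'"
        proof
          assume "?x - a' = repeat_mset q m'"
          then have "?x = repeat_mset q m' + a'" using sub by (metis subset_mset.diff_add)
          then have "a = a'" by (rule mset_mod_unique) (use a a' in \<open>auto simp: small_def\<close>)
          then show False using False by simp
        qed
      qed
      then show ?thesis using False Lm[OF l] by simp
    qed
    finally show ?thesis .
  qed
  have "(\<Oplus>\<^bsub>?S\<^esub>i\<in>Delta R n q \<Lambda>. c i [^]\<^bsub>?S\<^esub> q \<otimes>\<^bsub>?S\<^esub> i) =
    (\<Oplus>\<^bsub>?S\<^esub>z\<in>\<Lambda> \<times> small n. c (mono_of z) [^]\<^bsub>?S\<^esub> q \<otimes>\<^bsub>?S\<^esub> mono_of z)"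
    unfolding Delta_eq
    by (rule S.add.finprod_reindex[OF _ mono_of_inj]) (use cc mc in \<open>auto simp del: series_ring_ops\<close>)
  then have "(\<Oplus>\<^bsub>?S\<^esub>i\<in>Delta R n q \<Lambda>. c i [^]\<^bsub>?S\<^esub> q \<otimes>\<^bsub>?S\<^esub> i) ?x =
    (\<Oplus>\<^bsub>?S\<^esub>z\<in>\<Lambda> \<times> small n. c (mono_of z) [^]\<^bsub>?S\<^esub> q \<otimes>\<^bsub>?S\<^esub> mono_of z) ?x" by simp
  also have "\<dots> = (\<Oplus>z\<in>\<Lambda> \<times> small n. ?g (fst z) (snd z))"
    by (rule series_finsum) (use fin cc mc in \<open>auto simp del: series_ring_ops\<close>)
  also have "\<dots> = (\<Oplus>l\<in>\<Lambda>. \<Oplus>a'\<in>small n. ?g l a')"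
    by (rule finsum_Sigma[symmetric]) (use fin gc in auto)
  also have "\<dots> = (\<Oplus>l\<in>\<Lambda>. c (series_monom R l a) m [^] q \<otimes> l)"
  proof (rule finsum_cong')
    fix l assume l: "l \<in> \<Lambda>"
    have "(\<Oplus>a'\<in>small n. ?g l a') = ?g l a"
      by (rule finsum_single[where f = "\<lambda>a'. ?g l a'" and i = a, OF fin(2) a gc[OF l a]]) (use g[OF l] in auto)
    then show "(\<Oplus>a'\<in>small n. ?g l a') = c (series_monom R l a) m [^] q \<otimes> l" using g[OF l a] by simp
  qed (use Lm series_coeff_closed[OF cc[OF _ a]] in auto)
  finally show ?thesis .
qed

text \<open>The exponents of s are sorted by their residue a modulo q. At q m + a the coefficient of
  s is expanded in \<Lambda>, and its l-th coordinate becomes the coefficient at m of the coordinate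
  of s that belongs to (l, a); uniqueness is inherited from \<Lambda>.\<close>

theorem Delta_basis:
  assumes s: "s \<in> carrier (series_ring R b n)"
  shows "\<exists>!c. c \<in> Delta R n q \<Lambda> \<rightarrow>\<^sub>E carrier (series_ring R b n) \<and>
    s = (\<Oplus>\<^bsub>series_ring R b n\<^esub>i\<in>Delta R n q \<Lambda>. c i [^]\<^bsub>series_ring R b n\<^esub> q \<otimes>\<^bsub>series_ring R b n\<^esub> i)"
proof -
  let ?S = "series_ring R b n"
  let ?D = "Delta R n q \<Lambda>"
  interpret S: cring ?S by (rule series_ring_cring)
  have Lm: "u \<in> \<Lambda> \<Longrightarrow> u \<in> carrier R" for u using basis_carrier by auto
  define \<kappa> where "\<kappa> x = (THE c. c \<in> \<Lambda> \<rightarrow>\<^sub>E carrier R \<and> x = (\<Oplus>u\<in>\<Lambda>. c u [^] q \<otimes> u))" for x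
  have \<kappa>: "\<kappa> x \<in> \<Lambda> \<rightarrow>\<^sub>E carrier R" "x = (\<Oplus>u\<in>\<Lambda>. \<kappa> x u [^] q \<otimes> u)" if "x \<in> carrier R" for x
    using theI'[OF basis_coordinates[OF that]] unfolding \<kappa>_def by auto
  have \<kappa>c: "\<kappa> x u \<in> carrier R" if "x \<in> carrier R" "u \<in> \<Lambda>" for x u using \<kappa>(1) that by auto
  have \<kappa>_eqI: "\<kappa> x = c" if "x \<in> carrier R" "c \<in> \<Lambda> \<rightarrow>\<^sub>E carrier R" "x = (\<Oplus>u\<in>\<Lambda>. c u [^] q \<otimes> u)" for x c
    unfolding \<kappa>_def by (rule the1_equality[OF basis_coordinates[OF that(1)], OF conjI[OF that(2,3)]])
  \<comment> \<open>The coordinates of zero vanish, so the coordinates of a polynomial again have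
    finite support.\<close>
  have \<kappa>0: "\<kappa> \<zero> u = \<zero>" if u: "u \<in> \<Lambda>" for u
  proof -
    have "(\<Oplus>u\<in>\<Lambda>. (\<lambda>u\<in>\<Lambda>. \<zero>) u [^] q \<otimes> u) = \<zero>" using Lm zero_pow by (intro finsum_all_zero) simp
    moreover have "(\<lambda>u\<in>\<Lambda>. \<zero>) \<in> \<Lambda> \<rightarrow>\<^sub>E carrier R" by auto
    ultimately have "\<kappa> \<zero> = (\<lambda>u\<in>\<Lambda>. \<zero>)" by (intro \<kappa>_eqI) simp_all
    then show ?thesis using u by simp
  qed
  define g where "g = inv_into (\<Lambda> \<times> small n) mono_of"
  have g: "g (series_monom R l a) = (l, a)" if "l \<in> \<Lambda>" "a \<in> small n" for l a
    unfolding g_def using inv_into_f_f[OF mono_of_inj, of "(l, a)" n] that by simp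
  define c where "c = (\<lambda>i\<in>?D. \<lambda>m. if m \<in> monomials n then \<kappa> (s (repeat_mset q m + snd (g i))) (fst (g i)) else \<zero>)"
  have c_monom: "c (series_monom R l a) m = (if m \<in> monomials n then \<kappa> (s (repeat_mset q m + a)) l else \<zero>)"
    if "l \<in> \<Lambda>" "a \<in> small n" for l a m
  proof -
    have "series_monom R l a \<in> ?D" using that by (force simp: Delta_eq)
    then show ?thesis using that by (simp add: c_def g)
  qed
  have cS: "c i \<in> carrier ?S" if i: "i \<in> ?D" for i
  proof -
    obtain l a where la: "i = series_monom R l a" "l \<in> \<Lambda>" "a \<in> small n" using i unfolding Delta_eq by auto
    have nz: "s (repeat_mset q m + a) \<noteq> \<zero>" if "c i m \<noteq> \<zero>" for m
      using that \<kappa>0[OF la(2)] unfolding la(1) c_monom[OF la(2,3)] by (auto split: if_splits)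
    show ?thesis unfolding series_carrier_iff
    proof (intro conjI allI impI)
      show "c i m \<in> carrier R" for m
        unfolding la(1) c_monom[OF la(2,3)] using \<kappa>(1)[of "s (repeat_mset q m + a)"] s la(2) by auto
      show "m \<in> monomials n" if "c i m \<noteq> \<zero>" for m
        using that unfolding la(1) c_monom[OF la(2,3)] by (auto split: if_splits)
      assume b
      have "inj (\<lambda>m. repeat_mset q m + a)"
        by (rule injI) (use repeat_mset_inject[OF q_pos] in auto)
      then have "finite ((\<lambda>m. repeat_mset q m + a) -` {m. s m \<noteq> \<zero>})"
        using s \<open>b\<close> by (intro finite_vimageI) (auto simp: series_carrier_iff)
      then show "finite {m. c i m \<noteq> \<zero>}" by (rule finite_subset[rotated]) (use nz in auto)
    qed
  qed
  have decomp: "\<exists>m a. x = repeat_mset q m + a \<and> m \<in> monomials n \<and> a \<in> small n" if "x \<in> monomials n" for x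
    using mset_div_mod[OF q_pos, of x] that repeat_mset_monomials[OF q_pos] by (fastforce simp: small_def)
  have zero_outside: "g x = \<zero>" if "g \<in> carrier ?S" "x \<notin> monomials n" for g x
    using series_monomials[OF that(1), of x] that(2) by blast
  have sumS: "(\<Oplus>\<^bsub>?S\<^esub>i\<in>?D. c i [^]\<^bsub>?S\<^esub> q \<otimes>\<^bsub>?S\<^esub> i) \<in> carrier ?S" if "\<And>i. i \<in> ?D \<Longrightarrow> c i \<in> carrier ?S" for c
  proof (rule S.finsum_closed)
    have "i \<in> carrier ?S" if "i \<in> ?D" for i using that Lm unfolding Delta_eq small_def by auto
    then show "(\<lambda>i. c i [^]\<^bsub>?S\<^esub> q \<otimes>\<^bsub>?S\<^esub> i) \<in> ?D \<rightarrow> carrier ?S"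
      using that by (auto simp del: series_ring_ops)
  qed
  have c_PiE: "c \<in> ?D \<rightarrow>\<^sub>E carrier ?S" using cS by (auto simp: c_def)
  show ?thesis
  proof (rule ex1I[of _ c], intro conjI)
    show "c \<in> ?D \<rightarrow>\<^sub>E carrier ?S" by (rule c_PiE)
    show "s = (\<Oplus>\<^bsub>?S\<^esub>i\<in>?D. c i [^]\<^bsub>?S\<^esub> q \<otimes>\<^bsub>?S\<^esub> i)"
    proof
      fix x
      show "s x = (\<Oplus>\<^bsub>?S\<^esub>i\<in>?D. c i [^]\<^bsub>?S\<^esub> q \<otimes>\<^bsub>?S\<^esub> i) x"
      proof (cases "x \<in> monomials n")
        case False
        then show ?thesis using zero_outside[OF s] zero_outside[OF sumS[OF cS]] by simp
      next
        case True
        then obtain m a where ma: "x = repeat_mset q m + a" "m \<in> monomials n" "a \<in> small n" using decomp by blast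
        have "(\<Oplus>\<^bsub>?S\<^esub>i\<in>?D. c i [^]\<^bsub>?S\<^esub> q \<otimes>\<^bsub>?S\<^esub> i) x = (\<Oplus>l\<in>\<Lambda>. c (series_monom R l a) m [^] q \<otimes> l)"
          unfolding ma(1) by (rule combination_coeff[OF cS ma(3)])
        also have "\<dots> = (\<Oplus>l\<in>\<Lambda>. \<kappa> (s x) l [^] q \<otimes> l)"
          by (rule finsum_cong') (use c_monom ma Lm \<kappa>c s in auto)
        also have "\<dots> = s x" using \<kappa>(2)[of "s x"] s by simp
        finally show ?thesis by simp
      qed
    qed
  next
    fix c' assume c': "c' \<in> ?D \<rightarrow>\<^sub>E carrier ?S \<and> s = (\<Oplus>\<^bsub>?S\<^esub>i\<in>?D. c' i [^]\<^bsub>?S\<^esub> q \<otimes>\<^bsub>?S\<^esub> i)"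
    then have c'S: "i \<in> ?D \<Longrightarrow> c' i \<in> carrier ?S" for i by auto
    have "c' i = c i" if i: "i \<in> ?D" for i
    proof
      fix m
      obtain l a where la: "i = series_monom R l a" "l \<in> \<Lambda>" "a \<in> small n" using i unfolding Delta_eq by auto
      have iD: "series_monom R l a \<in> ?D" if "l \<in> \<Lambda>" for l using that la(3) by (force simp: Delta_eq)
      show "c' i m = c i m"
      proof (cases "m \<in> monomials n")
        case False
        then show ?thesis using zero_outside[OF c'S[OF i]] zero_outside[OF cS[OF i]] by simp
      next
        case True
        have "s (repeat_mset q m + a) = (\<Oplus>l\<in>\<Lambda>. c' (series_monom R l a) m [^] q \<otimes> l)"
          using combination_coeff[OF c'S la(3), where m = m] c' by simp
        also have "\<dots> = (\<Oplus>l\<in>\<Lambda>. (\<lambda>l\<in>\<Lambda>. c' (series_monom R l a) m) l [^] q \<otimes> l)"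
          by (rule finsum_cong') (use Lm series_coeff_closed[OF c'S[OF iD]] in auto)
        finally have "s (repeat_mset q m + a) = (\<Oplus>l\<in>\<Lambda>. (\<lambda>l\<in>\<Lambda>. c' (series_monom R l a) m) l [^] q \<otimes> l)" .
        moreover have "(\<lambda>l\<in>\<Lambda>. c' (series_monom R l a) m) \<in> \<Lambda> \<rightarrow>\<^sub>E carrier R"
          using series_coeff_closed[OF c'S[OF iD]] by auto
        moreover have "s (repeat_mset q m + a) \<in> carrier R" using s by simp
        ultimately have "\<kappa> (s (repeat_mset q m + a)) = (\<lambda>l\<in>\<Lambda>. c' (series_monom R l a) m)"
          by (intro \<kappa>_eqI)
        then show ?thesis unfolding la(1) c_monom[OF la(2,3)] using True la(2) by simp
      qed
    qed
    then show "c' = c" using c' c_PiE by (intro PiE_ext[of c' ?D "\<lambda>_. carrier ?S" c]) simp_all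
  qed
qed

lemma Delta_carrier: "finite (Delta R n q \<Lambda>)" "Delta R n q \<Lambda> \<subseteq> carrier (series_ring R b n)"
  unfolding Delta_eq using basis_carrier finite_small by (auto simp: small_def)

end

end

theorem proposition4p11:
  fixes K :: "('a, 'c) ring_scheme"
    and S :: "(nat multiset \<Rightarrow> 'a) ring"
    and R :: "(nat multiset \<Rightarrow> 'a) set ring"
    and p e n :: nat
    and \<Lambda> :: "'a set"
    and \<Delta> :: "(nat multiset \<Rightarrow> 'a) set"
    and f :: "nat multiset \<Rightarrow> 'a"
  assumes "field K"
    and "Factorial_Ring.prime p" and "has_characteristic K p"
    and "ring.finite_dimension K (powers_subfield K p) (carrier K)"
    and "S = polynomial_ring K n \<or> S = power_series_ring K n"
    and "e \<ge> 1"
    and "is_field_basis K (powers_subfield K (p ^ e)) \<Lambda>"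
    and "\<Delta> = Delta K n (p ^ e) \<Lambda>"
    and "f \<in> carrier S" and "f \<noteq> \<zero>\<^bsub>S\<^esub>" and "f \<notin> Units S"
    and "R = S Quot (PIdl\<^bsub>S\<^esub> f)"
  shows "maximal_cohen_macaulay R (frobenius_ring p e R) \<and>
    module_isomorphic S
      (restrict_scalars (\<lambda>s. PIdl\<^bsub>S\<^esub> f +>\<^bsub>S\<^esub> s) (frobenius_ring p e R))
      (Cok S \<Delta> (frobenius_matrix p e S \<Delta> f)) \<and>
    annihilates (PIdl\<^bsub>S\<^esub> f) (Cok S \<Delta> (frobenius_matrix p e S \<Delta> f)) \<and>
    module_isomorphic R
      (frobenius_ring p e R)
      (descend_scalars (Cok S \<Delta> (frobenius_matrix p e S \<Delta> f)))"
proof -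
  interpret K: char_p_field K p e
    using assms(1-3) by (simp add: char_p_field_def char_p_field_axioms_def)
  \<comment> \<open>The Boolean records which of the two rings \<open>S\<close> is; the rest of the
    argument treats them alike.\<close>
  obtain b where S: "S = series_ring K b n"
    using assms(5) K.polynomial_ring_eq series_ring_False by metis
  interpret F: frobenius_free S p e \<Delta> f R
    unfolding frobenius_free_def frobenius_free_axioms_def
  proof (intro conjI allI impI)
    show "cring S" unfolding S by (rule K.series_ring_cring)
    show "R = S Quot (PIdl\<^bsub>S\<^esub> f)" by fact
    show "p > 0" using assms(2) by (simp add: prime_gt_0_nat)
    show "f \<in> carrier S" by fact
    show "finite \<Delta>" "\<Delta> \<subseteq> carrier S"
      unfolding assms(8) S using K.Delta_carrier[OF assms(7)] by auto
    show "(a \<oplus>\<^bsub>S\<^esub> b) [^]\<^bsub>S\<^esub> (p ^ e) = a [^]\<^bsub>S\<^esub> (p ^ e) \<oplus>\<^bsub>S\<^esub> b [^]\<^bsub>S\<^esub> (p ^ e)"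
      if "a \<in> carrier S" "b \<in> carrier S" for a b
      using that unfolding S by (rule K.series_frob)
    show "\<exists>!c. c \<in> \<Delta> \<rightarrow>\<^sub>E carrier S \<and> s = (\<Oplus>\<^bsub>S\<^esub>i\<in>\<Delta>. c i [^]\<^bsub>S\<^esub> (p ^ e) \<otimes>\<^bsub>S\<^esub> i)"
      if "s \<in> carrier S" for s
      using that unfolding S assms(8) by (rule K.Delta_basis[OF assms(7)])
  qed
  \<comment> \<open>Here f being nonzero and a nonunit enters: it supplies the Weierstrass
    coordinates and excludes n = 0.\<close>
  have "cm_ring R (n - 1)"
    using K.series_quotient_cm_ring[of f b n] assms(9-11) unfolding assms(12) S by blast
  then show ?thesis using F.FR_mcm F.iso_S F.C_annihilated F.iso_R by blast
qed

end
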